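(* \textsc{ConsCheck: Edge Clique Cover} admits a fixed-parameter algorithm which runs in time $\mathcal{O}(2^{2^k}\cdot|\mathcal{I}|)$.
   Context: For a graph $G=(V,E)$, a family $\mathcal{F}=\{F_1,\dots,F_\ell\}$ of subsets of $\binom{V}{2}$ is an edge clique cover of $G$ if each $F_j$ is the edge set of a clique in $G$ and each edge of $G$ belongs to at least one $F_j$. \textsc{ConsCheck: Edge Clique Cover}: Input $\mathcal{I}$: a finite vertex set $V$, labeled samples $(E_i,\lambda_i)_{i\in[t]}$ with each $G_i=(V,E_i)$ a graph and $\lambda_i\in\{0,1\}$, and an integer $k$ (the parameter). Task: compute a family $\mathcal{F}\subseteq 2^{\binom{V}{2}}$ of size $k$ such that for each $i\in[t]$, $\mathcal{F}$ is an edge clique cover of $G_i$ iff $\lambda_i=1$, or report that none exists. *)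

theory Defs
  imports Main "HOL-Library.Ramsey"
begin

section \<open>Edge clique covers and the consistency problem\<close>

text \<open>
  A graph on \<open>V\<close> is given by an edge set \<open>E \<subseteq> [V]\<^bsup>2\<^esup>\<close>, where \<open>[V]\<^bsup>2\<^esup>\<close> is
  \<^term>\<open>nsets V 2\<close>, the set of two-element subsets of \<open>V\<close>.  Cliques are vertex sets, so the
  empty edge set is the edge set of a clique (with at most one vertex).
\<close>

definition clique_edge_set :: "'a set \<Rightarrow> 'a set set \<Rightarrow> 'a set set \<Rightarrow> bool" where
  "clique_edge_set V E F \<longleftrightarrow> (\<exists>C. C \<subseteq> V \<and> clique C E \<and> F = nsets C 2)"

definition edge_clique_cover :: "'a set \<Rightarrow> 'a set set \<Rightarrow> 'a set set set \<Rightarrow> bool" where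
  "edge_clique_cover V E \<F> \<longleftrightarrow>
     (\<forall>F\<in>\<F>. clique_edge_set V E F) \<and> (\<forall>e\<in>E. \<exists>F\<in>\<F>. e \<in> F)"

text \<open>Vertices are named by natural numbers, so that instances can be given to a machine.\<close>

record conscheck_instance =
  vertices :: "nat set"
  samples :: "(nat set set \<times> bool) list"
  parameter :: nat

definition conscheck_wf :: "conscheck_instance \<Rightarrow> bool" where
  "conscheck_wf I \<longleftrightarrow>
     finite (vertices I) \<and> (\<forall>(E, l) \<in> set (samples I). E \<subseteq> nsets (vertices I) 2)"

definition conscheck_solution :: "conscheck_instance \<Rightarrow> nat set set set \<Rightarrow> bool" where
  "conscheck_solution I \<F> \<longleftrightarrow>
     \<F> \<subseteq> Pow (nsets (vertices I) 2) \<and> card \<F> = parameter I \<and>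
     (\<forall>(E, l) \<in> set (samples I). edge_clique_cover (vertices I) E \<F> \<longleftrightarrow> l)"


section \<open>Random access machines\<close>

text \<open>
  The usual random access machine with addition, truncated subtraction, halving (rounding down)
  and indirect addressing, under the uniform cost measure: every instruction takes one step.  There
  is no multiplication.  A program refers to fixed registers; the unbounded memory is accessed only
  through addresses held in registers.
\<close>

datatype instr =
    Const nat nat     \<comment> \<open>\<open>r\<^sub>i := c\<close>\<close>
  | Add nat nat nat   \<comment> \<open>\<open>r\<^sub>i := r\<^sub>j + r\<^sub>l\<close>\<close>
  | Sub nat nat nat   \<comment> \<open>\<open>r\<^sub>i := r\<^sub>j - r\<^sub>l\<close>\<close>
  | Half nat nat      \<comment> \<open>\<open>r\<^sub>i := r\<^sub>j div 2\<close>\<close>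
  | Load nat nat      \<comment> \<open>\<open>r\<^sub>i := mem[r\<^sub>j]\<close>\<close>
  | Store nat nat     \<comment> \<open>\<open>mem[r\<^sub>i] := r\<^sub>j\<close>\<close>
  | Jump nat
  | JumpZero nat nat  \<comment> \<open>\<open>if r\<^sub>i = 0 then goto p\<close>\<close>

type_synonym program = "instr list"

record config =
  pc :: nat
  reg :: "nat \<Rightarrow> nat"
  mem :: "nat \<Rightarrow> nat"

fun exec :: "instr \<Rightarrow> config \<Rightarrow> config" where
  "exec (Const i c) s = s\<lparr>pc := Suc (pc s), reg := (reg s)(i := c)\<rparr>"
| "exec (Add i j l) s = s\<lparr>pc := Suc (pc s), reg := (reg s)(i := reg s j + reg s l)\<rparr>"
| "exec (Sub i j l) s = s\<lparr>pc := Suc (pc s), reg := (reg s)(i := reg s j - reg s l)\<rparr>"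
| "exec (Half i j) s = s\<lparr>pc := Suc (pc s), reg := (reg s)(i := reg s j div 2)\<rparr>"
| "exec (Load i j) s = s\<lparr>pc := Suc (pc s), reg := (reg s)(i := mem s (reg s j))\<rparr>"
| "exec (Store i j) s = s\<lparr>pc := Suc (pc s), mem := (mem s)(reg s i := reg s j)\<rparr>"
| "exec (Jump p) s = s\<lparr>pc := p\<rparr>"
| "exec (JumpZero i p) s = s\<lparr>pc := (if reg s i = 0 then p else Suc (pc s))\<rparr>"

definition halted :: "program \<Rightarrow> config \<Rightarrow> bool" where
  "halted P s \<longleftrightarrow> length P \<le> pc s"

definition step :: "program \<Rightarrow> config \<Rightarrow> config" where
  "step P s = (if halted P s then s else exec (P ! pc s) s)"

text \<open>
  Input and output are words over the natural numbers.  A word is held in memory with its length in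
  cell \<open>0\<close> and its letters in the cells \<open>1, 2, \<dots>\<close>; all other cells and all registers are
  initially \<open>0\<close>.
\<close>

definition initial :: "nat list \<Rightarrow> config" where
  "initial xs =
     \<lparr>pc = 0, reg = (\<lambda>_. 0),
      mem = (\<lambda>a. if a \<le> length xs then (length xs # xs) ! a else 0)\<rparr>"

definition holds_word :: "config \<Rightarrow> nat list \<Rightarrow> bool" where
  "holds_word s ys \<longleftrightarrow> (\<forall>a \<le> length ys. mem s a = (length ys # ys) ! a)"

definition computes_within :: "program \<Rightarrow> nat list \<Rightarrow> nat \<Rightarrow> nat list \<Rightarrow> bool" where
  "computes_within P xs T ys \<longleftrightarrow>
     (\<exists>n \<le> T. let s = (step P ^^ n) (initial xs) in halted P s \<and> holds_word s ys)"


section \<open>Encoding of instances and answers\<close>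

text \<open>
  An edge set is listed with each edge occurring exactly once; the order of the edges, and of the
  two endpoints of an edge, is arbitrary.
\<close>

definition edge_set_code :: "nat set set \<Rightarrow> nat list \<Rightarrow> bool" where
  "edge_set_code E ws \<longleftrightarrow>
     (\<exists>es. distinct (map (\<lambda>(u, v). {u, v}) es) \<and> set (map (\<lambda>(u, v). {u, v}) es) = E \<and>
       ws = length es # concat (map (\<lambda>(u, v). [u, v]) es))"

definition sample_code :: "nat set set \<times> bool \<Rightarrow> nat list \<Rightarrow> bool" where
  "sample_code S ws \<longleftrightarrow> (\<exists>us. edge_set_code (fst S) us \<and> ws = of_bool (snd S) # us)"

definition conscheck_code :: "conscheck_instance \<Rightarrow> nat list \<Rightarrow> bool" where
  "conscheck_code I xs \<longleftrightarrow>
     (\<exists>vs wss. distinct vs \<and> set vs = vertices I \<and> list_all2 sample_code (samples I) wss \<and>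
       xs = parameter I # length vs # vs @ length (samples I) # concat wss)"

definition family_code :: "nat set set set \<Rightarrow> nat list \<Rightarrow> bool" where
  "family_code \<F> ws \<longleftrightarrow>
     (\<exists>Fs wss. distinct Fs \<and> set Fs = \<F> \<and> list_all2 edge_set_code Fs wss \<and>
       ws = length Fs # concat wss)"

text \<open>The word \<open>[0]\<close> reports that there is no solution.\<close>

definition conscheck_answer :: "conscheck_instance \<Rightarrow> nat list \<Rightarrow> bool" where
  "conscheck_answer I ys \<longleftrightarrow>
     (if \<exists>\<F>. conscheck_solution I \<F>
      then \<exists>\<F> ws. conscheck_solution I \<F> \<and> family_code \<F> ws \<and> ys = 1 # ws
      else ys = [0])"

text \<open>The size of an instance is the common length of all its codes.\<close>

definition conscheck_size :: "conscheck_instance \<Rightarrow> nat" where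
  "conscheck_size I =
     3 + card (vertices I) + (\<Sum>(E, l) \<leftarrow> samples I. 2 + 2 * card E)"

lemma edge_set_code_length:
  assumes "edge_set_code E ws"
  shows "length ws = 1 + 2 * card E"
proof -
  obtain es :: "(nat \<times> nat) list" where es: "distinct (map (\<lambda>(u, v). {u, v}) es)"
    "set (map (\<lambda>(u, v). {u, v}) es) = E"
    "ws = length es # concat (map (\<lambda>(u, v). [u, v]) es)"
    using assms unfolding edge_set_code_def by blast
  have "card E = length es"
    using distinct_card[OF es(1)] es(2) by simp
  moreover have "length (concat (map (\<lambda>(u, v). [u, v]) es)) = 2 * length es"
    by (induction es) auto
  ultimately show ?thesis
    using es(3) by simp
qed

lemma conscheck_code_length:
  assumes "conscheck_code I xs"
  shows "length xs = conscheck_size I"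
proof -
  obtain vs wss where *: "distinct vs" "set vs = vertices I"
    "list_all2 sample_code (samples I) wss"
    "xs = parameter I # length vs # vs @ length (samples I) # concat wss"
    using assms unfolding conscheck_code_def by blast
  have "length (concat wss) = (\<Sum>(E, l) \<leftarrow> samples I. 2 + 2 * card E)"
    using *(3)
  proof (induction rule: list_all2_induct)
    case (Cons S Ss ws wss)
    obtain us where "edge_set_code (fst S) us" "ws = of_bool (snd S) # us"
      using Cons.hyps(1) unfolding sample_code_def by blast
    then show ?case
      using Cons.IH edge_set_code_length by (simp add: case_prod_beta)
  qed simp
  then show ?thesis
    using *(1,2,4) distinct_card[OF *(1)] by (simp add: conscheck_size_def)
qed

lemma edge_set_code_exists:
  assumes "finite V" and "E \<subseteq> nsets V 2"
  shows "\<exists>ws. edge_set_code E ws"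
proof -
  have "finite E"
    using assms finite_imp_finite_nsets finite_subset by blast
  then obtain es where es: "distinct es" "set es = E"
    using finite_distinct_list by blast
  have "\<exists>p. (\<lambda>(u, v). {u, v}) p = e" if "e \<in> E" for e
  proof -
    have "card e = 2"
      using that assms(2) by (auto simp: nsets_def)
    then show ?thesis
      by (auto simp: card_2_iff)
  qed
  then have "\<forall>e\<in>E. \<exists>p. (\<lambda>(u, v). {u, v}) p = e"
    by blast
  from bchoice[OF this] obtain f where f: "\<forall>e\<in>E. (\<lambda>(u, v). {u, v}) (f e) = e"
    by blast
  have "map (\<lambda>(u, v). {u, v}) (map f es) = es"
    unfolding map_map using f es(2) by (intro map_idI) simp
  with es have "distinct (map (\<lambda>(u, v). {u, v}) (map f es)) \<and>
    set (map (\<lambda>(u, v). {u, v}) (map f es)) = E"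
    by (simp only:)
  then show ?thesis
    unfolding edge_set_code_def by blast
qed

lemma conscheck_code_exists:
  assumes "conscheck_wf I"
  shows "\<exists>xs. conscheck_code I xs"
proof -
  obtain vs where vs: "distinct vs" "set vs = vertices I"
    using assms finite_distinct_list[of "vertices I"] unfolding conscheck_wf_def by auto
  have "\<exists>ws. sample_code S ws" if "S \<in> set (samples I)" for S
  proof -
    have "finite (vertices I)" "fst S \<subseteq> nsets (vertices I) 2"
      using that assms unfolding conscheck_wf_def by (cases S; force)+
    then obtain us where "edge_set_code (fst S) us"
      using edge_set_code_exists by blast
    then show ?thesis
      unfolding sample_code_def by blast
  qed
  then have "\<forall>S \<in> set (samples I). \<exists>ws. sample_code S ws"
    by blast
  from bchoice[OF this] obtain g where "\<forall>S \<in> set (samples I). sample_code S (g S)"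
    by blast
  then have "list_all2 sample_code (samples I) (map g (samples I))"
    by (simp add: list_all2_conv_all_nth)
  with vs have "conscheck_code I (parameter I # length vs # vs @
    length (samples I) # concat (map g (samples I)))"
    unfolding conscheck_code_def by (intro exI conjI) (assumption | rule refl)+
  then show ?thesis ..
qed

end

theory Submission
  imports Defs Complex_Main "HOL-Library.Discrete_Functions" "HOL-Library.Nat_Bijection"
begin

text \<open>
  A family that covers the edges of a graph by cliques determines the graph, so one positive sample
  fixes the graph to be covered, and every other sample is only compared with it.  A cover by \<open>k\<close>
  cliques is a labelling of the vertices by subsets of a \<open>k\<close>-element set such that distinct vertices
  are adjacent iff their labels meet.  Closed twins may share a label, hence at most \<open>2 ^ k\<close> classes
  of nonisolated vertices have to be labelled.  Trying all labellings of the classes is too slow for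
  large \<open>k\<close>; instead a labelling is certified by \<open>2 ^ (k - 1)\<close> bits.  It suffices to label a minimal
  kernel of classes, whose labels form, by an antichain argument, a set of size much smaller than
  \<open>2 ^ k\<close>.  The certificate lists the kernel and the set of its labels, together with a short
  description of an isomorphism between the adjacency graph of the kernel and the intersection graph
  of the labels: a few individualised pairs colour the vertices so that adjacency follows the colours up
  to a graph of small degree, whose components are described by spanning trees and matched in order.
  A family of fewer than \<open>k\<close> sets is padded by the empty set, single edges and further cliques.
\<close>

text \<open>The kernel and the set of its labels are cheap to list: increasing lists are stored by
  their gaps, with \<open>9 * h\<close> bits per gap where \<open>h\<close> is the bit length of
  \<open>k\<close>. Pairing kernel vertices with labels is the obstacle: writing a label out takes
  \<open>k\<close> bits, and \<open>k\<close> times the available bound on the kernel size exceeds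
  \<open>2 ^ k\<close>. The two sorted lists lose the pairing, so it is rebuilt from the two graphs.
  Any isomorphism serves, because only adjacency has to be preserved; this is why components of one
  type may be matched in order. The bound is \<open>2 ^ (k - 1)\<close> bits, not
  \<open>2 ^ k\<close>, so that a check costing a power of \<open>4 ^ k\<close> per certificate
  still fits below \<open>2 ^ 2 ^ k\<close>. The inequalities between the parameters hold from
  \<open>h = 64\<close> on, that is, for \<open>k \<ge> 2 ^ 63\<close>; below, plain labellings are
  enumerated and only the constant factor suffers. Linearity in the input rests on indirect
  addressing: arrays are indexed by vertex names, by sums of two powers of two and by neighbourhoods
  coded as integers, so edges and twin classes are found by single lookups.\<close>

abbreviation (input) iff_ascii :: "bool => bool => bool" (infixr "<->" 25) where "A <-> B == A = B"

section \<open>Kernels and antichains\<close>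

text \<open>Induction on the ground set. For each \<open>y\<close> the members avoiding
  \<open>y\<close> form an antichain in \<open>Y - {y}\<close>. Summed over all \<open>y\<close>, a
  member \<open>A\<close> is counted \<open>card Y - card A\<close> times, which is exactly the
  factor that turns \<open>n choose card A\<close> into \<open>Suc n choose card A\<close>. The case
  \<open>Y \<in> \<A>\<close> is separate, since then \<open>Y\<close> is the only member.\<close>

lemma lubell_yamamoto_meshalkin:
 assumes "finite Y" "\<A> \<subseteq> Pow Y" "!!A B. A \<in> \<A> ==> B \<in> \<A> ==> A \<subseteq> B ==> A = B"
 shows "(\<Sum>A\<in>\<A>. 1 / real (card Y choose card A)) \<le> 1"
 using assms
proof (induction "card Y" arbitrary: Y \<A>)
 case 0
 then have "\<A> \<subseteq> {{}}" by auto
 then have "(\<Sum>A\<in>\<A>. 1 / real (card Y choose card A)) \<le> (\<Sum>A\<in>{{}::'a set}. 1 / real (card Y choose card A))"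
  by (intro sum_mono2) auto
 then show ?case by simp
next
 case (Suc n)
 have fin: "finite \<A>" using finite_subset[OF Suc.prems(2)] Suc.prems(1) by simp
 show ?case
 proof (cases "Y \<in> \<A>")
  case True
  then have "\<A> = {Y}" using Suc.prems by blast
  then show ?thesis by simp
 next
  case False
  have 1: "(\<Sum>A\<in>{A\<in>\<A>. y \<notin> A}. 1 / real (n choose card A)) \<le> 1" if "y \<in> Y" for y
  proof -
   have "n = card (Y - {y})" using Suc.hyps(2) Suc.prems(1) that by simp
   moreover have "(\<Sum>A\<in>{A\<in>\<A>. y \<notin> A}. 1 / real (card (Y - {y}) choose card A)) \<le> 1"
   proof (rule Suc.hyps(1)[OF calculation])
    show "{A\<in>\<A>. y \<notin> A} \<subseteq> Pow (Y - {y})" using Suc.prems(2) by blast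
    show "A = B" if "A \<in> {A\<in>\<A>. y \<notin> A}" "B \<in> {A\<in>\<A>. y \<notin> A}" "A \<subseteq> B" for A B
     using Suc.prems(3)[of A B] that by blast
   qed (use Suc.prems(1) in simp)
   ultimately show ?thesis by simp
  qed
  have card_less: "card A \<le> n" if "A \<in> \<A>" for A
  proof -
   have "A \<subset> Y" using that False Suc.prems(2) by blast
   then have "card A < card Y" by (rule psubset_card_mono[OF Suc.prems(1)])
   then show ?thesis using Suc.hyps(2) by simp
  qed
  have "(\<Sum>y\<in>Y. \<Sum>A\<in>{A\<in>\<A>. y \<notin> A}. 1 / real (n choose card A))
    = (\<Sum>A\<in>\<A>. \<Sum>y\<in>{y\<in>Y. y \<notin> A}. 1 / real (n choose card A))"
   using sum.swap_restrict[OF Suc.prems(1) fin, of "%y A. 1 / real (n choose card A)" "%y A. y \<notin> A"] .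
  also have "\<dots> = (\<Sum>A\<in>\<A>. real (Suc n) * (1 / real (Suc n choose card A)))"
  proof (rule sum.cong[OF refl])
   fix A assume A: "A \<in> \<A>"
   then have AY: "A \<subseteq> Y" using Suc.prems(2) by auto
   have "{y\<in>Y. y \<notin> A} = Y - A" by auto
   then have c: "card {y\<in>Y. y \<notin> A} = Suc n - card A"
    using AY Suc.hyps(2) Suc.prems(1) by (simp add: card_Diff_subset finite_subset)
   have "(Suc n - card A) * (Suc n choose card A) = Suc n * (n choose card A)"
    using binomial_absorb_comp[of "Suc n" "card A"] by simp
   then have "real (Suc n - card A) * real (Suc n choose card A) = real (Suc n) * real (n choose card A)"
    by (metis of_nat_mult)
   moreover have "n choose card A > 0" "Suc n choose card A > 0"
    using card_less[OF A] by simp_all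
   ultimately show "(\<Sum>y\<in>{y\<in>Y. y \<notin> A}. 1 / real (n choose card A)) = real (Suc n) * (1 / real (Suc n choose card A))"
    by (simp add: c field_simps)
  qed
  also have "\<dots> = real (Suc n) * (\<Sum>A\<in>\<A>. 1 / real (Suc n choose card A))"
   by (simp add: sum_distrib_left)
  finally have "real (Suc n) * (\<Sum>A\<in>\<A>. 1 / real (Suc n choose card A))
   = (\<Sum>y\<in>Y. \<Sum>A\<in>{A\<in>\<A>. y \<notin> A}. 1 / real (n choose card A))" by (rule sym)
  also have "\<dots> \<le> (\<Sum>y\<in>Y. 1)" by (rule sum_mono[OF 1])
  finally have "real (Suc n) * (\<Sum>A\<in>\<A>. 1 / real (Suc n choose card A)) \<le> real (Suc n) * 1"
   using Suc.hyps(2) by simp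
  then have "(\<Sum>A\<in>\<A>. 1 / real (Suc n choose card A)) \<le> 1"
   by (rule mult_left_le_imp_le) simp
  then show ?thesis using Suc.hyps(2) by simp
 qed
qed

text \<open>Every summand of the preceding inequality is at least the reciprocal of the central
  binomial coefficient.\<close>

lemma sperner:
 assumes "finite Y" "\<A> \<subseteq> Pow Y" "!!A B. A \<in> \<A> ==> B \<in> \<A> ==> A \<subseteq> B ==> A = B"
 shows "card \<A> \<le> card Y choose (card Y div 2)"
proof -
 let ?c = "card Y choose (card Y div 2)"
 have pos: "?c > 0" by simp
 have "real (card \<A>) * (1 / real ?c) = (\<Sum>A\<in>\<A>. 1 / real ?c)" by simp
 also have "\<dots> \<le> (\<Sum>A\<in>\<A>. 1 / real (card Y choose card A))"
 proof (rule sum_mono)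
  fix A assume "A \<in> \<A>"
  then have "card A \<le> card Y" using assms(1,2) by (intro card_mono) auto
  then have "card Y choose card A > 0" by simp
  moreover have "card Y choose card A \<le> ?c" by (rule binomial_maximum)
  ultimately show "1 / real ?c \<le> 1 / real (card Y choose card A)"
   by (intro divide_left_mono) auto
 qed
 also have "\<dots> \<le> 1" by (rule lubell_yamamoto_meshalkin[OF assms])
 finally show ?thesis using pos by (simp add: field_simps)
qed

text \<open>The estimate \<open>4 ^ m / sqrt (2 * m + 1)\<close> for the central binomial
  coefficient, squared to avoid roots. In the induction the coefficient is multiplied by
  \<open>2 * (2 * m + 1) / (m + 1)\<close>, so that the whole step reduces to
  \<open>(2 * m + 3) * (2 * m + 1) \<le> 4 * (m + 1)\<^sup>2\<close>.\<close>

lemma central_binomial_le: "(2 * m + 1) * (2 * m choose m)\<^sup>2 \<le> 16 ^ m"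
proof (induction m)
 case (Suc m)
 let ?b = "2 * m choose m" let ?c = "2 * Suc m choose Suc m"
 have "Suc m * ?c = 2 * Suc m * (Suc (2 * m) choose m)"
  using Suc_times_binomial[of m "Suc (2 * m)"] by simp
 then have c: "?c = 2 * (Suc (2 * m) choose m)" by (metis mult.commute mult.left_commute mult_cancel1 nat.distinct(1))
 have "Suc m * (Suc (2 * m) choose m) = Suc (2 * m) * ?b"
  using Suc_times_binomial_eq[of "2 * m" m] binomial_symmetric[of m "Suc (2 * m)"] by (simp add: algebra_simps Suc_diff_le)
 then have e: "Suc m * ?c = 2 * (2 * m + 1) * ?b"
  unfolding c by (metis Suc_eq_plus1 mult.assoc mult.left_commute)
 have "(m + 1)\<^sup>2 * ((2 * Suc m + 1) * ?c\<^sup>2) = (2 * m + 3) * (Suc m * ?c)\<^sup>2"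
  by (simp add: power2_eq_square algebra_simps)
 also have "\<dots> = 4 * ((2 * m + 3) * (2 * m + 1)) * ((2 * m + 1) * ?b\<^sup>2)"
  unfolding e by (simp add: power2_eq_square algebra_simps)
 also have "\<dots> \<le> 4 * (4 * (m + 1)\<^sup>2) * 16 ^ m"
 proof (rule mult_le_mono[OF mult_le_mono2 Suc])
  show "(2 * m + 3) * (2 * m + 1) \<le> 4 * (m + 1)\<^sup>2"
   by (simp add: power2_eq_square algebra_simps)
 qed
 finally have "(m + 1)\<^sup>2 * ((2 * Suc m + 1) * ?c\<^sup>2) \<le> (m + 1)\<^sup>2 * 16 ^ Suc m"
  by simp
 then show ?case by simp
qed simp

text \<open>The critical element \<open>c A\<close> lies in no member properly contained in
  \<open>A\<close>. Consider members whose critical element is outside \<open>Y\<close> and which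
  agree outside \<open>Y\<close>: if the trace of \<open>A\<close> on \<open>Y\<close> is contained
  in that of \<open>B\<close>, then \<open>A \<subseteq> B\<close>, and \<open>A\<close> contains
  \<open>c B\<close>, so \<open>A = B\<close>. The traces form an antichain, and Sperner's bound
  saves a factor of order \<open>sqrt m\<close> against \<open>2 ^ k\<close>.\<close>

lemma card_critical_family:
 assumes "\<S> \<subseteq> Pow {..<k}" "4 * m \<le> (k::nat)"
  and crit: "!!A. A \<in> \<S> ==> \<exists>x\<in>A. \<forall>B\<in>\<S>. B \<subseteq> A --> x \<in> B --> B = A"
 shows "card \<S> * 4 ^ m \<le> 2 * 2 ^ k * (2 * m choose m)"
proof -
 have fin: "finite \<S>" using assms(1) finite_subset by auto
 obtain c where c: "!!A. A \<in> \<S> ==> c A \<in> A" "!!A B. A \<in> \<S> ==> B \<in> \<S> ==> B \<subseteq> A ==> c A \<in> B ==> B = A"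
  using crit by metis
 \<comment> \<open>Two disjoint candidates of size \<open>2 * m\<close> exist because
   \<open>4 * m \<le> k\<close>. A critical element avoids at least one of them, so one candidate is
   avoided by at least half of the family.\<close>
 have "EX Y. Y \<subseteq> {..<k} & card Y = 2 * m & card \<S> \<le> 2 * card {A\<in>\<S>. c A \<notin> Y}"
 proof (rule ccontr)
  assume no: "~ ?thesis"
  have un: "{A\<in>\<S>. c A \<notin> {..<2*m}} \<union> {A\<in>\<S>. c A \<notin> {2*m..<4*m}} = \<S>" by auto
  have "card \<S> \<le> card {A\<in>\<S>. c A \<notin> {..<2*m}} + card {A\<in>\<S>. c A \<notin> {2*m..<4*m}}"
   using card_Un_le[of "{A\<in>\<S>. c A \<notin> {..<2*m}}" "{A\<in>\<S>. c A \<notin> {2*m..<4*m}}"] unfolding un .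
  moreover have "2 * card {A\<in>\<S>. c A \<notin> {..<2*m}} < card \<S>"
   using no[unfolded not_ex, rule_format, of "{..<2*m}"] assms(2) by auto
  moreover have "2 * card {A\<in>\<S>. c A \<notin> {2*m..<4*m}} < card \<S>"
   using no[unfolded not_ex, rule_format, of "{2*m..<4*m}"] assms(2) by auto
  ultimately show False by linarith
 qed
 then obtain Y where Y: "Y \<subseteq> {..<k}" "card Y = 2 * m" "card \<S> \<le> 2 * card {A\<in>\<S>. c A \<notin> Y}" by blast
 let ?S = "{A\<in>\<S>. c A \<notin> Y}"
 have "card ?S = (\<Sum>Z\<in>Pow ({..<k} - Y). card {A\<in>?S. A - Y = Z})"
 proof -
  have "(\<Sum>Z\<in>Pow ({..<k} - Y). \<Sum>A\<in>{A\<in>?S. A - Y = Z}. (1::nat)) = (\<Sum>A\<in>?S. 1)"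
   by (rule sum.group) (use fin assms(1) in auto)
  then show ?thesis by simp
 qed
 also have "\<dots> \<le> (\<Sum>Z\<in>Pow ({..<k} - Y). 2 * m choose m)"
 proof (rule sum_mono)
  fix Z assume "Z \<in> Pow ({..<k} - Y)"
  let ?T = "{A\<in>?S. A - Y = Z}"
  have inj: "inj_on (%A. A \<inter> Y) ?T" by (rule inj_onI) blast
  have "card ((%A. A \<inter> Y) ` ?T) \<le> card Y choose (card Y div 2)"
  proof (rule sperner)
   show "finite Y" using Y(1) finite_subset by auto
   fix A' B' assume "A' \<in> (%A. A \<inter> Y) ` ?T" "B' \<in> (%A. A \<inter> Y) ` ?T" "A' \<subseteq> B'"
   then obtain A B where AB: "A \<in> ?T" "B \<in> ?T" "A' = A \<inter> Y" "B' = B \<inter> Y" by blast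
   have "A \<subseteq> B" using AB \<open>A' \<subseteq> B'\<close> by blast
   moreover have "c B \<in> A" using c(1)[of B] AB by blast
   ultimately have "A = B" using c(2)[of B A] AB by blast
   then show "A' = B'" using AB by simp
  qed auto
  then show "card ?T \<le> 2 * m choose m" using card_image[OF inj] Y(2) by simp
 qed
 also have "\<dots> = 2 ^ (k - 2 * m) * (2 * m choose m)"
  using Y(1,2) by (simp add: card_Pow card_Diff_subset finite_subset)
 finally have "card \<S> \<le> 2 * 2 ^ (k - 2 * m) * (2 * m choose m)" using Y(3) by simp
 then have "card \<S> * 4 ^ m \<le> 2 * (2 ^ (k - 2 * m) * 4 ^ m) * (2 * m choose m)"
  using mult_le_mono1[of "card \<S>" "2 * 2 ^ (k - 2 * m) * (2 * m choose m)" "4 ^ m"] by (simp add: ac_simps)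
 also have "(2::nat) ^ (k - 2 * m) * 4 ^ m = 2 ^ k"
 proof -
  have "(4::nat) ^ m = 2 ^ (2 * m)" by (simp add: power_mult)
  then show ?thesis using assms(2) by (simp add: power_add[symmetric])
 qed
 finally show ?thesis .
qed

text \<open>Closed neighbourhoods are preordered by inclusion; a kernel contains below every edge another
 edge (possibly a loop).  Labels of a kernel extend to the whole graph by taking unions downwards.\<close>

definition nle :: "'v set => ('v => 'v => bool) => 'v => 'v => bool" where
 "nle R a u v <-> (\<forall>w\<in>R. a u w --> a v w)"

definition kernel :: "'v set => ('v => 'v => bool) => 'v set => bool" where
 "kernel R a K <-> K \<subseteq> R & (\<forall>v\<in>R. \<forall>w\<in>R. a v w --> (\<exists>p\<in>K. \<exists>q\<in>K. nle R a p v & nle R a q w & a p q))"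

definition intersects_on :: "'v set => ('v => 'v => bool) => ('v => 'x set) => bool" where
 "intersects_on R a lab <-> (\<forall>u\<in>R. \<forall>v\<in>R. a u v <-> lab u \<inter> lab v ~= {})"

text \<open>A common element of two such unions comes from kernel vertices \<open>p\<close> and
  \<open>q\<close> below \<open>v\<close> and \<open>w\<close> whose labels meet, so
  \<open>p\<close> and \<open>q\<close> are adjacent; adjacency is lifted from \<open>p\<close> to
  \<open>v\<close> and then, by symmetry, from \<open>q\<close> to \<open>w\<close>. Any labelling
  that is correct on the kernel will do, in particular one other than the labelling that produced
  the kernel.\<close>

lemma kernel_extend:
 assumes "kernel R a K" "intersects_on K a \<mu>" and sym: "!!u v. a u v ==> a v u"
 shows "intersects_on R a (%v. \<Union>p\<in>{p\<in>K. nle R a p v}. \<mu> p)"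
 unfolding intersects_on_def
proof (intro ballI iffI)
 fix v w assume vw: "v \<in> R" "w \<in> R" "a v w"
 then obtain p q where "p \<in> K" "q \<in> K" "nle R a p v" "nle R a q w" "a p q"
  using assms(1) unfolding kernel_def by blast
 moreover from this have "\<mu> p \<inter> \<mu> q ~= {}" using assms(2) unfolding intersects_on_def by blast
 ultimately show "(\<Union>p\<in>{p\<in>K. nle R a p v}. \<mu> p) \<inter> (\<Union>p\<in>{p\<in>K. nle R a p w}. \<mu> p) ~= {}" by blast
next
 fix v w assume vw: "v \<in> R" "w \<in> R"
  and "(\<Union>p\<in>{p\<in>K. nle R a p v}. \<mu> p) \<inter> (\<Union>p\<in>{p\<in>K. nle R a p w}. \<mu> p) ~= {}"
 then obtain x p q where "p \<in> K" "q \<in> K" "nle R a p v" "nle R a q w" "x \<in> \<mu> p" "x \<in> \<mu> q" by blast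
 then have pq: "p \<in> K" "q \<in> K" "nle R a p v" "nle R a q w" "\<mu> p \<inter> \<mu> q ~= {}" by blast+
 then have "a p q" using assms(2) unfolding intersects_on_def by blast
 moreover have "q \<in> R" using pq(2) assms(1) by (auto simp: kernel_def)
 ultimately have "a v q" using pq(3) by (simp add: nle_def)
 then have "a q v" by (rule sym)
 then have "a w v" using pq(4) vw(1) by (simp add: nle_def)
 then show "a v w" by (rule sym)
qed

text \<open>A kernel of least cardinality has the critical elements that
  \<open>card_critical_family\<close> asks for: if every element of \<open>lab u\<close> also
  belonged to a label contained in \<open>lab u\<close> of another kernel vertex, then
  \<open>u\<close> could be deleted from the kernel.\<close>

lemma minimal_kernel:
 assumes "finite R" "intersects_on R a lab" and refl: "!!u. u \<in> R ==> a u u"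
 obtains K where "kernel R a K"
  "!!u. u \<in> K ==> \<exists>x\<in>lab u. \<forall>p\<in>K. lab p \<subseteq> lab u --> x \<in> lab p --> p = u"
proof -
 have nr: "nle R a u u" for u by (simp add: nle_def)
 have nt: "nle R a u v ==> nle R a v w ==> nle R a u w" for u v w by (simp add: nle_def)
 have "kernel R a R" unfolding kernel_def using nr by blast
 then obtain K where K: "kernel R a K" "!!K'. kernel R a K' ==> card K \<le> card K'"
  using ex_has_least_nat[of "kernel R a" R card] by blast
 have KR: "K \<subseteq> R" using K(1) by (simp add: kernel_def)
 have fK: "finite K" using KR assms(1) finite_subset by blast
 have ne: "lab u ~= {}" if "u \<in> R" for u
  using refl[OF that] assms(2) that unfolding intersects_on_def by blast
 have sub: "nle R a p u" if "p \<in> R" "u \<in> R" "lab p \<subseteq> lab u" for p u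
  using that assms(2) unfolding nle_def intersects_on_def by blast
 have "\<exists>x\<in>lab u. \<forall>p\<in>K. lab p \<subseteq> lab u --> x \<in> lab p --> p = u" if u: "u \<in> K" for u
 proof (rule ccontr)
  assume no: "~ ?thesis"
  \<comment> \<open>Containment of labels implies \<open>nle\<close>. The substitute for
    \<open>u\<close> is chosen for one label element \<open>x\<close>; taking for \<open>x\<close> a
    common element of the two labels of a kernel pair, both ends can be replaced while
    \<open>x\<close> still witnesses their adjacency.\<close>
  have repl: "\<exists>p\<in>K-{u}. nle R a p u & x \<in> lab p" if "x \<in> lab u" for x
  proof -
   from no that obtain p where "p \<in> K" "lab p \<subseteq> lab u" "x \<in> lab p" "p ~= u" by blast
   then show ?thesis using sub[of p u] KR u by blast
  qed
  have "kernel R a (K - {u})"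
   unfolding kernel_def
  proof (intro conjI ballI impI)
   fix v w assume "v \<in> R" "w \<in> R" "a v w"
   then obtain p q where pq: "p \<in> K" "q \<in> K" "nle R a p v" "nle R a q w" "a p q"
    using K(1) unfolding kernel_def by blast
   have "lab p \<inter> lab q ~= {}" using pq KR assms(2) unfolding intersects_on_def by blast
   then obtain x where x: "x \<in> lab p" "x \<in> lab q" by blast
   have r: "\<exists>p'\<in>K-{u}. nle R a p' p & x \<in> lab p'" if "p \<in> K" "x \<in> lab p" for p
    using that repl[of x] nr by (cases "p = u") auto
   obtain p' q' where p': "p' \<in> K-{u}" "nle R a p' p" "x \<in> lab p'" and q': "q' \<in> K-{u}" "nle R a q' q" "x \<in> lab q'"
    using r[OF pq(1) x(1)] r[OF pq(2) x(2)] by blast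
   have "a p' q'" using p' q' KR assms(2) unfolding intersects_on_def by blast
   then show "\<exists>p\<in>K-{u}. \<exists>q\<in>K-{u}. nle R a p v & nle R a q w & a p q"
    using p' q' nt pq by blast
  qed (use KR in blast)
  from K(2)[OF this] card_Diff1_less[OF fK u] show False by linarith
 qed
 with that K(1) show ?thesis by blast
qed

section \<open>Isomorphism certificates\<close>

text \<open>The clause on equality individualises the members of \<open>T\<close>: each of them is
  alone in its class.\<close>

definition patS :: "('v => 'v => bool) => 'v set => 'v => 'v => bool" where
 "patS a T z z' <-> (\<forall>t\<in>T. (a z t <-> a z' t) & (z = t <-> z' = t))"

definition clsS :: "'v set => ('v => 'v => bool) => 'v set => 'v => 'v set" where
 "clsS X a T z = {y\<in>X. patS a T y z}"

text \<open>However a tie is decided, at most half of a class disagrees with the majority value.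
  This is what halves classes in the potential argument below.\<close>

definition majS :: "'v set => ('v => 'v => bool) => 'v set => 'v => 'v => bool" where
 "majS X a T p z <-> card (clsS X a T z) < 2 * card {y\<in>clsS X a T z. a p y}"

definition devS :: "'v set => ('v => 'v => bool) => 'v set => 'v => 'v set" where
 "devS X a T p = {z\<in>X. a p z ~= majS X a T p z}"

lemma patS_refl [simp]: "patS a T z z" by (simp add: patS_def)
lemma patS_sym: "patS a T z z' <-> patS a T z' z" by (auto simp: patS_def)
lemma patS_trans: "patS a T x y ==> patS a T y z ==> patS a T x z" by (simp add: patS_def)
lemma patS_mono: "patS a T z z' ==> T' \<subseteq> T ==> patS a T' z z'" by (auto simp: patS_def)

lemma clsS_cong: "patS a T z z' ==> clsS X a T z = clsS X a T z'"
proof -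
 assume "patS a T z z'"
 then have "patS a T y z <-> patS a T y z'" for y
  using patS_trans[of a T y z z'] patS_trans[of a T y z' z] patS_sym[of a T z z'] by blast
 then show ?thesis by (simp add: clsS_def)
qed

lemma majS_cong: "patS a T z z' ==> majS X a T p z = majS X a T p z'"
 by (simp only: majS_def clsS_cong[of a T z z' X])

lemma clsS_eq_iff: "z \<in> X ==> clsS X a T z = clsS X a T z' <-> z \<in> clsS X a T z'"
proof
 assume "z \<in> X" "clsS X a T z = clsS X a T z'"
 moreover have "z \<in> X ==> z \<in> clsS X a T z" by (simp add: clsS_def)
 ultimately show "z \<in> clsS X a T z'" by simp
next
 assume "z \<in> clsS X a T z'"
 then have "patS a T z z'" by (simp add: clsS_def)
 then show "clsS X a T z = clsS X a T z'" by (rule clsS_cong)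
qed

lemma card_split_bool: "finite C ==> card C = card {y\<in>C. P y} + card {y\<in>C. ~ P y}"
proof -
 assume "finite C"
 then have "card ({y\<in>C. P y} \<union> {y\<in>C. ~ P y}) = card {y\<in>C. P y} + card {y\<in>C. ~ P y}"
  by (intro card_Un_disjoint) auto
 moreover have "{y\<in>C. P y} \<union> {y\<in>C. ~ P y} = C" by blast
 ultimately show ?thesis by simp
qed

text \<open>\<open>D\<close> is any set of exceptions outside which adjacency to \<open>p\<close> is
  constant on classes. Inside a class one of the two values then occurs only within
  \<open>D\<close>, and the majority rule fails only on the rarer value. This allows deviation sets
  for different \<open>T\<close> to be compared.\<close>

lemma card_devS_le:
 assumes "finite X" "D \<subseteq> X"
  and D: "!!z z'. z \<in> X - D ==> z' \<in> X - D ==> patS a T z z' ==> a p z = a p z'"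
 shows "card (devS X a T p) \<le> card D"
proof -
 let ?c = "clsS X a T"
 have grp: "card E = (\<Sum>C\<in>?c ` X. card {z\<in>E. ?c z = C})" if "E \<subseteq> X" for E
 proof -
  have "(\<Sum>C\<in>?c ` X. \<Sum>z\<in>{z\<in>E. ?c z = C}. (1::nat)) = (\<Sum>z\<in>E. 1)"
   by (rule sum.group) (use that assms(1) finite_subset in auto)
  then show ?thesis by simp
 qed
 have "card (devS X a T p) = (\<Sum>C\<in>?c ` X. card {z\<in>devS X a T p. ?c z = C})"
  by (rule grp) (auto simp: devS_def)
 also have "\<dots> \<le> (\<Sum>C\<in>?c ` X. card {z\<in>D. ?c z = C})"
 proof (rule sum_mono)
  fix C assume "C \<in> ?c ` X"
  then obtain z0 where z0: "z0 \<in> X" "C = ?c z0" by blast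
  have CX: "C \<subseteq> X" using z0 by (auto simp: clsS_def)
  then have fC: "finite C" using assms(1) finite_subset by blast
  have mem: "?c z = C <-> z \<in> C" if "z \<in> X" for z using clsS_eq_iff[OF that] z0 by blast
  have maj: "majS X a T p z <-> card C < 2 * card {y\<in>C. a p y}" if "z \<in> C" for z
   using mem[of z] that CX by (auto simp: majS_def)
  have e1: "{z\<in>devS X a T p. ?c z = C} = {z\<in>C. a p z ~= (card C < 2 * card {y\<in>C. a p y})}"
   using CX maj mem unfolding devS_def by blast
  have e2: "{z\<in>D. ?c z = C} = D \<inter> C" using mem assms(2) by blast
  have DC: "{z\<in>C. a p z} \<subseteq> D \<inter> C \<or> {z\<in>C. ~ a p z} \<subseteq> D \<inter> C"
  proof (rule ccontr)
   assume "~ ?thesis"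
   then obtain z z' where z: "z \<in> C" "a p z" "z \<notin> D" "z' \<in> C" "~ a p z'" "z' \<notin> D" by blast
   have "patS a T z z'" using z z0 patS_trans patS_sym unfolding clsS_def by (metis (mono_tags, lifting) mem_Collect_eq)
   then show False using D[of z z'] z CX by blast
  qed
  have "card {z\<in>C. a p z} \<le> card (D \<inter> C) \<or> card {z\<in>C. ~ a p z} \<le> card (D \<inter> C)"
   using DC fC by (meson card_mono finite_Int)
  moreover have "card C = card {z\<in>C. a p z} + card {z\<in>C. ~ a p z}" by (rule card_split_bool[OF fC])
  ultimately show "card {z\<in>devS X a T p. ?c z = C} \<le> card {z\<in>D. ?c z = C}"
   unfolding e1 e2 by (cases "card C < 2 * card {y\<in>C. a p y}") auto
 qed
 also have "\<dots> = card D" using grp[OF assms(2)] by simp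
 finally show ?thesis .
qed

text \<open>Two potential arguments, one for the outgoing and one for the incoming degree of the
  deviation relation. The second keeps what the first has achieved because it only enlarges
  \<open>T\<close>.\<close>

lemma exists_separating_set:
 assumes fin: "finite X" and ne: "X ~= {}" and cX: "card X \<le> 2 ^ k" and m: "0 < m" and b: "0 < (b::nat)"
  and sym: "!!u v. a u v <-> a v u"
 obtains T where "T \<subseteq> X" "T ~= {}" "card T \<le> 1 + k * card X div m + m * card X div b"
  "!!p. p \<in> X ==> card (devS X a T p) \<le> m" "!!q. q \<in> X ==> card {p\<in>X. q \<in> devS X a T p} \<le> b"
proof -
 obtain x0 where x0: "x0 \<in> X" using ne by blast
 have fcl: "finite (clsS X a T z)" for T z using fin by (simp add: clsS_def)
 \<comment> \<open>A member of \<open>T\<close> costs \<open>m\<close>, and each vertex contributes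
   the logarithm of the size of its class. Adding \<open>p\<close> at least halves the class of
   every vertex deviating at \<open>p\<close>; so at a minimum no \<open>p\<close> has more than
   \<open>m\<close> deviations, and comparison with the singleton \<open>{x0}\<close> bounds
   \<open>card T1\<close>.\<close>
 define f where "f = (%T. m * card T + (\<Sum>z\<in>X. floor_log (card (clsS X a T z))))"
 obtain T1 where T1: "T1 \<subseteq> X" "T1 ~= {}" "!!T. T \<subseteq> X ==> T ~= {} ==> f T1 \<le> f T"
 proof -
  have "EX T. (T \<subseteq> X & T ~= {}) & (ALL T'. T' \<subseteq> X & T' ~= {} --> f T \<le> f T')"
   by (rule ex_has_least_nat[of _ "{x0}"]) (use x0 in simp)
  then show ?thesis using that by (elim exE conjE) simp
 qed
 have fT1: "finite T1" using T1(1) fin finite_subset by blast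
 have "floor_log (card (clsS X a {x0} z)) \<le> k" for z
 proof -
  have "card (clsS X a {x0} z) \<le> 2 ^ k"
   using card_mono[OF fin, of "clsS X a {x0} z"] cX by (auto simp: clsS_def)
  then show ?thesis using floor_log_mono by (metis floor_log_power monoD)
 qed
 then have "(\<Sum>z\<in>X. floor_log (card (clsS X a {x0} z))) \<le> card X * k"
  by (metis (no_types, lifting) sum_bounded_above of_nat_id)
 then have "f {x0} \<le> m + card X * k" by (simp add: f_def)
 then have "m * card T1 \<le> m + k * card X" using T1(3)[of "{x0}"] x0 by (simp add: f_def mult.commute)
 then have "m * (card T1 - 1) \<le> k * card X" by (simp add: diff_mult_distrib2)
 then have cT1: "card T1 \<le> 1 + k * card X div m"
 proof -
  have "card T1 - 1 \<le> k * card X div m"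
   using \<open>m * (card T1 - 1) \<le> k * card X\<close> m by (metis less_eq_div_iff_mult_less_eq mult.commute)
  then show ?thesis by linarith
 qed
 have dev1: "card (devS X a T1 p) \<le> m" if p: "p \<in> X" for p
 proof -
  let ?T = "insert p T1"
  have pt: "floor_log (card (clsS X a ?T z)) + of_bool (z \<in> devS X a T1 p) \<le> floor_log (card (clsS X a T1 z))" if z: "z \<in> X" for z
  proof -
   let ?C = "clsS X a T1 z" let ?C' = "clsS X a ?T z"
   have sub: "?C' \<subseteq> ?C" unfolding clsS_def using patS_mono[of a ?T _ z T1] by blast
   show ?thesis
   proof (cases "z \<in> devS X a T1 p")
    case True
    \<comment> \<open>The refined class retains only vertices that agree with \<open>z\<close>
      towards \<open>p\<close>. Since \<open>z\<close> deviates, these are at most half of the old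
      class.\<close>
    have "?C' \<subseteq> {y\<in>?C. a p y = a p z}"
     using sub sym unfolding clsS_def patS_def by auto
    then have "card ?C' \<le> card {y\<in>?C. a p y = a p z}" using fcl[of T1 z] by (intro card_mono) auto
    also have "2 * card {y\<in>?C. a p y = a p z} \<le> card ?C"
     using True card_split_bool[OF fcl[of T1 z], of "a p"] unfolding devS_def majS_def
     by (cases "a p z") auto
    finally have le: "2 * card ?C' \<le> card ?C" by simp
    have "z \<in> ?C'" using z by (simp add: clsS_def)
    then have "card ?C' > 0" using fcl card_gt_0_iff by blast
    then have "floor_log (2 * card ?C') = Suc (floor_log (card ?C'))" by (simp add: floor_log_twice)
    moreover have "floor_log (2 * card ?C') \<le> floor_log (card ?C)" using le floor_log_mono monoD by blast
    ultimately show ?thesis using True by simp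
   next
    case False
    have "card ?C' \<le> card ?C" using sub fcl by (intro card_mono)
    then show ?thesis using False floor_log_mono by (auto dest: monoD)
   qed
  qed
  have "(\<Sum>z\<in>X. floor_log (card (clsS X a ?T z))) + card (devS X a T1 p)
   = (\<Sum>z\<in>X. floor_log (card (clsS X a ?T z)) + of_bool (z \<in> devS X a T1 p))"
  proof -
   have "{z\<in>X. z \<in> devS X a T1 p} = devS X a T1 p" by (auto simp: devS_def)
   then show ?thesis using fin by (simp add: sum.distrib of_bool_def sum.If_cases Int_def)
  qed
  also have "\<dots> \<le> (\<Sum>z\<in>X. floor_log (card (clsS X a T1 z)))" by (rule sum_mono[OF pt])
  finally have s: "(\<Sum>z\<in>X. floor_log (card (clsS X a ?T z))) + card (devS X a T1 p)
   \<le> (\<Sum>z\<in>X. floor_log (card (clsS X a T1 z)))" .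
  have "f T1 \<le> f ?T" by (rule T1(3)) (use T1(1) p in simp_all)
  moreover have "card ?T \<le> card T1 + 1" using fT1 by (simp add: card_insert_if)
  then have "m * card ?T \<le> m * card T1 + m" using mult_le_mono2[of "card ?T" "card T1 + 1" m] by simp
  ultimately show ?thesis using s unfolding f_def by linarith
 qed
 \<comment> \<open>Here a member costs \<open>b\<close>. Adding \<open>q\<close> lowers the size of
   every deviation set containing \<open>q\<close> and raises none, so at a minimum \<open>q\<close>
   occurs in at most \<open>b\<close> of them. The initial value is controlled by the bound
   \<open>m\<close> reached before.\<close>
 define g where "g = (%T. b * card T + (\<Sum>p\<in>X. card (devS X a T p)))"
 obtain T where T: "T1 \<subseteq> T" "T \<subseteq> X" "!!T'. T1 \<subseteq> T' ==> T' \<subseteq> X ==> g T \<le> g T'"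
 proof -
  have "EX T. (T1 \<subseteq> T & T \<subseteq> X) & (ALL T'. T1 \<subseteq> T' & T' \<subseteq> X --> g T \<le> g T')"
   by (rule ex_has_least_nat[of _ T1]) (use T1(1) in simp)
  then show ?thesis using that by (elim exE conjE) simp
 qed
 have fT: "finite T" using T(2) fin finite_subset by blast
 have "(\<Sum>p\<in>X. card (devS X a T1 p)) \<le> card X * m"
  using sum_bounded_above[of X "%p. card (devS X a T1 p)" m] dev1 by simp
 then have "b * card T \<le> b * card T1 + m * card X" using T(3)[of T1] T1(1) by (simp add: g_def mult.commute)
 then have "b * (card T - card T1) \<le> m * card X" by (simp add: diff_mult_distrib2)
 then have "card T - card T1 \<le> m * card X div b"
  using b by (metis less_eq_div_iff_mult_less_eq mult.commute)
 then have cT: "card T \<le> 1 + k * card X div m + m * card X div b" using cT1 by linarith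
 have dev: "card (devS X a T p) \<le> m" if p: "p \<in> X" for p
 proof -
  \<comment> \<open>Finer classes have no more deviations: the deviations with respect to
    \<open>T1\<close> are an admissible set of exceptions for \<open>T\<close>.\<close>
  have "card (devS X a T p) \<le> card (devS X a T1 p)"
  proof (rule card_devS_le[OF fin])
   fix z z' assume z: "z \<in> X - devS X a T1 p" "z' \<in> X - devS X a T1 p" "patS a T z z'"
   then have "majS X a T1 p z = majS X a T1 p z'" using majS_cong patS_mono[OF z(3) T(1)] by metis
   then show "a p z = a p z'" using z by (auto simp: devS_def)
  qed (auto simp: devS_def)
  then show ?thesis using dev1[OF p] by simp
 qed
 have ind: "card {p\<in>X. q \<in> devS X a T p} \<le> b" if q: "q \<in> X" for q
 proof -
  let ?T = "insert q T"
  have pt: "card (devS X a ?T p) + of_bool (q \<in> devS X a T p) \<le> card (devS X a T p)" if "p \<in> X" for p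
  proof -
   have fd: "finite (devS X a T p)" using fin by (simp add: devS_def)
   have "card (devS X a ?T p) \<le> card (devS X a T p - {q})"
   proof (rule card_devS_le[OF fin])
    fix z z' assume z: "z \<in> X - (devS X a T p - {q})" "z' \<in> X - (devS X a T p - {q})" "patS a ?T z z'"
    show "a p z = a p z'"
    proof (cases "z = q \<or> z' = q")
     case True
     then have "z = z'" using z(3) by (simp add: patS_def)
     then show ?thesis by simp
    next
     case False
     have "patS a T z z'" by (rule patS_mono[OF z(3)]) auto
     then have "majS X a T p z = majS X a T p z'" by (rule majS_cong)
     then show ?thesis using z(1,2) False by (simp add: devS_def)
    qed
   qed (auto simp: devS_def)
   moreover have "card (devS X a T p - {q}) + of_bool (q \<in> devS X a T p) = card (devS X a T p)"
    using fd card_Suc_Diff1[OF fd, of q] by auto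
   ultimately show ?thesis by linarith
  qed
  have "(\<Sum>p\<in>X. card (devS X a ?T p)) + card {p\<in>X. q \<in> devS X a T p}
   = (\<Sum>p\<in>X. card (devS X a ?T p) + of_bool (q \<in> devS X a T p))"
   using fin by (simp add: sum.distrib of_bool_def sum.If_cases Int_def)
  also have "\<dots> \<le> (\<Sum>p\<in>X. card (devS X a T p))" by (rule sum_mono[OF pt])
  finally have s: "(\<Sum>p\<in>X. card (devS X a ?T p)) + card {p\<in>X. q \<in> devS X a T p} \<le> (\<Sum>p\<in>X. card (devS X a T p))" .
  have "g T \<le> g ?T" by (rule T(3)) (use T(1,2) q in auto)
  moreover have "card ?T \<le> card T + 1" using fT by (simp add: card_insert_if)
  then have "b * card ?T \<le> b * card T + b" using mult_le_mono2[of "card ?T" "card T + 1" b] by simp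
  ultimately show ?thesis using s unfolding g_def by linarith
 qed
 show ?thesis
  by (rule that[OF T(2) _ cT dev ind]) (use T1(2) T(1) in auto)
qed

section \<open>Ranks in finite sets of numbers, spanning trees and their canonical templates\<close>

lemma rank_inject:
 fixes A :: "nat set"
 assumes "finite A" "x \<in> A" "y \<in> A" "card {z\<in>A. z < x} = card {z\<in>A. z < y}"
 shows "x = y"
proof -
 have lt: "card {z\<in>A. z < u} < card {z\<in>A. z < v}" if "u \<in> A" "u < v" for u v
  by (rule psubset_card_mono) (use assms(1) that in auto)
 have "~ x < y" using lt[OF assms(2), of y] assms(4) by linarith
 moreover have "~ y < x" using lt[OF assms(3), of x] assms(4) by linarith
 ultimately show ?thesis by linarith
qed

lemma rank_exists:
 fixes A B :: "nat set"
 assumes "finite A" "finite B" "card A = card B" "x \<in> A"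
 shows "\<exists>y\<in>B. card {z\<in>B. z < y} = card {z\<in>A. z < x}"
proof -
 have lt: "card {z\<in>C. z < u} < card C" if "u \<in> C" "finite C" for C and u :: nat
  by (rule psubset_card_mono) (use that in auto)
 let ?r = "%y. card {z\<in>B. z < y}"
 have "inj_on ?r B" using rank_inject[OF assms(2)] by (auto intro: inj_onI)
 then have "card (?r ` B) = card {..<card B}" by (simp add: card_image)
 moreover have "?r ` B \<subseteq> {..<card B}" using lt assms(2) by blast
 ultimately have "?r ` B = {..<card B}" by (intro card_subset_eq) auto
 moreover have "card {z\<in>A. z < x} \<in> {..<card B}" using lt[of x A] assms by simp
 ultimately have "card {z\<in>A. z < x} \<in> ?r ` B" by (simp only:)
 then obtain y where "y \<in> B" "card {z\<in>A. z < x} = card {z\<in>B. z < y}" by (rule imageE)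
 then show ?thesis by (intro bexI[of _ y]) simp
qed

text \<open>Parents are chosen closer to the root. The distance falls strictly along
  \<open>p\<close> until the root is met, so the iterates before it are distinct elements of
  \<open>X\<close>. All vertices thus reach the root within the common number \<open>card X\<close>
  of steps, and \<open>p\<close> rests there.\<close>

lemma spanning_tree:
 assumes fin: "finite X" and D: "D = {v. (\<rho>, v) \<in> E\<^sup>*}" "D \<subseteq> X" and sym: "sym E"
 obtains p where "p \<rho> = \<rho>" "!!w. w \<in> D ==> p w \<in> D" "!!w. w \<in> D ==> w ~= \<rho> ==> (w, p w) \<in> E"
  "!!w. w \<in> D ==> (p ^^ card X) w = \<rho>"
proof -
 define dist where "dist w = (LEAST n. (\<rho>, w) \<in> E ^^ n)" for w
 have dist: "(\<rho>, w) \<in> E ^^ dist w" if "w \<in> D" for w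
 proof -
  have "(\<rho>, w) \<in> E\<^sup>*" using that D(1) by simp
  then have "EX n. (\<rho>, w) \<in> E ^^ n" by (rule rtrancl_imp_relpow)
  then show ?thesis unfolding dist_def by (rule LeastI_ex)
 qed
 have pre: "EX u. (u, w) \<in> E & u \<in> D & dist u < dist w" if w: "w \<in> D" "w ~= \<rho>" for w
 proof (cases "dist w")
  case 0
  then show ?thesis using dist[OF w(1)] w(2) by simp
 next
  case (Suc n)
  then obtain u where u: "(\<rho>, u) \<in> E ^^ n" "(u, w) \<in> E" using dist[OF w(1)] by (auto elim: relpow_Suc_E)
  then have "u \<in> D" using D(1) relpow_imp_rtrancl by auto
  moreover have "dist u \<le> n" unfolding dist_def using u(1) by (rule Least_le)
  ultimately show ?thesis using u(2) Suc by auto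
 qed
 define p where "p w = (if w = \<rho> then \<rho> else SOME u. (u, w) \<in> E & u \<in> D & dist u < dist w)" for w
 have p: "(p w, w) \<in> E" "p w \<in> D" "dist (p w) < dist w" if w: "w \<in> D" "w ~= \<rho>" for w
  using someI_ex[OF pre[OF w]] w(2) by (simp_all add: p_def)
 have rD: "\<rho> \<in> D" using D(1) by simp
 have pD: "p w \<in> D" if "w \<in> D" for w using p(2)[OF that] rD by (cases "w = \<rho>") (simp_all add: p_def)
 have itD: "(p ^^ i) w \<in> D" if "w \<in> D" for i w using that pD by (induction i) auto
 have fixp: "(p ^^ i) \<rho> = \<rho>" for i by (induction i) (simp_all add: p_def)
 have "(p ^^ card X) w = \<rho>" if w: "w \<in> D" for w
 proof (rule ccontr)
  assume no: "(p ^^ card X) w ~= \<rho>"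
  have ne: "(p ^^ i) w ~= \<rho>" if "i \<le> card X" for i
  proof
   assume "(p ^^ i) w = \<rho>"
   then have "(p ^^ (card X - i)) ((p ^^ i) w) = \<rho>" using fixp by simp
   then have "(p ^^ (card X - i + i)) w = \<rho>" by (simp only: funpow_add o_apply)
   then show False using no that by simp
  qed
  have dec: "dist ((p ^^ (i + Suc j)) w) < dist ((p ^^ i) w)" if "i + Suc j \<le> card X" for i j
   using that
  proof (induction j)
   case 0
   then show ?case using p(3)[OF itD[OF w] ne, of i] by simp
  next
   case (Suc j)
   have "dist (p ((p ^^ (i + Suc j)) w)) < dist ((p ^^ (i + Suc j)) w)"
    by (rule p(3)[OF itD[OF w] ne]) (use Suc.prems in simp)
   then show ?case using Suc by simp
  qed
  have "inj_on (%i. (p ^^ i) w) {..card X}"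
  proof (rule linorder_inj_onI)
   fix i j :: nat assume ij: "i < j" "i \<in> {..card X}" "j \<in> {..card X}"
   then obtain l where "j = i + Suc l" using less_iff_Suc_add by auto
   then have "dist ((p ^^ j) w) < dist ((p ^^ i) w)" using dec[of i l] ij by simp
   then show "(p ^^ i) w ~= (p ^^ j) w" by auto
  qed auto
  moreover have "(%i. (p ^^ i) w) ` {..card X} \<subseteq> X" using itD[OF w] D(2) by blast
  ultimately have "card {..card X} \<le> card X" by (rule card_inj_on_le[OF _ _ fin])
  then show False by simp
 qed
 moreover have "(w, p w) \<in> E" if "w \<in> D" "w ~= \<rho>" for w using p(1)[OF that] sym by (simp add: symD)
 ultimately show ?thesis using that[of p] pD by (simp add: p_def)
qed

text \<open>\<open>R w\<close> is a fixed representative of the isomorphism type of the component of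
  \<open>w\<close>, and \<open>h w\<close> is the place of \<open>w\<close> in it; the parent
  \<open>p\<close> and the child number \<open>c\<close> are pulled back from one spanning tree of
  the representative. Isomorphisms respect \<open>a\<close> and \<open>col\<close>, and by
  \<open>Eiso\<close> these two determine \<open>E\<close>, so tree edges are carried to edges of
  \<open>E\<close>. What makes the certificate short is that a child number is bounded by the degree
  \<open>d\<close>, and yet the child numbers on the way to the root determine
  \<open>h w\<close>.\<close>

lemma tree_templates:
 fixes X :: "nat set" and a col :: "nat => nat => bool" and E :: "(nat \<times> nat) set"
 assumes fin: "finite X" and EX: "E \<subseteq> X \<times> X" and symE: "sym E"
  and deg: "!!w. card {u. (w, u) \<in> E} \<le> d" and M: "card X < M"
  and col_refl: "!!u. col u u" and col_sym: "!!u v. col u v ==> col v u"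
  and col_trans: "!!u v w. col u v ==> col v w ==> col u w"
  and Eiso: "!!u v u' v'. u \<in> X ==> v \<in> X ==> u' \<in> X ==> v' \<in> X ==> col u u' ==> col v v' ==>
   a u v = a u' v' ==> (u, v) \<in> E ==> (u', v') \<in> E"
 obtains R :: "nat => nat set" and h p c :: "nat => nat" where
  "!!w. w \<in> X ==> p w \<in> X" "!!w. w \<in> X ==> (w, p w) \<in> E\<^sup>*"
  "!!w. w \<in> X ==> c w ~= 0 ==> (w, p w) \<in> E" "!!w. w \<in> X ==> c w = 0 ==> p w = w"
  "!!w i. w \<in> X ==> card X \<le> i ==> c ((p ^^ i) w) = 0"
  "!!w z. w \<in> X ==> z \<in> X ==> R w = R z ==> ALL i<M. c ((p ^^ i) w) = c ((p ^^ i) z) ==> h w = h z"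
  "!!w z i. w \<in> X ==> z \<in> X ==> R w = R z ==> h w = h z ==> c ((p ^^ i) w) = c ((p ^^ i) z)"
  "!!w z. w \<in> X ==> (w, z) \<in> E\<^sup>* ==> R w = R z"
  "!!w z. w \<in> X ==> (w, z) \<in> E\<^sup>* ==> h w = h z ==> w = z"
  "!!w z. w \<in> X ==> z \<in> X ==> R w = R z ==> \<exists>v\<in>X. (z, v) \<in> E\<^sup>* & h v = h w"
  "!!u v. u \<in> X ==> (u, v) \<in> E\<^sup>* ==> a u v = a (h u) (h v)"
  "!!u. u \<in> X ==> col u (h u)" "!!w. w \<in> X ==> c w \<le> d"
  "!!w z \<theta>. w \<in> X ==> z \<in> X ==> bij_betw \<theta> {u. (w, u) \<in> E\<^sup>*} {v. (z, v) \<in> E\<^sup>*} ==>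
    (!!u v. (w, u) \<in> E\<^sup>* ==> (w, v) \<in> E\<^sup>* ==> a u v = a (\<theta> u) (\<theta> v)) ==>
    (!!u. (w, u) \<in> E\<^sup>* ==> col u (\<theta> u)) ==> R w = R z"
proof -
 define comp where "comp w = {v. (w, v) \<in> E\<^sup>*}" for w
 have symS: "(u, v) \<in> E\<^sup>* ==> (v, u) \<in> E\<^sup>*" for u v using sym_rtrancl[OF symE] by (rule symD)
 have comp_eq: "comp w = comp z" if "(w, z) \<in> E\<^sup>*" for w z
  unfolding comp_def using that symS[OF that] by (auto intro: rtrancl_trans)
 have self: "w \<in> comp w" for w by (simp add: comp_def)
 have compX: "comp w \<subseteq> X" if "w \<in> X" for w
 proof
  fix v assume "v \<in> comp w"
  then have "(w, v) \<in> E\<^sup>*" by (simp add: comp_def)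
  then show "v \<in> X" using that EX by (induction rule: rtrancl_induct) auto
 qed
 define iso where "iso C C' \<theta> <-> bij_betw \<theta> C C' & (\<forall>u\<in>C. \<forall>v\<in>C. a u v = a (\<theta> u) (\<theta> v)) & (\<forall>u\<in>C. col u (\<theta> u))"
  for C C' and \<theta> :: "nat => nat"
 have iso_refl: "iso C C id" for C using col_refl by (simp add: iso_def)
 have iso_inv: "iso C' C (inv_into C \<theta>)" if i: "iso C C' \<theta>" for C C' \<theta>
 proof -
  have b: "bij_betw \<theta> C C'" using i by (simp add: iso_def)
  have m: "inv_into C \<theta> u \<in> C" "\<theta> (inv_into C \<theta> u) = u" if "u \<in> C'" for u
   using b that by (auto simp: bij_betw_def inv_into_into f_inv_into_f)
  show ?thesis
   unfolding iso_def
  proof (intro conjI ballI)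
   show "bij_betw (inv_into C \<theta>) C' C" using b by (rule bij_betw_inv_into)
   fix u assume u: "u \<in> C'"
   have "col (inv_into C \<theta> u) (\<theta> (inv_into C \<theta> u))" using i m(1)[OF u] by (simp add: iso_def)
   then show "col u (inv_into C \<theta> u)" using col_sym m(2)[OF u] by simp
   fix v assume v: "v \<in> C'"
   have "a (inv_into C \<theta> u) (inv_into C \<theta> v) = a (\<theta> (inv_into C \<theta> u)) (\<theta> (inv_into C \<theta> v))"
    using i m(1)[OF u] m(1)[OF v] by (simp add: iso_def)
   then show "a u v = a (inv_into C \<theta> u) (inv_into C \<theta> v)" using m(2)[OF u] m(2)[OF v] by simp
  qed
 qed
 have iso_comp: "iso C C'' (\<theta>' \<circ> \<theta>)" if i: "iso C C' \<theta>" "iso C' C'' \<theta>'" for C C' C'' \<theta> \<theta>'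
 proof -
  have m: "\<theta> u \<in> C'" if "u \<in> C" for u using i(1) that by (auto simp: iso_def bij_betw_def)
  show ?thesis
   unfolding iso_def
  proof (intro conjI ballI)
   show "bij_betw (\<theta>' \<circ> \<theta>) C C''" using i by (auto simp: iso_def intro: bij_betw_trans)
   fix u assume u: "u \<in> C"
   have "col u (\<theta> u)" "col (\<theta> u) (\<theta>' (\<theta> u))" using i u m by (simp_all add: iso_def)
   then show "col u ((\<theta>' \<circ> \<theta>) u)" using col_trans by simp
   fix v assume v: "v \<in> C"
   have "a u v = a (\<theta> u) (\<theta> v)" "a (\<theta> u) (\<theta> v) = a (\<theta>' (\<theta> u)) (\<theta>' (\<theta> v))" using i u v m by (simp_all add: iso_def)
   then show "a u v = a ((\<theta>' \<circ> \<theta>) u) ((\<theta>' \<circ> \<theta>) v)" by simp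
  qed
 qed
 define cs where "cs = comp ` X"
 define eqv where "eqv C C' <-> (\<exists>\<theta>. iso C C' \<theta>)" for C C'
 \<comment> \<open>The choice ranges over all components equivalent to \<open>C\<close> and so
   depends only on the equivalence class: isomorphic components receive literally the same
   template.\<close>
 define rep where "rep C = (SOME D. D \<in> cs & eqv D C)" for C
 have rep: "rep C \<in> cs" "eqv (rep C) C" if "C \<in> cs" for C
 proof -
  have "C \<in> cs & eqv C C" using that iso_refl unfolding eqv_def by blast
  then have "rep C \<in> cs & eqv (rep C) C" unfolding rep_def by (rule someI)
  then show "rep C \<in> cs" "eqv (rep C) C" by simp_all
 qed
 have rep_eq: "rep C = rep C'" if "eqv C C'" for C C'
 proof -
  from that obtain \<theta> where t: "iso C C' \<theta>" unfolding eqv_def by blast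
  have "eqv D C <-> eqv D C'" for D
  proof
   assume "eqv D C" then obtain \<theta>' where "iso D C \<theta>'" unfolding eqv_def by blast
   from iso_comp[OF this t] show "eqv D C'" unfolding eqv_def by blast
  next
   assume "eqv D C'" then obtain \<theta>' where "iso D C' \<theta>'" unfolding eqv_def by blast
   from iso_comp[OF this iso_inv[OF t]] show "eqv D C" unfolding eqv_def by blast
  qed
  then show ?thesis unfolding rep_def by simp
 qed
 define th where "th C = (SOME \<theta>. iso (rep C) C \<theta>)" for C
 have th: "iso (rep C) C (th C)" if "C \<in> cs" for C
  using rep(2)[OF that] unfolding eqv_def th_def by (rule someI_ex)
 have "EX q. fst q \<in> D & snd q (fst q) = fst q & (\<forall>w\<in>D. snd q w \<in> D) & (\<forall>w\<in>D. w ~= fst q --> (w, snd q w) \<in> E) &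
   (\<forall>w\<in>D. (snd q ^^ card X) w = fst q)" if "D \<in> cs" for D
 proof -
  from that obtain r where r0: "D = comp r" "r \<in> X" unfolding cs_def by blast
  then have r: "r \<in> X" "D = {v. (r, v) \<in> E\<^sup>*}" by (simp_all only: comp_def)
  have "D \<subseteq> X" using compX[OF r(1)] r(2) by (simp add: comp_def)
  show ?thesis
  proof (rule spanning_tree[OF fin r(2) \<open>D \<subseteq> X\<close> symE])
   fix p assume p: "p r = r" "!!w. w \<in> D ==> p w \<in> D"
    "!!w. w \<in> D ==> w ~= r ==> (w, p w) \<in> E" "!!w. w \<in> D ==> (p ^^ card X) w = r"
   have "r \<in> D" using r(2) by simp
   with p show ?thesis by (intro exI[of _ "(r, p)"]) simp
  qed
 qed
 note tree_ex = this
 have "\<forall>D\<in>cs. EX q. fst q \<in> D & snd q (fst q) = fst q & (\<forall>w\<in>D. snd q w \<in> D) & (\<forall>w\<in>D. w ~= fst q --> (w, snd q w) \<in> E) &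
   (\<forall>w\<in>D. (snd q ^^ card X) w = fst q)" by (intro ballI tree_ex)
 from bchoice[OF this] obtain Q where Q: "\<forall>D\<in>cs. fst (Q D) \<in> D & snd (Q D) (fst (Q D)) = fst (Q D) & (\<forall>w\<in>D. snd (Q D) w \<in> D) &
   (\<forall>w\<in>D. w ~= fst (Q D) --> (w, snd (Q D) w) \<in> E) & (\<forall>w\<in>D. (snd (Q D) ^^ card X) w = fst (Q D))" by blast
 define rr where "rr D = fst (Q D)" for D
 define pr where "pr D = snd (Q D)" for D
 have tree: "rr D \<in> D" "pr D (rr D) = rr D" "!!w. w \<in> D ==> pr D w \<in> D" "!!w. w \<in> D ==> w ~= rr D ==> (w, pr D w) \<in> E"
  "!!w. w \<in> D ==> (pr D ^^ card X) w = rr D" if "D \<in> cs" for D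
  using Q that by (auto simp: rr_def pr_def)
 \<comment> \<open>Siblings are numbered from 1 in their order as natural numbers; 0 is reserved for
   the root.\<close>
 define cR where "cR D u = (if u = rr D then 0 else Suc (card {v\<in>D. v < u & v ~= rr D & pr D v = pr D u}))" for D u
 define R where "R w = rep (comp w)" for w
 define h where "h w = inv_into (R w) (th (comp w)) w" for w
 define p where "p w = th (comp w) (pr (R w) (h w))" for w
 define c where "c w = cR (R w) (h w)" for w
 have Ccs: "comp w \<in> cs" if "w \<in> X" for w using that by (simp add: cs_def)
 have Rcs: "R w \<in> cs" if "w \<in> X" for w unfolding R_def by (rule rep(1)[OF Ccs[OF that]])
 have thb: "bij_betw (th (comp w)) (R w) (comp w)" if "w \<in> X" for w
  using th[OF Ccs[OF that]] by (simp add: iso_def R_def)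
 have tha: "a u v = a (th (comp w) u) (th (comp w) v)" if "w \<in> X" "u \<in> R w" "v \<in> R w" for w u v
  using th[OF Ccs[OF that(1)]] that by (simp add: iso_def R_def)
 have thc: "col u (th (comp w) u)" if "w \<in> X" "u \<in> R w" for w u
  using th[OF Ccs[OF that(1)]] that by (simp add: iso_def R_def)
 have csX: "D \<subseteq> X" if "D \<in> cs" for D using that compX by (auto simp: cs_def)
 have hR: "h w \<in> R w" "th (comp w) (h w) = w" if "w \<in> X" for w
  using thb[OF that] self[of w] by (auto simp: h_def bij_betw_def inv_into_into f_inv_into_f)
 have up: "th (comp w) u \<in> X" "(w, th (comp w) u) \<in> E\<^sup>*" "comp (th (comp w) u) = comp w" "R (th (comp w) u) = R w" "h (th (comp w) u) = u"
  if "w \<in> X" "u \<in> R w" for w u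
 proof -
  have "th (comp w) u \<in> comp w" using thb[OF that(1)] that(2) by (auto simp: bij_betw_def)
  then show 1: "(w, th (comp w) u) \<in> E\<^sup>*" by (simp add: comp_def)
  show "th (comp w) u \<in> X" using compX[OF that(1)] \<open>th (comp w) u \<in> comp w\<close> by blast
  show 2: "comp (th (comp w) u) = comp w" using comp_eq[OF 1] by simp
  then show 3: "R (th (comp w) u) = R w" by (simp add: R_def)
  show "h (th (comp w) u) = u" unfolding h_def 2 3
   using thb[OF that(1)] that(2) by (simp add: bij_betw_def inv_into_f_f)
 qed
 have prR: "pr (R w) (h w) \<in> R w" if "w \<in> X" for w using tree(3)[OF Rcs[OF that]] hR(1)[OF that] .
 have pX: "p w \<in> X" "(w, p w) \<in> E\<^sup>*" "R (p w) = R w" "h (p w) = pr (R w) (h w)" if "w \<in> X" for w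
  unfolding p_def using up[OF that prR[OF that]] by simp_all
 have it: "(p ^^ i) w \<in> X & R ((p ^^ i) w) = R w & h ((p ^^ i) w) = (pr (R w) ^^ i) (h w)" if "w \<in> X" for w i
  by (induction i) (use that pX in auto)
 have cit: "c ((p ^^ i) w) = cR (R w) ((pr (R w) ^^ i) (h w))" if "w \<in> X" for w i
  unfolding c_def using it[OF that, of i] by simp
 have prD: "(pr D ^^ i) u \<in> D" if "D \<in> cs" "u \<in> D" for D i u using tree(3)[OF that(1)] that(2) by (induction i) auto
 have rrfix: "(pr D ^^ i) (rr D) = rr D" if "D \<in> cs" for D i using tree(2)[OF that] by (induction i) auto
 have late: "(pr D ^^ i) u = rr D" if "D \<in> cs" "u \<in> D" "card X \<le> i" for D i u
 proof -
  have "(pr D ^^ i) u = (pr D ^^ (i - card X + card X)) u" using that(3) by simp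
  also have "\<dots> = (pr D ^^ (i - card X)) ((pr D ^^ card X) u)" by (simp only: funpow_add o_apply)
  also have "\<dots> = rr D" using tree(5)[OF that(1,2)] rrfix[OF that(1)] by simp
  finally show ?thesis .
 qed
 \<comment> \<open>Both paths are at the root after \<open>card X\<close> steps. Going back from
   there, equal parents and equal child numbers give equal children; \<open>card X < M\<close>
   guarantees that the compared sequences are long enough.\<close>
 have inj: "u = v" if D: "D \<in> cs" and uv: "u \<in> D" "v \<in> D" and e: "ALL i<M. cR D ((pr D ^^ i) u) = cR D ((pr D ^^ i) v)" for D u v
 proof -
  have fD: "finite D" by (rule finite_subset[OF csX[OF D] fin])
  have "(pr D ^^ (card X - j)) u = (pr D ^^ (card X - j)) v" if "j \<le> card X" for j
   using that
  proof (induction j)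
   case 0
   then show ?case using tree(5)[OF D] uv by simp
  next
   case (Suc j)
   let ?i = "card X - Suc j" let ?u = "(pr D ^^ ?i) u" let ?v = "(pr D ^^ ?i) v"
   have i: "card X - j = Suc ?i" using Suc.prems by simp
   have pe: "pr D ?u = pr D ?v" using Suc.IH Suc.prems unfolding i by simp
   have ce: "cR D ?u = cR D ?v" using e M by simp
   have m: "?u \<in> D" "?v \<in> D" using prD[OF D] uv by blast+
   show ?case
   proof (cases "?u = rr D \<or> ?v = rr D")
    case True
    then show ?thesis using ce by (auto simp: cR_def split: if_splits)
   next
    case False
    let ?S = "{v\<in>D. v ~= rr D & pr D v = pr D ?u}"
    have s: "{z\<in>?S. z < x} = {z\<in>D. z < x & z ~= rr D & pr D z = pr D ?u}" for x by auto
    have k: "card {z\<in>?S. z < ?u} = card {z\<in>?S. z < ?v}"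
     unfolding s using ce False pe by (simp add: cR_def)
    have "?u \<in> ?S" "?v \<in> ?S" using m False pe by simp_all
    moreover have "finite ?S" using fD by simp
    ultimately show ?thesis using k by (intro rank_inject[of ?S ?u ?v])
   qed
  qed
  from this[of "card X"] show ?thesis by simp
 qed
 show ?thesis
 proof (rule that[of p c R h])
  fix w assume w: "w \<in> X"
  show "p w \<in> X" "(w, p w) \<in> E\<^sup>*" using pX[OF w] by simp_all
  have "col (h w) w" using thc[OF w hR(1)[OF w]] hR(2)[OF w] by simp
  then show "col w (h w)" by (rule col_sym)
  show "(w, p w) \<in> E" if "c w ~= 0"
  proof -
   have ne: "h w ~= rr (R w)" using that by (auto simp: c_def cR_def)
   have "(h w, pr (R w) (h w)) \<in> E" by (rule tree(4)[OF Rcs[OF w] hR(1)[OF w] ne])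
   moreover have "h w \<in> X" "pr (R w) (h w) \<in> X" using csX[OF Rcs[OF w]] hR(1)[OF w] prR[OF w] by blast+
   moreover have "col (h w) w" using thc[OF w hR(1)[OF w]] hR(2)[OF w] by simp
   moreover have "col (pr (R w) (h w)) (p w)" unfolding p_def by (rule thc[OF w prR[OF w]])
   moreover have "a (h w) (pr (R w) (h w)) = a w (p w)"
    using tha[OF w hR(1)[OF w] prR[OF w]] hR(2)[OF w] by (simp add: p_def)
   ultimately show ?thesis using Eiso[of "h w" "pr (R w) (h w)" w "p w"] w pX(1)[OF w] by simp
  qed
  show "p w = w" if "c w = 0"
  proof -
   have "h w = rr (R w)" using that by (auto simp: c_def cR_def split: if_splits)
   then have "pr (R w) (h w) = h w" using tree(2)[OF Rcs[OF w]] by simp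
   then show ?thesis using hR(2)[OF w] by (simp add: p_def)
  qed
  show "c ((p ^^ i) w) = 0" if "card X \<le> i" for i
   unfolding cit[OF w] late[OF Rcs[OF w] hR(1)[OF w] that] by (simp add: cR_def)
  show "c w \<le> d"
  proof (cases "h w = rr (R w)")
   case False
   let ?D = "R w" let ?u = "h w"
   let ?S = "{v\<in>?D. v < ?u & v ~= rr ?D & pr ?D v = pr ?D ?u}"
   have "?S \<subseteq> X" using csX[OF Rcs[OF w]] by blast
   then have fS: "finite ?S" using fin by (rule finite_subset)
   have "{v. (pr ?D ?u, v) \<in> E} \<subseteq> X" using EX by blast
   then have fin': "finite {v. (pr ?D ?u, v) \<in> E}" using fin by (rule finite_subset)
   \<comment> \<open>Siblings are neighbours of their common parent, so a child number cannot exceed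
     the degree of the parent.\<close>
   have "insert ?u ?S \<subseteq> {v. (pr ?D ?u, v) \<in> E}"
   proof
    fix v assume "v \<in> insert ?u ?S"
    then have "v \<in> ?D" "v ~= rr ?D" "pr ?D v = pr ?D ?u" using False hR(1)[OF w] by auto
    then have "(v, pr ?D ?u) \<in> E" using tree(4)[OF Rcs[OF w], of v] by simp
    then show "v \<in> {v. (pr ?D ?u, v) \<in> E}" using symE by (simp add: symD)
   qed
   then have "card (insert ?u ?S) \<le> card {v. (pr ?D ?u, v) \<in> E}" by (rule card_mono[OF fin'])
   also have "\<dots> \<le> d" by (rule deg)
   finally have "card (insert ?u ?S) \<le> d" .
   then show ?thesis using fS False by (simp add: c_def cR_def)
  qed (simp add: c_def cR_def)
  fix z
  show "R w = R z" if "(w, z) \<in> E\<^sup>*" using comp_eq[OF that] by (simp add: R_def)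
  show "w = z" if "(w, z) \<in> E\<^sup>*" "h w = h z"
  proof -
   have "z \<in> X" using compX[OF w] that(1) by (auto simp: comp_def)
   then have z: "th (comp z) (h z) = z" by (rule hR(2))
   have "w = th (comp w) (h w)" using hR(2)[OF w] by (rule sym)
   also have "\<dots> = th (comp z) (h z)" unfolding comp_eq[OF that(1)] that(2) by (rule refl)
   finally show ?thesis unfolding z .
  qed
  show "a w z = a (h w) (h z)" if "(w, z) \<in> E\<^sup>*"
  proof -
   have z: "z \<in> X" using compX[OF w] that(1) by (auto simp: comp_def)
   have e: "comp z = comp w" "R z = R w" using comp_eq[OF that] by (simp_all add: R_def)
   have "h z \<in> R w" using hR(1)[OF z] unfolding e .
   from tha[OF w hR(1)[OF w] this] have "a (h w) (h z) = a (th (comp w) (h w)) (th (comp z) (h z))" unfolding e .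
   then show ?thesis unfolding hR(2)[OF w] hR(2)[OF z] by (rule sym)
  qed
  show "R w = R z" if "z \<in> X" "bij_betw \<theta> {u. (w, u) \<in> E\<^sup>*} {v. (z, v) \<in> E\<^sup>*}"
    "!!u v. (w, u) \<in> E\<^sup>* ==> (w, v) \<in> E\<^sup>* ==> a u v = a (\<theta> u) (\<theta> v)"
    "!!u. (w, u) \<in> E\<^sup>* ==> col u (\<theta> u)" for \<theta>
  proof -
   have "iso (comp w) (comp z) \<theta>" using that(2-4) by (simp add: iso_def comp_def)
   then show ?thesis unfolding R_def by (intro rep_eq) (auto simp: eqv_def)
  qed
  assume z: "z \<in> X" and Rz: "R w = R z"
  show "h w = h z" if "ALL i<M. c ((p ^^ i) w) = c ((p ^^ i) z)"
  proof (rule inj[OF Rcs[OF w] hR(1)[OF w]])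
   show "h z \<in> R w" using hR(1)[OF z] unfolding Rz .
   show "ALL i<M. cR (R w) ((pr (R w) ^^ i) (h w)) = cR (R w) ((pr (R w) ^^ i) (h z))"
    using that unfolding cit[OF w] cit[OF z] Rz .
  qed
  show "c ((p ^^ i) w) = c ((p ^^ i) z)" if "h w = h z" for i
   unfolding cit[OF w] cit[OF z] that Rz by (rule refl)
  show "\<exists>v\<in>X. (z, v) \<in> E\<^sup>* & h v = h w"
  proof -
   have "h w \<in> R z" using hR(1)[OF w] unfolding Rz .
   from up[OF z this] show ?thesis by blast
  qed
 qed
qed

text \<open>The decoder of an isomorphism certificate, phrased by bounded counts, sums and
  quantifiers so that a machine can evaluate it. Positions below \<open>ell\<close> stand for graph
  vertices, positions from \<open>ell\<close> to \<open>2 * ell - 1\<close> for labels, and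
  \<open>vld\<close> marks those in use. The certificate consists of the individualised pairs
  \<open>tg\<close>, \<open>ts\<close>, the number \<open>pp\<close> of the parent among the
  deviating neighbours and the child number \<open>cc\<close>.\<close>

locale gi =
 fixes M ell tau :: nat and vld :: "nat => bool" and al :: "nat => nat => bool" and tg ts pp cc :: "nat => nat"
begin

definition "same w z <-> (w < ell <-> z < ell)"
definition "tt i w = (if w < ell then tg i else ts i)"
definition "pos w <-> w < 2 * ell & vld w"
definition "pat w z <-> (ALL i<tau. (al w (tt i w) <-> al z (tt i z)) & (w = tt i w <-> z = tt i z))"
definition "cnt w z = card {y. pos y & same y w & pat y z}"
definition "cnta w z = card {y. pos y & same y w & pat y z & al w y}"
definition "maj w z <-> cnt w z < 2 * cnta w z"
definition "col w z <-> pat w z & (ALL y. pos y --> (maj w y <-> maj z y))"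
text \<open>Symmetrised in order to obtain an undirected graph; its degree is bounded by the sum of
  the two bounds of \<open>exists_separating_set\<close>.\<close>

definition "adev w z <-> pos w & pos z & same w z & ((al w z ~= maj w z) \<or> (al z w ~= maj z w))"
text \<open>For a correct certificate the set is a singleton, and summing it is a definite
  description that can be computed. Naming the parent by its rank among few neighbours takes far
  fewer bits than naming its position.\<close>

definition "par w = (if cc w = 0 then w else \<Sum>{u. adev w u & card {v. v < u & adev w v} = pp w})"
definition "anc i w = (par ^^ i) w"
definition "rootp w = anc M w"
definition "sim w z <-> (ALL i<M. cc (anc i w) = cc (anc i z))"
text \<open>Equality of addresses (\<open>sim\<close>) relates the component with root
  \<open>x\<close> to that with root \<open>y\<close> in a total and surjective way that respects
  colour and adjacency. For a correct certificate addresses are unique inside a component, so this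
  is an isomorphism.\<close>

definition "mat x y <->
 (ALL w. pos w & rootp w = x --> (EX z. pos z & rootp z = y & sim w z & col w z)) &
 (ALL z. pos z & rootp z = y --> (EX w. pos w & rootp w = x & sim w z)) &
 (ALL w w' z z'. pos w & pos w' & pos z & pos z' & rootp w = x & rootp w' = x & rootp z = y & rootp z' = y &
   sim w z & sim w' z' --> (al w w' <-> al z z'))"
definition "rkG x y = card {x'. x' < x & x' < ell & pos x' & cc x' = 0 & mat x' y}"
definition "rkS x y = card {y'. y' < y & ~ y' < ell & pos y' & cc y' = 0 & mat x y'}"
text \<open>Components of one type are paired by the ranks of their roots, and inside a pair equal
  addresses correspond. The sum again extracts the element of a singleton.\<close>

definition "phi w = \<Sum>{z. pos z & ~ z < ell & sim w z & mat (rootp w) (rootp z) & rkG (rootp w) (rootp z) = rkS (rootp w) (rootp z)}"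

end

text \<open>The situation of a correct certificate: \<open>\<psi>\<close> is an isomorphism from the
  graph side to the label side, and all data on the label side are the images of those on the graph
  side. The decoder does not know \<open>\<psi>\<close>, and its result \<open>phi\<close> may
  differ from it. The assumptions on \<open>R\<close>, \<open>h\<close>, \<open>p\<close>,
  \<open>c\<close> are the conclusions of \<open>tree_templates\<close>.\<close>

locale gi_iso = gi +
 fixes X T :: "nat set" and \<psi> :: "nat => nat" and a :: "nat => nat => bool"
  and R :: "nat => nat set" and h p c :: "nat => nat" and E :: "(nat \<times> nat) set" and colS
 assumes X: "X = {w. pos w & w < ell}" and M: "2 * ell \<le> M"
  and psi: "bij_betw \<psi> X {w. pos w & ~ w < ell}"
  and a: "!!u v. a u v <-> u \<in> X & v \<in> X & al u v"
  and al_psi: "!!u v. u \<in> X ==> v \<in> X ==> al u v <-> al (\<psi> u) (\<psi> v)"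
  and TX: "T \<subseteq> X" and tg: "tg ` {..<tau} = T" and ts: "!!i. i < tau ==> ts i = \<psi> (tg i)"
  and colS: "!!u v. colS u v <-> patS a T u v & (\<forall>y\<in>X. majS X a T u y = majS X a T v y)"
  and E: "E = {(u, v). u \<in> X & v \<in> X & (v \<in> devS X a T u \<or> u \<in> devS X a T v)}"
  and p1: "!!w. w \<in> X ==> p w \<in> X" and p2: "!!w. w \<in> X ==> (w, p w) \<in> E\<^sup>*"
  and p3: "!!w. w \<in> X ==> c w ~= 0 ==> (w, p w) \<in> E" and p4: "!!w. w \<in> X ==> c w = 0 ==> p w = w"
  and p5: "!!w i. w \<in> X ==> card X \<le> i ==> c ((p ^^ i) w) = 0"
  and p6: "!!w z. w \<in> X ==> z \<in> X ==> R w = R z ==> ALL i<M. c ((p ^^ i) w) = c ((p ^^ i) z) ==> h w = h z"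
  and p7: "!!w z i. w \<in> X ==> z \<in> X ==> R w = R z ==> h w = h z ==> c ((p ^^ i) w) = c ((p ^^ i) z)"
  and p8: "!!w z. w \<in> X ==> (w, z) \<in> E\<^sup>* ==> R w = R z"
  and p9: "!!w z. w \<in> X ==> (w, z) \<in> E\<^sup>* ==> h w = h z ==> w = z"
  and p10: "!!w z. w \<in> X ==> z \<in> X ==> R w = R z ==> \<exists>v\<in>X. (z, v) \<in> E\<^sup>* & h v = h w"
  and p11: "!!u v. u \<in> X ==> (u, v) \<in> E\<^sup>* ==> a u v = a (h u) (h v)"
  and p12: "!!u. u \<in> X ==> colS u (h u)"
  and p14: "!!w z \<theta>. w \<in> X ==> z \<in> X ==> bij_betw \<theta> {u. (w, u) \<in> E\<^sup>*} {v. (z, v) \<in> E\<^sup>*} ==>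
    (!!u v. (w, u) \<in> E\<^sup>* ==> (w, v) \<in> E\<^sup>* ==> a u v = a (\<theta> u) (\<theta> v)) ==>
    (!!u. (w, u) \<in> E\<^sup>* ==> colS u (\<theta> u)) ==> R w = R z"
  and cc: "!!u. u \<in> X ==> cc u = c u" "!!u. u \<in> X ==> cc (\<psi> u) = c u"
  and pp: "!!u. u \<in> X ==> pp u = card {v. v < p u & adev u v}"
   "!!u. u \<in> X ==> pp (\<psi> u) = card {v. v < \<psi> (p u) & adev (\<psi> u) v}"
begin

text \<open>\<open>kp\<close> brings a position of either side back to the graph side, and
  \<open>lf w\<close> transports a graph vertex to the side of \<open>w\<close>. Every notion of the
  decoder is computed on \<open>X\<close> by way of these two maps, which treats both sides at
  once.\<close>

definition "kp w = (if w < ell then w else inv_into X \<psi> w)"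
definition "lf w v = (if w < ell then v else \<psi> v)"

lemma finX: "finite X" unfolding X by (rule finite_subset[of _ "{..<2*ell}"]) (auto simp: pos_def)

lemma cardX: "card X \<le> ell"
 using card_mono[of "{..<ell}" X] unfolding X by auto

lemma kp_in: "pos w ==> kp w \<in> X"
proof -
 assume w: "pos w"
 show ?thesis
 proof (cases "w < ell")
  case False
  then have "w \<in> \<psi> ` X" using psi w by (simp add: bij_betw_def)
  then show ?thesis using False by (simp add: kp_def inv_into_into)
 next
  case True
  then have "kp w = w" by (simp add: kp_def)
  then show ?thesis using w True by (simp only: X mem_Collect_eq)
 qed
qed

lemma lf_kp: "pos w ==> lf w (kp w) = w"
 using psi unfolding kp_def lf_def by (auto simp: bij_betw_def f_inv_into_f)

lemma X_lt: "u \<in> X ==> u < ell" "u \<in> X ==> pos u"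
 by (auto simp: X)

lemma psi_pos: "u \<in> X ==> pos (\<psi> u)" "u \<in> X ==> ~ \<psi> u < ell"
 using psi by (auto simp: bij_betw_def)

lemma psi_inj: "u \<in> X ==> v \<in> X ==> \<psi> u = \<psi> v <-> u = v"
 using psi by (auto simp: bij_betw_def inj_on_def)

lemma lf_pos: "v \<in> X ==> pos (lf w v)" "v \<in> X ==> same w (lf w v)"
 using X_lt psi_pos by (auto simp: lf_def same_def)

lemma kp_X: "u \<in> X ==> kp u = u" "u \<in> X ==> kp (\<psi> u) = u"
 using X_lt psi_pos psi by (auto simp: kp_def bij_betw_def inv_into_f_f)

lemma kp_lf: "u \<in> X ==> kp (lf w u) = u"
 by (simp add: lf_def kp_X)

lemma same_lf: "same w z ==> lf w v = lf z v"
 by (auto simp: same_def lf_def)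

lemma al_kp: "pos w ==> pos z ==> same w z ==> al w z <-> a (kp w) (kp z)"
 using al_psi[OF kp_in kp_in, of w z] lf_kp[of w] lf_kp[of z] kp_in[of w] kp_in[of z]
 by (cases "w < ell") (auto simp: a lf_def same_def kp_def)

lemma tt_kp:
 assumes "pos w" "i < tau"
 shows "al w (tt i w) <-> a (kp w) (tg i)" "w = tt i w <-> kp w = tg i"
proof -
 have t: "tg i \<in> X" using assms(2) tg TX by blast
 have e: "tt i w = lf w (tg i)" using ts[OF assms(2)] by (simp add: tt_def lf_def)
 show "al w (tt i w) <-> a (kp w) (tg i)"
  unfolding e using al_kp[OF assms(1) lf_pos(1)[OF t] lf_pos(2)[OF t]] by (simp add: kp_lf[OF t])
 show "w = tt i w <-> kp w = tg i"
  unfolding e using lf_kp[OF assms(1)] kp_lf[OF t, of w] by metis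
qed

lemma pat_kp: "pos w ==> pos z ==> pat w z <-> patS a T (kp w) (kp z)"
 unfolding pat_def patS_def tg[symmetric] by (auto simp: tt_kp)

lemma card_side:
 assumes "pos w"
 shows "card {y. pos y & same y w & P (kp y)} = card {y\<in>X. P y}"
proof -
 have "{y. pos y & same y w & P (kp y)} = lf w ` {y\<in>X. P y}"
 proof (intro equalityI subsetI)
  fix y assume y: "y \<in> {y. pos y & same y w & P (kp y)}"
  then have "y = lf w (kp y)" using lf_kp[of y] same_lf[of y w] by simp
  then show "y \<in> lf w ` {y\<in>X. P y}" using y kp_in[of y] by blast
 next
  fix y assume "y \<in> lf w ` {y\<in>X. P y}"
  then obtain u where u: "u \<in> X" "P u" "y = lf w u" by blast
  then show "y \<in> {y. pos y & same y w & P (kp y)}"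
   using lf_pos[OF u(1), of w] kp_lf[OF u(1)] by (simp add: same_def)
 qed
 moreover have "inj_on (lf w) {y\<in>X. P y}"
  by (rule inj_on_inverseI[of _ kp]) (use kp_lf in blast)
 ultimately show ?thesis by (simp add: card_image)
qed

lemma maj_kp:
 assumes w: "pos w" and z: "pos z"
 shows "maj w z <-> majS X a T (kp w) (kp z)"
proof -
 have "{y. pos y & same y w & pat y z} = {y. pos y & same y w & patS a T (kp y) (kp z)}"
  using pat_kp[OF _ z] by blast
 then have 1: "cnt w z = card (clsS X a T (kp z))"
  unfolding cnt_def clsS_def using card_side[OF w, of "%u. patS a T u (kp z)"] by simp
 have "{y. pos y & same y w & pat y z & al w y} = {y. pos y & same y w & patS a T (kp y) (kp z) & a (kp w) (kp y)}"
  using pat_kp[OF _ z] al_kp[OF w] by (auto simp: same_def)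
 then have "cnta w z = card {y\<in>X. patS a T y (kp z) & a (kp w) y}"
  unfolding cnta_def using card_side[OF w, of "%u. patS a T u (kp z) & a (kp w) u"] by simp
 also have "{y\<in>X. patS a T y (kp z) & a (kp w) y} = {y\<in>clsS X a T (kp z). a (kp w) y}" by (auto simp: clsS_def)
 finally show ?thesis using 1 by (simp add: maj_def majS_def)
qed

lemma col_kp:
 assumes w: "pos w" and z: "pos z"
 shows "col w z <-> colS (kp w) (kp z)"
proof -
 have "(ALL y. pos y --> (maj w y <-> maj z y)) <-> (\<forall>u\<in>X. majS X a T (kp w) u = majS X a T (kp z) u)"
 proof
  assume h: "ALL y. pos y --> (maj w y <-> maj z y)"
  show "\<forall>u\<in>X. majS X a T (kp w) u = majS X a T (kp z) u"
  proof
   fix u assume u: "u \<in> X"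
   show "majS X a T (kp w) u = majS X a T (kp z) u"
    using h X_lt(2)[OF u] maj_kp[OF w X_lt(2)[OF u]] maj_kp[OF z X_lt(2)[OF u]] kp_X(1)[OF u] by simp
  qed
 next
  assume "\<forall>u\<in>X. majS X a T (kp w) u = majS X a T (kp z) u"
  then show "ALL y. pos y --> (maj w y <-> maj z y)"
   using maj_kp[OF w] maj_kp[OF z] kp_in by simp
 qed
 then show ?thesis unfolding col_def colS using pat_kp[OF w z] by simp
qed

lemma adev_kp: "pos w ==> pos z ==> same w z ==> adev w z <-> (kp w, kp z) \<in> E"
 unfolding adev_def E devS_def
 using al_kp[of w z] al_kp[of z w] maj_kp[of w z] maj_kp[of z w] kp_in[of w] kp_in[of z]
 by (auto simp: same_def)

lemma par_kp:
 assumes "pos w"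
 shows "par w = lf w (p (kp w))"
proof (cases "cc w = 0")
 case True
 have "c (kp w) = 0"
  using True cc(1)[OF kp_in[OF assms]] cc(2)[OF kp_in[OF assms]] lf_kp[OF assms] by (cases "w < ell") (auto simp: lf_def)
 then have "p (kp w) = kp w" using p4[OF kp_in[OF assms]] by simp
 then show ?thesis using True lf_kp[OF assms] by (simp add: par_def)
next
 case False
 let ?u = "lf w (p (kp w))"
 have k: "kp w \<in> X" "p (kp w) \<in> X" using kp_in[OF assms] p1 by auto
 have "c (kp w) ~= 0"
  using False cc(1)[OF k(1)] cc(2)[OF k(1)] lf_kp[OF assms] by (cases "w < ell") (auto simp: lf_def)
 then have "(kp w, p (kp w)) \<in> E" using p3[OF k(1)] by simp
 then have U: "adev w ?u"
  using adev_kp[OF assms lf_pos(1)[OF k(2)] lf_pos(2)[OF k(2)]] kp_lf[OF k(2)] by simp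
 have ppw: "pp w = card {v. v < ?u & adev w v}"
  using pp(1)[OF k(1)] pp(2)[OF k(1)] lf_kp[OF assms] by (cases "w < ell") (auto simp: lf_def)
 have fin: "finite {v. adev w v}" by (rule finite_subset[of _ "{..<2*ell}"]) (auto simp: adev_def pos_def)
 have s: "{z \<in> {v. adev w v}. z < x} = {v. v < x & adev w v}" for x by auto
 have "{u. adev w u & card {v. v < u & adev w v} = pp w} = {?u}"
 proof (intro equalityI subsetI)
  fix u assume "u \<in> {u. adev w u & card {v. v < u & adev w v} = pp w}"
  then have u: "adev w u" "card {v. v < u & adev w v} = card {v. v < ?u & adev w v}" using ppw by simp_all
  have "u = ?u"
   by (rule rank_inject[OF fin]) (use u U in \<open>simp_all add: conj_commute\<close>)
  then show "u \<in> {?u}" by simp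
 qed (use U ppw in simp)
 then show ?thesis using False by (simp add: par_def)
qed

lemma par_pos: "pos w ==> pos (par w) & same w (par w) & kp (par w) = p (kp w)"
 using par_kp[of w] lf_pos[OF p1[OF kp_in], of w w] kp_lf[OF p1[OF kp_in], of w w] by simp

lemma anc_kp: "pos w ==> pos (anc i w) & same w (anc i w) & kp (anc i w) = (p ^^ i) (kp w)"
proof (induction i)
 case (Suc i)
 then show ?case using par_pos[of "anc i w"] by (auto simp: anc_def same_def)
qed (simp add: anc_def same_def)

lemma pow_X: "u \<in> X ==> (p ^^ i) u \<in> X"
 by (induction i) (auto intro: p1)

lemma cc_kp: "pos w ==> cc w = c (kp w)"
 using cc(1)[OF kp_in, of w] cc(2)[OF kp_in, of w] lf_kp[of w] by (cases "w < ell") (auto simp: lf_def)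

lemma sim_kp: "pos w ==> pos z ==> sim w z <-> (ALL i<M. c ((p ^^ i) (kp w)) = c ((p ^^ i) (kp z)))"
 unfolding sim_def using anc_kp cc_kp by simp

definition "rt u = (p ^^ M) u"

lemma symS: "(u, v) \<in> E\<^sup>* ==> (v, u) \<in> E\<^sup>*"
proof -
 have "sym E" unfolding E by (rule symI) auto
 then show "(u, v) \<in> E\<^sup>* ==> (v, u) \<in> E\<^sup>*" using sym_rtrancl[of E] by (auto dest: symD)
qed

lemma conn_X: "(u, v) \<in> E\<^sup>* ==> u \<in> X ==> v \<in> X"
 by (induction rule: rtrancl_induct) (auto simp: E)

lemma rt: "u \<in> X ==> rt u \<in> X" "u \<in> X ==> (u, rt u) \<in> E\<^sup>*" "u \<in> X ==> c (rt u) = 0"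
proof -
 assume u: "u \<in> X"
 show "rt u \<in> X" unfolding rt_def using u by (rule pow_X)
 have "(u, (p ^^ i) u) \<in> E\<^sup>*" for i
 proof (induction i)
  case (Suc i)
  then show ?case using p2[OF pow_X[OF u, of i]] by (simp add: rtrancl_trans)
 qed simp
 then show "(u, rt u) \<in> E\<^sup>*" unfolding rt_def .
 show "c (rt u) = 0" unfolding rt_def using u cardX M by (intro p5) auto
qed

lemma zero_fix: "u \<in> X ==> c u = 0 ==> (p ^^ i) u = u"
 by (induction i) (auto simp: p4)

lemma zero_unique: "u \<in> X ==> (u, v) \<in> E\<^sup>* ==> c u = 0 ==> c v = 0 ==> u = v"
proof -
 assume h: "u \<in> X" "(u, v) \<in> E\<^sup>*" "c u = 0" "c v = 0"
 have v: "v \<in> X" using conn_X[OF h(2,1)] .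
 have "h u = h v"
  by (rule p6[OF h(1) v p8[OF h(1,2)]]) (simp add: zero_fix[OF h(1,3)] zero_fix[OF v h(4)] h(3,4))
 then show "u = v" by (rule p9[OF h(1,2)])
qed

lemma rt_eq_iff: "u \<in> X ==> v \<in> X ==> rt u = rt v <-> (u, v) \<in> E\<^sup>*"
proof
 assume h: "u \<in> X" "v \<in> X" "rt u = rt v"
 have "(u, rt u) \<in> E\<^sup>*" "(rt v, v) \<in> E\<^sup>*" using rt(2)[OF h(1)] symS[OF rt(2)[OF h(2)]] by auto
 then show "(u, v) \<in> E\<^sup>*" using h(3) by (simp add: rtrancl_trans)
next
 assume h: "u \<in> X" "v \<in> X" "(u, v) \<in> E\<^sup>*"
 have "(rt u, u) \<in> E\<^sup>*" by (rule symS[OF rt(2)[OF h(1)]])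
 then have "(rt u, rt v) \<in> E\<^sup>*" using h(3) rt(2)[OF h(2)] by (blast intro: rtrancl_trans)
 then show "rt u = rt v" by (rule zero_unique[OF rt(1)[OF h(1)] _ rt(3)[OF h(1)] rt(3)[OF h(2)]])
qed

lemma root_kp: "pos w ==> rootp w = lf w (rt (kp w))"
 using anc_kp[of w M] lf_kp[of "anc M w"] same_lf[of w "anc M w"] by (simp add: rootp_def rt_def)

lemma root_pos: "pos w ==> pos (rootp w) & same w (rootp w) & kp (rootp w) = rt (kp w)"
 using anc_kp[of w M] by (simp add: rootp_def rt_def)

lemma root_eq: "pos w ==> pos w' ==> rootp w = rootp w' <-> same w w' & (kp w, kp w') \<in> E\<^sup>*"
proof
 assume h: "pos w" "pos w'" "rootp w = rootp w'"
 have "rt (kp w) = rt (kp w')" using root_pos[OF h(1)] root_pos[OF h(2)] h(3) by metis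
 then show "same w w' & (kp w, kp w') \<in> E\<^sup>*"
  using root_pos[OF h(1)] root_pos[OF h(2)] h(3) rt_eq_iff[OF kp_in[OF h(1)] kp_in[OF h(2)]] by (auto simp: same_def)
next
 assume h: "pos w" "pos w'" "same w w' & (kp w, kp w') \<in> E\<^sup>*"
 then have "rt (kp w) = rt (kp w')" using rt_eq_iff[OF kp_in[OF h(1)] kp_in[OF h(2)]] by simp
 then show "rootp w = rootp w'" using root_kp[OF h(1)] root_kp[OF h(2)] same_lf[of w w'] h(3) by simp
qed

lemma colS_sym: "colS u v ==> colS v u"
 using patS_sym[of a T u v] by (simp add: colS)

lemma colS_trans: "colS u v ==> colS v w ==> colS u w"
 using patS_trans[of a T u v w] by (simp add: colS)

lemma colS_h: "u \<in> X ==> v \<in> X ==> h u = h v ==> colS u v"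
 using p12[of u] colS_sym[OF p12[of v]] colS_trans[of u "h u" v] by simp

text \<open>If the templates agree, \<open>sim\<close> coincides with equality of places in the
  template, which is an isomorphism. Conversely, the correspondence asserted by \<open>mat\<close>
  is an isomorphism of the two components, and \<open>p14\<close> says that isomorphic components
  have the same template.\<close>

lemma mat_iff:
 assumes w0: "pos w0" and z0: "pos z0"
 shows "mat (rootp w0) (rootp z0) <-> R (kp w0) = R (kp z0)"
proof
 assume eq: "R (kp w0) = R (kp z0)"
 have Req: "R (kp w) = R (kp z)" if w: "pos w" "rootp w = rootp w0" and z: "pos z" "rootp z = rootp z0" for w z
 proof -
  have "R (kp w0) = R (kp w)" using p8[OF kp_in[OF w0]] root_eq[OF w0 w(1)] w(2) by simp
  moreover have "R (kp z0) = R (kp z)" using p8[OF kp_in[OF z0]] root_eq[OF z0 z(1)] z(2) by simp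
  ultimately show ?thesis using eq by simp
 qed
 have simh: "sim w z <-> h (kp w) = h (kp z)" if w: "pos w" "rootp w = rootp w0" and z: "pos z" "rootp z = rootp z0" for w z
 proof
  assume "sim w z"
  then show "h (kp w) = h (kp z)" using sim_kp[OF w(1) z(1)] by (intro p6[OF kp_in[OF w(1)] kp_in[OF z(1)] Req[OF w z]]) simp
 next
  assume "h (kp w) = h (kp z)"
  then show "sim w z" using p7[OF kp_in[OF w(1)] kp_in[OF z(1)] Req[OF w z]] sim_kp[OF w(1) z(1)] by simp
 qed
 have move: "EX z. pos z & rootp z = rootp z1 & h (kp z) = h (kp w)"
  if w: "pos w" and z1: "pos z1" and e: "R (kp w) = R (kp z1)" for w z1
 proof -
  obtain v where v: "v \<in> X" "(kp z1, v) \<in> E\<^sup>*" "h v = h (kp w)"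
   using p10[OF kp_in[OF w] kp_in[OF z1] e] by blast
  have "rootp z1 = rootp (lf z1 v)"
   using root_eq[OF z1 lf_pos(1)[OF v(1)], of z1] lf_pos(2)[OF v(1), of z1] kp_lf[OF v(1), of z1] v(2) by simp
  then show ?thesis using lf_pos(1)[OF v(1), of z1] kp_lf[OF v(1), of z1] v(3) by (intro exI[of _ "lf z1 v"]) simp
 qed
 show "mat (rootp w0) (rootp z0)"
  unfolding mat_def
 proof (intro conjI allI impI)
  fix w assume w: "pos w & rootp w = rootp w0"
  have "R (kp w) = R (kp z0)" using Req[of w z0] w z0 by simp
  then obtain z where z: "pos z" "rootp z = rootp z0" "h (kp z) = h (kp w)" using move[of w z0] w z0 by blast
  have "sim w z" using simh[of w z] w z by simp
  moreover have "col w z" using col_kp[of w z] colS_h[of "kp w" "kp z"] kp_in[of w] kp_in[of z] w z by simp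
  ultimately show "EX z. pos z & rootp z = rootp z0 & sim w z & col w z" using z by blast
 next
  fix z assume z: "pos z & rootp z = rootp z0"
  have "R (kp z) = R (kp w0)" using Req[of w0 z] z w0 by simp
  then obtain w where w: "pos w" "rootp w = rootp w0" "h (kp w) = h (kp z)" using move[of z w0] z w0 by blast
  then show "EX w. pos w & rootp w = rootp w0 & sim w z" using simh[of w z] z by blast
 next
  fix w w' z z' assume q: "pos w & pos w' & pos z & pos z' & rootp w = rootp w0 & rootp w' = rootp w0 & rootp z = rootp z0 & rootp z' = rootp z0 & sim w z & sim w' z'"
  have hh: "h (kp w) = h (kp z)" "h (kp w') = h (kp z')" using simh[of w z] simh[of w' z'] q by simp_all
  have cw: "same w w'" "(kp w, kp w') \<in> E\<^sup>*" using root_eq[of w w'] q by simp_all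
  have cz: "same z z'" "(kp z, kp z') \<in> E\<^sup>*" using root_eq[of z z'] q by simp_all
  have "al w w' <-> a (h (kp w)) (h (kp w'))" using al_kp[of w w'] p11[OF kp_in cw(2)] q cw(1) by simp
  also have "\<dots> <-> al z z'" unfolding hh using al_kp[of z z'] p11[OF kp_in cz(2)] q cz(1) by simp
  finally show "al w w' <-> al z z'" .
 qed
next
 assume m: "mat (rootp w0) (rootp z0)"
 let ?C = "{u. (kp w0, u) \<in> E\<^sup>*}" let ?D = "{v. (kp z0, v) \<in> E\<^sup>*}"
 have inC: "u \<in> X & pos (lf w0 u) & rootp (lf w0 u) = rootp w0 & kp (lf w0 u) = u" if "(kp w0, u) \<in> E\<^sup>*" for u
 proof -
  have u: "u \<in> X" using conn_X[OF that kp_in[OF w0]] .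
  show ?thesis using u lf_pos[OF u, of w0] kp_lf[OF u, of w0] root_eq[OF w0 lf_pos(1)[OF u], of w0] that by simp
 qed
 have inD: "(kp z0, kp z) \<in> E\<^sup>*" if "pos z" "rootp z = rootp z0" for z
  using root_eq[OF z0 that(1)] that(2) by simp
 have inD': "u \<in> X & pos (lf z0 u) & rootp (lf z0 u) = rootp z0 & kp (lf z0 u) = u" if "(kp z0, u) \<in> E\<^sup>*" for u
 proof -
  have u: "u \<in> X" using conn_X[OF that kp_in[OF z0]] .
  show ?thesis using u lf_pos[OF u, of z0] kp_lf[OF u, of z0] root_eq[OF z0 lf_pos(1)[OF u], of z0] that by simp
 qed
 have "EX z. pos z & rootp z = rootp z0 & sim (lf w0 u) z & col (lf w0 u) z" if "(kp w0, u) \<in> E\<^sup>*" for u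
  using m inC[OF that] unfolding mat_def by simp
 then obtain g where g: "pos (g u)" "rootp (g u) = rootp z0" "sim (lf w0 u) (g u)" "col (lf w0 u) (g u)"
  if "(kp w0, u) \<in> E\<^sup>*" for u by metis
 define \<theta> where "\<theta> u = kp (g u)" for u
 have simS: "ALL i<M. c ((p ^^ i) u) = c ((p ^^ i) (\<theta> u))" if "(kp w0, u) \<in> E\<^sup>*" for u
  using g(3)[OF that] sim_kp[OF _ g(1)[OF that], of "lf w0 u"] inC[OF that] by (simp add: \<theta>_def)
 have uniq: "u = v" if "u \<in> X" "(u, v) \<in> E\<^sup>*" "ALL i<M. c ((p ^^ i) u) = c ((p ^^ i) v)" for u v
  by (rule p9[OF that(1,2) p6[OF that(1) conn_X[OF that(2,1)] p8[OF that(1,2)] that(3)]])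
 have conn2: "(u, v) \<in> E\<^sup>*" if "(x, u) \<in> E\<^sup>*" "(x, v) \<in> E\<^sup>*" for x u v
  using symS[OF that(1)] that(2) by (rule rtrancl_trans)
 have thD: "(kp z0, \<theta> u) \<in> E\<^sup>*" if "(kp w0, u) \<in> E\<^sup>*" for u
  unfolding \<theta>_def by (rule inD[OF g(1,2)[OF that]])
 show "R (kp w0) = R (kp z0)"
 proof (rule p14[OF kp_in[OF w0] kp_in[OF z0], of \<theta>])
  show "bij_betw \<theta> ?C ?D"
  proof (rule bij_betw_imageI)
   show "inj_on \<theta> ?C"
   proof (rule inj_onI)
    fix u v assume uv: "u \<in> ?C" "v \<in> ?C" "\<theta> u = \<theta> v"
    then have "ALL i<M. c ((p ^^ i) u) = c ((p ^^ i) v)" using simS[of u] simS[of v] by simp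
    then show "u = v" using uv inC[of u] conn2[of "kp w0" u v] uniq[of u v] by simp
   qed
   show "\<theta> ` ?C = ?D"
   proof (intro equalityI subsetI)
    fix v assume "v \<in> \<theta> ` ?C"
    then show "v \<in> ?D" using thD by auto
   next
    fix v assume v: "v \<in> ?D"
    then have v': "pos (lf z0 v)" "rootp (lf z0 v) = rootp z0" "kp (lf z0 v) = v" using inD'[of v] by simp_all
    then obtain w where w: "pos w" "rootp w = rootp w0" "sim w (lf z0 v)" using m unfolding mat_def by blast
    have cw: "(kp w0, kp w) \<in> E\<^sup>*" using root_eq[OF w0 w(1)] w(2) by simp
    have "ALL i<M. c ((p ^^ i) (kp w)) = c ((p ^^ i) v)" using sim_kp[OF w(1) v'(1)] w(3) v'(3) by simp
    then have "ALL i<M. c ((p ^^ i) (\<theta> (kp w))) = c ((p ^^ i) v)" using simS[OF cw] by simp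
    then have "\<theta> (kp w) = v"
     using uniq[of "\<theta> (kp w)" v] conn2[OF thD[OF cw], of v] v conn_X[OF thD[OF cw] kp_in[OF z0]] by simp
    then show "v \<in> \<theta> ` ?C" using cw by blast
   qed
  qed
  fix u assume u: "(kp w0, u) \<in> E\<^sup>*"
  show "colS u (\<theta> u)" using g(4)[OF u] col_kp[of "lf w0 u" "g u"] inC[OF u] g(1)[OF u] by (simp add: \<theta>_def)
  fix v assume v: "(kp w0, v) \<in> E\<^sup>*"
  have al: "al (lf w0 u) (lf w0 v) <-> al (g u) (g v)"
   using m inC[OF u] inC[OF v] g(1-3)[OF u] g(1-3)[OF v] unfolding mat_def by blast
  have "same (lf w0 u) (lf w0 v)" "same (g u) (g v)"
   using root_eq[of "lf w0 u" "lf w0 v"] root_eq[of "g u" "g v"] inC[OF u] inC[OF v] g(1,2)[OF u] g(1,2)[OF v] by simp_all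
  then show "a u v = a (\<theta> u) (\<theta> v)"
   using al al_kp[of "lf w0 u" "lf w0 v"] al_kp[of "g u" "g v"] inC[OF u] inC[OF v] g(1)[OF u] g(1)[OF v] by (simp add: \<theta>_def)
 qed
qed

definition "GR r = {x\<in>X. c x = 0 & R x = r}"
definition "SR r = \<psi> ` GR r"

lemma GR_fin: "finite (GR r)" "finite (SR r)" "card (GR r) = card (SR r)"
proof -
 show "finite (GR r)" using finX by (simp add: GR_def)
 then show "finite (SR r)" by (simp add: SR_def)
 have "inj_on \<psi> (GR r)" using psi by (auto simp: bij_betw_def GR_def intro: inj_on_subset)
 then show "card (GR r) = card (SR r)" by (simp add: SR_def card_image)
qed

lemma root_zero: "pos x ==> c (kp x) = 0 ==> rootp x = x"
 using root_kp[of x] zero_fix[OF kp_in, of x M] lf_kp[of x] by (simp add: rt_def)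

text \<open>\<open>phi\<close> keeps the place in the template but may change the component: it
  selects the component whose root has the same rank among the roots of its type. Such a root exists
  since \<open>\<psi>\<close> maps the list \<open>GR\<close> of graph-side roots of a type
  bijectively to the list \<open>SR\<close> on the label side.\<close>

lemma phi_ex:
 assumes w: "w \<in> X"
 obtains v where "v \<in> X" "phi w = \<psi> v" "R v = R w" "h v = h w"
  "card {x\<in>GR (R w). x < rt w} = card {y\<in>SR (R w). y < \<psi> (rt v)}"
proof -
 have pw: "pos w" "kp w = w" "w < ell" using X_lt[OF w] kp_X[OF w] by simp_all
 have rw: "rootp w = rt w" using root_kp[OF pw(1)] pw by (simp add: lf_def)
 have rtw: "rt w \<in> GR (R w)" using rt[OF w] p8[OF w rt(2)[OF w]] by (simp add: GR_def)
 have mz: "mat (rootp w) (rootp z) <-> R (kp z) = R w" if "pos z" for z using mat_iff[OF pw(1) that] pw(2) by auto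
 have ranks: "rkG (rootp w) (rootp z) = card {x\<in>GR (R w). x < rt w} & rkS (rootp w) (rootp z) = card {y\<in>SR (R w). y < rootp z}"
  if z: "pos z" "R (kp z) = R w" for z
 proof
  have "{x'. x' < rootp w & x' < ell & pos x' & cc x' = 0 & mat x' (rootp z)} = {x\<in>GR (R w). x < rt w}"
  proof (rule Collect_cong)
   fix x
   show "(x < rootp w & x < ell & pos x & cc x = 0 & mat x (rootp z)) = (x \<in> GR (R w) & x < rt w)"
   proof (cases "x \<in> X & c x = 0")
    case True
    then have x: "pos x" "x < ell" "kp x = x" "cc x = 0" using X_lt kp_X cc by simp_all
    then have "rootp x = x" using root_zero[OF x(1)] True by simp
    then show ?thesis using mat_iff[OF x(1) z(1)] x z(2) True rw by (auto simp: GR_def)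
   next
    case False
    have "~ (x < ell & pos x & cc x = 0)" using False cc(1)[of x] by (auto simp: X)
    then show ?thesis using False by (auto simp: GR_def)
   qed
  qed
  then show "rkG (rootp w) (rootp z) = card {x\<in>GR (R w). x < rt w}" by (simp add: rkG_def)
  have "{y'. y' < rootp z & ~ y' < ell & pos y' & cc y' = 0 & mat (rootp w) y'} = {y\<in>SR (R w). y < rootp z}"
  proof (rule Collect_cong)
   fix y
   show "(y < rootp z & ~ y < ell & pos y & cc y = 0 & mat (rootp w) y) = (y \<in> SR (R w) & y < rootp z)"
   proof (cases "pos y & ~ y < ell & cc y = 0")
    case True
    then have y: "pos y" "~ y < ell" "c (kp y) = 0" "\<psi> (kp y) = y" "kp y \<in> X"
     using cc_kp[of y] lf_kp[of y] kp_in[of y] by (simp_all add: lf_def)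
    then have "rootp y = y" using root_zero by simp
    then have "mat (rootp w) y <-> R (kp y) = R w" using mz[OF y(1)] by simp
    moreover have "y \<in> SR (R w) <-> R (kp y) = R w"
    proof
     assume "y \<in> SR (R w)"
     then obtain u where "u \<in> X" "R u = R w" "y = \<psi> u" by (auto simp: SR_def GR_def)
     then show "R (kp y) = R w" using kp_X(2)[of u] by simp
    next
     assume "R (kp y) = R w"
     then have "kp y \<in> GR (R w)" using y by (simp add: GR_def)
     then show "y \<in> SR (R w)" unfolding SR_def using y(4) by (metis imageI)
    qed
    ultimately show ?thesis using True by blast
   next
    case False
    have "y \<notin> SR (R w)"
    proof
     assume "y \<in> SR (R w)"
     then obtain u where "u \<in> X" "c u = 0" "y = \<psi> u" by (auto simp: SR_def GR_def)
     then show False using False psi_pos[of u] cc(2)[of u] by simp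
    qed
    then show ?thesis using False by blast
   qed
  qed
  then show "rkS (rootp w) (rootp z) = card {y\<in>SR (R w). y < rootp z}" by (simp add: rkS_def)
 qed
 \<comment> \<open>The root of equal rank on the label side. It is the image of some root
   \<open>u\<close> of the same type, in general not of \<open>rt w\<close>.\<close>
 obtain y where y: "y \<in> SR (R w)" "card {z\<in>SR (R w). z < y} = card {x\<in>GR (R w). x < rt w}"
  using rank_exists[OF GR_fin(1) GR_fin(2) GR_fin(3) rtw] by blast
 obtain u where u: "u \<in> X" "c u = 0" "R u = R w" "y = \<psi> u" using y(1) by (auto simp: SR_def GR_def)
 obtain v where v: "v \<in> X" "(u, v) \<in> E\<^sup>*" "h v = h w" using p10[OF w u(1)] u(3) by auto
 have Rv: "R v = R w" using p8[OF u(1) v(2)] u(3) by simp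
 have rtv: "rt v = u"
  using rt_eq_iff[OF u(1) v(1)] v(2) zero_fix[OF u(1,2), of M] by (simp add: rt_def)
 have pv: "pos (\<psi> v)" "~ \<psi> v < ell" "kp (\<psi> v) = v" using psi_pos[OF v(1)] kp_X[OF v(1)] by simp_all
 have rv: "rootp (\<psi> v) = y" using root_kp[OF pv(1)] pv rtv u(4) by (simp add: lf_def)
 have simw: "sim w z <-> h (kp z) = h w" if "pos z" "R (kp z) = R w" for z
  using sim_kp[OF pw(1) that(1)] p6[OF w kp_in[OF that(1)]] p7[OF w kp_in[OF that(1)]] that(2) pw(2) by auto
 have "{z. pos z & ~ z < ell & sim w z & mat (rootp w) (rootp z) & rkG (rootp w) (rootp z) = rkS (rootp w) (rootp z)} = {\<psi> v}"
 proof (intro equalityI subsetI)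
  fix z assume "z \<in> {z. pos z & ~ z < ell & sim w z & mat (rootp w) (rootp z) & rkG (rootp w) (rootp z) = rkS (rootp w) (rootp z)}"
  then have z: "pos z" "~ z < ell" "sim w z" "R (kp z) = R w" "rkG (rootp w) (rootp z) = rkS (rootp w) (rootp z)" using mz by auto
  have k: "kp z \<in> X" using kp_in[OF z(1)] .
  have "rootp z \<in> SR (R w)"
  proof -
   have "rt (kp z) \<in> GR (R w)" using rt[OF k] p8[OF k rt(2)[OF k]] z(4) by (simp add: GR_def)
   then show ?thesis using root_kp[OF z(1)] z(2) by (simp add: lf_def SR_def)
  qed
  moreover have "card {z'\<in>SR (R w). z' < rootp z} = card {z\<in>SR (R w). z < y}"
   using ranks[OF z(1,4)] z(5) y(2) by simp
  ultimately have "rootp z = y" by (rule rank_inject[OF GR_fin(2) _ y(1)])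
  then have "(v, kp z) \<in> E\<^sup>*" using root_eq[OF pv(1) z(1)] rv pv(3) by simp
  moreover have "h v = h (kp z)" using simw[OF z(1,4)] z(3) v(3) by simp
  ultimately have "v = kp z" by (rule p9[OF v(1)])
  then show "z \<in> {\<psi> v}" using lf_kp[OF z(1)] z(2) by (simp add: lf_def)
 next
  fix z assume "z \<in> {\<psi> v}"
  then have z: "z = \<psi> v" by simp
  have "sim w (\<psi> v)" "mat (rootp w) (rootp (\<psi> v))" "rkG (rootp w) (rootp (\<psi> v)) = rkS (rootp w) (rootp (\<psi> v))"
   using simw[OF pv(1)] mz[OF pv(1)] ranks[OF pv(1)] pv(3) Rv v(3) rv y(2) by simp_all
  then show "z \<in> {z. pos z & ~ z < ell & sim w z & mat (rootp w) (rootp z) & rkG (rootp w) (rootp z) = rkS (rootp w) (rootp z)}"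
   using z pv by simp
 qed
 then have "phi w = \<psi> v" by (simp add: phi_def)
 then show ?thesis using that[OF v(1) _ Rv v(3)] y(2) rtv u(4) by simp
qed

text \<open>Inside a component adjacency is read off in the template. Between different components
  no deviation is possible, so adjacency equals the majority value, and this depends only on
  colours, which \<open>phi\<close> preserves.\<close>

theorem phi_correct:
 assumes w: "w1 \<in> X" "w2 \<in> X"
 shows "phi w1 \<in> \<psi> ` X" "al w1 w2 <-> al (phi w1) (phi w2)"
proof -
 obtain v1 where v1: "v1 \<in> X" "phi w1 = \<psi> v1" "R v1 = R w1" "h v1 = h w1"
  "card {x\<in>GR (R w1). x < rt w1} = card {y\<in>SR (R w1). y < \<psi> (rt v1)}" by (rule phi_ex[OF w(1)])
 obtain v2 where v2: "v2 \<in> X" "phi w2 = \<psi> v2" "R v2 = R w2" "h v2 = h w2"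
  "card {x\<in>GR (R w2). x < rt w2} = card {y\<in>SR (R w2). y < \<psi> (rt v2)}" by (rule phi_ex[OF w(2)])
 show "phi w1 \<in> \<psi> ` X" using v1 by simp
 have GRw: "rt u \<in> GR (R u)" if "u \<in> X" for u using rt[OF that] p8[OF that rt(2)[OF that]] by (simp add: GR_def)
 have SRv: "\<psi> (rt u) \<in> SR (R u)" if "u \<in> X" for u using GRw[OF that] by (simp add: SR_def)
 \<comment> \<open>Roots of one type are determined by their ranks, on both sides; hence
   \<open>phi\<close> neither splits nor merges components.\<close>
 have iff: "(w1, w2) \<in> E\<^sup>* <-> (v1, v2) \<in> E\<^sup>*"
 proof
  assume c: "(w1, w2) \<in> E\<^sup>*"
  have "rt w1 = rt w2" "R w1 = R w2" using rt_eq_iff[OF w] c p8[OF w(1) c] by simp_all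
  then have "\<psi> (rt v1) = \<psi> (rt v2)"
   using rank_inject[OF GR_fin(2), of "\<psi> (rt v1)" "R w1" "\<psi> (rt v2)"] SRv[OF v1(1)] SRv[OF v2(1)] v1(3,5) v2(3,5) by simp
  then have "rt v1 = rt v2" using psi_inj[OF rt(1)[OF v1(1)] rt(1)[OF v2(1)]] by simp
  then show "(v1, v2) \<in> E\<^sup>*" using rt_eq_iff[OF v1(1) v2(1)] by simp
 next
  assume c: "(v1, v2) \<in> E\<^sup>*"
  have "rt v1 = rt v2" "R v1 = R v2" using rt_eq_iff[OF v1(1) v2(1)] c p8[OF v1(1) c] by simp_all
  then have "rt w1 = rt w2"
   using rank_inject[OF GR_fin(1), of "rt w1" "R w1" "rt w2"] GRw[OF w(1)] GRw[OF w(2)] v1(3,5) v2(3,5) by simp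
  then show "(w1, w2) \<in> E\<^sup>*" using rt_eq_iff[OF w] by simp
 qed
 have alv: "al (phi w1) (phi w2) <-> a v1 v2" using al_psi[OF v1(1) v2(1)] v1 v2 a by simp
 have alw: "al w1 w2 <-> a w1 w2" using a w by simp
 show "al w1 w2 <-> al (phi w1) (phi w2)"
 proof (cases "(w1, w2) \<in> E\<^sup>*")
  case True
  have "a w1 w2 = a (h w1) (h w2)" by (rule p11[OF w(1) True])
  moreover have "a v1 v2 = a (h v1) (h v2)" by (rule p11[OF v1(1)]) (use True iff in simp)
  ultimately show ?thesis using alv alw v1(4) v2(4) by simp
 next
  case False
  have nw: "w2 \<notin> devS X a T w1" using False w by (auto simp: E)
  have nv: "v2 \<notin> devS X a T v1" using False iff v1(1) v2(1) by (auto simp: E)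
  have c1: "colS w1 v1" using colS_h[OF w(1) v1(1)] v1(4) by simp
  have c2: "patS a T w2 v2" using colS_h[OF w(2) v2(1)] v2(4) by (simp add: colS)
  have "a w1 w2 = majS X a T w1 w2" using nw w by (simp add: devS_def)
  also have "\<dots> = majS X a T v1 w2" using c1 w(2) by (simp add: colS)
  also have "\<dots> = majS X a T v1 v2" by (rule majS_cong[OF c2])
  also have "\<dots> = a v1 v2" using nv v2(1) by (simp add: devS_def)
  finally show ?thesis using alv alw by simp
 qed
qed

end

text \<open>The bound \<open>m + b\<close> is the degree of the symmetrised deviation graph and so
  bounds parent and child numbers. Together with the number \<open>tau\<close> of pairs it fixes how
  many bits the certificate takes.\<close>

theorem gi_complete:
 fixes al :: "nat => nat => bool" and vld :: "nat => bool"
 assumes ell: "0 < ell" "2 * ell \<le> M"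
  and psi: "bij_betw \<psi> {w. w < ell & vld w} {w. ell \<le> w & w < 2 * ell & vld w}"
  and al_psi: "!!u v. u < ell ==> v < ell ==> vld u ==> vld v ==> al u v <-> al (\<psi> u) (\<psi> v)"
  and sym: "!!u v. u < ell ==> v < ell ==> al u v <-> al v u"
  and small: "card {w. w < ell & vld w} \<le> 2 ^ k" and mb: "0 < m" "0 < b"
  and tau: "1 + k * card {w. w < ell & vld w} div m + m * card {w. w < ell & vld w} div b \<le> tau"
 shows "EX tg ts pp cc. (ALL i<tau. tg i < 2 * ell & ts i < 2 * ell) & (\<forall>i\<ge>tau. tg i = 0 & ts i = 0) &
  (ALL w. pp w \<le> m + b & cc w \<le> m + b & (~ (w < 2 * ell & vld w) --> pp w = 0 & cc w = 0)) &
  (ALL w z. w < ell --> vld w --> z < ell --> vld z -->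
   (let \<phi> = gi.phi M ell tau vld al tg ts pp cc in
    ell \<le> \<phi> w & \<phi> w < 2 * ell & vld (\<phi> w) & (al w z <-> al (\<phi> w) (\<phi> z))))"
proof (cases "{w. w < ell & vld w} = {}")
 case True
 then show ?thesis using ell(1) by (intro exI[of _ "%_. 0"]) auto
next
 case False
 define X where "X = {w. w < ell & vld w}"
 have finX: "finite X" unfolding X_def by simp
 have cardX: "card X \<le> ell" using card_mono[of "{..<ell}" X] by (auto simp: X_def)
 define a where "a u v <-> u \<in> X & v \<in> X & al u v" for u v
 have asym: "a u v <-> a v u" for u v using sym[of u v] by (auto simp: a_def X_def)
 obtain T where T: "T \<subseteq> X" "T ~= {}" "card T \<le> 1 + k * card X div m + m * card X div b"
  and dev: "!!p. p \<in> X ==> card (devS X a T p) \<le> m" and ind: "!!q. q \<in> X ==> card {p\<in>X. q \<in> devS X a T p} \<le> b"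
  by (rule exists_separating_set[of X k m b a]) (use finX False small mb asym in \<open>auto simp: X_def\<close>)
 define E where "E = {(u, v). u \<in> X & v \<in> X & (v \<in> devS X a T u \<or> u \<in> devS X a T v)}"
 define colS where "colS u v <-> patS a T u v & (\<forall>y\<in>X. majS X a T u y = majS X a T v y)" for u v
 have colS_sym: "colS v u" if "colS u v" for u v using that patS_sym[of a T u v] by (simp add: colS_def)
 have colS_trans: "colS u w" if "colS u v" "colS v w" for u v w using that patS_trans[of a T u v w] by (simp add: colS_def)
 have deg: "card {u. (w, u) \<in> E} \<le> m + b" for w
 proof (cases "w \<in> X")
  case True
  have "{u. (w, u) \<in> E} \<subseteq> devS X a T w \<union> {p\<in>X. w \<in> devS X a T p}" by (auto simp: E_def)
  moreover have "finite (devS X a T w \<union> {p\<in>X. w \<in> devS X a T p})" using finX by (simp add: devS_def)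
  ultimately have "card {u. (w, u) \<in> E} \<le> card (devS X a T w \<union> {p\<in>X. w \<in> devS X a T p})" by (rule card_mono[rotated])
  also have "\<dots> \<le> card (devS X a T w) + card {p\<in>X. w \<in> devS X a T p}" by (rule card_Un_le)
  finally show ?thesis using dev[OF True] ind[OF True] by linarith
 next
  case False
  then have "{u. (w, u) \<in> E} = {}" by (simp add: E_def)
  then show ?thesis by simp
 qed
 have Eiso: "(u', v') \<in> E" if u: "u \<in> X" "v \<in> X" "u' \<in> X" "v' \<in> X" "colS u u'" "colS v v'" "a u v = a u' v'" "(u, v) \<in> E" for u v u' v'
 proof -
  have 1: "majS X a T u v = majS X a T u' v'"
   using u(2,5,6) majS_cong[of a T v v' X u'] by (simp add: colS_def)
  have 2: "majS X a T v u = majS X a T v' u'"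
   using u(1,5,6) majS_cong[of a T u u' X v'] by (simp add: colS_def)
  show ?thesis using u(1-4,7,8) 1 2 asym[of u v] asym[of u' v'] by (auto simp: E_def devS_def)
 qed
 have EX: "E \<subseteq> X \<times> X" by (auto simp: E_def)
 have symE: "sym E" by (rule symI) (auto simp: E_def)
 have cM: "card X < M" using cardX ell by linarith
 have colr: "colS u u" for u by (simp add: colS_def)
 obtain R :: "nat => nat set" and h p c where
  q1: "!!w. w \<in> X ==> p w \<in> X" and q2: "!!w. w \<in> X ==> (w, p w) \<in> E\<^sup>*" and
  q3: "!!w. w \<in> X ==> c w ~= 0 ==> (w, p w) \<in> E" and q4: "!!w. w \<in> X ==> c w = 0 ==> p w = w" and
  q5: "!!w i. w \<in> X ==> card X \<le> i ==> c ((p ^^ i) w) = 0" and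
  q6: "!!w z. w \<in> X ==> z \<in> X ==> R w = R z ==> ALL i<M. c ((p ^^ i) w) = c ((p ^^ i) z) ==> h w = h z" and
  q7: "!!w z i. w \<in> X ==> z \<in> X ==> R w = R z ==> h w = h z ==> c ((p ^^ i) w) = c ((p ^^ i) z)" and
  q8: "!!w z. w \<in> X ==> (w, z) \<in> E\<^sup>* ==> R w = R z" and
  q9: "!!w z. w \<in> X ==> (w, z) \<in> E\<^sup>* ==> h w = h z ==> w = z" and
  q10: "!!w z. w \<in> X ==> z \<in> X ==> R w = R z ==> \<exists>v\<in>X. (z, v) \<in> E\<^sup>* & h v = h w" and
  q11: "!!u v. u \<in> X ==> (u, v) \<in> E\<^sup>* ==> a u v = a (h u) (h v)" and
  q12: "!!u. u \<in> X ==> colS u (h u)" and q13: "!!w. w \<in> X ==> c w \<le> m + b" and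
  q14: "!!w z \<theta>. w \<in> X ==> z \<in> X ==> bij_betw \<theta> {u. (w, u) \<in> E\<^sup>*} {v. (z, v) \<in> E\<^sup>*} ==>
    (!!u v. (w, u) \<in> E\<^sup>* ==> (w, v) \<in> E\<^sup>* ==> a u v = a (\<theta> u) (\<theta> v)) ==>
    (!!u. (w, u) \<in> E\<^sup>* ==> colS u (\<theta> u)) ==> R w = R z"
 proof -
  show ?thesis
   by (rule tree_templates[of X E "m + b" M colS a]; fact finX EX symE deg cM colr colS_sym colS_trans Eiso that)
 qed
 have fT: "finite T" using T(1) finX finite_subset by blast
 obtain e where e: "bij_betw e {0..<card T} T" using ex_bij_betw_nat_finite[OF fT] by blast
 have cT: "0 < card T" "card T \<le> tau" using T(2) fT card_gt_0_iff[of T] T(3) tau by (simp_all add: X_def)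
 \<comment> \<open>If there are fewer than \<open>tau\<close> individualised vertices, the first of
   them is repeated.\<close>
 define tg where "tg i = (if i < tau then e (if i < card T then i else 0) else 0)" for i
 have tgT: "tg i \<in> T" if "i < tau" for i using that e cT(1) by (auto simp: tg_def bij_betw_def)
 have tg: "tg ` {..<tau} = T"
 proof (intro equalityI subsetI)
  fix x assume "x \<in> T"
  then have "x \<in> e ` {0..<card T}" using e by (simp add: bij_betw_def)
  then obtain i where "i < card T" "x = e i" by auto
  then show "x \<in> tg ` {..<tau}" using cT(2) by (intro image_eqI[of _ _ i]) (auto simp: tg_def)
 qed (use tgT in auto)
 define ts where "ts i = (if i < tau then \<psi> (tg i) else 0)" for i
 have psiX: "ell \<le> \<psi> u & \<psi> u < 2 * ell & vld (\<psi> u)" if "u \<in> X" for u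
  using psi that by (auto simp: bij_betw_def X_def)
 have psiinv: "inv_into X \<psi> (\<psi> u) = u" if "u \<in> X" for u
  using psi that by (auto simp: bij_betw_def X_def[symmetric] inv_into_f_f)
 have inve: "inv_into X \<psi> w \<in> X" if "ell \<le> w" "w < 2 * ell" "vld w" for w
 proof (rule inv_into_into)
  have "\<psi> ` X = {w. ell \<le> w & w < 2 * ell & vld w}" using psi by (simp add: bij_betw_def X_def)
  then show "w \<in> \<psi> ` X" using that by blast
 qed
 \<comment> \<open>\<open>adev\<close> depends on neither parent nor child numbers. An instance with
   dummy values therefore provides the graph from which the parent numbers are then
   computed.\<close>
 interpret G: gi M ell tau vld al tg ts "%_. 0" "%_. 0" .
 define k' where "k' w = (if w < ell then w else inv_into X \<psi> w)" for w
 define tgt where "tgt w = (if w < ell then p w else \<psi> (p (k' w)))" for w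
 define pp where "pp w = (if w < 2 * ell & vld w then card {v. v < tgt w & G.adev w v} else 0)" for w
 define cc where "cc w = (if w < 2 * ell & vld w then c (k' w) else 0)" for w
 have k'X: "k' w \<in> X" if "w < 2 * ell" "vld w" for w using that inve[of w] by (auto simp: k'_def X_def)
 interpret H: gi_iso M ell tau vld al tg ts pp cc X T \<psi> a R h p c E colS
 proof
  show "X = {w. gi.pos ell vld w & w < ell}" unfolding X_def gi.pos_def by auto
  have "{w. gi.pos ell vld w & ~ w < ell} = {w. ell \<le> w & w < 2 * ell & vld w}" unfolding gi.pos_def by auto
  then show "bij_betw \<psi> X {w. gi.pos ell vld w & ~ w < ell}" using psi by (simp add: X_def)
  show "al u v <-> al (\<psi> u) (\<psi> v)" if "u \<in> X" "v \<in> X" for u v using al_psi that by (simp add: X_def)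
  show "R w = R z" if "w \<in> X" "z \<in> X" "bij_betw \<theta> {u. (w, u) \<in> E\<^sup>*} {v. (z, v) \<in> E\<^sup>*}"
    "!!u v. (w, u) \<in> E\<^sup>* ==> (w, v) \<in> E\<^sup>* ==> a u v = a (\<theta> u) (\<theta> v)"
    "!!u. (w, u) \<in> E\<^sup>* ==> colS u (\<theta> u)" for w z \<theta>
   by (rule q14[OF that])
  fix u assume u: "u \<in> X"
  then have u': "u < ell" "vld u" "u < 2 * ell" by (auto simp: X_def)
  have k'u: "k' u = u" "k' (\<psi> u) = u" using u' psiX[OF u] psiinv[OF u] by (auto simp: k'_def)
  show "cc u = c u" "cc (\<psi> u) = c u" using u' psiX[OF u] k'u by (simp_all add: cc_def)
  show "pp u = card {v. v < p u & gi.adev ell tau vld al tg ts u v}" using u' by (simp add: pp_def tgt_def)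
  show "pp (\<psi> u) = card {v. v < \<psi> (p u) & gi.adev ell tau vld al tg ts (\<psi> u) v}"
   using psiX[OF u] k'u by (simp add: pp_def tgt_def)
  show "p u \<in> X" "(u, p u) \<in> E\<^sup>*" by (fact q1[OF u], fact q2[OF u])
  show "(u, p u) \<in> E" if "c u ~= 0" by (rule q3[OF u that])
  show "p u = u" if "c u = 0" by (rule q4[OF u that])
  show "c ((p ^^ i) u) = 0" if "card X \<le> i" for i by (rule q5[OF u that])
  show "colS u (h u)" by (rule q12[OF u])
  fix z
  show "R u = R z" if "(u, z) \<in> E\<^sup>*" by (rule q8[OF u that])
  show "u = z" if "(u, z) \<in> E\<^sup>*" "h u = h z" by (rule q9[OF u that])
  show "a u z = a (h u) (h z)" if "(u, z) \<in> E\<^sup>*" by (rule q11[OF u that])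
  assume z: "z \<in> X" and Rz: "R u = R z"
  show "h u = h z" if "ALL i<M. c ((p ^^ i) u) = c ((p ^^ i) z)" by (rule q6[OF u z Rz that])
  show "c ((p ^^ i) u) = c ((p ^^ i) z)" if "h u = h z" for i by (rule q7[OF u z Rz that])
  show "\<exists>v\<in>X. (z, v) \<in> E\<^sup>* & h v = h u" by (rule q10[OF u z Rz])
 qed (use ell(2) T(1) tg in \<open>simp_all add: a_def ts_def colS_def E_def\<close>)
 have ppb: "pp w \<le> m + b" for w
 proof (cases "w < 2 * ell & vld w")
  case True
  then have w: "H.pos w" by (simp add: H.pos_def)
  have fin: "finite {v. G.adev w v}" by (rule finite_subset[of _ "{..<2*ell}"]) (auto simp: G.adev_def G.pos_def)
  have "inj_on H.kp {v. G.adev w v}"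
  proof (rule inj_onI)
   fix x y assume xy: "x \<in> {v. G.adev w v}" "y \<in> {v. G.adev w v}" "H.kp x = H.kp y"
   then have p: "H.pos x" "H.pos y" "H.same x y" by (auto simp: H.adev_def H.same_def)
   have "x = H.lf x (H.kp x)" by (rule H.lf_kp[OF p(1), symmetric])
   also have "\<dots> = H.lf y (H.kp y)" unfolding H.same_lf[OF p(3)] xy(3) by (rule refl)
   also have "\<dots> = y" by (rule H.lf_kp[OF p(2)])
   finally show "x = y" .
  qed
  moreover have "H.kp ` {v. G.adev w v} \<subseteq> {u. (H.kp w, u) \<in> E}"
  proof
   fix u assume "u \<in> H.kp ` {v. G.adev w v}"
   then obtain v where v: "G.adev w v" "u = H.kp v" by blast
   then have "H.pos v" "H.same w v" by (simp_all add: H.adev_def)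
   then show "u \<in> {u. (H.kp w, u) \<in> E}" using H.adev_kp[OF w] v by simp
  qed
  moreover have "finite {u. (H.kp w, u) \<in> E}" by (rule finite_subset[OF _ finX]) (auto simp: E_def)
  ultimately have "card {v. G.adev w v} \<le> card {u. (H.kp w, u) \<in> E}" by (rule card_inj_on_le)
  also have "\<dots> \<le> m + b" by (rule deg)
  finally have "card {v. G.adev w v} \<le> m + b" .
  moreover have "card {v. v < tgt w & G.adev w v} \<le> card {v. G.adev w v}" by (rule card_mono[OF fin]) auto
  ultimately show ?thesis using True by (simp add: pp_def)
 qed (auto simp: pp_def)
 have ccb: "cc w \<le> m + b" for w using q13 k'X[of w] by (simp add: cc_def)
 have tgX: "tg i < 2 * ell" "ts i < 2 * ell" if "i < tau" for i
 proof -
  have "tg i \<in> X" using tgT[OF that] T(1) by blast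
  then show "tg i < 2 * ell" "ts i < 2 * ell" using psiX[of "tg i"] that by (auto simp: X_def ts_def)
 qed
 have "ell \<le> H.phi w & H.phi w < 2 * ell & vld (H.phi w) & (al w z <-> al (H.phi w) (H.phi z))" if "w \<in> X" "z \<in> X" for w z
  using H.phi_correct[OF that] psiX by auto
 note phi = this
 have 1: "ALL i<tau. tg i < 2 * ell & ts i < 2 * ell" using tgX by simp
 have 2: "\<forall>i\<ge>tau. tg i = 0 & ts i = 0" by (simp add: tg_def ts_def)
 have 3: "ALL w. pp w \<le> m + b & cc w \<le> m + b & (~ (w < 2 * ell & vld w) --> pp w = 0 & cc w = 0)"
  using ppb ccb by (auto simp: pp_def cc_def)
 have 4: "ALL w z. w < ell --> vld w --> z < ell --> vld z -->
   (let \<phi> = H.phi in ell \<le> \<phi> w & \<phi> w < 2 * ell & vld (\<phi> w) & (al w z <-> al (\<phi> w) (\<phi> z)))"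
  using phi by (simp add: X_def Let_def)
 from 1 2 3 4 show ?thesis by blast
qed

section \<open>Certificates for large parameters\<close>

text \<open>Increasing enumeration by gaps of at most \<open>D\<close>. A longer gap is bridged by
  void entries, each advancing by the full \<open>D\<close>, so at most \<open>N / D\<close> entries
  are void. The induction carries along that the running total stays within \<open>D\<close> of
  \<open>N\<close>.\<close>

lemma gap_coding:
 fixes Y :: "nat set" and D :: nat
 assumes D: "0 < D"
 shows "EX n s v. n * D \<le> N + D * card (Y \<inter> {..<N}) & (ALL i. s i \<le> D) &
  bij_betw (%j. \<Sum>i\<le>j. s i) {j. j < n & v j} (Y \<inter> {..<N})"
proof -
 have "EX n s v. n * D \<le> (\<Sum>i<n. s i) + D * card (Y \<inter> {..<N}) & (\<Sum>i<n. s i) \<le> N & N \<le> (\<Sum>i<n. s i) + D & (ALL i. s i \<le> D) &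
  bij_betw (%j. \<Sum>i\<le>j. s i) {j. j < n & v j} (Y \<inter> {..<N})"
 proof (induction N)
  case 0
  then show ?case by (rule exI[of _ 0], rule exI[of _ "%_. 0"]) (auto simp: bij_betw_def)
 next
  case (Suc N)
  then obtain n s v where IH: "n * D \<le> (\<Sum>i<n. s i) + D * card (Y \<inter> {..<N})" "(\<Sum>i<n. s i) \<le> N" "N \<le> (\<Sum>i<n. s i) + D"
   "!!i. s i \<le> D" "bij_betw (%j. \<Sum>i\<le>j. s i) {j. j < n & v j} (Y \<inter> {..<N})" by blast
  let ?s = "%x. s(n := x)"
  have cum: "(\<Sum>i\<le>j. (s(n := x)) i) = (\<Sum>i\<le>j. s i)" if "j < n" for j x
   by (rule sum.cong) (use that in auto)
  have cum': "(\<Sum>i<n. (s(n := x)) i) = (\<Sum>i<n. s i)" for x by (rule sum.cong) auto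
  have cn: "(\<Sum>i\<le>n. (s(n := x)) i) = (\<Sum>i<n. s i) + x" for x
   unfolding lessThan_Suc_atMost[symmetric] sum.lessThan_Suc cum' by simp
  have cS: "(\<Sum>i<Suc n. (s(n := x)) i) = (\<Sum>i<n. s i) + x" for x
   unfolding sum.lessThan_Suc cum' by simp
  have bij: "bij_betw (%j. \<Sum>i\<le>j. (s(n := x)) i) {j. j < n & v j} (Y \<inter> {..<N})" for x
   using IH(5) by (subst bij_betw_cong[of _ _ "%j. \<Sum>i\<le>j. s i"]) (use cum in auto)
  show ?case
  proof (cases "N \<in> Y")
   case True
   let ?x = "N - (\<Sum>i<n. s i)" let ?v = "v(n := True)"
   have Y: "Y \<inter> {..<Suc N} = insert N (Y \<inter> {..<N})" using True by (auto simp: less_Suc_eq)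
   have c: "card (Y \<inter> {..<Suc N}) = Suc (card (Y \<inter> {..<N}))" unfolding Y by simp
   have J: "{j. j < Suc n & ?v j} = insert n {j. j < n & v j}" by auto
   have b: "bij_betw (%j. \<Sum>i\<le>j. (s(n := ?x)) i) {j. j < Suc n & ?v j} (Y \<inter> {..<Suc N})"
   proof -
    have f: "(%j. \<Sum>i\<le>j. (s(n := ?x)) i) n = N" using cn[of ?x] IH(2) by simp
    have "bij_betw (%j. \<Sum>i\<le>j. (s(n := ?x)) i) ({j. j < n & v j} \<union> {n}) ((Y \<inter> {..<N}) \<union> {(%j. \<Sum>i\<le>j. (s(n := ?x)) i) n})"
     by (rule notIn_Un_bij_betw[OF _ _ bij]) (simp_all only: f, auto)
    then show ?thesis unfolding J Y using f by simp
   qed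
   show ?thesis
    by (rule exI[of _ "Suc n"], rule exI[of _ "s(n := ?x)"], rule exI[of _ ?v])
     (intro conjI b allI, use IH(1-4) c cS[of ?x] D in \<open>auto simp: algebra_simps\<close>)
  next
   case False
   have Y: "Y \<inter> {..<Suc N} = Y \<inter> {..<N}" using False by (auto simp: less_Suc_eq)
   show ?thesis
   proof (cases "Suc N \<le> (\<Sum>i<n. s i) + D")
    case True
    then show ?thesis unfolding Y using IH by (intro exI[of _ n] exI[of _ s] exI[of _ v]) auto
   next
    case F2: False
    let ?v = "v(n := False)"
    have J: "{j. j < Suc n & ?v j} = {j. j < n & v j}" by (auto simp: less_Suc_eq)
    have b: "bij_betw (%j. \<Sum>i\<le>j. (s(n := D)) i) {j. j < Suc n & ?v j} (Y \<inter> {..<N})"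
     unfolding J by (rule bij)
    have n: "Suc n * D \<le> (\<Sum>i<Suc n. (s(n := D)) i) + D * card (Y \<inter> {..<N})"
     "(\<Sum>i<Suc n. (s(n := D)) i) \<le> Suc N" "Suc N \<le> (\<Sum>i<Suc n. (s(n := D)) i) + D"
     unfolding cS using IH(1,3) F2 D by simp_all
    have "ALL i. (s(n := D)) i \<le> D" using IH(4) by simp
    with b n show ?thesis unfolding Y by blast
   qed
  qed
 qed
 then obtain n s v where r: "n * D \<le> (\<Sum>i<n. s i) + D * card (Y \<inter> {..<N})" "(\<Sum>i<n. s i) \<le> N" "ALL i. s i \<le> D"
  "bij_betw (%j. \<Sum>i\<le>j. s i) {j. j < n & v j} (Y \<inter> {..<N})" by blast
 then have "n * D \<le> N + D * card (Y \<inter> {..<N})" by linarith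
 then show ?thesis using r(3,4) by blast
qed

section \<open>Certificates as integers: bit fields and the decoding of kernel, labels and
  pairs\<close>

definition fld :: "nat => nat => nat => nat" where "fld o' w b = (b div 2 ^ o') mod 2 ^ w"

lemma fields_exist:
 assumes "!!i. i < n ==> f i < 2 ^ w"
 shows "EX B<2 ^ (n * w). ALL i<n. fld (i * w) w B = f i"
 using assms
proof (induction n)
 case (Suc n)
 then obtain B where B: "B < 2 ^ (n * w)" "ALL i<n. fld (i * w) w B = f i" by auto
 let ?B = "B + 2 ^ (n * w) * f n"
 have fn: "f n < 2 ^ w" using Suc.prems by simp
 have "?B < 2 ^ (n * w) * Suc (f n)" using B(1) by simp
 also have "\<dots> \<le> 2 ^ (n * w) * 2 ^ w" using fn by (intro mult_le_mono2) simp
 finally have 1: "?B < 2 ^ (Suc n * w)" by (simp add: power_add mult.commute)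
 have 2: "fld (i * w) w ?B = f i" if "i < Suc n" for i
 proof (cases "i = n")
  case True
  have "?B div 2 ^ (n * w) = f n" using B(1) by (simp add: add.commute)
  then show ?thesis using True fn by (simp add: fld_def)
 next
  case False
  then have i: "i < n" using that by simp
  then obtain d where "n = Suc i + d" using less_iff_Suc_add by auto
  then have "(2::nat) ^ (n * w) = 2 ^ (i * w) * (2 ^ w * 2 ^ (d * w))"
   by (simp add: power_add[symmetric] algebra_simps)
  then have "?B div 2 ^ (i * w) = B div 2 ^ (i * w) + 2 ^ w * (2 ^ (d * w) * f n)"
   by (simp add: mult.assoc div_mult_self2)
  then have "fld (i * w) w ?B = fld (i * w) w B" by (simp add: fld_def)
  then show ?thesis using B(2) i by simp
 qed
 show ?case using 1 2 by (intro exI[of _ ?B]) simp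
qed simp

lemma fld_low:
 assumes "o' + w \<le> L"
 shows "fld o' w (B + 2 ^ L * C) = fld o' w B"
proof -
 obtain d where "L = o' + w + d" using assms le_iff_add by blast
 then have "(2::nat) ^ L = 2 ^ o' * (2 ^ w * 2 ^ d)" by (simp add: power_add algebra_simps)
 then have "(B + 2 ^ L * C) div 2 ^ o' = B div 2 ^ o' + 2 ^ w * (2 ^ d * C)"
  by (simp add: mult.assoc div_mult_self2)
 then show ?thesis by (simp add: fld_def)
qed

lemma fld_high:
 assumes "B < 2 ^ L"
 shows "fld (L + o') w (B + 2 ^ L * C) = fld o' w C"
proof -
 have "(B + 2 ^ L * C) div 2 ^ L = C" using assms by (simp add: add.commute)
 then show ?thesis by (simp add: fld_def power_add div_mult2_eq)
qed

definition bt :: "nat => nat => bool" where "bt x t <-> odd (x div 2 ^ t)"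

lemma bt_set_encode: "finite A ==> bt (set_encode A) t <-> t \<in> A"
proof -
 assume "finite A"
 then have "t \<in> set_decode (set_encode A) <-> t \<in> A" by simp
 then show ?thesis by (simp only: bt_def set_decode_def mem_Collect_eq)
qed

lemma set_encode_less: "A \<subseteq> {..<k} ==> set_encode A < 2 ^ k"
proof -
 assume "A \<subseteq> {..<k}"
 then have "set_encode A \<le> (\<Sum>x<k. 2 ^ x)" unfolding set_encode_def by (intro sum_mono2) auto
 also have "\<dots> < 2 ^ k" by (induction k) auto
 finally show ?thesis .
qed

text \<open>The integer \<open>b\<close> holds \<open>6 * ell\<close> fields of \<open>q\<close>
  bits, namely gaps, parent numbers and child numbers for \<open>2 * ell\<close> positions each,
  followed by \<open>2 * tau\<close> fields of \<open>k\<close> bits for the individualised pairs.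
  Every \<open>b\<close> decodes to some labelling; that a labelling is right is ensured by
  \<open>chk\<close> alone.\<close>

locale core =
 fixes M k ell q tau r0 b :: nat and adj :: "nat => nat => bool"
begin

definition "aC i j <-> i = j \<or> adj i j"
definition "sF i = (if i < 2 * ell then fld (i * q) q b else 0)"
definition "pF i = fld ((2 * ell + i) * q) q b"
definition "cF i = (if i < 2 * ell then fld ((4 * ell + i) * q) q b else 0)"
definition "tgF i = (if i < tau then fld (6 * ell * q + i * k) k b else 0)"
definition "tsF i = (if i < tau then fld (6 * ell * q + (tau + i) * k) k b else 0)"
text \<open>The summation of gaps starts afresh at position \<open>ell\<close>. Below
  \<open>ell\<close> the value is a class number, from \<open>ell\<close> on it is a label, that is,
  a subset of \<open>{..<k}\<close> in binary.\<close>

definition "xv w = (\<Sum>i | i \<le> w & (i < ell <-> w < ell). sF i)"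
text \<open>Parent numbers are stored increased by one, so that 0 can mark a void position;
  \<open>ppF\<close> undoes the shift.\<close>

definition "vldF w <-> w < 2 * ell & pF w ~= 0"
definition "alF w z <-> w < 2 * ell & z < 2 * ell &
 (if w < ell then aC (xv w) (xv z) else EX x<k. bt (xv w) x & bt (xv z) x)"
definition "ppF w = (if w < 2 * ell then pF w - 1 else 0)"
definition "phiF = gi.phi M ell tau vldF alF tgF tsF ppF cF"
text \<open>The label of the kernel vertex at \<open>w\<close> is the one at \<open>phiF w\<close>,
  and the clause on \<open>z\<close> is \<open>nle\<close>. So this is the downward union of
  \<open>kernel_extend\<close>, and it labels all classes.\<close>

definition "lb i x <-> (EX w<ell. vldF w & (ALL z<r0. aC (xv w) z --> aC i z) & bt (xv (phiF w)) x)"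
definition "chk <-> (ALL i<r0. ALL j<r0. aC i j <-> (EX x<k. lb i x & lb j x))"

end

lemma xv_low: "w < ell ==> core.xv ell q b w = (\<Sum>i\<le>w. core.sF ell q b i)"
 unfolding core.xv_def by (rule sum.cong) auto

lemma xv_high: "ell \<le> w ==> core.xv ell q b w = (\<Sum>i\<le>w - ell. core.sF ell q b (ell + i))"
proof -
 assume "ell \<le> w"
 then show ?thesis unfolding core.xv_def
  by (intro sum.reindex_bij_witness[of _ "%i. ell + i" "%i. i - ell"]) auto
qed

section \<open>Numerical estimates for the parameters of the certificate\<close>

lemma linear_le_pow: "16 \<le> e ==> 216 * (4 * e + 3) \<le> (2::nat) ^ e"
 by (induction e rule: dec_induct) simp_all

text \<open>\<open>216\<close> is \<open>4 * 6 * 9\<close>: with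
  \<open>ell = 2 ^ (k - h div 4)\<close>, the \<open>6 * ell\<close> fields of \<open>9 * h\<close>
  bits shall occupy at most a quarter of \<open>2 ^ k\<close> bits.\<close>

lemma pow_quarter: "64 \<le> h ==> 216 * h \<le> (2::nat) ^ (h div 4)"
proof -
 assume "64 \<le> h"
 then have "216 * (4 * (h div 4) + 3) \<le> (2::nat) ^ (h div 4)" by (intro linear_le_pow) simp
 moreover have "216 * h \<le> 216 * (4 * (h div 4) + 3)" by (rule mult_le_mono2) simp
 ultimately show ?thesis by (rule le_trans[rotated])
qed

lemma linear_le_half_pow: "64 \<le> h ==> 8 * h \<le> (2::nat) ^ (h - 1)"
proof -
 have "63 \<le> n ==> 8 * (n + 1) \<le> (2::nat) ^ n" for n by (induction n rule: dec_induct) simp_all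
 from this[of "h - 1"] show "64 \<le> h ==> ?thesis" by simp
qed

text \<open>The antichain bound saves a factor of order \<open>sqrt k\<close>, about
  \<open>2 ^ (h / 2)\<close>. Only \<open>2 ^ (h / 4)\<close> of it is kept, and the rest pays for
  the constants. Squares are compared throughout in order to stay in the natural numbers.\<close>

lemma kernel_small:
 fixes c h k :: nat
 assumes h: "64 \<le> h" "2 ^ (h - 1) \<le> k" and c: "c * 4 ^ (k div 4) \<le> 2 * 2 ^ k * (2 * (k div 4) choose (k div 4))"
 shows "2 * c \<le> 2 ^ (k - h div 4)"
proof (rule ccontr)
 assume no: "~ ?thesis"
 let ?m = "k div 4" let ?C = "2 * ?m choose ?m" let ?e = "h div 4"
 have hk: "8 * h \<le> k" using linear_le_half_pow[OF h(1)] h(2) by linarith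
 have "(c * 4 ^ ?m)\<^sup>2 \<le> (2 * 2 ^ k * ?C)\<^sup>2" using c by (rule power_mono) simp
 moreover have "((4::nat) ^ ?m)\<^sup>2 = 16 ^ ?m" by (simp add: power2_eq_square power_mult_distrib[symmetric])
 ultimately have "c\<^sup>2 * 16 ^ ?m \<le> 2\<^sup>2 * (2 ^ k)\<^sup>2 * ?C\<^sup>2" by (simp only: power_mult_distrib)
 then have "c\<^sup>2 * 16 ^ ?m \<le> 4 * (2 ^ k)\<^sup>2 * ?C\<^sup>2" by simp
 then have "(2 * ?m + 1) * (c\<^sup>2 * 16 ^ ?m) \<le> (2 * ?m + 1) * (4 * (2 ^ k)\<^sup>2 * ?C\<^sup>2)" by (rule mult_le_mono2)
 also have "\<dots> = 4 * (2 ^ k)\<^sup>2 * ((2 * ?m + 1) * ?C\<^sup>2)" by (simp only: ac_simps)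
 also have "\<dots> \<le> 4 * (2 ^ k)\<^sup>2 * 16 ^ ?m" by (intro mult_le_mono2 central_binomial_le)
 finally have "((2 * ?m + 1) * c\<^sup>2) * 16 ^ ?m \<le> (4 * (2 ^ k)\<^sup>2) * 16 ^ ?m" by (simp only: ac_simps)
 then have 1: "(2 * ?m + 1) * c\<^sup>2 \<le> 4 * (2 ^ k)\<^sup>2" by simp
 have "(2::nat) ^ (h - 1) = 2 * 2 ^ (h - 2)" using h(1) by (simp flip: power_Suc)
 then have "2 ^ (h - 2) \<le> 2 * ?m + 1" using h(2) by linarith
 then have "2 ^ (h - 2) * c\<^sup>2 \<le> 4 * (2 ^ k)\<^sup>2" using 1 mult_le_mono1 le_trans by blast
 moreover have "2 ^ (h - 2) * (4 * c\<^sup>2) = 4 * (2 ^ (h - 2) * c\<^sup>2)" by (rule mult.left_commute)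
 ultimately have "2 ^ (h - 2) * (4 * c\<^sup>2) \<le> 16 * (2 ^ k)\<^sup>2" by linarith
 moreover have "(2 ^ (k - ?e))\<^sup>2 < (2 * c)\<^sup>2" using no by (intro power_strict_mono) auto
 then have "2 ^ (h - 2) * (2 ^ (k - ?e))\<^sup>2 < 2 ^ (h - 2) * (4 * c\<^sup>2)" by (simp add: power_mult_distrib)
 ultimately have "(2::nat) ^ (h - 2) * (2 ^ (k - ?e))\<^sup>2 < 16 * (2 ^ k)\<^sup>2" by linarith
 also have "(16::nat) * (2 ^ k)\<^sup>2 = 2 ^ (4 + 2 * k)" by (simp add: power_add power_mult[symmetric] mult.commute)
 also have "(2::nat) ^ (h - 2) * (2 ^ (k - ?e))\<^sup>2 = 2 ^ (h - 2 + 2 * (k - ?e))" by (simp add: power_add power_mult[symmetric] mult.commute)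
 finally have "h - 2 + 2 * (k - ?e) < 4 + 2 * k" by simp
 then show False using h(1) hk by linarith
qed

text \<open>The given labelling serves to produce a kernel, the set of its labels and an isomorphism
  between the two graphs. The certificate may decode to a different labelling, hence the conclusion
  is that \<open>chk\<close> succeeds and not that the labels are recovered.\<close>

theorem core_complete:
 fixes lab :: "nat => nat set"
 assumes h: "64 \<le> h" "2 ^ (h - 1) \<le> k" "k < 2 ^ h"
  and ell: "ell = 2 ^ (k - h div 4)" and tau: "tau = 2 ^ (k - 2 * h)" and q: "q = 9 * h" and M: "2 * ell \<le> M"
  and r0: "r0 \<le> 2 ^ k" and sym: "!!i j. adj i j <-> adj j i"
  and lab: "!!i. i < r0 ==> lab i \<subseteq> {..<k}"
   "!!i j. i < r0 ==> j < r0 ==> (i = j \<or> adj i j) <-> lab i \<inter> lab j ~= {}"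
 shows "EX b<2 ^ 2 ^ (k - 1). core.chk M k ell q tau r0 b adj"
proof -
 have hk: "8 * h \<le> k" using linear_le_half_pow[OF h(1)] h(2) by linarith
 define a where "a i j <-> i = j \<or> adj i j" for i j
 have asym: "a i j ==> a j i" for i j using sym[of i j] by (auto simp: a_def)
 have il: "intersects_on {..<r0} a lab" unfolding intersects_on_def a_def using lab(2) by simp
 obtain K where K: "kernel {..<r0} a K"
  and crit: "!!u. u \<in> K ==> \<exists>x\<in>lab u. \<forall>p\<in>K. lab p \<subseteq> lab u --> x \<in> lab p --> p = u"
  using minimal_kernel[of "{..<r0}" a lab] il by (auto simp: a_def)
 have KR: "K \<subseteq> {..<r0}" using K by (simp add: kernel_def)
 have finK: "finite K" using KR finite_subset by blast
 have labK: "lab u \<subseteq> {..<k}" if "u \<in> K" for u using lab(1) KR that by blast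
 have inj: "inj_on lab K"
 proof (rule inj_onI)
  fix u v assume uv: "u \<in> K" "v \<in> K" "lab u = lab v"
  obtain x where "x \<in> lab u" "\<forall>p\<in>K. lab p \<subseteq> lab u --> x \<in> lab p --> p = u" using crit[OF uv(1)] by blast
  then show "u = v" using uv by auto
 qed
 have cK: "2 * card K \<le> ell"
 proof -
  have "card (lab ` K) * 4 ^ (k div 4) \<le> 2 * 2 ^ k * (2 * (k div 4) choose (k div 4))"
  proof (rule card_critical_family)
   show "lab ` K \<subseteq> Pow {..<k}" using labK by blast
   fix A assume "A \<in> lab ` K"
   then obtain u where u: "u \<in> K" "A = lab u" by blast
   from crit[OF u(1)] obtain x where x: "x \<in> lab u" "\<forall>p\<in>K. lab p \<subseteq> lab u --> x \<in> lab p --> p = u" by blast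
   show "\<exists>x\<in>A. \<forall>B\<in>lab ` K. B \<subseteq> A --> x \<in> B --> B = A"
    by (rule bexI[of _ x]) (use x u in auto)
  qed simp
  then show ?thesis using kernel_small[OF h(1,2), of "card K"] card_image[OF inj] ell by simp
 qed
 define lbn where "lbn u = set_encode (lab u)" for u
 have flab: "finite (lab u)" if "u \<in> K" for u using labK[OF that] finite_subset by blast
 have bt_lbn: "bt (lbn u) x <-> x \<in> lab u" if "u \<in> K" for u x unfolding lbn_def by (rule bt_set_encode[OF flab[OF that]])
 have lbn_less: "lbn u < 2 ^ k" if "u \<in> K" for u unfolding lbn_def by (rule set_encode_less[OF labK[OF that]])
 have injl: "inj_on lbn K"
 proof (rule inj_onI)
  fix u v assume uv: "u \<in> K" "v \<in> K" "lbn u = lbn v"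
  have "lab u = lab v" using bt_lbn[OF uv(1)] bt_lbn[OF uv(2)] uv(3) by auto
  then show "u = v" using inj uv by (simp add: inj_on_def)
 qed
 define D :: nat where "D = 2 ^ q - 1"
 have Dpos: "0 < D" using one_less_power[of "2::nat" q] h(1) q by (simp add: D_def)
 have Dell: "2 * 2 ^ k \<le> D * ell"
 proof -
  have "2 ^ (q - 1) \<le> D"
  proof -
   have "(2::nat) ^ q = 2 * 2 ^ (q - 1)" using h(1) q by (simp flip: power_Suc)
   moreover have "(1::nat) \<le> 2 ^ (q - 1)" by simp
   ultimately show ?thesis unfolding D_def by linarith
  qed
  then have "2 ^ (q - 1) * ell \<le> D * ell" by (rule mult_le_mono1)
  moreover have "(2::nat) ^ (k + 1) \<le> 2 ^ (q - 1 + (k - h div 4))" using hk h(1) q by (intro power_increasing) auto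
  then have "2 * 2 ^ k \<le> 2 ^ (q - 1) * ell" by (simp add: ell power_add)
  ultimately show ?thesis by linarith
 qed
 \<comment> \<open>At most half of the \<open>ell\<close> entries stand for elements of
   \<open>Y\<close>, and \<open>Dell\<close> shows that the other half suffices for the void
   entries, where \<open>D\<close> is the largest gap that fits into \<open>q\<close> bits.\<close>
 have code: "EX s v. (ALL i. s i \<le> D) & bij_betw (%j. \<Sum>i\<le>j. s i) {j. j < ell & v j} Y"
  if Y: "Y \<subseteq> {..<2 ^ k}" "2 * card Y \<le> ell" for Y
 proof -
  have YI: "Y \<inter> {..<2 ^ k} = Y" using Y(1) by blast
  obtain n s v where n: "n * D \<le> 2 ^ k + D * card Y" "ALL i. s i \<le> D" "bij_betw (%j. \<Sum>i\<le>j. s i) {j. j < n & v j} Y"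
   using gap_coding[OF Dpos, of "2 ^ k" Y] unfolding YI by blast
  have "n \<le> ell"
  proof (rule ccontr)
   assume "~ n \<le> ell"
   then have "(ell + 1) * D \<le> n * D" by (intro mult_le_mono1) simp
   then have "2 * (ell * D) + 2 * D \<le> 2 * 2 ^ k + D * (2 * card Y)" using n(1) by (simp add: algebra_simps)
   moreover have "D * (2 * card Y) \<le> D * ell" using Y(2) by (rule mult_le_mono2)
   ultimately show False using Dell Dpos by (simp add: mult.commute)
  qed
  then have "{j. j < ell & (j < n & v j)} = {j. j < n & v j}" by auto
  then show ?thesis using n(2,3) by (intro exI[of _ s] exI[of _ "%j. j < n & v j"]) simp
 qed
 have K2: "K \<subseteq> {..<2 ^ k}" using KR r0 by auto
 obtain sG vG where G: "ALL i. sG i \<le> D" "bij_betw (%j. \<Sum>i\<le>j. sG i) {j. j < ell & vG j} K"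
  using code[OF K2 cK] by blast
 have "lbn ` K \<subseteq> {..<2 ^ k}" "2 * card (lbn ` K) \<le> ell" using lbn_less cK card_image[OF injl] by auto
 from code[OF this] obtain sS vS where S: "ALL i. sS i \<le> D" "bij_betw (%j. \<Sum>i\<le>j. sS i) {j. j < ell & vS j} (lbn ` K)"
  by blast
 define s where "s i = (if i < ell then sG i else sS (i - ell))" for i
 define v where "v w <-> w < 2 * ell & (if w < ell then vG w else vS (w - ell))" for w
 define xs where "xs w = (if w < ell then (\<Sum>i\<le>w. sG i) else (\<Sum>i\<le>w - ell. sS i))" for w
 define al where "al w z <-> w < 2 * ell & z < 2 * ell & (if w < ell then a (xs w) (xs z) else EX x<k. bt (xs w) x & bt (xs z) x)" for w z
 let ?PG = "{w. w < ell & v w}" let ?PS = "{w. ell \<le> w & w < 2 * ell & v w}"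
 have bG: "bij_betw xs ?PG K"
 proof -
  have "?PG = {j. j < ell & vG j}" by (auto simp: v_def)
  moreover have "bij_betw xs {j. j < ell & vG j} K"
   using G(2) by (subst bij_betw_cong[of _ _ "%j. \<Sum>i\<le>j. sG i"]) (simp_all add: xs_def)
  ultimately show ?thesis by simp
 qed
 have bS: "bij_betw xs ?PS (lbn ` K)"
 proof -
  have "bij_betw (%w. w - ell) ?PS {j. j < ell & vS j}"
   by (rule bij_betw_byWitness[where f' = "%j. j + ell"]) (auto simp: v_def)
  from bij_betw_trans[OF this S(2)] show ?thesis
   by (subst bij_betw_cong[of _ _ "(%j. \<Sum>i\<le>j. sS i) \<circ> (%w. w - ell)"]) (simp_all add: xs_def)
 qed
 have bL: "bij_betw lbn K (lbn ` K)" using injl by (simp add: bij_betw_def)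
 \<comment> \<open>Both sides are listed in increasing order; \<open>\<psi>\<close> is the pairing
   of the two orders prescribed by the given labelling. It is this pairing that is too expensive to
   be stored.\<close>
 define \<psi> where "\<psi> = inv_into ?PS xs \<circ> (lbn \<circ> xs)"
 have psi: "bij_betw \<psi> ?PG ?PS"
  unfolding \<psi>_def by (rule bij_betw_trans[OF bij_betw_trans[OF bG bL] bij_betw_inv_into[OF bS]])
 have xpsi: "xs (\<psi> w) = lbn (xs w)" if "w \<in> ?PG" for w
 proof -
  have "lbn (xs w) \<in> xs ` ?PS" using bG bS that by (auto simp: bij_betw_def)
  then show ?thesis unfolding \<psi>_def by (simp add: f_inv_into_f)
 qed
 have xK: "xs w \<in> K" if "w < ell" "v w" for w using bG that by (auto simp: bij_betw_def)
 have psiS: "ell \<le> \<psi> w" "\<psi> w < 2 * ell" if "w < ell" "v w" for w using psi that by (auto simp: bij_betw_def)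
 have alG: "al u w <-> a (xs u) (xs w)" if "u < ell" "w < ell" for u w using that by (simp add: al_def)
 have al_psi: "al u w <-> al (\<psi> u) (\<psi> w)" if uw: "u < ell" "w < ell" "v u" "v w" for u w
 proof -
  have "al u w <-> lab (xs u) \<inter> lab (xs w) ~= {}"
   using alG[OF uw(1,2)] il xK[OF uw(1,3)] xK[OF uw(2,4)] KR unfolding intersects_on_def by blast
  also have "\<dots> <-> (EX x<k. bt (xs (\<psi> u)) x & bt (xs (\<psi> w)) x)"
   using xpsi uw bt_lbn[OF xK[OF uw(1,3)]] bt_lbn[OF xK[OF uw(2,4)]] labK[OF xK[OF uw(1,3)]] by auto
  also have "\<dots> <-> al (\<psi> u) (\<psi> w)" using psiS[OF uw(1,3)] psiS[OF uw(2,4)] by (simp add: al_def)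
  finally show ?thesis .
 qed
 have cPG: "card ?PG \<le> 2 ^ k" "card ?PG = card K"
 proof -
  show 1: "card ?PG = card K" by (rule bij_betw_same_card[OF bG])
  have "ell \<le> 2 ^ k" unfolding ell by (intro power_increasing) auto
  then show "card ?PG \<le> 2 ^ k" using cK 1 by linarith
 qed
 \<comment> \<open>As \<open>k < 2 ^ h\<close>, the value \<open>2 ^ (4 * h)\<close> for the
   outgoing degree keeps the first kind of individualised vertices below
   \<open>2 ^ (k - 3 * h)\<close>, and squaring it for the incoming degree keeps the second kind
   below the same bound. Both fit into \<open>tau = 2 ^ (k - 2 * h)\<close>, while
   \<open>?m + ?b + 1\<close> still fits into \<open>q = 9 * h\<close> bits.\<close>
 let ?m = "2 ^ (4 * h) :: nat" let ?b = "2 ^ (8 * h) :: nat"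
 have taub: "1 + k * card ?PG div ?m + ?m * card ?PG div ?b \<le> tau"
 proof -
  have 1: "k * card ?PG div ?m \<le> 2 ^ (k - 3 * h)"
  proof -
   have "k * card ?PG \<le> 2 ^ h * 2 ^ k" using h(3) cPG(1) by (intro mult_mono) auto
   also have "\<dots> = 2 ^ (k - 3 * h) * ?m" using hk by (simp add: power_add[symmetric])
   finally have "k * card ?PG div ?m \<le> 2 ^ (k - 3 * h) * ?m div ?m" by (rule div_le_mono)
   then show ?thesis by simp
  qed
  have 2: "?m * card ?PG div ?b \<le> 2 ^ (k - 3 * h)"
  proof -
   have "?m * card ?PG \<le> ?m * 2 ^ k" using cPG(1) by (rule mult_le_mono2)
   also have "\<dots> \<le> 2 ^ (k - 3 * h) * ?b" using hk by (simp add: power_add[symmetric])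
   finally have "?m * card ?PG div ?b \<le> 2 ^ (k - 3 * h) * ?b div ?b" by (rule div_le_mono)
   then show ?thesis by simp
  qed
  have "(2::nat) ^ (k - 3 * h + 2) \<le> tau" unfolding tau using hk h(1) by (intro power_increasing) auto
  then have "4 * 2 ^ (k - 3 * h) \<le> tau" by (simp add: power_add)
  moreover have "(1::nat) \<le> 2 ^ (k - 3 * h)" by simp
  ultimately show ?thesis using 1 2 by linarith
 qed
 have ellpos: "0 < ell" by (simp add: ell)
 have alsym: "al u w <-> al w u" if "u < ell" "w < ell" for u w
  using alG[OF that] alG[OF that(2,1)] asym by blast
 have mbpos: "0 < ?m" "0 < ?b" by simp_all
 have "EX tg ts pp cc. (ALL i<tau. tg i < 2 * ell & ts i < 2 * ell) & (\<forall>i\<ge>tau. tg i = 0 & ts i = 0) &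
  (ALL w. pp w \<le> ?m + ?b & cc w \<le> ?m + ?b & (~ (w < 2 * ell & v w) --> pp w = 0 & cc w = 0)) &
  (ALL w z. w < ell --> v w --> z < ell --> v z -->
   (let \<phi> = gi.phi M ell tau v al tg ts pp cc in ell \<le> \<phi> w & \<phi> w < 2 * ell & v (\<phi> w) & (al w z <-> al (\<phi> w) (\<phi> z))))"
  by (rule gi_complete[where k = k and \<psi> = \<psi>]; fact ellpos M psi al_psi alsym cPG(1) mbpos taub)
 then obtain tg ts pp cc where g1: "ALL i<tau. tg i < 2 * ell & ts i < 2 * ell" and g2: "\<forall>i\<ge>tau. tg i = 0 & ts i = 0"
  and g3: "ALL w. pp w \<le> ?m + ?b & cc w \<le> ?m + ?b & (~ (w < 2 * ell & v w) --> pp w = 0 & cc w = 0)"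
  and g4: "ALL w z. w < ell --> v w --> z < ell --> v z -->
   (let \<phi> = gi.phi M ell tau v al tg ts pp cc in ell \<le> \<phi> w & \<phi> w < 2 * ell & v (\<phi> w) & (al w z <-> al (\<phi> w) (\<phi> z)))"
  by (elim exE conjE)
 have mb: "?m + ?b + 1 < 2 ^ q"
 proof -
  have "?m \<le> ?b" by (intro power_increasing) auto
  moreover have "(1::nat) \<le> ?m" by simp
  moreover have "(2::nat) ^ (8 * h + 2) \<le> 2 ^ q" using q h(1) by (intro power_increasing) auto
  then have "4 * ?b \<le> 2 ^ q" by (simp add: power_add)
  ultimately show ?thesis by linarith
 qed
 define f where "f i = (if i < 2 * ell then s i else if i < 4 * ell then (if v (i - 2 * ell) then pp (i - 2 * ell) + 1 else 0) else cc (i - 4 * ell))" for i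
 have fb: "f i < 2 ^ q" for i
 proof -
  have "D < 2 ^ q" by (simp add: D_def)
  then have "s j < 2 ^ q" for j using G(1) S(1) unfolding s_def by (auto intro: le_less_trans)
  moreover have "pp w + 1 < 2 ^ q" "cc w < 2 ^ q" for w using g3[rule_format, of w] mb by linarith+
  ultimately show ?thesis unfolding f_def by simp
 qed
 obtain B1 where B1: "B1 < 2 ^ (6 * ell * q)" "ALL i<6 * ell. fld (i * q) q B1 = f i" using fields_exist[of "6 * ell" f q] fb by blast
 define g where "g i = (if i < tau then tg i else ts (i - tau))" for i
 have "2 * ell \<le> 2 ^ k"
 proof -
  have "(2::nat) ^ (k - h div 4 + 1) \<le> 2 ^ k" using h(1) hk by (intro power_increasing) auto
  then show ?thesis by (simp add: ell)
 qed
 then have gb: "g i < 2 ^ k" if "i < 2 * tau" for i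
 proof (cases "i < tau")
  case False
  then have "i - tau < tau" using that by linarith
  from g1[rule_format, OF this] show ?thesis using False \<open>2 * ell \<le> 2 ^ k\<close> by (simp add: g_def)
 qed (use g1[rule_format, of i] in \<open>simp add: g_def\<close>)
 obtain B2 where B2: "B2 < 2 ^ (2 * tau * k)" "ALL i<2 * tau. fld (i * k) k B2 = g i" using fields_exist[of "2 * tau" g k] gb by blast
 define b where "b = B1 + 2 ^ (6 * ell * q) * B2"
 \<comment> \<open>The fields for positions and those for pairs take at most a quarter of
   \<open>2 ^ k\<close> bits each.\<close>
 have bb: "b < 2 ^ 2 ^ (k - 1)"
 proof -
  have "b < 2 ^ (6 * ell * q) * Suc B2" using B1(1) by (simp add: b_def)
  also have "\<dots> \<le> 2 ^ (6 * ell * q) * 2 ^ (2 * tau * k)" using B2(1) by (intro mult_le_mono2) simp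
  also have "\<dots> = 2 ^ (6 * ell * q + 2 * tau * k)" by (simp add: power_add)
  also have "\<dots> \<le> 2 ^ 2 ^ (k - 1)"
  proof (rule power_increasing)
   have "4 * (6 * ell * q) = ell * (216 * h)" by (simp add: q)
   also have "\<dots> \<le> ell * 2 ^ (h div 4)" by (intro mult_le_mono2 pow_quarter h(1))
   also have "\<dots> = 2 ^ k" using hk by (simp add: ell power_add[symmetric])
   finally have 1: "4 * (6 * ell * q) \<le> 2 ^ k" .
   have "tau * k \<le> 2 ^ (k - 2 * h) * 2 ^ h" unfolding tau using h(3) by (intro mult_le_mono2) simp
   also have "\<dots> = 2 ^ (k - h)" using hk by (simp add: power_add[symmetric])
   finally have "8 * (tau * k) \<le> 2 ^ (k - h + 3)" by (simp add: power_add)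
   also have "\<dots> \<le> 2 ^ k" using h(1) hk by (intro power_increasing) auto
   finally have 2: "8 * (tau * k) \<le> 2 ^ k" .
   have "(2::nat) ^ k = 2 * 2 ^ (k - 1)" using hk h(1) by (simp flip: power_Suc)
   then show "6 * ell * q + 2 * tau * k \<le> 2 ^ (k - 1)" using 1 2 by linarith
  qed simp
  finally show ?thesis .
 qed
 have low: "fld (i * q) q b = f i" if "i < 6 * ell" for i
 proof -
  have "(i + 1) * q \<le> 6 * ell * q" using that by (intro mult_le_mono1) simp
  then show ?thesis unfolding b_def using B1(2) that by (subst fld_low) (simp_all add: algebra_simps)
 qed
 have high: "fld (6 * ell * q + i * k) k b = g i" if "i < 2 * tau" for i
  unfolding b_def using B2(2) that fld_high[OF B1(1)] by simp
 interpret C: core M k ell q tau r0 b adj .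
 have aC: "C.aC = a" by (intro ext) (simp add: C.aC_def a_def)
 have sF: "C.sF i = s i" if "i < 2 * ell" for i unfolding C.sF_def using low[of i] that by (simp add: f_def)
 have pF: "C.pF i = (if v i then pp i + 1 else 0)" if "i < 2 * ell" for i
  unfolding C.pF_def using low[of "2 * ell + i"] that by (simp add: f_def)
 have cF: "C.cF = cc"
 proof
  fix i show "C.cF i = cc i"
   using low[of "4 * ell + i"] g3 by (cases "i < 2 * ell") (simp_all add: C.cF_def f_def)
 qed
 have tgF: "C.tgF = tg"
 proof
  fix i show "C.tgF i = tg i" using high[of i] g2 by (simp add: C.tgF_def g_def)
 qed
 have tsF: "C.tsF = ts"
 proof
  fix i show "C.tsF i = ts i" using high[of "tau + i"] g2 by (simp add: C.tsF_def g_def)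
 qed
 have vldF: "C.vldF = v"
 proof
  fix i show "C.vldF i = v i" using pF[of i] by (auto simp: C.vldF_def v_def split: if_splits)
 qed
 have ppF: "C.ppF = pp"
 proof
  fix i show "C.ppF i = pp i" using pF[of i] g3 by (auto simp: C.ppF_def)
 qed
 have xv: "C.xv w = xs w" if "w < 2 * ell" for w
 proof (cases "w < ell")
  case True
  then show ?thesis using xv_low[of w ell q b] sF by (simp add: xs_def s_def)
 next
  case False
  then show ?thesis using xv_high[of ell w q b] sF that by (simp add: xs_def s_def)
 qed
 have alF: "C.alF = al"
 proof (intro ext)
  fix w z show "C.alF w z = al w z" using xv[of w] xv[of z] by (auto simp: C.alF_def al_def aC)
 qed
 let ?\<phi> = "gi.phi M ell tau v al tg ts pp cc"
 have phiF: "C.phiF = ?\<phi>" unfolding C.phiF_def vldF alF tgF tsF ppF cF ..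
 have ph: "ell \<le> ?\<phi> w" "?\<phi> w < 2 * ell" "al w z <-> al (?\<phi> w) (?\<phi> z)" if "w < ell" "v w" "z < ell" "v z" for w z
  using g4 that by (auto simp: Let_def)
 \<comment> \<open>The decoded labels, possibly attached to other kernel vertices than before. They
   represent the kernel because \<open>phi\<close> preserves adjacency, and
   \<open>kernel_extend\<close> asks for nothing else.\<close>
 define \<mu> where "\<mu> u = {x. x < k & bt (xs (?\<phi> (inv_into ?PG xs u))) x}" for u
 have pos: "EX w<ell. v w & xs w = u & \<mu> u = {x. x < k & bt (xs (?\<phi> w)) x}" if "u \<in> K" for u
 proof -
  have "u \<in> xs ` ?PG" using bG that by (simp add: bij_betw_def)
  then have "inv_into ?PG xs u \<in> ?PG" "xs (inv_into ?PG xs u) = u" by (simp_all only: inv_into_into f_inv_into_f)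
  then show ?thesis by (intro exI[of _ "inv_into ?PG xs u"]) (simp add: \<mu>_def)
 qed
 have mux: "\<mu> (xs w) = {x. x < k & bt (xs (?\<phi> w)) x}" if "w < ell" "v w" for w
 proof -
  have "inv_into ?PG xs (xs w) = w" using bG that by (simp add: bij_betw_def inv_into_f_f)
  then show ?thesis by (simp add: \<mu>_def)
 qed
 have "intersects_on K a \<mu>"
  unfolding intersects_on_def
 proof (intro ballI)
  fix u u' assume "u \<in> K" "u' \<in> K"
  then obtain w w' where w: "w < ell" "v w" "xs w = u" "\<mu> u = {x. x < k & bt (xs (?\<phi> w)) x}"
   and w': "w' < ell" "v w'" "xs w' = u'" "\<mu> u' = {x. x < k & bt (xs (?\<phi> w')) x}" using pos by meson
  have "a u u' <-> al w w'" using alG[OF w(1) w'(1)] w(3) w'(3) by simp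
  also have "\<dots> <-> al (?\<phi> w) (?\<phi> w')" by (rule ph(3)[OF w(1,2) w'(1,2)])
  also have "\<dots> <-> (EX x<k. bt (xs (?\<phi> w)) x & bt (xs (?\<phi> w')) x)"
   using ph(1,2)[OF w(1,2) w(1,2)] ph(1,2)[OF w'(1,2) w'(1,2)] by (simp add: al_def)
  also have "\<dots> <-> \<mu> u \<inter> \<mu> u' ~= {}" unfolding w(4) w'(4) by blast
  finally show "a u u' <-> \<mu> u \<inter> \<mu> u' ~= {}" .
 qed
 from kernel_extend[OF K this asym]
 have ext: "intersects_on {..<r0} a (%v. \<Union>p\<in>{p\<in>K. nle {..<r0} a p v}. \<mu> p)" .
 have lb: "C.lb i x <-> x \<in> (\<Union>p\<in>{p\<in>K. nle {..<r0} a p i}. \<mu> p)" if "x < k" for i x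
 proof
  assume "C.lb i x"
  then obtain w where w: "w < ell" "v w" "ALL z<r0. a (xs w) z --> a i z" "bt (xs (?\<phi> w)) x"
   unfolding C.lb_def aC vldF phiF using xv ph(2) by auto
  then have "x \<in> \<mu> (xs w)" "xs w \<in> K" "nle {..<r0} a (xs w) i" using mux[OF w(1,2)] xK[OF w(1,2)] that by (auto simp: nle_def)
  then show "x \<in> (\<Union>p\<in>{p\<in>K. nle {..<r0} a p i}. \<mu> p)" by blast
 next
  assume "x \<in> (\<Union>p\<in>{p\<in>K. nle {..<r0} a p i}. \<mu> p)"
  then obtain u where u: "u \<in> K" "nle {..<r0} a u i" "x \<in> \<mu> u" by blast
  obtain w where w: "w < ell" "v w" "xs w = u" "\<mu> u = {x. x < k & bt (xs (?\<phi> w)) x}" using pos[OF u(1)] by blast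
  show "C.lb i x"
   unfolding C.lb_def aC vldF phiF
  proof (intro exI[of _ w] conjI)
   show "ALL z<r0. a (C.xv w) z --> a i z" using xv[of w] w u(2) by (simp add: nle_def)
   show "bt (C.xv (?\<phi> w)) x" using xv[of "?\<phi> w"] ph(2)[OF w(1,2) w(1,2)] u(3) w(4) by simp
  qed (use w in auto)
 qed
 have muk: "\<mu> u \<subseteq> {..<k}" for u by (auto simp: \<mu>_def)
 have "C.chk"
  unfolding C.chk_def aC
 proof (intro allI impI)
  fix i j assume ij: "i < r0" "j < r0"
  have "a i j <-> (\<Union>p\<in>{p\<in>K. nle {..<r0} a p i}. \<mu> p) \<inter> (\<Union>p\<in>{p\<in>K. nle {..<r0} a p j}. \<mu> p) ~= {}"
   using ext ij by (simp add: intersects_on_def)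
  also have "\<dots> <-> (EX x<k. x \<in> (\<Union>p\<in>{p\<in>K. nle {..<r0} a p i}. \<mu> p) & x \<in> (\<Union>p\<in>{p\<in>K. nle {..<r0} a p j}. \<mu> p))"
  proof -
   have "(\<Union>p\<in>{p\<in>K. nle {..<r0} a p i}. \<mu> p) \<subseteq> {..<k}" by (rule UN_least) (rule muk)
   then show ?thesis by blast
  qed
  also have "\<dots> <-> (EX x<k. C.lb i x & C.lb j x)" by (simp only: lb cong: conj_cong)
  finally show "a i j <-> (EX x<k. C.lb i x & C.lb j x)" .
 qed
 then show ?thesis using bb by (intro exI[of _ b] conjI)
qed

section \<open>A term language and its compilation\<close>

text \<open>The only loops are \<open>Sum\<close> and \<open>Iter\<close>, both running up to the
  value of variable 0; so a fixed term costs a polynomial in that value, and time bounds only have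
  to count commands. \<open>Scope\<close> forgets all but the last variables of the environment,
  which lets a term be called like a function with its own argument numbering.\<close>

datatype tm = Num nat | Glob nat | Var nat | Plus tm tm | Monus tm tm | Halve tm | Inp tm
 | Arr nat tm | Cond tm tm tm | Sum tm | Iter tm tm | LetT tm tm | Scope nat tm

record st =
 inp :: "nat => nat"
 gv :: "nat => nat"
 ar :: "nat => nat => nat"
 clk :: nat

primrec eval :: "tm => st => nat list => nat" where
 "eval (Num c) s e = c"
| "eval (Glob g) s e = gv s g"
| "eval (Var i) s e = (if i < length e then e ! i else 0)"
| "eval (Plus t u) s e = eval t s e + eval u s e"
| "eval (Monus t u) s e = eval t s e - eval u s e"
| "eval (Halve t) s e = eval t s e div 2"
| "eval (Inp t) s e = inp s (eval t s e)"
| "eval (Arr a t) s e = ar s (a mod 16) (eval t s e)"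
| "eval (Cond c t u) s e = (if eval c s e = 0 then eval u s e else eval t s e)"
| "eval (Sum t) s e = (\<Sum>i<gv s 0. eval t s (e @ [i]))"
| "eval (Iter t u) s e = rec_nat (eval t s e) (%j x. eval u s (e @ [j, x])) (gv s 0)"
| "eval (LetT t u) s e = eval u s (e @ [eval t s e])"
| "eval (Scope m t) s e = eval t s (drop (length e - m) e)"

primrec tcost :: "tm => nat => nat" where
 "tcost (Num c) M = 1"
| "tcost (Glob g) M = 2"
| "tcost (Var i) M = 2"
| "tcost (Plus t u) M = tcost t M + tcost u M + 1"
| "tcost (Monus t u) M = tcost t M + tcost u M + 1"
| "tcost (Halve t) M = tcost t M + 1"
| "tcost (Inp t) M = tcost t M + 4"
| "tcost (Arr a t) M = tcost t M + 8"
| "tcost (Cond c t u) M = tcost c M + tcost t M + tcost u M + 2"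
| "tcost (Sum t) M = 4 + M * (tcost t M + 5)"
| "tcost (Iter t u) M = tcost t M + 3 + M * (tcost u M + 6)"
| "tcost (LetT t u) M = tcost t M + tcost u M + 2"
| "tcost (Scope m t) M = tcost t M"

text \<open>Polynomial growth is preserved by sums and by bounded loops; the degree reflects the
  nesting of loops.\<close>

lemma tcost_poly: "EX C D. ALL M. tcost t M \<le> C * (M + 1) ^ D"
proof -
 have up: "C * (M + 1) ^ D \<le> C * (M + 1) ^ (D + D')" for C D D' M :: nat
  by (simp add: power_increasing)
 have two: "EX C D. ALL M. f M + g M + k \<le> C * (M + 1) ^ D"
  if "ALL M. f M \<le> C1 * (M + 1) ^ D1" "ALL M. g M \<le> C2 * (M + 1) ^ D2"
  for f g :: "nat => nat" and k C1 C2 D1 D2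
 proof (intro exI allI)
  fix M
  have "f M \<le> C1 * (M + 1) ^ (D1 + D2)"
   using that(1) up le_trans by blast
  moreover have "g M \<le> C2 * (M + 1) ^ (D1 + D2)"
   using that(2) up[of C2 M D2 D1] le_trans by (metis add.commute)
  moreover have "k \<le> k * (M + 1) ^ (D1 + D2)" by simp
  ultimately show "f M + g M + k \<le> (C1 + C2 + k) * (M + 1) ^ (D1 + D2)"
   unfolding add_mult_distrib by (intro add_mono)
 qed
 have loop: "EX C D. ALL M. M * (f M + k) \<le> C * (M + 1) ^ D"
  if "ALL M. f M \<le> C1 * (M + 1) ^ D1" for f :: "nat => nat" and k C1 D1
 proof (intro exI allI)
  fix M
  have "f M + k \<le> (C1 + k) * (M + 1) ^ D1"
   using that[rule_format, of M] by (simp add: add_mult_distrib add_mono)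
  then have "M * (f M + k) \<le> (M + 1) * ((C1 + k) * (M + 1) ^ D1)"
   by (intro mult_mono) auto
  then show "M * (f M + k) \<le> (C1 + k) * (M + 1) ^ Suc D1"
   by (simp add: algebra_simps)
 qed
 have zero: "ALL M::nat. 0 \<le> 0 * (M + 1) ^ 0" by simp
 have const: "EX C D. ALL M::nat. k \<le> C * (M + 1) ^ D" for k :: nat
  by (rule exI[of _ k], rule exI[of _ 0]) simp
 show ?thesis
 proof (induction t)
  case (Cond c t u)
  then obtain C1 D1 C2 D2 where *: "ALL M. tcost c M \<le> C1 * (M + 1) ^ D1" "ALL M. tcost t M \<le> C2 * (M + 1) ^ D2"
   by blast
  from two[OF *, of 0] Cond obtain C3 D3 C4 D4 where "ALL M. tcost c M + tcost t M + 0 \<le> C3 * (M + 1) ^ D3"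
   "ALL M. tcost u M \<le> C4 * (M + 1) ^ D4" by blast
  from two[OF this, of 2] show ?case by simp
 next
  case (Sum t)
  then obtain C1 D1 where *: "ALL M. tcost t M \<le> C1 * (M + 1) ^ D1" by blast
  from loop[OF *, of 5] obtain C2 D2 where "ALL M. M * (tcost t M + 5) \<le> C2 * (M + 1) ^ D2" by blast
  from two[OF zero this, of 4] show ?case by (simp add: algebra_simps)
 next
  case (Iter t u)
  then obtain C1 D1 C0 D0 where *: "ALL M. tcost u M \<le> C1 * (M + 1) ^ D1" and t: "ALL M. tcost t M \<le> C0 * (M + 1) ^ D0"
   by blast
  from loop[OF *, of 6] obtain C2 D2 where "ALL M. M * (tcost u M + 6) \<le> C2 * (M + 1) ^ D2" by blast
  from two[OF t this, of 3] show ?case by (simp add: algebra_simps)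
 next
  case (Plus t u) then obtain C1 D1 C2 D2 where "ALL M. tcost t M \<le> C1 * (M + 1) ^ D1" "ALL M. tcost u M \<le> C2 * (M + 1) ^ D2" by blast
  from two[OF this, of 1] show ?case by simp
 next
  case (Monus t u) then obtain C1 D1 C2 D2 where "ALL M. tcost t M \<le> C1 * (M + 1) ^ D1" "ALL M. tcost u M \<le> C2 * (M + 1) ^ D2" by blast
  from two[OF this, of 1] show ?case by simp
 next
  case (LetT t u) then obtain C1 D1 C2 D2 where "ALL M. tcost t M \<le> C1 * (M + 1) ^ D1" "ALL M. tcost u M \<le> C2 * (M + 1) ^ D2" by blast
  from two[OF this, of 2] show ?case by simp
 next
  case (Halve t) then obtain C1 D1 where "ALL M. tcost t M \<le> C1 * (M + 1) ^ D1" by blast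
  from two[OF this zero, of 1] show ?case by simp
 next
  case (Inp t) then obtain C1 D1 where "ALL M. tcost t M \<le> C1 * (M + 1) ^ D1" by blast
  from two[OF this zero, of 4] show ?case by simp
 next
  case (Arr a t) then obtain C1 D1 where "ALL M. tcost t M \<le> C1 * (M + 1) ^ D1" by blast
  from two[OF this zero, of 8] show ?case by simp
 qed (use const in \<open>auto\<close>)
qed

text \<open>Program variables live in the even registers, the evaluation stack in the odd ones.  Stack
 cells 0 and 1 permanently hold the constant 1 and the first address behind the input.\<close>

definition rg :: "nat => nat" where "rg g = 2 * g"
definition rs :: "nat => nat" where "rs i = 2 * i + 1"

lemma reg_neq [simp]: "rg g ~= rs i" "rs i ~= rg g" "rs i = rs j <-> i = j" "rg g = rg g' <-> g = g'"
 unfolding rg_def rs_def by presburger+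

text \<open>\<open>\<rho>\<close> lists the stack cells of the variables, \<open>d\<close> is the
  first free cell, and \<open>a\<close> the address of the code, needed because jumps are absolute.
  Registers are copied by \<open>Const\<close> with 0 followed by \<open>Add\<close>. The code of
  \<open>Inp\<close> compares the address with stack cell 1, since the memory behind the input holds
  the arrays whereas \<open>inp\<close> is 0 there.\<close>

primrec ct :: "tm => nat list => nat => nat => instr list" where
 "ct (Num c) \<rho> d a = [Const (rs d) c]"
| "ct (Glob g) \<rho> d a = [Const (rs d) 0, Add (rs d) (rs d) (rg g)]"
| "ct (Var i) \<rho> d a = (if i < length \<rho> then [Const (rs d) 0, Add (rs d) (rs d) (rs (\<rho> ! i))] else [Const (rs d) 0])"
| "ct (Plus t u) \<rho> d a = (let A = ct t \<rho> d a in A @ ct u \<rho> (Suc d) (a + length A) @ [Add (rs d) (rs d) (rs (Suc d))])"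
| "ct (Monus t u) \<rho> d a = (let A = ct t \<rho> d a in A @ ct u \<rho> (Suc d) (a + length A) @ [Sub (rs d) (rs d) (rs (Suc d))])"
| "ct (Halve t) \<rho> d a = ct t \<rho> d a @ [Half (rs d) (rs d)]"
| "ct (Inp t) \<rho> d a = (let A = ct t \<rho> d a; b = a + length A in
   A @ [Sub (rs (Suc d)) (rs 1) (rs d), JumpZero (rs (Suc d)) (b + 4), Load (rs d) (rs d), Jump (b + 5), Const (rs d) 0])"
| "ct (Arr x t) \<rho> d a = ct t \<rho> d a @ [Add (rs d) (rs d) (rs d), Add (rs d) (rs d) (rs d), Add (rs d) (rs d) (rs d),
   Add (rs d) (rs d) (rs d), Add (rs d) (rs d) (rs 1), Const (rs (Suc d)) (x mod 16), Add (rs d) (rs d) (rs (Suc d)), Load (rs d) (rs d)]"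
| "ct (Cond c t u) \<rho> d a = (let A = ct c \<rho> d a; b = a + length A + 1; B = ct t \<rho> d b; b' = b + length B + 1; C = ct u \<rho> d b' in
   A @ [JumpZero (rs d) b'] @ B @ [Jump (b' + length C)] @ C)"
| "ct (Sum t) \<rho> d a = (let B = ct t (\<rho> @ [Suc d]) (d + 2) (a + 4) in
   [Const (rs d) 0, Const (rs (Suc d)) 0, Sub (rs (d + 2)) (rg 0) (rs (Suc d)), JumpZero (rs (d + 2)) (a + length B + 7)]
   @ B @ [Add (rs d) (rs d) (rs (d + 2)), Add (rs (Suc d)) (rs (Suc d)) (rs 0), Jump (a + 2)])"
| "ct (Iter t u) \<rho> d a = (let A = ct t \<rho> d a; b = a + length A; B = ct u (\<rho> @ [Suc d, d]) (d + 2) (b + 3) in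
   A @ [Const (rs (Suc d)) 0, Sub (rs (d + 2)) (rg 0) (rs (Suc d)), JumpZero (rs (d + 2)) (b + length B + 7)]
   @ B @ [Const (rs d) 0, Add (rs d) (rs d) (rs (d + 2)), Add (rs (Suc d)) (rs (Suc d)) (rs 0), Jump (b + 1)])"
| "ct (LetT t u) \<rho> d a = (let A = ct t \<rho> d a; B = ct u (\<rho> @ [d]) (Suc d) (a + length A) in
   A @ B @ [Const (rs d) 0, Add (rs d) (rs d) (rs (Suc d))])"
| "ct (Scope m t) \<rho> d a = ct t (drop (length \<rho> - m) \<rho>) d a"

section \<open>Correctness of compiled terms\<close>

definition codeat :: "program => nat => instr list => bool" where
 "codeat P a is <-> (ALL i<length is. a + i < length P & P ! (a + i) = is ! i)"

lemma codeat_Nil [simp]: "codeat P a []"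
 by (simp add: codeat_def)

lemma codeat_append [simp]: "codeat P a (xs @ ys) <-> codeat P a xs & codeat P (a + length xs) ys"
proof -
 have "codeat P (a + length xs) ys" if *: "codeat P a (xs @ ys)"
  unfolding codeat_def
 proof (intro allI impI)
  fix i assume "i < length ys"
  then show "a + length xs + i < length P & P ! (a + length xs + i) = ys ! i"
   using *[unfolded codeat_def, rule_format, of "length xs + i"] by (simp add: nth_append add.assoc)
 qed
 moreover have "codeat P a xs" if *: "codeat P a (xs @ ys)"
  using * unfolding codeat_def by (metis length_append nth_append trans_less_add1)
 moreover have "codeat P a (xs @ ys)" if "codeat P a xs" "codeat P (a + length xs) ys"
  unfolding codeat_def
 proof (intro allI impI)
  fix i assume i: "i < length (xs @ ys)"
  show "a + i < length P & P ! (a + i) = (xs @ ys) ! i"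
  proof (cases "i < length xs")
   case False
   then show ?thesis
    using that(2)[unfolded codeat_def, rule_format, of "i - length xs"] i by (simp add: nth_append)
  qed (use that(1) in \<open>simp add: codeat_def nth_append\<close>)
 qed
 ultimately show ?thesis by blast
qed

lemma codeat_Cons: "codeat P a (i # is) <-> (a < length P & P ! a = i) & codeat P (Suc a) is"
 using codeat_append[of P a "[i]" "is"] by (simp add: codeat_def)

definition runs :: "program => config => nat => (config => bool) => bool" where
 "runs P cf T Q <-> (\<exists>n\<le>T. Q ((step P ^^ n) cf))"

lemma runs_done: "Q cf ==> runs P cf T Q"
 unfolding runs_def by (rule exI[of _ 0]) simp

lemma runs_trans:
 assumes "runs P cf T1 Q1" "!!cf'. Q1 cf' ==> runs P cf' T2 Q" "T1 + T2 \<le> T"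
 shows "runs P cf T Q"
proof -
 obtain n where n: "n \<le> T1" "Q1 ((step P ^^ n) cf)" using assms(1) unfolding runs_def by blast
 then obtain m where "m \<le> T2" "Q ((step P ^^ m) ((step P ^^ n) cf))" using assms(2) unfolding runs_def by blast
 then show ?thesis unfolding runs_def using n assms(3)
  by (intro exI[of _ "m + n"]) (simp add: funpow_add)
qed

lemma runs_step:
 assumes "pc cf < length P" "P ! pc cf = i" "runs P (exec i cf) T Q"
 shows "runs P cf (Suc T) Q"
proof (rule runs_trans[where ?T1.0 = 1 and ?Q1.0 = "%c. c = exec i cf" and ?T2.0 = T])
 show "runs P cf 1 (%c. c = exec i cf)"
  unfolding runs_def using assms(1,2) by (intro exI[of _ 1]) (auto simp: step_def halted_def)
qed (use assms(3) in auto)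

lemma runs_mono: "runs P cf T Q ==> T \<le> T' ==> (!!c. Q c ==> Q' c) ==> runs P cf T' Q'"
 unfolding runs_def by (meson le_trans)

text \<open>The arrays are interleaved behind the input: entry \<open>i\<close> of array
  \<open>a\<close> lives at \<open>base + 16 * i + a\<close>, an address computed by four doublings.
  So each of the 16 arrays is unbounded and may be indexed by numbers as large as sums of powers of
  two.\<close>

definition rel :: "nat => st => config => bool" where
 "rel base s cf <-> (ALL g. reg cf (rg g) = gv s g) & reg cf (rs 0) = 1 & reg cf (rs 1) = base &
   (ALL i<base. mem cf i = inp s i) & (\<forall>i\<ge>base. inp s i = 0) &
   (ALL a<16. ALL i. mem cf (base + 16 * i + a) = ar s a i)"

definition agree :: "nat => config => config => bool" where
 "agree d cf cf' <-> mem cf' = mem cf & (ALL g. reg cf' (rg g) = reg cf (rg g)) &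
   (ALL i<d. reg cf' (rs i) = reg cf (rs i))"

definition envok :: "nat list => nat list => nat => config => bool" where
 "envok \<rho> e d cf <-> length \<rho> = length e & (\<forall>i<length \<rho>. \<rho> ! i < d & reg cf (rs (\<rho> ! i)) = e ! i)"

lemma agree_refl [simp]: "agree d cf cf" by (simp add: agree_def)
lemma agree_trans: "agree d cf cf' ==> agree d' cf' cf'' ==> d \<le> d' ==> agree d cf cf''"
 by (auto simp: agree_def)
lemma agree_rel: "agree d cf cf' ==> rel base s cf ==> 2 \<le> d ==> rel base s cf'"
 by (simp add: agree_def rel_def)
lemma agree_envok: "agree d cf cf' ==> envok \<rho> e d cf ==> d \<le> d' ==> envok \<rho> e d' cf'"
 by (auto simp: agree_def envok_def intro: less_le_trans)
lemma envok_drop: "envok \<rho> e d cf ==> envok (drop (length \<rho> - m) \<rho>) (drop (length e - m) e) d cf"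
 by (auto simp: envok_def)
lemma envok_snoc: "envok \<rho> e d cf ==> j < d ==> reg cf (rs j) = v ==> envok (\<rho> @ [j]) (e @ [v]) d cf"
 by (auto simp: envok_def nth_append)

definition tpost :: "nat => nat => nat => config => config => bool" where
 "tpost a' v d cf cf' <-> pc cf' = a' & reg cf' (rs d) = v & agree d cf cf'"

abbreviation addr_code :: "nat => nat => instr list" where
 "addr_code d c \<equiv> [Add (rs d) (rs d) (rs d), Add (rs d) (rs d) (rs d), Add (rs d) (rs d) (rs d),
   Add (rs d) (rs d) (rs d), Add (rs d) (rs d) (rs 1), Const (rs (Suc d)) c, Add (rs d) (rs d) (rs (Suc d))]"

lemma length_addr_code: "length (addr_code d c) = 7"
 by simp

lemma runs_addr_code:
 assumes "codeat P a (addr_code d c)" "pc cf = a" "2 \<le> d"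
  "runs P (cf\<lparr>pc := a + 7, reg := (reg cf)(rs d := reg cf (rs 1) + 16 * reg cf (rs d) + c, rs (Suc d) := c)\<rparr>) T Q"
 shows "runs P cf (T + 7) Q"
proof -
 define v where "v = reg cf (rs d)"
 have e: "exec (Add (rs d) (rs d) (rs (Suc d))) (exec (Const (rs (Suc d)) c) (exec (Add (rs d) (rs d) (rs 1))
   (exec (Add (rs d) (rs d) (rs d)) (exec (Add (rs d) (rs d) (rs d)) (exec (Add (rs d) (rs d) (rs d)) (exec (Add (rs d) (rs d) (rs d)) cf))))))
  = cf\<lparr>pc := a + 7, reg := (reg cf)(rs d := reg cf (rs 1) + 16 * reg cf (rs d) + c, rs (Suc d) := c)\<rparr>"
 proof -
  have v: "v + v + (v + v) + (v + v + (v + v)) + (v + v + (v + v) + (v + v + (v + v))) + reg cf (rs 1) + c = reg cf (rs 1) + 16 * v + c"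
   by simp
  have seven: "a + 7 = Suc (Suc (Suc (Suc (Suc (Suc (Suc a))))))" by simp
  show ?thesis
   unfolding v_def[symmetric] v[symmetric] seven using assms(2,3) by (simp add: v_def[symmetric] fun_upd_twist)
 qed
 have "runs P cf (Suc (Suc (Suc (Suc (Suc (Suc (Suc T))))))) Q"
  by (rule runs_step[OF _ _ runs_step[OF _ _ runs_step[OF _ _ runs_step[OF _ _ runs_step[OF _ _ runs_step[OF _ _ runs_step[OF _ _ assms(4)[folded e]]]]]]]])
   (use assms(1,2) in \<open>simp_all add: codeat_Cons\<close>)
 then show ?thesis by (simp add: numeral_eq_Suc)
qed

text \<open>The induction rests on the stack discipline: the value appears in cell \<open>d\<close>,
  while memory, program variables and the cells below \<open>d\<close> keep their contents.
  \<open>tcost\<close> depends on the state only through variable 0, hence is the same in all rounds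
  of a loop.\<close>

lemma ct_correct:
 assumes "codeat P a (ct t \<rho> d a)" "pc cf = a" "rel base s cf" "envok \<rho> e d cf" "2 \<le> d"
 shows "runs P cf (tcost t (gv s 0)) (tpost (a + length (ct t \<rho> d a)) (eval t s e) d cf)"
 using assms
proof (induction t arbitrary: \<rho> d a cf e)
 case (Num c)
 then have "runs P cf (Suc 0) (tpost (a + length (ct (Num c) \<rho> d a)) (eval (Num c) s e) d cf)"
  by (intro runs_step runs_done) (auto simp: codeat_Cons tpost_def agree_def)
 then show ?case by simp
next
 case (Glob g)
 then have "runs P cf (Suc (Suc 0)) (tpost (a + length (ct (Glob g) \<rho> d a)) (eval (Glob g) s e) d cf)"
  by (intro runs_step runs_done) (auto simp: codeat_Cons tpost_def agree_def rel_def)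
 then show ?case by (simp add: numeral_2_eq_2)
next
 case (Var i)
 have "runs P cf (Suc (Suc 0)) (tpost (a + length (ct (Var i) \<rho> d a)) (eval (Var i) s e) d cf)"
 proof (cases "i < length \<rho>")
  case True
  with Var have "\<rho> ! i < d" "reg cf (rs (\<rho> ! i)) = e ! i" "i < length e" by (auto simp: envok_def)
  with Var True show ?thesis
   by (intro runs_step runs_done) (auto simp: codeat_Cons tpost_def agree_def)
 next
  case False
  with Var have "i \<ge> length e" by (auto simp: envok_def)
  with Var False show ?thesis
   by (intro runs_step[where T = "Suc 0"] runs_done) (auto simp: codeat_Cons tpost_def agree_def)
 qed
 then show ?case by (simp add: numeral_2_eq_2)
next
 case (Plus t u)
 let ?A = "ct t \<rho> d a" let ?b = "a + length ?A" let ?B = "ct u \<rho> (Suc d) ?b"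
 have c: "codeat P a ?A" "codeat P ?b ?B" "codeat P (?b + length ?B) [Add (rs d) (rs d) (rs (Suc d))]"
  using Plus.prems(1) by (auto simp: Let_def add.assoc)
 have 1: "runs P cf (tcost t (gv s 0)) (tpost ?b (eval t s e) d cf)"
  using Plus.IH(1) c Plus.prems by blast
 show ?case
 proof (rule runs_trans[OF 1, where ?T2.0 = "tcost u (gv s 0) + 1"])
  fix cf1 assume cf1: "tpost ?b (eval t s e) d cf cf1"
  have 2: "runs P cf1 (tcost u (gv s 0)) (tpost (?b + length ?B) (eval u s e) (Suc d) cf1)"
   using cf1 Plus.prems c by (intro Plus.IH(2)) (auto simp: tpost_def intro: agree_rel agree_envok)
  show "runs P cf1 (tcost u (gv s 0) + 1) (tpost (a + length (ct (Plus t u) \<rho> d a)) (eval (Plus t u) s e) d cf)"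
  proof (rule runs_trans[OF 2, where ?T2.0 = "Suc 0"])
   fix cf2 assume cf2: "tpost (?b + length ?B) (eval u s e) (Suc d) cf1 cf2"
   show "runs P cf2 (Suc 0) (tpost (a + length (ct (Plus t u) \<rho> d a)) (eval (Plus t u) s e) d cf)"
    using c(3) cf1 cf2 by (intro runs_step runs_done) (auto simp: codeat_Cons tpost_def agree_def Let_def)
  qed simp
 qed simp
next
 case (Monus t u)
 let ?A = "ct t \<rho> d a" let ?b = "a + length ?A" let ?B = "ct u \<rho> (Suc d) ?b"
 have c: "codeat P a ?A" "codeat P ?b ?B" "codeat P (?b + length ?B) [Sub (rs d) (rs d) (rs (Suc d))]"
  using Monus.prems(1) by (auto simp: Let_def add.assoc)
 have 1: "runs P cf (tcost t (gv s 0)) (tpost ?b (eval t s e) d cf)"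
  using Monus.IH(1) c Monus.prems by blast
 show ?case
 proof (rule runs_trans[OF 1, where ?T2.0 = "tcost u (gv s 0) + 1"])
  fix cf1 assume cf1: "tpost ?b (eval t s e) d cf cf1"
  have 2: "runs P cf1 (tcost u (gv s 0)) (tpost (?b + length ?B) (eval u s e) (Suc d) cf1)"
   using cf1 Monus.prems c by (intro Monus.IH(2)) (auto simp: tpost_def intro: agree_rel agree_envok)
  show "runs P cf1 (tcost u (gv s 0) + 1) (tpost (a + length (ct (Monus t u) \<rho> d a)) (eval (Monus t u) s e) d cf)"
  proof (rule runs_trans[OF 2, where ?T2.0 = "Suc 0"])
   fix cf2 assume cf2: "tpost (?b + length ?B) (eval u s e) (Suc d) cf1 cf2"
   show "runs P cf2 (Suc 0) (tpost (a + length (ct (Monus t u) \<rho> d a)) (eval (Monus t u) s e) d cf)"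
    using c(3) cf1 cf2 by (intro runs_step runs_done) (auto simp: codeat_Cons tpost_def agree_def Let_def)
  qed simp
 qed simp
next
 case (Halve t)
 let ?A = "ct t \<rho> d a" let ?b = "a + length ?A"
 have c: "codeat P a ?A" "codeat P ?b [Half (rs d) (rs d)]"
  using Halve.prems(1) by auto
 show ?case
 proof (rule runs_trans[OF Halve.IH[OF c(1) Halve.prems(2-5)], where ?T2.0 = "Suc 0"])
  fix cf1 assume "tpost ?b (eval t s e) d cf cf1"
  then show "runs P cf1 (Suc 0) (tpost (a + length (ct (Halve t) \<rho> d a)) (eval (Halve t) s e) d cf)"
   using c by (intro runs_step runs_done) (auto simp: codeat_Cons tpost_def agree_def)
 qed simp
next
 case (Inp t)
 let ?A = "ct t \<rho> d a" let ?b = "a + length ?A"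
 have c: "codeat P a ?A" "codeat P ?b [Sub (rs (Suc d)) (rs 1) (rs d), JumpZero (rs (Suc d)) (?b + 4), Load (rs d) (rs d), Jump (?b + 5), Const (rs d) 0]"
  using Inp.prems(1) by (auto simp: Let_def)
 show ?case
 proof (rule runs_trans[OF Inp.IH[OF c(1) Inp.prems(2-5)], where ?T2.0 = "Suc (Suc (Suc (Suc 0)))"])
  fix cf1 assume cf1: "tpost ?b (eval t s e) d cf cf1"
  then have r: "rel base s cf1" using Inp.prems(3,5) by (auto simp: tpost_def intro: agree_rel)
  have d: "rs d ~= rs 1" "rs (Suc d) ~= rs 1" using Inp.prems(5) by auto
  let ?Q = "tpost (a + length (ct (Inp t) \<rho> d a)) (eval (Inp t) s e) d cf"
  let ?c2 = "exec (JumpZero (rs (Suc d)) (?b + 4)) (exec (Sub (rs (Suc d)) (rs 1) (rs d)) cf1)"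
  have "runs P ?c2 (Suc (Suc 0)) ?Q"
  proof (cases "eval t s e < base")
   case True
   have 3: "runs P (exec (Jump (?b + 5)) (exec (Load (rs d) (rs d)) ?c2)) 0 ?Q"
    by (rule runs_done) (use True cf1 r d in \<open>simp add: tpost_def agree_def Let_def rel_def\<close>)
   show ?thesis
    by (rule runs_step[OF _ _ runs_step[OF _ _ 3]])
     (use True c(2) cf1 r d in \<open>simp_all add: codeat_Cons tpost_def rel_def\<close>)
  next
   case False
   have 3: "runs P (exec (Const (rs d) 0) ?c2) (Suc 0) ?Q"
    by (rule runs_done) (use False cf1 r d in \<open>simp add: tpost_def agree_def Let_def rel_def\<close>)
   show ?thesis
    by (rule runs_step[OF _ _ 3])
     (use False c(2) cf1 r d in \<open>simp_all add: codeat_Cons tpost_def rel_def numeral_eq_Suc\<close>)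
  qed
  note 2 = this
  show "runs P cf1 (Suc (Suc (Suc (Suc 0)))) ?Q"
   by (rule runs_step[OF _ _ runs_step[OF _ _ 2]])
    (use c(2) cf1 in \<open>simp_all add: codeat_Cons tpost_def\<close>)
 qed simp
next
 case (Arr x t)
 let ?A = "ct t \<rho> d a" let ?b = "a + length ?A"
 have c: "codeat P a ?A" "codeat P ?b (addr_code d (x mod 16))" "codeat P (?b + 7) [Load (rs d) (rs d)]"
 proof -
  have "ct (Arr x t) \<rho> d a = ?A @ addr_code d (x mod 16) @ [Load (rs d) (rs d)]" by simp
  from Arr.prems(1)[unfolded this codeat_append length_addr_code]
  show "codeat P a ?A" "codeat P ?b (addr_code d (x mod 16))" "codeat P (?b + 7) [Load (rs d) (rs d)]" by simp_all
 qed
 let ?Q = "tpost (a + length (ct (Arr x t) \<rho> d a)) (eval (Arr x t) s e) d cf"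
 show ?case
 proof (rule runs_trans[OF Arr.IH[OF c(1) Arr.prems(2-5)], where ?T2.0 = "Suc 0 + 7"])
  fix cf1 assume cf1: "tpost ?b (eval t s e) d cf cf1"
  then have r: "rel base s cf1" using Arr.prems(3,5) by (auto simp: tpost_def intro: agree_rel)
  show "runs P cf1 (Suc 0 + 7) ?Q"
  proof (rule runs_addr_code[OF c(2) _ Arr.prems(5)])
   show "runs P (cf1\<lparr>pc := ?b + 7, reg := (reg cf1)(rs d := reg cf1 (rs 1) + 16 * reg cf1 (rs d) + x mod 16, rs (Suc d) := x mod 16)\<rparr>) (Suc 0) ?Q"
    using c(3) cf1 r by (intro runs_step runs_done) (auto simp: codeat_Cons tpost_def agree_def rel_def)
  qed (use cf1 in \<open>simp add: tpost_def\<close>)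
 qed simp
next
 case (Cond c t u)
 let ?A = "ct c \<rho> d a" let ?b = "a + length ?A + 1" let ?B = "ct t \<rho> d ?b" let ?b' = "?b + length ?B + 1" let ?C = "ct u \<rho> d ?b'"
 let ?Q = "tpost (a + length (ct (Cond c t u) \<rho> d a)) (eval (Cond c t u) s e) d cf"
 have cd: "codeat P a ?A" "codeat P (a + length ?A) [JumpZero (rs d) ?b']" "codeat P ?b ?B" "codeat P (?b + length ?B) [Jump (?b' + length ?C)]"
  "codeat P ?b' ?C"
  using Cond.prems(1) by (auto simp: Let_def codeat_Cons add.assoc)
 have end_: "a + length (ct (Cond c t u) \<rho> d a) = ?b' + length ?C" by (simp add: Let_def)
 show ?case
 proof (rule runs_trans[OF Cond.IH(1)[OF cd(1) Cond.prems(2-5)], where ?T2.0 = "tcost t (gv s 0) + tcost u (gv s 0) + 2"])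
  fix cf1 assume cf1: "tpost (a + length ?A) (eval c s e) d cf cf1"
  show "runs P cf1 (tcost t (gv s 0) + tcost u (gv s 0) + 2) ?Q"
  proof (cases "eval c s e = 0")
   case True
   let ?cf = "cf1\<lparr>pc := ?b'\<rparr>"
   have ag: "agree d cf ?cf" using cf1 by (simp add: tpost_def agree_def)
   have "runs P ?cf (tcost u (gv s 0)) (tpost (?b' + length ?C) (eval u s e) d ?cf)"
    using ag cd Cond.prems by (intro Cond.IH(3)) (auto intro: agree_rel agree_envok)
   then have "runs P ?cf (tcost u (gv s 0)) ?Q"
    by (rule runs_mono) (use True ag end_ in \<open>auto simp: tpost_def intro: agree_trans\<close>)
   then have "runs P cf1 (Suc (tcost u (gv s 0))) ?Q"
    using cd(2) cf1 True by (intro runs_step[where i="JumpZero (rs d) ?b'"]) (auto simp: codeat_Cons tpost_def)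
   then show ?thesis by (rule runs_mono) auto
  next
   case False
   let ?cf = "cf1\<lparr>pc := ?b\<rparr>"
   have ag: "agree d cf ?cf" using cf1 by (simp add: tpost_def agree_def)
   have 1: "runs P ?cf (tcost t (gv s 0)) (tpost (?b + length ?B) (eval t s e) d ?cf)"
    using ag cd Cond.prems by (intro Cond.IH(2)) (auto intro: agree_rel agree_envok)
   have "runs P ?cf (tcost t (gv s 0) + 1) ?Q"
   proof (rule runs_trans[OF 1, where ?T2.0 = "Suc 0"])
    fix cf2 assume "tpost (?b + length ?B) (eval t s e) d ?cf cf2"
    then show "runs P cf2 (Suc 0) ?Q"
     using cd(4) False ag end_
     by (intro runs_step runs_done) (auto simp: codeat_Cons tpost_def agree_def)
   qed simp
   then have "runs P cf1 (Suc (tcost t (gv s 0) + 1)) ?Q"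
    using cd(2) cf1 False by (intro runs_step[where i="JumpZero (rs d) ?b'"]) (auto simp: codeat_Cons tpost_def)
   then show ?thesis by (rule runs_mono) auto
  qed
 qed simp
next
 case (Sum t)
 let ?M = "gv s 0" let ?B = "ct t (\<rho> @ [Suc d]) (d + 2) (a + 4)" let ?f = "%i. eval t s (e @ [i])"
 let ?Q = "tpost (a + length (ct (Sum t) \<rho> d a)) (eval (Sum t) s e) d cf"
 have cd: "codeat P a [Const (rs d) 0, Const (rs (Suc d)) 0, Sub (rs (d + 2)) (rg 0) (rs (Suc d)), JumpZero (rs (d + 2)) (a + length ?B + 7)]"
  "codeat P (a + 4) ?B"
  "codeat P (a + 4 + length ?B) [Add (rs d) (rs d) (rs (d + 2)), Add (rs (Suc d)) (rs (Suc d)) (rs 0), Jump (a + 2)]"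
  using Sum.prems(1) by (simp_all add: Let_def codeat_Cons numeral_eq_Suc)
 \<comment> \<open>Induction on the number \<open>n\<close> of rounds still to come, with
   \<open>i\<close> rounds done; the final summand 2 is the failing loop test.\<close>
 have loop: "runs P c' (n * (tcost t ?M + 5) + 2) ?Q"
  if "n + i = ?M" "pc c' = a + 2" "reg c' (rs d) = (\<Sum>j<i. ?f j)" "reg c' (rs (Suc d)) = i" "agree d cf c'" for n i c'
  using that
 proof (induction n arbitrary: i c')
  case 0
  have g: "reg c' (rg 0) = ?M" using agree_rel[OF 0(5) Sum.prems(3,5)] by (simp add: rel_def)
  have "runs P c' (Suc (Suc 0)) ?Q"
   using cd(1) 0 g by (intro runs_step runs_done) (auto simp: codeat_Cons tpost_def agree_def Let_def)
  then show ?case by (simp add: numeral_2_eq_2)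
 next
  case (Suc n)
  have r: "rel base s c'" using agree_rel[OF Suc(6) Sum.prems(3,5)] .
  then have g: "reg c' (rg 0) = ?M" by (simp add: rel_def)
  define c1 where "c1 = c'\<lparr>pc := a + 4, reg := (reg c')(rs (d + 2) := ?M - i)\<rparr>"
  have ag: "agree (d + 2) c' c1" by (simp add: c1_def agree_def)
  have eo: "envok (\<rho> @ [Suc d]) (e @ [i]) (d + 2) c1"
  proof (rule envok_snoc)
   show "envok \<rho> e (d + 2) c1"
    using agree_envok[OF agree_trans[OF Suc(6) ag] Sum.prems(4), of "d + 2"] by simp
  qed (use Suc in \<open>auto simp: c1_def\<close>)
  have 1: "runs P c1 (tcost t ?M) (tpost (a + 4 + length ?B) (?f i) (d + 2) c1)"
   using eo cd r ag Sum.prems(5) by (intro Sum.IH) (auto intro: agree_rel simp: c1_def)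
  have 2: "runs P c1 (tcost t ?M + (3 + (n * (tcost t ?M + 5) + 2))) ?Q"
  proof (rule runs_trans[OF 1, where ?T2.0 = "Suc (Suc (Suc (n * (tcost t ?M + 5) + 2)))"])
   fix c2 assume c2: "tpost (a + 4 + length ?B) (?f i) (d + 2) c1 c2"
   have x: "reg c2 (rs 0) = 1"
    using agree_rel[of "d + 2" c1 c2 base s] agree_rel[OF ag r] Sum.prems(5) c2 by (auto simp: tpost_def rel_def)
   have y: "reg c2 (rs d) = (\<Sum>j<i. ?f j)" "reg c2 (rs (Suc d)) = i" "agree d cf c2"
    using c2 Suc(4-6) ag by (auto simp: tpost_def agree_def c1_def)
   define c3 where "c3 = exec (Jump (a + 2)) (exec (Add (rs (Suc d)) (rs (Suc d)) (rs 0)) (exec (Add (rs d) (rs d) (rs (d + 2))) c2))"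
   have "runs P c3 (n * (tcost t ?M + 5) + 2) ?Q"
   proof (rule Suc.IH[of "Suc i"])
    show "reg c3 (rs d) = (\<Sum>j<Suc i. ?f j)" "reg c3 (rs (Suc d)) = Suc i" "agree d cf c3"
     using y x c2 Sum.prems(5) by (auto simp: c3_def tpost_def agree_def)
   qed (use Suc(2) in \<open>auto simp: c3_def\<close>)
   then show "runs P c2 (Suc (Suc (Suc (n * (tcost t ?M + 5) + 2)))) ?Q"
    unfolding c3_def using cd(3) c2 by (intro runs_step) (auto simp: codeat_Cons tpost_def)
  qed simp
  have "runs P c' (Suc (Suc (tcost t ?M + (3 + (n * (tcost t ?M + 5) + 2))))) ?Q"
  proof (rule runs_step[OF _ _ runs_step])
   show "runs P (exec (JumpZero (rs (d + 2)) (a + length ?B + 7)) (exec (Sub (rs (d + 2)) (rg 0) (rs (Suc d))) c')) (tcost t ?M + (3 + (n * (tcost t ?M + 5) + 2))) ?Q"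
   proof -
    have "exec (JumpZero (rs (d + 2)) (a + length ?B + 7)) (exec (Sub (rs (d + 2)) (rg 0) (rs (Suc d))) c') = c1"
     using Suc(2-5) g by (simp add: c1_def)
    then show ?thesis using 2 by simp
   qed
  qed (use cd(1) Suc(3) in \<open>auto simp: codeat_Cons\<close>)
  then show ?case by (rule runs_mono) auto
 qed
 have "runs P cf (Suc (Suc (?M * (tcost t ?M + 5) + 2))) ?Q"
  using cd(1) Sum.prems(2)
  by (intro runs_step[OF _ _ runs_step[OF _ _ loop[of ?M 0]]]) (auto simp: codeat_Cons agree_def)
 then show ?case by (rule runs_mono) auto
next
 case (Iter t u)
 let ?M = "gv s 0" let ?A = "ct t \<rho> d a" let ?b = "a + length ?A" let ?B = "ct u (\<rho> @ [Suc d, d]) (d + 2) (?b + 3)"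
 let ?f = "%n. rec_nat (eval t s e) (%j x. eval u s (e @ [j, x])) n"
 let ?Q = "tpost (a + length (ct (Iter t u) \<rho> d a)) (eval (Iter t u) s e) d cf"
 have cd: "codeat P a ?A" "codeat P ?b [Const (rs (Suc d)) 0, Sub (rs (d + 2)) (rg 0) (rs (Suc d)), JumpZero (rs (d + 2)) (?b + length ?B + 7)]"
  "codeat P (?b + 3) ?B"
  "codeat P (?b + 3 + length ?B) [Const (rs d) 0, Add (rs d) (rs d) (rs (d + 2)), Add (rs (Suc d)) (rs (Suc d)) (rs 0), Jump (?b + 1)]"
  using Iter.prems(1) by (simp_all add: Let_def codeat_Cons numeral_eq_Suc)
 have loop: "runs P c' (n * (tcost u ?M + 6) + 2) ?Q"
  if "n + i = ?M" "pc c' = ?b + 1" "reg c' (rs d) = ?f i" "reg c' (rs (Suc d)) = i" "agree d cf c'" for n i c'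
  using that
 proof (induction n arbitrary: i c')
  case 0
  have g: "reg c' (rg 0) = ?M" using agree_rel[OF 0(5) Iter.prems(3,5)] by (simp add: rel_def)
  have "runs P c' (Suc (Suc 0)) ?Q"
   using cd(2) 0 g by (intro runs_step runs_done) (auto simp: codeat_Cons tpost_def agree_def Let_def)
  then show ?case by (simp add: numeral_2_eq_2)
 next
  case (Suc n)
  have r: "rel base s c'" using agree_rel[OF Suc(6) Iter.prems(3,5)] .
  then have g: "reg c' (rg 0) = ?M" by (simp add: rel_def)
  define c1 where "c1 = c'\<lparr>pc := ?b + 3, reg := (reg c')(rs (d + 2) := ?M - i)\<rparr>"
  have ag: "agree (d + 2) c' c1" by (simp add: c1_def agree_def)
  have eo: "envok ((\<rho> @ [Suc d]) @ [d]) ((e @ [i]) @ [?f i]) (d + 2) c1"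
  proof (intro envok_snoc)
   show "envok \<rho> e (d + 2) c1"
    using agree_envok[OF agree_trans[OF Suc(6) ag] Iter.prems(4), of "d + 2"] by simp
  qed (use Suc in \<open>auto simp: c1_def\<close>)
  have 1: "runs P c1 (tcost u ?M) (tpost (?b + 3 + length ?B) (?f (Suc i)) (d + 2) c1)"
  proof -
   have "envok (\<rho> @ [Suc d, d]) (e @ [i, ?f i]) (d + 2) c1" using eo by simp
   from Iter.IH(2)[OF cd(3) _ agree_rel[OF ag r] this] show ?thesis by (simp add: c1_def)
  qed
  have 2: "runs P c1 (tcost u ?M + (4 + (n * (tcost u ?M + 6) + 2))) ?Q"
  proof (rule runs_trans[OF 1, where ?T2.0 = "Suc (Suc (Suc (Suc (n * (tcost u ?M + 6) + 2))))"])
   fix c2 assume c2: "tpost (?b + 3 + length ?B) (?f (Suc i)) (d + 2) c1 c2"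
   have x: "reg c2 (rs 0) = 1"
    using agree_rel[of "d + 2" c1 c2 base s] agree_rel[OF ag r] Iter.prems(5) c2 by (auto simp: tpost_def rel_def)
   have y: "reg c2 (rs (Suc d)) = i" "agree d cf c2"
    using c2 Suc(4-6) ag by (auto simp: tpost_def agree_def c1_def)
   define c3 where "c3 = exec (Jump (?b + 1)) (exec (Add (rs (Suc d)) (rs (Suc d)) (rs 0)) (exec (Add (rs d) (rs d) (rs (d + 2))) (exec (Const (rs d) 0) c2)))"
   have "runs P c3 (n * (tcost u ?M + 6) + 2) ?Q"
   proof (rule Suc.IH[of "Suc i"])
    show "reg c3 (rs d) = ?f (Suc i)" "reg c3 (rs (Suc d)) = Suc i" "agree d cf c3"
     using y x c2 Iter.prems(5) by (auto simp: c3_def tpost_def agree_def)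
   qed (use Suc(2) in \<open>auto simp: c3_def\<close>)
   then show "runs P c2 (Suc (Suc (Suc (Suc (n * (tcost u ?M + 6) + 2))))) ?Q"
    unfolding c3_def using cd(4) c2 by (intro runs_step) (auto simp: codeat_Cons tpost_def)
  qed simp
  have "runs P c' (Suc (Suc (tcost u ?M + (4 + (n * (tcost u ?M + 6) + 2))))) ?Q"
  proof (rule runs_step[OF _ _ runs_step])
   show "runs P (exec (JumpZero (rs (d + 2)) (?b + length ?B + 7)) (exec (Sub (rs (d + 2)) (rg 0) (rs (Suc d))) c')) (tcost u ?M + (4 + (n * (tcost u ?M + 6) + 2))) ?Q"
   proof -
    have "exec (JumpZero (rs (d + 2)) (?b + length ?B + 7)) (exec (Sub (rs (d + 2)) (rg 0) (rs (Suc d))) c') = c1"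
     using Suc(2-5) g by (simp add: c1_def)
    then show ?thesis using 2 by simp
   qed
  qed (use cd(2) Suc(3) in \<open>auto simp: codeat_Cons\<close>)
  then show ?case by (rule runs_mono) auto
 qed
 show ?case
 proof (rule runs_trans[OF Iter.IH(1)[OF cd(1) Iter.prems(2-5)], where ?T2.0 = "Suc (?M * (tcost u ?M + 6) + 2)"])
  fix c1 assume c1: "tpost ?b (eval t s e) d cf c1"
  show "runs P c1 (Suc (?M * (tcost u ?M + 6) + 2)) ?Q"
   using cd(2) c1 by (intro runs_step[OF _ _ loop[of ?M 0]]) (auto simp: codeat_Cons tpost_def agree_def)
 qed simp
next
 case (LetT t u)
 let ?A = "ct t \<rho> d a" let ?b = "a + length ?A" let ?B = "ct u (\<rho> @ [d]) (Suc d) ?b"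
 let ?Q = "tpost (a + length (ct (LetT t u) \<rho> d a)) (eval (LetT t u) s e) d cf"
 have c: "codeat P a ?A" "codeat P ?b ?B" "codeat P (?b + length ?B) [Const (rs d) 0, Add (rs d) (rs d) (rs (Suc d))]"
  using LetT.prems(1) by (auto simp: Let_def add.assoc)
 have 1: "runs P cf (tcost t (gv s 0)) (tpost ?b (eval t s e) d cf)"
  using LetT.IH(1) c LetT.prems by blast
 show ?case
 proof (rule runs_trans[OF 1, where ?T2.0 = "tcost u (gv s 0) + 2"])
  fix cf1 assume cf1: "tpost ?b (eval t s e) d cf cf1"
  have eo: "envok (\<rho> @ [d]) (e @ [eval t s e]) (Suc d) cf1"
   using cf1 LetT.prems(4) by (intro envok_snoc) (auto simp: tpost_def intro: agree_envok)
  have 2: "runs P cf1 (tcost u (gv s 0)) (tpost (?b + length ?B) (eval (LetT t u) s e) (Suc d) cf1)"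
  proof -
   have "rel base s cf1" "pc cf1 = ?b" using cf1 LetT.prems by (auto simp: tpost_def intro: agree_rel)
   from LetT.IH(2)[OF c(2) this(2,1) eo] LetT.prems(5) show ?thesis by simp
  qed
  show "runs P cf1 (tcost u (gv s 0) + 2) ?Q"
  proof (rule runs_trans[OF 2, where ?T2.0 = "Suc (Suc 0)"])
   fix cf2 assume cf2: "tpost (?b + length ?B) (eval (LetT t u) s e) (Suc d) cf1 cf2"
   show "runs P cf2 (Suc (Suc 0)) ?Q"
    using c(3) cf1 cf2 by (intro runs_step runs_done) (auto simp: codeat_Cons tpost_def agree_def Let_def)
  qed simp
 qed simp
next
 case (Scope m t)
 have "runs P cf (tcost t (gv s 0)) (tpost (a + length (ct t (drop (length \<rho> - m) \<rho>) d a)) (eval t s (drop (length e - m) e)) d cf)"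
  using Scope.prems by (intro Scope.IH envok_drop) auto
 then show ?case by simp
qed

section \<open>Commands, their clock and their compilation\<close>

datatype com = Skip | Asg nat tm | Put nat tm tm | Seq com com | If tm com com | For nat tm com

definition tick :: "nat => st => st" where "tick n s = s\<lparr>clk := clk s + n\<rparr>"
definition setg :: "nat => nat => st => st" where "setg x v s = s\<lparr>gv := (gv s)(x := v)\<rparr>"
definition seta :: "nat => nat => nat => st => st" where
 "seta a i v s = s\<lparr>ar := (ar s)(a := (ar s a)(i := v))\<rparr>"

lemma st_simps [simp]:
 "gv (tick n s) = gv s" "ar (tick n s) = ar s" "inp (tick n s) = inp s" "clk (tick n s) = clk s + n"
 "gv (setg x v s) = (gv s)(x := v)" "ar (setg x v s) = ar s" "inp (setg x v s) = inp s" "clk (setg x v s) = clk s"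
 "gv (seta a i v s) = gv s" "ar (seta a i v s) = (ar s)(a := (ar s a)(i := v))" "inp (seta a i v s) = inp s" "clk (seta a i v s) = clk s"
 by (simp_all add: tick_def setg_def seta_def)

text \<open>The clock advances by an upper bound on the machine steps of the compiled code, so that
  running times can be proved at the level of commands.\<close>

primrec run :: "com => st => st" where
 "run Skip s = s"
| "run (Asg x t) s = tick (tcost t (gv s 0) + 2) (setg x (eval t s []) s)"
| "run (Put a t u) s = tick (tcost t (gv s 0) + tcost u (gv s 0) + 8) (seta (a mod 16) (eval t s []) (eval u s []) s)"
| "run (Seq c1 c2) s = run c2 (run c1 s)"
| "run (If t c1 c2) s = (if eval t s [] = 0 then run c2 (tick (tcost t (gv s 0) + 2) s) else run c1 (tick (tcost t (gv s 0) + 2) s))"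
| "run (For x t c) s = fold (%i s. run c (tick 6 (setg x i s))) [0..<eval t s []] (tick (tcost t (gv s 0) + 3) s)"

primrec cc :: "com => nat => nat => instr list" where
 "cc Skip d a = []"
| "cc (Asg x t) d a = ct t [] d a @ [Const (rg x) 0, Add (rg x) (rg x) (rs d)]"
| "cc (Put x t u) d a = (let A = ct t [] d a in A @ [Add (rs d) (rs d) (rs d), Add (rs d) (rs d) (rs d), Add (rs d) (rs d) (rs d),
   Add (rs d) (rs d) (rs d), Add (rs d) (rs d) (rs 1), Const (rs (Suc d)) (x mod 16), Add (rs d) (rs d) (rs (Suc d))]
   @ ct u [] (Suc d) (a + length A + 7) @ [Store (rs d) (rs (Suc d))])"
| "cc (Seq c1 c2) d a = (let A = cc c1 d a in A @ cc c2 d (a + length A))"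
| "cc (If t c1 c2) d a = (let A = ct t [] d a; b = a + length A + 1; B = cc c1 d b; b' = b + length B + 1; C = cc c2 d b' in
   A @ [JumpZero (rs d) b'] @ B @ [Jump (b' + length C)] @ C)"
| "cc (For x t c) d a = (let A = ct t [] d a; b = a + length A; B = cc c (d + 2) (b + 5) in
   A @ [Const (rs (Suc d)) 0, Sub (rs (d + 2)) (rs d) (rs (Suc d)), JumpZero (rs (d + 2)) (b + length B + 7),
     Const (rg x) 0, Add (rg x) (rg x) (rs (Suc d))] @ B @ [Add (rs (Suc d)) (rs (Suc d)) (rs 0), Jump (b + 1)])"

lemma rel_tick [simp]: "rel base (tick n s) cf = rel base s cf"
 by (simp add: rel_def)

lemma addr_eq_iff:
 fixes base i j x y :: nat
 assumes "x < 16" "y < 16"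
 shows "base + 16 * i + x = base + 16 * j + y <-> i = j & x = y"
 using assms by presburger

definition cpost :: "nat => nat => st => nat => config => config => bool" where
 "cpost a' base s d cf cf' <-> pc cf' = a' & rel base s cf' & (ALL i<d. reg cf' (rs i) = reg cf (rs i))"

lemma cpost_trans: "cpost a base s d cf cf1 ==> cpost a' base s' d' cf1 cf2 ==> d \<le> d' ==> cpost a' base s' d cf cf2"
 by (auto simp: cpost_def)

text \<open>Time is expressed as a difference of clock values because the cost of a command depends
  on the states it passes through. In particular \<open>clk\<close> never decreases, which the cases
  of sequences and loops exploit.\<close>

lemma cc_correct:
 assumes "codeat P a (cc c d a)" "pc cf = a" "rel base s cf" "2 \<le> d"
 shows "EX T. clk (run c s) = clk s + T & runs P cf T (cpost (a + length (cc c d a)) base (run c s) d cf)"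
 using assms
proof (induction c arbitrary: d a cf s)
 case Skip
 then show ?case by (auto intro!: runs_done simp: cpost_def)
next
 case (Asg x t)
 let ?A = "ct t [] d a" let ?b = "a + length ?A"
 have c: "codeat P a ?A" "codeat P ?b [Const (rg x) 0, Add (rg x) (rg x) (rs d)]"
  using Asg.prems(1) by auto
 have "runs P cf (tcost t (gv s 0) + 2) (cpost (a + length (cc (Asg x t) d a)) base (run (Asg x t) s) d cf)"
 proof (rule runs_trans[where ?T2.0 = "Suc (Suc 0)"])
  show "runs P cf (tcost t (gv s 0)) (tpost ?b (eval t s []) d cf)"
   using c Asg.prems by (intro ct_correct) (auto simp: envok_def)
 next
  fix cf1 assume "tpost ?b (eval t s []) d cf cf1"
  moreover from this have "rel base s cf1" using Asg.prems by (auto simp: tpost_def intro: agree_rel)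
  ultimately show "runs P cf1 (Suc (Suc 0)) (cpost (a + length (cc (Asg x t) d a)) base (run (Asg x t) s) d cf)"
   using c(2) by (intro runs_step runs_done) (auto simp: codeat_Cons tpost_def agree_def cpost_def rel_def)
 qed simp
 then show ?case by auto
next
 case (Put x t u)
 let ?A = "ct t [] d a" let ?b = "a + length ?A" let ?B = "ct u [] (Suc d) (?b + 7)"
 let ?Q = "cpost (a + length (cc (Put x t u) d a)) base (run (Put x t u) s) d cf"
 let ?adr = "base + 16 * eval t s [] + x mod 16"
 have c: "codeat P a ?A" "codeat P ?b (addr_code d (x mod 16))"
   "codeat P (?b + 7) ?B" "codeat P (?b + 7 + length ?B) [Store (rs d) (rs (Suc d))]"
 proof -
  have "cc (Put x t u) d a = ?A @ addr_code d (x mod 16) @ ?B @ [Store (rs d) (rs (Suc d))]" by (simp add: Let_def)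
  from Put.prems(1)[unfolded this codeat_append length_addr_code]
  show "codeat P a ?A" "codeat P ?b (addr_code d (x mod 16))" "codeat P (?b + 7) ?B"
   "codeat P (?b + 7 + length ?B) [Store (rs d) (rs (Suc d))]" by simp_all
 qed
 have "runs P cf (tcost t (gv s 0) + (7 + (tcost u (gv s 0) + 1))) ?Q"
 proof (rule runs_trans[where ?T2.0 = "tcost u (gv s 0) + 1 + 7"])
  show "runs P cf (tcost t (gv s 0)) (tpost ?b (eval t s []) d cf)"
   using c Put.prems by (intro ct_correct) (auto simp: envok_def)
 next
  fix cf1 assume cf1: "tpost ?b (eval t s []) d cf cf1"
  then have r: "rel base s cf1" using Put.prems by (auto simp: tpost_def intro: agree_rel)
  have d: "rs d ~= rs 1" "rs (Suc d) ~= rs 1" using Put.prems by auto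
  define cf2 where "cf2 = cf1\<lparr>pc := ?b + 7, reg := (reg cf1)(rs d := ?adr, rs (Suc d) := x mod 16)\<rparr>"
  have ag2: "agree d cf1 cf2" "reg cf2 (rs d) = ?adr" "pc cf2 = ?b + 7"
   by (auto simp: cf2_def agree_def)
  have r2: "rel base s cf2" using agree_rel[OF ag2(1) r Put.prems(4)] .
  have 2: "runs P cf2 (tcost u (gv s 0) + 1) ?Q"
  proof (rule runs_trans[where ?T2.0 = "Suc 0"])
   show "runs P cf2 (tcost u (gv s 0)) (tpost (?b + 7 + length ?B) (eval u s []) (Suc d) cf2)"
    using c Put.prems r2 ag2 by (intro ct_correct) (auto simp: envok_def)
  next
   fix cf3 assume cf3: "tpost (?b + 7 + length ?B) (eval u s []) (Suc d) cf2 cf3"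
   then have r3: "rel base s cf3" using r2 Put.prems by (auto simp: tpost_def intro: agree_rel)
   have x3: "reg cf3 (rs d) = ?adr" "reg cf3 (rs (Suc d)) = eval u s []" using cf3 ag2 by (auto simp: tpost_def agree_def)
   have r4: "rel base (run (Put x t u) s) (exec (Store (rs d) (rs (Suc d))) cf3)"
    using r3 x3 by (auto simp: rel_def addr_eq_iff)
   have "ALL i<d. reg cf3 (rs i) = reg cf (rs i)"
    using cf1 cf3 ag2 by (auto simp: tpost_def agree_def)
   then show "runs P cf3 (Suc 0) ?Q"
    using c(4) cf3 r4 by (intro runs_step[where i="Store (rs d) (rs (Suc d))"] runs_done)
     (auto simp: codeat_Cons tpost_def cpost_def Let_def)
  qed simp
  have "cf2 = cf1\<lparr>pc := ?b + 7, reg := (reg cf1)(rs d := reg cf1 (rs 1) + 16 * reg cf1 (rs d) + x mod 16, rs (Suc d) := x mod 16)\<rparr>"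
   using cf1 r by (simp add: cf2_def tpost_def rel_def)
  with 2 show "runs P cf1 (tcost u (gv s 0) + 1 + 7) ?Q"
   using cf1 by (intro runs_addr_code[OF c(2) _ Put.prems(4)]) (auto simp: tpost_def)
 qed simp
 then show ?case
  by (intro exI[of _ "tcost t (gv s 0) + tcost u (gv s 0) + 8"]) (auto elim: runs_mono)
next
 case (Seq c1 c2)
 let ?A = "cc c1 d a" let ?b = "a + length ?A"
 have c: "codeat P a ?A" "codeat P ?b (cc c2 d ?b)" using Seq.prems(1) by (auto simp: Let_def)
 obtain T1 where T1: "clk (run c1 s) = clk s + T1" "runs P cf T1 (cpost ?b base (run c1 s) d cf)"
  using Seq.IH(1)[OF c(1) Seq.prems(2-4)] by blast
 have T2: "EX T2. clk (run c2 (run c1 s)) = clk (run c1 s) + T2 &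
  runs P cf1 T2 (cpost (?b + length (cc c2 d ?b)) base (run c2 (run c1 s)) d cf1)" if "cpost ?b base (run c1 s) d cf cf1" for cf1
  using that c Seq.prems by (intro Seq.IH(2)) (auto simp: cpost_def)
 have le: "clk (run c1 s) \<le> clk (run c2 (run c1 s))"
 proof -
  obtain cf1 where "cpost ?b base (run c1 s) d cf cf1" using T1(2) unfolding runs_def by blast
  from T2[OF this] show ?thesis by linarith
 qed
 have "runs P cf (clk (run c2 (run c1 s)) - clk s) (cpost (a + length (cc (Seq c1 c2) d a)) base (run (Seq c1 c2) s) d cf)"
 proof (rule runs_trans[OF T1(2), where ?T2.0 = "clk (run c2 (run c1 s)) - clk (run c1 s)"])
  fix cf1 assume cf1: "cpost ?b base (run c1 s) d cf cf1"
  from T2[OF this] show "runs P cf1 (clk (run c2 (run c1 s)) - clk (run c1 s)) (cpost (a + length (cc (Seq c1 c2) d a)) base (run (Seq c1 c2) s) d cf)"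
   using cf1 by (auto simp: Let_def add.assoc elim!: runs_mono intro: cpost_trans)
 next
  show "T1 + (clk (run c2 (run c1 s)) - clk (run c1 s)) \<le> clk (run c2 (run c1 s)) - clk s"
   using T1(1) le by simp
 qed
 moreover have "clk s \<le> clk (run c2 (run c1 s))"
  using T1 le by simp
 ultimately show ?case by (intro exI[of _ "clk (run c2 (run c1 s)) - clk s"]) auto
next
 case (If t c1 c2)
 let ?A = "ct t [] d a" let ?b = "a + length ?A + 1" let ?B = "cc c1 d ?b" let ?b' = "?b + length ?B + 1" let ?C = "cc c2 d ?b'"
 let ?s = "tick (tcost t (gv s 0) + 2) s"
 let ?Q = "cpost (a + length (cc (If t c1 c2) d a)) base (run (If t c1 c2) s) d cf"
 have cd: "codeat P a ?A" "codeat P (a + length ?A) [JumpZero (rs d) ?b']" "codeat P ?b ?B" "codeat P (?b + length ?B) [Jump (?b' + length ?C)]"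
  "codeat P ?b' ?C"
  using If.prems(1) by (auto simp: Let_def codeat_Cons add.assoc)
 have end_: "a + length (cc (If t c1 c2) d a) = ?b' + length ?C" by (simp add: Let_def)
 have t: "runs P cf (tcost t (gv s 0)) (tpost (a + length ?A) (eval t s []) d cf)"
  using cd If.prems by (intro ct_correct) (auto simp: envok_def)
 show ?case
 proof (cases "eval t s [] = 0")
  case True
  have IH: "EX T. clk (run c2 ?s) = clk ?s + T & runs P cf1 T (cpost (?b' + length ?C) base (run c2 ?s) d cf1)"
   if "pc cf1 = ?b'" "rel base s cf1" for cf1
   using that cd If.prems by (intro If.IH(2)) auto
  obtain T where T: "clk (run c2 ?s) = clk ?s + T"
   using IH[of "cf\<lparr>pc := ?b'\<rparr>"] If.prems(3) by (auto simp: rel_def)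
  have "runs P cf (tcost t (gv s 0) + (1 + T)) ?Q"
  proof (rule runs_trans[OF t, where ?T2.0 = "Suc T"])
   fix cf1 assume cf1: "tpost (a + length ?A) (eval t s []) d cf cf1"
   have r: "rel base s cf1" "ALL i<d. reg cf1 (rs i) = reg cf (rs i)"
    using cf1 If.prems by (auto simp: tpost_def intro: agree_rel) (auto simp: agree_def)
   let ?cf = "exec (JumpZero (rs d) ?b') cf1"
   have e: "?cf = cf1\<lparr>pc := ?b'\<rparr>" using cf1 True by (simp add: tpost_def)
   have "runs P ?cf T (cpost (?b' + length ?C) base (run c2 ?s) d ?cf)"
    using IH[of ?cf] T r(1) unfolding e by (auto simp: rel_def)
   then have "runs P ?cf T ?Q"
    by (rule runs_mono) (use True end_ r(2) e in \<open>auto simp: cpost_def\<close>)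
   then show "runs P cf1 (Suc T) ?Q"
    using cd(2) cf1 by (intro runs_step) (auto simp: codeat_Cons tpost_def)
  qed simp
  then show ?thesis using T True
   by (intro exI[of _ "tcost t (gv s 0) + 2 + T"]) (auto elim: runs_mono)
 next
  case False
  have IH: "EX T. clk (run c1 ?s) = clk ?s + T & runs P cf1 T (cpost (?b + length ?B) base (run c1 ?s) d cf1)"
   if "pc cf1 = ?b" "rel base s cf1" for cf1
   using that cd If.prems by (intro If.IH(1)) auto
  obtain T where T: "clk (run c1 ?s) = clk ?s + T"
   using IH[of "cf\<lparr>pc := ?b\<rparr>"] If.prems(3) by (auto simp: rel_def)
  have "runs P cf (tcost t (gv s 0) + (2 + T)) ?Q"
  proof (rule runs_trans[OF t, where ?T2.0 = "Suc (T + 1)"])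
   fix cf1 assume cf1: "tpost (a + length ?A) (eval t s []) d cf cf1"
   have r: "rel base s cf1" "ALL i<d. reg cf1 (rs i) = reg cf (rs i)"
    using cf1 If.prems by (auto simp: tpost_def intro: agree_rel) (auto simp: agree_def)
   let ?cf = "exec (JumpZero (rs d) ?b') cf1"
   have e: "?cf = cf1\<lparr>pc := ?b\<rparr>" using cf1 False by (simp add: tpost_def)
   have 1: "runs P ?cf T (cpost (?b + length ?B) base (run c1 ?s) d ?cf)"
    using IH[of ?cf] T r(1) unfolding e by (auto simp: rel_def)
   have "runs P ?cf (T + 1) ?Q"
   proof (rule runs_trans[OF 1, where ?T2.0 = "Suc 0"])
    fix cf2 assume "cpost (?b + length ?B) base (run c1 ?s) d ?cf cf2"
    then show "runs P cf2 (Suc 0) ?Q"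
     using cd(4) False end_ r(2) e by (intro runs_step runs_done) (auto simp: codeat_Cons cpost_def rel_def)
   qed simp
   then show "runs P cf1 (Suc (T + 1)) ?Q"
    using cd(2) cf1 by (intro runs_step) (auto simp: codeat_Cons tpost_def)
  qed simp
  then show ?thesis using T False
   by (intro exI[of _ "tcost t (gv s 0) + 2 + T"]) (auto elim: runs_mono)
 qed
next
 case (For x t c)
 let ?A = "ct t [] d a" let ?b = "a + length ?A" let ?B = "cc c (d + 2) (?b + 5)" let ?n = "eval t s []"
 let ?f = "%i s. run c (tick 6 (setg x i s))"
 let ?s0 = "tick (tcost t (gv s 0) + 3) s"
 let ?S = "%i. fold ?f [0..<i] ?s0"
 let ?Q = "cpost (a + length (cc (For x t c) d a)) base (?S ?n) d cf"
 have cd: "codeat P a ?A" "codeat P ?b [Const (rs (Suc d)) 0, Sub (rs (d + 2)) (rs d) (rs (Suc d)), JumpZero (rs (d + 2)) (?b + length ?B + 7),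
     Const (rg x) 0, Add (rg x) (rg x) (rs (Suc d))]"
  "codeat P (?b + 5) ?B" "codeat P (?b + 5 + length ?B) [Add (rs (Suc d)) (rs (Suc d)) (rs 0), Jump (?b + 1)]"
  using For.prems(1) by (simp_all add: Let_def codeat_Cons numeral_eq_Suc)
 have end_: "a + length (cc (For x t c) d a) = ?b + length ?B + 7" by (simp add: Let_def)
 have t: "runs P cf (tcost t (gv s 0)) (tpost (a + length ?A) (eval t s []) d cf)"
  using cd For.prems by (intro ct_correct) (auto simp: envok_def)
 \<comment> \<open>\<open>?S i\<close> is the source state before round \<open>i\<close>. Besides
   the run, the claim records that the clock at the end is not earlier than at \<open>?S i\<close>,
   without which the truncated difference would be meaningless.\<close>
 have loop: "clk (?S i) \<le> clk (?S ?n) & runs P c' (clk (?S ?n) - clk (?S i) + 2) ?Q"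
  if "m + i = ?n" "pc c' = ?b + 1" "reg c' (rs d) = ?n" "reg c' (rs (Suc d)) = i" "rel base (?S i) c'"
   "ALL j<d. reg c' (rs j) = reg cf (rs j)" for m i c'
  using that
 proof (induction m arbitrary: i c')
  case 0
  have "runs P c' (Suc (Suc 0)) ?Q"
   using cd(2) 0 end_ For.prems(4) by (intro runs_step runs_done) (auto simp: codeat_Cons cpost_def rel_def)
  then show ?case using 0 by (auto simp: numeral_2_eq_2)
 next
  case (Suc m)
  have S: "?S (Suc i) = ?f i (?S i)" by simp
  define c1 where "c1 = c'\<lparr>pc := ?b + 5, reg := (reg c')(rs (d + 2) := ?n - i, rg x := i)\<rparr>"
  have r1: "rel base (tick 6 (setg x i (?S i))) c1" using Suc(6) For.prems(4) by (auto simp: rel_def c1_def)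
  obtain T where T: "clk (?S (Suc i)) = clk (?S i) + 6 + T"
   "runs P c1 T (cpost (?b + 5 + length ?B) base (?S (Suc i)) (d + 2) c1)"
   using For.IH[OF cd(3) _ r1] unfolding S by (auto simp: c1_def)
  define g where "g = (%c2. exec (Jump (?b + 1)) (exec (Add (rs (Suc d)) (rs (Suc d)) (rs 0)) c2))"
  have IH: "clk (?S (Suc i)) \<le> clk (?S ?n) & runs P (g c2) (clk (?S ?n) - clk (?S (Suc i)) + 2) ?Q"
   if "cpost (?b + 5 + length ?B) base (?S (Suc i)) (d + 2) c1 c2" for c2
  proof (rule Suc.IH)
   show "m + Suc i = ?n" using Suc(2) by simp
   show "rel base (?S (Suc i)) (g c2)" using that For.prems(4) by (auto simp: cpost_def g_def rel_def)
   show "ALL j<d. reg (g c2) (rs j) = reg cf (rs j)" "reg (g c2) (rs d) = ?n"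
    using that Suc(4,7) by (auto simp: cpost_def g_def c1_def)
   show "reg (g c2) (rs (Suc d)) = Suc i"
    using that Suc(5) by (auto simp: cpost_def g_def c1_def rel_def)
  qed (simp add: g_def)
  then have le: "clk (?S (Suc i)) \<le> clk (?S ?n)" using T(2) by (auto simp: runs_def)
  have 2: "runs P c1 (T + (2 + (clk (?S ?n) - clk (?S (Suc i)) + 2))) ?Q"
  proof (rule runs_trans[OF T(2), where ?T2.0 = "Suc (Suc (clk (?S ?n) - clk (?S (Suc i)) + 2))"])
   fix c2 assume c2: "cpost (?b + 5 + length ?B) base (?S (Suc i)) (d + 2) c1 c2"
   show "runs P c2 (Suc (Suc (clk (?S ?n) - clk (?S (Suc i)) + 2))) ?Q"
    by (rule runs_step[OF _ _ runs_step[OF _ _ IH[OF c2, THEN conjunct2, unfolded g_def]]])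
     (use cd(4) c2 in \<open>auto simp: codeat_Cons cpost_def\<close>)
  qed simp
  have ex: "exec (Add (rg x) (rg x) (rs (Suc d))) (exec (Const (rg x) 0) (exec (JumpZero (rs (d + 2)) (?b + length ?B + 7))
   (exec (Sub (rs (d + 2)) (rs d) (rs (Suc d))) c'))) = c1"
   using Suc(2-5) by (auto simp: c1_def fun_eq_iff intro!: config.equality)
  have "runs P c' (Suc (Suc (Suc (Suc (T + (2 + (clk (?S ?n) - clk (?S (Suc i)) + 2))))))) ?Q"
   by (rule runs_step[OF _ _ runs_step[OF _ _ runs_step[OF _ _ runs_step[OF _ _ 2[folded ex]]]]])
    (use cd(2) Suc(2-5) in \<open>auto simp: codeat_Cons\<close>)
  then have "runs P c' (clk (?S ?n) - clk (?S i) + 2) ?Q"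
   by (rule runs_mono) (use T(1) le in auto)
  then show ?case using le T(1) by linarith
 qed
 have start: "clk ?s0 \<le> clk (?S ?n) & runs P c1 (Suc (clk (?S ?n) - clk ?s0 + 2)) ?Q" if "tpost ?b ?n d cf c1" for c1
 proof -
  have r: "rel base s c1" using that For.prems by (auto simp: tpost_def intro: agree_rel)
  let ?c = "exec (Const (rs (Suc d)) 0) c1"
  have r': "rel base (?S 0) ?c" using r For.prems(4) by (auto simp: rel_def)
  have "clk (?S 0) \<le> clk (?S ?n) & runs P ?c (clk (?S ?n) - clk (?S 0) + 2) ?Q"
   by (rule loop[of ?n]) (use r' that in \<open>auto simp: tpost_def agree_def\<close>)
  moreover from this have "runs P c1 (Suc (clk (?S ?n) - clk (?S 0) + 2)) ?Q"
   using cd(2) that by (intro runs_step[where i="Const (rs (Suc d)) 0"]) (auto simp: codeat_Cons tpost_def)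
  ultimately show ?thesis by simp
 qed
 then have le: "clk ?s0 \<le> clk (?S ?n)" using t by (auto simp: runs_def)
 have "runs P cf (tcost t (gv s 0) + Suc (clk (?S ?n) - clk ?s0 + 2)) ?Q"
  using t by (rule runs_trans) (use start in auto)
 then show ?case
  using le by (intro exI[of _ "tcost t (gv s 0) + Suc (clk (?S ?n) - clk ?s0 + 2)"]) auto
qed

section \<open>Whole programs: preparation of the stack and delivery of the output\<close>

definition prologue :: "instr list" where
 "prologue = [Const (rs 0) 1, Const (rs 1) 0, Load (rs 1) (rs 1), Add (rs 1) (rs 1) (rs 0)]"

definition epilogue :: "nat => instr list" where
 "epilogue a = [Const (rs 2) 0, Add (rs 3) (rg 1) (rs 0), Sub (rs 3) (rs 3) (rs 2), JumpZero (rs 3) (a + 15), Const (rs 4) 0,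
   Add (rs 4) (rs 4) (rs 2), Add (rs 4) (rs 4) (rs 4), Add (rs 4) (rs 4) (rs 4), Add (rs 4) (rs 4) (rs 4), Add (rs 4) (rs 4) (rs 4),
   Add (rs 4) (rs 4) (rs 1), Load (rs 4) (rs 4), Store (rs 2) (rs 4), Add (rs 2) (rs 2) (rs 0), Jump (a + 1)]"

definition assemble :: "com => program" where
 "assemble c = (let B = cc c 2 4 in prologue @ B @ epilogue (4 + length B))"

definition start_state :: "nat list => st" where
 "start_state xs = \<lparr>inp = mem (initial xs), gv = (%_. 0), ar = (%_ _. 0), clk = 0\<rparr>"


text \<open>The output overwrites the input, and possibly parts of the arrays, in increasing order.
  The source of cell \<open>j\<close> is \<open>base + 16 * j\<close>, which is larger than
  \<open>j\<close>, so nothing is overwritten before it has been read.\<close>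

lemma epilogue_correct:
 assumes cd: "codeat P a (epilogue a)" and "0 < base"
  and "pc cf = a" "reg cf (rs 0) = 1" "reg cf (rs 1) = base" "reg cf (rg 1) = n"
  and "\<forall>j\<le>n. mem cf (base + 16 * j) = f j"
 shows "runs P cf (14 * (n + 1) + 4) (%c. pc c = a + 15 & (\<forall>j\<le>n. mem c j = f j))"
proof -
 let ?Q = "%c. pc c = a + 15 & (\<forall>j\<le>n. mem c j = f j)"
 have loop: "runs P c (14 * m + 3) ?Q"
  if "m + i = Suc n" "pc c = a + 1" "reg c (rs 0) = 1" "reg c (rs 1) = base" "reg c (rg 1) = n" "reg c (rs 2) = i"
   "ALL j<i. mem c j = f j" "ALL j. i \<le> j --> j \<le> n --> mem c (base + 16 * j) = f j" for m i c
  using that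
 proof (induction m arbitrary: i c)
  case 0
  have "runs P c (Suc (Suc (Suc 0))) ?Q"
   using cd 0 by (intro runs_step runs_done) (auto simp: epilogue_def codeat_Cons numeral_eq_Suc)
  then show ?case by (rule runs_mono) auto
 next
  case (Suc m)
  define c1 where "c1 = c\<lparr>pc := a + 1, reg := (reg c)(rs 3 := Suc n - i, rs 4 := f i, rs 2 := Suc i), mem := (mem c)(i := f i)\<rparr>"
  have "runs P c1 (14 * m + 3) ?Q"
  proof (rule Suc.IH[of "Suc i"])
   show "ALL j<Suc i. mem c1 j = f j" using Suc(8) by (auto simp: c1_def less_Suc_eq)
   show "ALL j. Suc i \<le> j --> j \<le> n --> mem c1 (base + 16 * j) = f j"
    using Suc(9) assms(2) by (auto simp: c1_def)
  qed (use Suc in \<open>auto simp: c1_def\<close>)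
  moreover
  let ?x = "exec (Add (rs 4) (rs 4) (rs 4)) (exec (Add (rs 4) (rs 4) (rs 4)) (exec (Add (rs 4) (rs 4) (rs 4)) (exec (Add (rs 4) (rs 4) (rs 4)) (exec (Add (rs 4) (rs 4) (rs 2)) (exec (Const (rs 4) 0)
   (exec (JumpZero (rs 3) (a + 15)) (exec (Sub (rs 3) (rs 3) (rs 2)) (exec (Add (rs 3) (rg 1) (rs 0)) c))))))))"
  let ?y = "exec (Jump (a + 1)) (exec (Add (rs 2) (rs 2) (rs 0)) (exec (Store (rs 2) (rs 4)) (exec (Load (rs 4) (rs 4)) (exec (Add (rs 4) (rs 4) (rs 1)) ?x))))"
  have x: "?x = c\<lparr>pc := a + 10, reg := (reg c)(rs 3 := Suc n - i, rs 4 := 16 * i)\<rparr>"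
  proof -
   have i16: "16 * i = i + i + (i + i) + (i + i + (i + i)) + (i + i + (i + i) + (i + i + (i + i)))" by simp
   have ten: "a + 10 = Suc (Suc (Suc (Suc (Suc (Suc (Suc (Suc (Suc (Suc a)))))))))" by simp
   show ?thesis unfolding i16 ten using Suc(2-7) by (simp add: fun_upd_twist)
  qed
  have m: "mem c (base + 16 * i) = f i" using Suc(2,9) by simp
  have y: "?y = c1"
   unfolding x using Suc(2-7) m by (simp add: c1_def fun_upd_twist add.commute)
  ultimately have r: "runs P ?y (14 * m + 3) ?Q" by simp
  have n: "Suc n - i ~= 0" using Suc(2) by simp
  have r5: "runs P ?x (Suc (Suc (Suc (Suc (Suc (14 * m + 3)))))) ?Q"
   by (rule runs_step[OF _ _ runs_step[OF _ _ runs_step[OF _ _ runs_step[OF _ _ runs_step[OF _ _ r]]]]])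
    (use cd n in \<open>unfold x, simp_all add: epilogue_def codeat_Cons numeral_eq_Suc\<close>)
  have "runs P c (Suc (Suc (Suc (Suc (Suc (Suc (Suc (Suc (Suc (Suc (Suc (Suc (Suc (Suc (14 * m + 3)))))))))))))))  ?Q"
   by (rule runs_step[OF _ _ runs_step[OF _ _ runs_step[OF _ _ runs_step[OF _ _ runs_step[OF _ _ runs_step[OF _ _ runs_step[OF _ _ runs_step[OF _ _ runs_step[OF _ _ r5]]]]]]]]])
    (use cd n Suc(2-7) in \<open>simp_all add: epilogue_def codeat_Cons numeral_eq_Suc\<close>)
  then show ?case by (rule runs_mono) auto
 qed
 have "runs P (exec (Const (rs 2) 0) cf) (14 * Suc n + 3) ?Q"
  by (rule loop[of _ 0]) (use assms in auto)
 then have "runs P cf (Suc (14 * Suc n + 3)) ?Q"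
  using cd assms(3) by (intro runs_step) (auto simp: epilogue_def codeat_Cons)
 then show ?thesis by (rule runs_mono) auto
qed

text \<open>Four steps for the prologue, fourteen for each of the \<open>length ys + 1\<close>
  copied cells and four more for entering and leaving the copying loop make up
  \<open>14 * length ys + 22\<close>.\<close>

theorem assemble_correct:
 assumes "gv (run c (start_state xs)) 1 = length ys"
  and "\<forall>i\<le>length ys. ar (run c (start_state xs)) 0 i = (length ys # ys) ! i"
 shows "computes_within (assemble c) xs (clk (run c (start_state xs)) + 14 * length ys + 22) ys"
proof -
 let ?P = "assemble c" let ?B = "cc c 2 4" let ?s = "start_state xs" let ?base = "length xs + 1" let ?a = "4 + length ?B"
 have cd: "codeat ?P 0 prologue" "codeat ?P 4 ?B" "codeat ?P ?a (epilogue ?a)" "length ?P = ?a + 15"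
 proof -
  have l: "length prologue = 4" "length (epilogue ?a) = 15" by (simp_all add: prologue_def epilogue_def)
  have "codeat ?P 0 ?P" by (simp add: codeat_def)
  then have "codeat ?P 0 (prologue @ ?B @ epilogue ?a)" by (simp add: assemble_def Let_def)
  from this[unfolded codeat_append l] show "codeat ?P 0 prologue" "codeat ?P 4 ?B" "codeat ?P ?a (epilogue ?a)" by simp_all
  show "length ?P = ?a + 15" by (simp add: assemble_def Let_def l)
 qed
 define c0 where "c0 = (initial xs)\<lparr>pc := 4, reg := (%_. 0)(rs 0 := 1, rs 1 := ?base)\<rparr>"
 have ex: "exec (Add (rs 1) (rs 1) (rs 0)) (exec (Load (rs 1) (rs 1)) (exec (Const (rs 1) 0) (exec (Const (rs 0) 1) (initial xs)))) = c0"
  by (simp add: c0_def initial_def fun_upd_twist numeral_eq_Suc)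
 have r0: "rel ?base ?s c0"
  by (auto simp: rel_def c0_def start_state_def initial_def)
 obtain T where T: "clk (run c ?s) = clk ?s + T" "runs ?P c0 T (cpost (4 + length ?B) ?base (run c ?s) 2 c0)"
  using cc_correct[OF cd(2) _ r0, of] by (auto simp: c0_def)
 let ?Q = "%cf. pc cf = ?a + 15 & (\<forall>j\<le>length ys. mem cf j = (length ys # ys) ! j)"
 have r: "runs ?P c0 (T + (14 * (length ys + 1) + 4)) ?Q"
  using T(2)
 proof (rule runs_trans)
  fix cf assume cf: "cpost (4 + length ?B) ?base (run c ?s) 2 c0 cf"
  have "mem cf (?base + 16 * j + 0) = ar (run c ?s) 0 j" for j
  proof -
   have "ALL a<16. ALL i. mem cf (?base + 16 * i + a) = ar (run c ?s) a i" using cf by (simp add: cpost_def rel_def)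
   then have "0 < (16::nat) --> (ALL i. mem cf (?base + 16 * i + 0) = ar (run c ?s) 0 i)" by blast
   then show ?thesis by simp
  qed
  then show "runs ?P cf (14 * (length ys + 1) + 4) ?Q"
   using cf assms by (intro epilogue_correct[OF cd(3)]) (auto simp: cpost_def rel_def)
 qed simp
 have "runs ?P (initial xs) (Suc (Suc (Suc (Suc (T + (14 * (length ys + 1) + 4)))))) ?Q"
  by (rule runs_step[OF _ _ runs_step[OF _ _ runs_step[OF _ _ runs_step[OF _ _ r[folded ex]]]]])
   (use cd(1) in \<open>simp_all add: prologue_def codeat_Cons initial_def\<close>)
 then obtain n where n: "n \<le> Suc (Suc (Suc (Suc (T + (14 * (length ys + 1) + 4)))))" "?Q ((step ?P ^^ n) (initial xs))"
  unfolding runs_def by blast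
 then have "n \<le> T + 14 * length ys + 22" by simp
 with n(2) show ?thesis
  using T(1) cd(4) unfolding computes_within_def
  by (intro exI[of _ n]) (auto simp: start_state_def halted_def holds_word_def Let_def)
qed

section \<open>Terms for logic, arithmetic and the decoder\<close>

definition "tNot t = Cond t (Num 0) (Num 1)"
definition "tAnd t u = Cond t (Cond u (Num 1) (Num 0)) (Num 0)"
definition "tOr t u = Cond t (Num 1) (Cond u (Num 1) (Num 0))"
definition "tImp t u = Cond t (Cond u (Num 1) (Num 0)) (Num 1)"
definition "tLt t u = Cond (Monus u t) (Num 1) (Num 0)"
definition "tLe t u = Cond (Monus t u) (Num 0) (Num 1)"
definition "tEq t u = Cond (Plus (Monus t u) (Monus u t)) (Num 0) (Num 1)"
definition "tEx t = Cond (Sum t) (Num 1) (Num 0)"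
definition "tAll t = Cond (Sum (Cond t (Num 0) (Num 1))) (Num 0) (Num 1)"
definition "call1 t x = LetT x (Scope 1 t)"
definition "call2 t x y = LetT x (LetT y (Scope 2 t))"

lemma eval_Cond [simp]: "eval (Cond c t u) s e = (if eval c s e ~= 0 then eval t s e else eval u s e)"
 by simp

declare eval.simps(9) [simp del]

lemma eval_bool [simp]:
 "eval (tNot t) s e = of_bool (eval t s e = 0)"
 "eval (tAnd t u) s e = of_bool (eval t s e ~= 0 & eval u s e ~= 0)"
 "eval (tOr t u) s e = of_bool (eval t s e ~= 0 \<or> eval u s e ~= 0)"
 "eval (tImp t u) s e = of_bool (eval t s e ~= 0 --> eval u s e ~= 0)"
 "eval (tLt t u) s e = of_bool (eval t s e < eval u s e)"
 "eval (tLe t u) s e = of_bool (eval t s e \<le> eval u s e)"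
 "eval (tEq t u) s e = of_bool (eval t s e = eval u s e)"
 "eval (tEx t) s e = of_bool (EX i<gv s 0. eval t s (e @ [i]) ~= 0)"
 "eval (tAll t) s e = of_bool (ALL i<gv s 0. eval t s (e @ [i]) ~= 0)"
 by (auto simp: tNot_def tAnd_def tOr_def tImp_def tLt_def tLe_def tEq_def tEx_def tAll_def)

lemma eval_call [simp]:
 "eval (call1 t x) s e = eval t s [eval x s e]"
 "eval (call2 t x y) s e = eval t s [eval x s e, eval y s (e @ [eval x s e])]"
 by (simp_all add: call1_def call2_def)

lemma sum_of_bool_card: "(\<Sum>i<n. of_bool (P i)) = card {i::nat. i < n & P i}"
proof -
 have "{i. i < n & P i} = {..<n} \<inter> {i. P i}" by auto
 then show ?thesis by (simp add: of_bool_def sum.If_cases)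
qed

definition "tshr = Iter (Var 0) (Cond (tLt (Var 2) (Var 1)) (Halve (Var 3)) (Var 3))"
definition "tshl = Iter (Var 0) (Cond (tLt (Var 2) (Var 1)) (Plus (Var 3) (Var 3)) (Var 3))"
definition "tmul = Sum (Cond (tLt (Var 2) (Var 0)) (Var 1) (Num 0))"
definition "tbt = LetT (call2 tshr (Var 0) (Var 1)) (Monus (Var 2) (Plus (Halve (Var 2)) (Halve (Var 2))))"

text \<open>Loops in terms always run to the bound in variable 0 and idle after the desired number
  of rounds. Hence the premise here and in the similar lemmas below.\<close>

lemma eval_tshr: "t \<le> gv s 0 ==> eval tshr s [x, t] = x div 2 ^ t"
proof -
 have "rec_nat x (%j y. if j < t then y div 2 else y) n = x div 2 ^ min t n" for n
  by (induction n) (auto simp: min_def div_mult2_eq[symmetric] mult.commute le_Suc_eq)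
 then show "t \<le> gv s 0 ==> eval tshr s [x, t] = x div 2 ^ t"
  by (simp add: tshr_def min_def cong: if_cong)
qed

lemma eval_tshl: "t \<le> gv s 0 ==> eval tshl s [x, t] = x * 2 ^ t"
proof -
 have "rec_nat x (%j y. if j < t then y + y else y) n = x * 2 ^ min t n" for n
  by (induction n) (auto simp: min_def le_Suc_eq)
 then show "t \<le> gv s 0 ==> eval tshl s [x, t] = x * 2 ^ t"
  by (simp add: tshl_def min_def cong: if_cong)
qed

lemma eval_tmul: "i \<le> gv s 0 ==> eval tmul s [i, x] = i * x"
proof -
 assume "i \<le> gv s 0"
 then have "{..<gv s 0} \<inter> {j. j < i} = {..<i}" by auto
 then show ?thesis by (simp add: tmul_def sum.If_cases)
qed

lemma eval_tbt: "t \<le> gv s 0 ==> eval tbt s [x, t] = of_bool (bt x t)"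
proof -
 have "y - (y div 2 + y div 2) = of_bool (odd y)" for y :: nat by (cases "odd y") (auto elim!: oddE evenE)
 then show "t \<le> gv s 0 ==> ?thesis" by (simp add: tbt_def eval_tshr bt_def)
qed

text \<open>Program variables: 0 loop bound of terms, 1 output length, 2 parameter \<open>k\<close>, 3 number of vertices,
 4 \<open>2 ^ k\<close>, 6 to 8 ell, tau, q, 9 number of classes, 12 labels are read off directly, 13 number of edges,
 14 position of a positive sample (0 if there is none), 15 number of samples, 16 read position,
 17 and 18 some sample is empty, nonempty, 19 contradiction found, 20 success, 21 certificate,
 26 first mask, 29 number of masks, 30 write position; all others are temporary.
 Arrays: 0 output, 1 powers of two naming the vertices, 2 closed neighbourhoods as sums of these,
 3 edge index plus one by sum of endpoint names, 4 class plus one by closed neighbourhood,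
 5 class representatives, 6 and 7 set and list of chosen masks, 8 and 9 endpoints of the edges.
 A mask is a set of edge indices, coded in binary.\<close>

definition "t2ell = Plus (Glob 6) (Glob 6)"
definition "tfld = LetT (call2 tshr (Glob 21) (Var 0)) (Monus (Var 2) (call2 tshl (call2 tshr (Var 2) (Var 1)) (Var 1)))"
definition "tadj = tNot (tNot (Arr 3 (Plus (Arr 1 (Arr 5 (Var 0))) (Arr 1 (Arr 5 (Var 1))))))"
definition "taC = tOr (tEq (Var 0) (Var 1)) tadj"
definition "tmsF = Cond (tLt (Var 0) t2ell) (call2 tfld (call2 tmul (Var 0) (Glob 8)) (Glob 8)) (Num 0)"
definition "tpF = call2 tfld (call2 tmul (Plus t2ell (Var 0)) (Glob 8)) (Glob 8)"
definition "tcF = Cond (tLt (Var 0) t2ell) (call2 tfld (call2 tmul (Plus (Plus t2ell t2ell) (Var 0)) (Glob 8)) (Glob 8)) (Num 0)"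
definition "ttt = Cond (tLt (Var 1) (Glob 6))
  (call2 tfld (Plus (call2 tmul (Plus (Plus t2ell t2ell) t2ell) (Glob 8)) (call2 tmul (Var 0) (Glob 2))) (Glob 2))
  (call2 tfld (Plus (call2 tmul (Plus (Plus t2ell t2ell) t2ell) (Glob 8)) (call2 tmul (Plus (Glob 7) (Var 0)) (Glob 2))) (Glob 2))"
definition "tsame = tEq (tLt (Var 0) (Glob 6)) (tLt (Var 1) (Glob 6))"
definition "txv = Sum (Cond (tAnd (tLe (Var 1) (Var 0)) (call2 tsame (Var 1) (Var 0))) (call1 tmsF (Var 1)) (Num 0))"
definition "tpos = tAnd (tLt (Var 0) t2ell) (call1 tpF (Var 0))"
definition "tal = tAnd (tAnd (tLt (Var 0) t2ell) (tLt (Var 1) t2ell))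
  (Cond (tLt (Var 0) (Glob 6)) (call2 taC (call1 txv (Var 0)) (call1 txv (Var 1)))
   (tEx (tAnd (tLt (Var 2) (Glob 2)) (tAnd (call2 tbt (call1 txv (Var 0)) (Var 2)) (call2 tbt (call1 txv (Var 1)) (Var 2))))))"
definition "tpat = tAll (tImp (tLt (Var 2) (Glob 7)) (tAnd
  (tEq (call2 tal (Var 0) (call2 ttt (Var 2) (Var 0))) (call2 tal (Var 1) (call2 ttt (Var 2) (Var 1))))
  (tEq (tEq (Var 0) (call2 ttt (Var 2) (Var 0))) (tEq (Var 1) (call2 ttt (Var 2) (Var 1))))))"
definition "tcnt = Sum (tAnd (call1 tpos (Var 2)) (tAnd (call2 tsame (Var 2) (Var 0)) (call2 tpat (Var 2) (Var 1))))"
definition "tcnta = Sum (tAnd (call1 tpos (Var 2)) (tAnd (call2 tsame (Var 2) (Var 0)) (tAnd (call2 tpat (Var 2) (Var 1)) (call2 tal (Var 0) (Var 2)))))"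
definition "tmaj = tLt (call2 tcnt (Var 0) (Var 1)) (Plus (call2 tcnta (Var 0) (Var 1)) (call2 tcnta (Var 0) (Var 1)))"
definition "tcol = tAnd (call2 tpat (Var 0) (Var 1)) (tAll (tImp (call1 tpos (Var 2)) (tEq (call2 tmaj (Var 0) (Var 2)) (call2 tmaj (Var 1) (Var 2)))))"
definition "tadev = tAnd (tAnd (call1 tpos (Var 0)) (call1 tpos (Var 1))) (tAnd (call2 tsame (Var 0) (Var 1))
  (tOr (tNot (tEq (call2 tal (Var 0) (Var 1)) (call2 tmaj (Var 0) (Var 1)))) (tNot (tEq (call2 tal (Var 1) (Var 0)) (call2 tmaj (Var 1) (Var 0))))))"
definition "tpar = Cond (call1 tcF (Var 0))
  (Sum (Cond (tAnd (call2 tadev (Var 0) (Var 1))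
   (tEq (Sum (tAnd (tLt (Var 2) (Var 1)) (call2 tadev (Var 0) (Var 2)))) (Cond (tLt (Var 0) t2ell) (Monus (call1 tpF (Var 0)) (Num 1)) (Num 0)))) (Var 1) (Num 0)))
  (Var 0)"
definition "tanc = Iter (Var 1) (Cond (tLt (Var 2) (Var 0)) (call1 tpar (Var 3)) (Var 3))"
definition "troot = call2 tanc (Glob 0) (Var 0)"
definition "tsim = tAll (tEq (call1 tcF (call2 tanc (Var 2) (Var 0))) (call1 tcF (call2 tanc (Var 2) (Var 1))))"
definition "tmember = tAnd (call1 tpos (Var 0)) (tEq (call1 troot (Var 0)) (Var 1))"
definition "tmat = tAnd
 (tAll (tImp (call2 tmember (Var 2) (Var 0)) (tEx (tAnd (call2 tmember (Var 3) (Var 1)) (tAnd (call2 tsim (Var 2) (Var 3)) (call2 tcol (Var 2) (Var 3)))))))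
 (tAnd (tAll (tImp (call2 tmember (Var 2) (Var 1)) (tEx (tAnd (call2 tmember (Var 3) (Var 0)) (call2 tsim (Var 3) (Var 2))))))
 (tAll (tAll (tAll (tAll (tImp (tAnd (tAnd (call2 tmember (Var 2) (Var 0)) (call2 tmember (Var 3) (Var 0)))
   (tAnd (tAnd (call2 tmember (Var 4) (Var 1)) (call2 tmember (Var 5) (Var 1))) (tAnd (call2 tsim (Var 2) (Var 4)) (call2 tsim (Var 3) (Var 5)))))
   (tEq (call2 tal (Var 2) (Var 3)) (call2 tal (Var 4) (Var 5)))))))))"
definition "trkG = Sum (tAnd (tAnd (tLt (Var 2) (Var 0)) (tLt (Var 2) (Glob 6))) (tAnd (tAnd (call1 tpos (Var 2)) (tNot (call1 tcF (Var 2)))) (call2 tmat (Var 2) (Var 1))))"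
definition "trkS = Sum (tAnd (tAnd (tLt (Var 2) (Var 1)) (tLe (Glob 6) (Var 2))) (tAnd (tAnd (call1 tpos (Var 2)) (tNot (call1 tcF (Var 2)))) (call2 tmat (Var 0) (Var 2))))"
definition "tphi = Sum (Cond (tAnd (tAnd (call1 tpos (Var 1)) (tLe (Glob 6) (Var 1))) (tAnd (call2 tsim (Var 0) (Var 1))
  (tAnd (call2 tmat (call1 troot (Var 0)) (call1 troot (Var 1)))
   (tEq (call2 trkG (call1 troot (Var 0)) (call1 troot (Var 1))) (call2 trkS (call1 troot (Var 0)) (call1 troot (Var 1)))))))
  (Var 1) (Num 0))"
definition "tlb = tEx (tAnd (tAnd (tLt (Var 2) (Glob 6)) (call1 tpos (Var 2)))
  (tAnd (tAll (tImp (tLt (Var 3) (Glob 9)) (tImp (call2 taC (call1 txv (Var 2)) (Var 3)) (call2 taC (Var 0) (Var 3)))))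
   (call2 tbt (call1 txv (call1 tphi (Var 2))) (Var 1))))"

text \<open>The bounds ensure that all shift counts, factors and positions of the decoder stay below
  variable 0; then every term computes the notion of the decoder that it imitates.\<close>

locale core_state =
 fixes s :: st and adj :: "nat => nat => bool"
 assumes adj: "!!i j. adj i j <-> ar s 3 (ar s 1 (ar s 5 i) + ar s 1 (ar s 5 j)) ~= 0"
  and bounds: "6 * gv s 6 \<le> gv s 0" "2 * gv s 7 \<le> gv s 0" "gv s 2 \<le> gv s 0" "gv s 8 \<le> gv s 0" "gv s 9 \<le> gv s 0"
  "6 * gv s 6 * gv s 8 + 2 * gv s 7 * gv s 2 \<le> gv s 0"
begin

abbreviation "M \<equiv> gv s 0"

interpretation core M "gv s 2" "gv s 6" "gv s 8" "gv s 7" "gv s 9" "gv s 21" adj .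
interpretation gi M "gv s 6" "gv s 7" vldF alF tgF tsF ppF cF .

lemma e_fld [simp]: "o' \<le> M ==> w \<le> M ==> eval tfld s [o', w] = fld o' w (gv s 21)"
 by (simp add: tfld_def eval_tshr eval_tshl fld_def minus_div_mult_eq_mod)

lemma e_2ell [simp]: "eval t2ell s e = 2 * gv s 6" by (simp add: t2ell_def)

lemma e_aC [simp]: "eval taC s [i, j] = of_bool (aC i j)"
 by (simp add: taC_def tadj_def aC_def adj)

lemma mult_bound: "i \<le> 6 * gv s 6 ==> i * gv s 8 \<le> M"
proof -
 assume "i \<le> 6 * gv s 6"
 then have "i * gv s 8 \<le> 6 * gv s 6 * gv s 8" by (rule mult_le_mono1)
 then show ?thesis using bounds(6) by linarith
qed

lemma e_sF [simp]: "eval tmsF s [i] = sF i"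
 using bounds mult_bound[of i] by (simp add: tmsF_def sF_def eval_tmul)

lemma e_pF [simp]: "i < 2 * gv s 6 ==> eval tpF s [i] = pF i"
 using bounds mult_bound[of "2 * gv s 6 + i"] by (simp add: tpF_def pF_def eval_tmul)

lemma e_cF [simp]: "eval tcF s [i] = cF i"
 using bounds mult_bound[of "4 * gv s 6 + i"] by (simp add: tcF_def cF_def eval_tmul)

lemma e_tt [simp]: "i < gv s 7 ==> eval ttt s [i, w] = tt i w"
proof -
 assume i: "i < gv s 7"
 have "(gv s 7 + i) * gv s 2 \<le> 2 * gv s 7 * gv s 2" "i * gv s 2 \<le> 2 * gv s 7 * gv s 2"
  using i by (intro mult_le_mono1; simp)+
 then have "6 * gv s 6 * gv s 8 + i * gv s 2 \<le> M" "6 * gv s 6 * gv s 8 + (gv s 7 + i) * gv s 2 \<le> M"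
  using bounds(6) by linarith+
 then show ?thesis using i bounds by (simp add: ttt_def tt_def tgF_def tsF_def eval_tmul)
qed

lemma e_same [simp]: "eval tsame s [w, z] = of_bool (same w z)"
 by (simp add: tsame_def same_def)

lemma e_xv [simp]: "eval txv s [w] = xv w"
proof -
 have "eval txv s [w] = (\<Sum>i<M. if i \<le> w & same i w then sF i else 0)"
  by (simp add: txv_def cong: if_cong)
 also have "\<dots> = (\<Sum>i | i < M & i \<le> w & same i w. sF i)"
  by (simp add: sum.If_cases Int_def)
 also have "\<dots> = xv w"
  unfolding xv_def same_def using bounds by (intro sum.mono_neutral_left) (auto simp: sF_def)
 finally show ?thesis .
qed

lemma e_pos [simp]: "eval tpos s [w] = of_bool (pos w)"
 by (simp add: tpos_def pos_def vldF_def cong: conj_cong)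

lemma pos_less: "pos w ==> w < M" using bounds by (simp add: pos_def)

lemma e_al [simp]: "eval tal s [w, z] = of_bool (alF w z)"
proof -
 have "(EX i<M. i < gv s 2 & P i) <-> (EX i<gv s 2. P i)" for P using bounds(3) by (meson less_le_trans)
 then show ?thesis using bounds(3) by (simp add: tal_def alF_def eval_tbt cong: conj_cong if_cong)
qed

lemma e_pat [simp]: "eval tpat s [w, z] = of_bool (pat w z)"
proof -
 have 1: "(ALL i<M. i < gv s 7 --> P i) <-> (ALL i<gv s 7. P i)" for P using bounds(2) by auto
 have "eval tpat s [w, z] = of_bool (ALL i<M. i < gv s 7 --> (alF w (tt i w) <-> alF z (tt i z)) & (w = tt i w <-> z = tt i z))"
  by (simp add: tpat_def of_bool_eq_iff split del: if_split split_of_bool split_of_bool_asm cong: imp_cong)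
 then show ?thesis unfolding 1 pat_def .
qed

lemma e_cnt [simp]: "eval tcnt s [w, z] = cnt w z" "eval tcnta s [w, z] = cnta w z"
proof -
 have 1: "{y. y < M & pos y & P y} = {y. pos y & P y}" for P using pos_less by blast
 have "eval tcnt s [w, z] = card {y. y < M & pos y & same y w & pat y z}"
  by (simp add: tcnt_def sum_of_bool_card)
 then show "eval tcnt s [w, z] = cnt w z" unfolding 1 cnt_def .
 have "eval tcnta s [w, z] = card {y. y < M & pos y & same y w & pat y z & alF w y}"
  by (simp add: tcnta_def sum_of_bool_card conj_ac)
 then show "eval tcnta s [w, z] = cnta w z" unfolding 1 cnta_def .
qed

lemma e_maj [simp]: "eval tmaj s [w, z] = of_bool (maj w z)"
 by (simp add: tmaj_def maj_def mult_2)

lemma e_col [simp]: "eval tcol s [w, z] = of_bool (col w z)"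
proof -
 have 1: "(ALL i<M. pos i --> maj w i = maj z i) <-> (ALL y. pos y --> maj w y = maj z y)" using pos_less by blast
 have "eval tcol s [w, z] = of_bool (pat w z & (ALL i<M. pos i --> maj w i = maj z i))" by (simp add: tcol_def of_bool_eq_iff split del: split_of_bool split_of_bool_asm) blast
 then show ?thesis unfolding 1 col_def .
qed

lemma e_adev [simp]: "eval tadev s [w, z] = of_bool (adev w z)"
 by (auto simp: tadev_def adev_def)

lemma e_par [simp]: "eval tpar s [w] = par w"
proof -
 have lt: "adev w u ==> u < M" for u using pos_less[of u] by (simp add: adev_def)
 have 1: "{v. v < M & v < u & adev w v} = {v. v < u & adev w v}" for u using lt by blast
 have pp: "(if w < 2 * gv s 6 then pF w - 1 else 0) = ppF w" by (simp add: ppF_def)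
 have "eval tpar s [w] = (if cF w = 0 then w else \<Sum>u<M. if adev w u & card {v. v < u & adev w v} = ppF w then u else 0)"
  using pp by (simp add: tpar_def sum_of_bool_card 1 cong: if_cong)
 also have "(\<Sum>u<M. if adev w u & card {v. v < u & adev w v} = ppF w then u else 0) = \<Sum>{u. adev w u & card {v. v < u & adev w v} = ppF w}"
 proof -
  have "{..<M} \<inter> {u. adev w u & card {v. v < u & adev w v} = ppF w} = {u. adev w u & card {v. v < u & adev w v} = ppF w}"
   using lt by blast
  then show ?thesis by (simp add: sum.If_cases)
 qed
 finally show ?thesis by (simp add: par_def)
qed

lemma e_anc [simp]: "i \<le> M ==> eval tanc s [i, w] = anc i w"
proof -
 have "rec_nat w (%j y. if j < i then par y else y) n = (par ^^ min i n) w" for n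
  by (induction n) (auto simp: min_def le_Suc_eq)
 then show "i \<le> M ==> ?thesis" by (simp add: tanc_def anc_def min_def cong: if_cong)
qed

lemma e_root [simp]: "eval troot s [w] = rootp w"
 by (simp add: troot_def rootp_def)

lemma e_sim [simp]: "eval tsim s [w, z] = of_bool (sim w z)"
 by (auto simp: tsim_def sim_def)

lemma e_member [simp]: "eval tmember s [w, x] = of_bool (pos w & rootp w = x)"
 by (simp add: tmember_def)

text \<open>Quantifiers of the decoder are relative to \<open>pos\<close>, so cutting them off at
  the loop bound changes nothing.\<close>

lemma bounded_pos: "(ALL w<M. pos w & Q w --> P w) <-> (ALL w. pos w & Q w --> P w)"
 "(EX w<M. (pos w & Q w) & P w) <-> (EX w. pos w & Q w & P w)"
 using pos_less by blast+

lemma e_mat [simp]: "eval tmat s [x, y] = of_bool (mat x y)"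
proof -
 have 4: "(ALL w<M. ALL w'<M. ALL z<M. ALL z'<M. ((pos w & rootp w = x) & (pos w' & rootp w' = x)) & ((pos z & rootp z = y) & (pos z' & rootp z' = y)) & sim w z & sim w' z' --> (alF w w' <-> alF z z'))
  <-> (ALL w w' z z'. pos w & pos w' & pos z & pos z' & rootp w = x & rootp w' = x & rootp z = y & rootp z' = y & sim w z & sim w' z' --> (alF w w' <-> alF z z'))"
  (is "?L = ?R")
 proof (rule iffI; intro allI impI)
  fix w w' z z'
  assume H: ?L and q: "pos w & pos w' & pos z & pos z' & rootp w = x & rootp w' = x & rootp z = y & rootp z' = y & sim w z & sim w' z'"
  from H[rule_format, of w w' z z'] q pos_less[of w] pos_less[of w'] pos_less[of z] pos_less[of z']
  show "alF w w' <-> alF z z'" by simp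
 next
  fix w w' z z' assume H: ?R
   and q: "((pos w & rootp w = x) & (pos w' & rootp w' = x)) & ((pos z & rootp z = y) & (pos z' & rootp z' = y)) & sim w z & sim w' z'"
  from q show "alF w w' <-> alF z z'" by (intro H[rule_format]) simp
 qed
 have "eval tmat s [x, y] = of_bool ((ALL w<M. pos w & rootp w = x --> (EX z<M. (pos z & rootp z = y) & sim w z & col w z)) &
   (ALL z<M. pos z & rootp z = y --> (EX w<M. (pos w & rootp w = x) & sim w z)) &
   (ALL w<M. ALL w'<M. ALL z<M. ALL z'<M. ((pos w & rootp w = x) & (pos w' & rootp w' = x)) & ((pos z & rootp z = y) & (pos z' & rootp z' = y)) & sim w z & sim w' z' --> (alF w w' <-> alF z z')))"
  by (simp add: tmat_def of_bool_eq_iff conj_assoc split del: split_of_bool split_of_bool_asm) (intro arg_cong2[where f="(&)"]; blast)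
 then show ?thesis unfolding bounded_pos 4 mat_def by simp
qed

lemma e_rk [simp]: "eval trkG s [x, y] = rkG x y" "eval trkS s [x, y] = rkS x y"
proof -
 have "{i. i < M & (i < x & i < gv s 6) & (pos i & cF i = 0) & mat i y} = {x'. x' < x & x' < gv s 6 & pos x' & cF x' = 0 & mat x' y}"
  using pos_less by blast
 then show "eval trkG s [x, y] = rkG x y" by (simp add: trkG_def rkG_def sum_of_bool_card)
 have "{i. i < M & (i < y & gv s 6 \<le> i) & (pos i & cF i = 0) & mat x i} = {y'. y' < y & ~ y' < gv s 6 & pos y' & cF y' = 0 & mat x y'}"
  unfolding not_less using pos_less by blast
 then show "eval trkS s [x, y] = rkS x y" by (simp add: trkS_def rkS_def sum_of_bool_card)
qed

lemma e_phi [simp]: "eval tphi s [w] = phi w"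
proof -
 let ?P = "%z. (pos z & gv s 6 \<le> z) & sim w z & mat (rootp w) (rootp z) & rkG (rootp w) (rootp z) = rkS (rootp w) (rootp z)"
 have "eval tphi s [w] = (\<Sum>z<M. if ?P z then z else 0)" by (simp add: tphi_def conj_ac cong: if_cong)
 also have "\<dots> = \<Sum>({..<M} \<inter> {z. ?P z})" by (simp add: sum.If_cases)
 also have "{..<M} \<inter> {z. ?P z} = {z. pos z & ~ z < gv s 6 & sim w z & mat (rootp w) (rootp z) & rkG (rootp w) (rootp z) = rkS (rootp w) (rootp z)}"
  unfolding not_less using pos_less by blast
 finally show ?thesis by (simp add: phi_def)
qed

lemma e_lb:
 assumes "x \<le> M"
 shows "eval tlb s [i, x] = of_bool (core.lb M (gv s 2) (gv s 6) (gv s 8) (gv s 7) (gv s 9) (gv s 21) adj i x)"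
proof -
 have "eval tlb s [i, x] = of_bool (EX w<M. (w < gv s 6 & pos w) & (ALL z<M. z < gv s 9 --> aC (xv w) z --> aC i z) & bt (xv (phi w)) x)"
  using assms by (simp add: tlb_def eval_tbt split del: split_of_bool split_of_bool_asm) (rule arg_cong[where f=of_bool], blast)
 also have "(EX w<M. (w < gv s 6 & pos w) & (ALL z<M. z < gv s 9 --> aC (xv w) z --> aC i z) & bt (xv (phi w)) x) <-> lb i x"
 proof -
  have 1: "(ALL z<M. z < gv s 9 --> Q z) <-> (ALL z<gv s 9. Q z)" for Q using bounds(5) by auto
  have 2: "w < M & (w < gv s 6 & pos w) & Q <-> w < gv s 6 & vldF w & Q" for w Q
   using pos_less[of w] bounds(1) by (auto simp: pos_def vldF_def)
  show ?thesis unfolding lb_def phiF_def 1 2 ..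
 qed
 finally show ?thesis .
qed

end

section \<open>Reading the input\<close>

primrec blk :: "com list => com" where
 "blk [] = Skip"
| "blk (c # cs) = Seq c (blk cs)"

text \<open>Counts commands only and leaves out the cost of evaluating terms;
  \<open>clk_le_steps\<close> puts the two together.\<close>

primrec steps :: "com => st => nat" where
 "steps Skip s = 0"
| "steps (Asg x t) s = 1"
| "steps (Put a t u) s = 1"
| "steps (Seq c1 c2) s = steps c1 s + steps c2 (run c1 s)"
| "steps (If t c1 c2) s = 1 + (if eval t s [] = 0 then steps c2 (tick (tcost t (gv s 0) + 2) s) else steps c1 (tick (tcost t (gv s 0) + 2) s))"
| "steps (For x t c) s = 1 + (\<Sum>i<eval t s []. 1 + steps c (tick 6 (setg x i
   (fold (%i s. run c (tick 6 (setg x i s))) [0..<i] (tick (tcost t (gv s 0) + 3) s)))))"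

primrec gvars :: "com => nat set" where
 "gvars Skip = {}"
| "gvars (Asg x t) = {x}"
| "gvars (Put a t u) = {}"
| "gvars (Seq c1 c2) = gvars c1 \<union> gvars c2"
| "gvars (If t c1 c2) = gvars c1 \<union> gvars c2"
| "gvars (For x t c) = insert x (gvars c)"

primrec avars :: "com => nat set" where
 "avars Skip = {}"
| "avars (Asg x t) = {}"
| "avars (Put a t u) = {a mod 16}"
| "avars (Seq c1 c2) = avars c1 \<union> avars c2"
| "avars (If t c1 c2) = avars c1 \<union> avars c2"
| "avars (For x t c) = avars c"

primrec ctms :: "com => tm set" where
 "ctms Skip = {}"
| "ctms (Asg x t) = {t}"
| "ctms (Put a t u) = {t, u}"
| "ctms (Seq c1 c2) = ctms c1 \<union> ctms c2"
| "ctms (If t c1 c2) = insert t (ctms c1 \<union> ctms c2)"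
| "ctms (For x t c) = insert t (ctms c)"

lemma finite_ctms: "finite (ctms c)"
 by (induction c) auto

definition frm :: "com => st => st => bool" where
 "frm c s s' <-> inp s' = inp s & (ALL x. x \<notin> gvars c --> gv s' x = gv s x) & (ALL a. a \<notin> avars c --> ar s' a = ar s a)"

lemma frm_inp: "frm c s s' ==> inp s' = inp s"
 and frm_gv: "frm c s s' ==> x \<notin> gvars c ==> gv s' x = gv s x"
 and frm_ar: "frm c s s' ==> a \<notin> avars c ==> ar s' a = ar s a"
 by (simp_all add: frm_def)

lemma frm_run: "frm c s (run c s)"
proof (induction c arbitrary: s)
 case (Seq c1 c2)
 from Seq(1)[of s] Seq(2)[of "run c1 s"] show ?case by (simp add: frm_def)
next
 case (If t c1 c2)
 from If(1)[of "tick (tcost t (gv s 0) + 2) s"] If(2)[of "tick (tcost t (gv s 0) + 2) s"] show ?case by (simp add: frm_def)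
next
 case (For x t c)
 have "frm (For x t c) s (fold (%i s. run c (tick 6 (setg x i s))) [0..<n] (tick (tcost t (gv s 0) + 3) s))" for n
 proof (induction n)
  case (Suc n)
  let ?r = "fold (%i s. run c (tick 6 (setg x i s))) [0..<n] (tick (tcost t (gv s 0) + 3) s)"
  from Suc For[of "tick 6 (setg x n ?r)"] show ?case by (simp add: frm_def)
 qed (simp add: frm_def)
 then show ?case by simp
qed (simp_all add: frm_def)

lemma run_inp [simp]: "inp (run c s) = inp s"
 using frm_run[of c s] by (simp add: frm_def)

lemma run_gv: "x \<notin> gvars c ==> gv (run c s) x = gv s x"
 and run_ar: "a \<notin> avars c ==> ar (run c s) a = ar s a"
 using frm_run[of c s] by (simp_all add: frm_def)

text \<open>A command evaluates at most two terms, whence the factor \<open>2 * W + 8\<close>.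
  Variable 0 must not be assigned: it bounds the loops inside terms, so only then is
  \<open>W\<close> valid throughout.\<close>

lemma clk_le_steps:
 assumes "0 \<notin> gvars c" "\<forall>t\<in>ctms c. tcost t (gv s 0) \<le> W"
 shows "clk (run c s) \<le> clk s + (2 * W + 8) * steps c s"
 using assms
proof (induction c arbitrary: s)
 case (Put a t u)
 then have "tcost t (gv s 0) \<le> W" "tcost u (gv s 0) \<le> W" by auto
 then show ?case by simp
next
 case (Seq c1 c2)
 have g: "gv (run c1 s) 0 = gv s 0" using Seq.prems(1) run_gv[of 0 c1 s] by simp
 have "clk (run c1 s) \<le> clk s + (2 * W + 8) * steps c1 s" using Seq by simp
 moreover have "clk (run c2 (run c1 s)) \<le> clk (run c1 s) + (2 * W + 8) * steps c2 (run c1 s)"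
  using Seq g by simp
 ultimately show ?case by (simp add: add_mult_distrib2)
next
 case (If t c1 c2)
 let ?s = "tick (tcost t (gv s 0) + 2) s"
 have "tcost t (gv s 0) \<le> W" using If.prems by simp
 moreover have "clk (run c1 ?s) \<le> clk ?s + (2 * W + 8) * steps c1 ?s" "clk (run c2 ?s) \<le> clk ?s + (2 * W + 8) * steps c2 ?s"
  using If.prems by (intro If.IH; simp)+
 ultimately show ?case by (simp add: add_mult_distrib2)
next
 case (For x t c)
 let ?s = "tick (tcost t (gv s 0) + 3) s"
 let ?S = "%n. fold (%i s. run c (tick 6 (setg x i s))) [0..<n] ?s"
 have tc: "tcost t (gv s 0) \<le> W" using For.prems by simp
 have "gv (?S n) 0 = gv s 0 & clk (?S n) \<le> clk ?s + (2 * W + 8) * (\<Sum>i<n. 1 + steps c (tick 6 (setg x i (?S i))))" for n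
 proof (induction n)
  case (Suc n)
  let ?u = "tick 6 (setg x n (?S n))"
  have 0: "gv ?u 0 = gv s 0" using Suc For.prems(1) by simp
  have 1: "gv (run c ?u) 0 = gv s 0" using 0 run_gv[of 0 c ?u] For.prems(1) by simp
  have "clk (run c ?u) \<le> clk ?u + (2 * W + 8) * steps c ?u"
   using For.prems 0 by (intro For.IH) simp_all
  then show ?case using Suc 1 by (simp add: add_mult_distrib2)
 qed simp
 from this[of "eval t s []"] tc show ?case by (simp add: add_mult_distrib2)
qed auto

text \<open>An invariant rule that yields functional correctness and the step bound together. The
  frame \<open>frm\<close> hands over everything that the loop cannot change, so invariants mention
  only what does change.\<close>

lemma For_rule:
 assumes "eval t s [] = N"
  and "!!s0. gv s0 = gv s ==> ar s0 = ar s ==> inp s0 = inp s ==> I 0 s0"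
  and "!!i s'. i < N ==> I i s' ==> frm (For x t c) s s' ==>
   I (Suc i) (run c (tick 6 (setg x i s'))) & steps c (tick 6 (setg x i s')) \<le> B i"
 shows "I N (run (For x t c) s) & steps (For x t c) s \<le> 1 + (\<Sum>i<N. 1 + B i)"
proof -
 let ?s = "tick (tcost t (gv s 0) + 3) s"
 let ?S = "%n. fold (%i s. run c (tick 6 (setg x i s))) [0..<n] ?s"
 have *: "n \<le> N ==> I n (?S n) & frm (For x t c) s (?S n) & (\<Sum>i<n. 1 + steps c (tick 6 (setg x i (?S i)))) \<le> (\<Sum>i<n. 1 + B i)" for n
 proof (induction n)
  case 0
  have "I 0 ?s" by (rule assms(2)) simp_all
  then show ?case by (simp add: frm_def)
 next
  case (Suc n)
  let ?u = "tick 6 (setg x n (?S n))"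
  have IH: "I n (?S n)" "frm (For x t c) s (?S n)" "(\<Sum>i<n. 1 + steps c (tick 6 (setg x i (?S i)))) \<le> (\<Sum>i<n. 1 + B i)"
   using Suc by simp_all
  have st: "I (Suc n) (run c ?u) & steps c ?u \<le> B n" using Suc.prems by (intro assms(3) IH) simp
  have "frm (For x t c) s (run c ?u)" using IH(2) frm_run[of c ?u] by (simp add: frm_def)
  then show ?case using st IH(3) by simp
 qed
 from *[of N] assms(1) show ?thesis by simp
qed

primrec flat :: "com => bool" where
 "flat Skip = True"
| "flat (Asg x t) = True"
| "flat (Put a t u) = True"
| "flat (Seq c1 c2) = (flat c1 & flat c2)"
| "flat (If t c1 c2) = (flat c1 & flat c2)"
| "flat (For x t c) = False"

primrec fsz :: "com => nat" where
 "fsz Skip = 0"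
| "fsz (Asg x t) = 1"
| "fsz (Put a t u) = 1"
| "fsz (Seq c1 c2) = fsz c1 + fsz c2"
| "fsz (If t c1 c2) = 1 + fsz c1 + fsz c2"
| "fsz (For x t c) = 0"

lemma steps_flat: "flat c ==> steps c s \<le> fsz c"
proof (induction c arbitrary: s)
 case (Seq c1 c2)
 from Seq(1)[of s] Seq(2)[of "run c1 s"] Seq(3) show ?case by simp
next
 case (If t c1 c2)
 from If(1)[of "tick (tcost t (gv s 0) + 2) s"] If(2)[of "tick (tcost t (gv s 0) + 2) s"] If(3) show ?case by simp
qed simp_all

declare One_nat_def [simp del]

lemma plus_1_eq_Suc [simp]: "(x::nat) + 1 = Suc x" by simp

notation Plus (infixl "+." 65)
notation Monus (infixl "-." 65)

text \<open>\<open>f\<close> is the initial memory. The address \<open>4 + n\<close> of the first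
  sample skips the word length in cell 0, the parameter, the number of vertices, the vertices
  themselves and the number of samples; \<open>ps i\<close> is the address of the sign of sample
  \<open>i\<close>, which is followed by its edge count and its edges.\<close>

locale input =
 fixes f :: "nat => nat" and k n T :: nat and vs :: "nat list" and es :: "nat => (nat \<times> nat) list"
  and lab :: "nat => bool" and ps :: "nat => nat"
 assumes fk: "f 1 = k" and fn: "f 2 = n" and lvs: "length vs = n" "distinct vs"
  and fv: "!!i. i < n ==> f (3 + i) = vs ! i" and fT: "f (3 + n) = T"
  and ps0: "ps 0 = 4 + n" and psS: "!!i. i < T ==> ps (Suc i) = ps i + 2 + 2 * length (es i)"
  and flab: "!!i. i < T ==> f (ps i) = of_bool (lab i)" and flen: "!!i. i < T ==> f (ps i + 1) = length (es i)"
  and fes: "!!i j. i < T ==> j < length (es i) ==> f (ps i + 2 + 2 * j) = fst (es i ! j) & f (ps i + 3 + 2 * j) = snd (es i ! j)"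
  and esv: "!!i u v. i < T ==> (u, v) \<in> set (es i) ==> u \<in> set vs & v \<in> set vs & u ~= v"
  and esd: "!!i. i < T ==> distinct (map (%(u, v). {u, v}) (es i))"
begin

definition E :: "nat => nat set set" where "E i = set (map (%(u, v). {u, v}) (es i))"

definition ix :: "nat => nat" where "ix v = (THE i. i < n & vs ! i = v)"

lemma ix_nth [simp]: "i < n ==> ix (vs ! i) = i"
 unfolding ix_def by (rule the_equality) (use lvs nth_eq_iff_index_eq in \<open>auto\<close>)

lemma ix_less [simp]: "v \<in> set vs ==> ix v < n"
 and nth_ix [simp]: "v \<in> set vs ==> vs ! ix v = v"
proof -
 assume "v \<in> set vs"
 then obtain i where "i < n" "v = vs ! i" using lvs(1) by (auto simp: in_set_conv_nth)
 then show "ix v < n" "vs ! ix v = v" by simp_all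
qed

lemma ix_inj: "u \<in> set vs ==> v \<in> set vs ==> ix u = ix v <-> u = v"
 by (metis nth_ix)

lemma ps_ge: "i \<le> T ==> 4 + n \<le> ps i"
proof (induction i)
 case (Suc i) then show ?case using psS[of i] by simp
qed (simp add: ps0)

definition key :: "nat \<times> nat => nat" where "key e = 2 ^ ix (fst e) + 2 ^ ix (snd e)"

text \<open>Uniqueness of binary representation. Distinct endpoints give two different bits, whereas
  \<open>u' = v'\<close> gives a single bit by carry, so a loop never shares its key with an
  edge.\<close>

lemma key_eq:
 assumes "u \<in> set vs" "v \<in> set vs" "u ~= v" "u' \<in> set vs" "v' \<in> set vs"
 shows "key (u, v) = key (u', v') <-> {u, v} = {u', v'}"
proof
 assume *: "key (u, v) = key (u', v')"
 have ne: "ix u ~= ix v" using assms ix_inj by simp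
 show "{u, v} = {u', v'}"
 proof (cases "u' = v'")
  case True
  then have "set_encode {ix u, ix v} = set_encode {Suc (ix u')}"
   using * ne by (simp add: key_def set_encode_def)
  then have "{ix u, ix v} = {Suc (ix u')}" by (subst (asm) set_encode_eq) simp_all
  then show ?thesis using ne by (auto simp: doubleton_eq_iff)
 next
  case False
  then have "ix u' ~= ix v'" using assms ix_inj by simp
  then have "set_encode {ix u, ix v} = set_encode {ix u', ix v'}"
   using * ne by (simp add: key_def set_encode_def)
  then have "{ix u, ix v} = {ix u', ix v'}" by (subst (asm) set_encode_eq) simp_all
  then show ?thesis using assms by (auto simp: doubleton_eq_iff ix_inj)
 qed
next
 assume "{u, v} = {u', v'}"
 then show "key (u, v) = key (u', v')" by (auto simp: doubleton_eq_iff key_def)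
qed

end

section \<open>Reading, comparing and reducing the samples\<close>

definition "pinc = Asg 16 (Glob 16 +. Num 2 +. Inp (Glob 16 +. Num 1) +. Inp (Glob 16 +. Num 1))"

definition "bScanB = blk [If (Inp (Glob 16)) (Asg 14 (Glob 16)) Skip,
  If (Inp (Glob 16 +. Num 1)) (Asg 18 (Num 1)) (Asg 17 (Num 1)), pinc]"
definition "bScan = blk [Asg 15 (Inp (Num 3 +. Glob 3)), Asg 16 (Num 4 +. Glob 3), For 22 (Glob 15) bScanB]"

definition "bPW = blk [Asg 23 (Num 1), For 22 (Glob 3) (blk
  [Put 1 (Inp (Num 3 +. Glob 22)) (Glob 23), Put 2 (Inp (Num 3 +. Glob 22)) (Glob 23), Asg 23 (Glob 23 +. Glob 23)])]"

definition "bLoadM = blk [Put 2 (Glob 23) (Arr 2 (Glob 23) +. Arr 1 (Glob 24)), Put 2 (Glob 24) (Arr 2 (Glob 24) +. Arr 1 (Glob 23))]"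
definition "bLoadB = blk [Asg 23 (Inp (Glob 14 +. Num 2 +. Glob 22 +. Glob 22)), Asg 24 (Inp (Glob 14 +. Num 3 +. Glob 22 +. Glob 22)),
  Put 8 (Glob 22) (Glob 23), Put 9 (Glob 22) (Glob 24), Put 3 (Arr 1 (Glob 23) +. Arr 1 (Glob 24)) (Glob 22 +. Num 1), bLoadM]"
definition "bLoad = blk [Asg 13 (Inp (Glob 14 +. Num 1)), For 22 (Glob 13) bLoadB]"

definition "bCompI = If (Arr 3 (Arr 1 (Inp (Glob 16 +. Num 2 +. Glob 23 +. Glob 23)) +. Arr 1 (Inp (Glob 16 +. Num 3 +. Glob 23 +. Glob 23)))) Skip (Asg 26 (Num 1))"
definition "bCompE = blk [If (Inp (Glob 16)) (If (Glob 26) (Asg 19 (Num 1)) Skip) (If (Glob 26) Skip (Asg 19 (Num 1))), pinc]"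
definition "bCompB = blk [Asg 25 (Inp (Glob 16 +. Num 1)), Asg 26 ((Glob 25 -. Glob 13) +. (Glob 13 -. Glob 25)), For 23 (Glob 25) bCompI, bCompE]"
definition "bComp = blk [Asg 16 (Num 4 +. Glob 3), For 22 (Glob 15) bCompB]"

definition "bRepB = blk [Asg 23 (Inp (Num 3 +. Glob 22)), Asg 24 (Arr 2 (Glob 23)),
  If (tEq (Glob 24) (Arr 1 (Glob 23))) Skip (If (Arr 4 (Glob 24)) Skip
   (blk [Put 5 (Glob 9) (Glob 23), Asg 9 (Glob 9 +. Num 1), Put 4 (Glob 24) (Glob 9)]))]"
definition "bRep = For 22 (Glob 3) bRepB"

context input
begin

lemma bScan:
 assumes "inp s = f" "gv s 3 = n" "gv s 14 = 0" "gv s 17 = 0" "gv s 18 = 0"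
 defines "s' \<equiv> run bScan s"
 shows "gv s' 15 = T" "(ALL i<T. ~ lab i) & gv s' 14 = 0 \<or> (EX i<T. lab i & gv s' 14 = ps i)"
  "gv s' 17 ~= 0 <-> (EX i<T. es i = [])" "gv s' 18 ~= 0 <-> (EX i<T. es i ~= [])" "steps bScan s \<le> 3 + 7 * T"
proof -
 let ?s = "run (Asg 16 (Num 4 +. Glob 3)) (run (Asg 15 (Inp (Num 3 +. Glob 3))) s)"
 let ?I = "%i s. gv s 16 = ps i & ((ALL i'<i. ~ lab i') & gv s 14 = 0 \<or> (EX i'<i. lab i' & gv s 14 = ps i')) &
  (gv s 17 ~= 0 <-> (EX i'<i. es i' = [])) & (gv s 18 ~= 0 <-> (EX i'<i. es i' ~= []))"
 have "?I T (run (For 22 (Glob 15) bScanB) ?s) & steps (For 22 (Glob 15) bScanB) ?s \<le> 1 + (\<Sum>i<T. 1 + 6)"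
 proof (rule For_rule, goal_cases)
  case 1 then show ?case using assms fT by simp
 next
  case (2 s0) then show ?case using assms ps0 by simp
 next
  case (3 i s')
  have [simp]: "inp s' = f" using frm_inp[OF 3(3)] assms by simp
  have st: "steps bScanB (tick 6 (setg 22 i s')) \<le> 6"
   by (rule order_trans[OF steps_flat]) (simp_all add: bScanB_def pinc_def)
  have e: "(length (es i) = 0) = (es i = [])" by simp
  have "?I (Suc i) (run bScanB (tick 6 (setg 22 i s')))"
   using 3(1,2) psS[OF 3(1)] flab[OF 3(1)] flen[OF 3(1)]
   by (cases "lab i"; cases "es i = []") (auto simp: bScanB_def pinc_def less_Suc_eq)
  then show ?case using st by blast
 qed
 then have *: "?I T s' & steps (For 22 (Glob 15) bScanB) ?s \<le> 1 + 7 * T" unfolding s'_def bScan_def by (simp del: run.simps(6))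
 have "gv s' 15 = T" unfolding s'_def bScan_def using assms fT
  by (simp add: run_gv bScanB_def pinc_def del: run.simps(6))
 with * show "gv s' 15 = T" "(ALL i<T. ~ lab i) & gv s' 14 = 0 \<or> (EX i<T. lab i & gv s' 14 = ps i)"
  "gv s' 17 ~= 0 <-> (EX i<T. es i = [])" "gv s' 18 ~= 0 <-> (EX i<T. es i ~= [])" "steps bScan s \<le> 3 + 7 * T"
  by (simp_all add: bScan_def del: run.simps(6) steps.simps(6))
qed

lemma bPW:
 assumes "inp s = f" "gv s 3 = n"
 shows "\<forall>v\<in>set vs. ar (run bPW s) 1 v = 2 ^ ix v & ar (run bPW s) 2 v = 2 ^ ix v" "steps bPW s \<le> 2 + 4 * n"
proof -
 let ?c = "blk [Put 1 (Inp (Num 3 +. Glob 22)) (Glob 23), Put 2 (Inp (Num 3 +. Glob 22)) (Glob 23), Asg 23 (Glob 23 +. Glob 23)]"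
 let ?s = "run (Asg 23 (Num 1)) s"
 let ?I = "%i s. gv s 23 = 2 ^ i & (ALL j<i. ar s 1 (vs ! j) = 2 ^ j & ar s 2 (vs ! j) = 2 ^ j)"
 have *: "?I n (run (For 22 (Glob 3) ?c) ?s) & steps (For 22 (Glob 3) ?c) ?s \<le> 1 + (\<Sum>i<n. 1 + 3)"
 proof (rule For_rule, goal_cases)
  case 1 then show ?case using assms by simp
 next
  case (2 s0) then show ?case by simp
 next
  case (3 i s')
  have [simp]: "inp s' = f" using frm_inp[OF 3(3)] assms by simp
  have st: "steps ?c (tick 6 (setg 22 i s')) \<le> 3" by (rule order_trans[OF steps_flat]) simp_all
  have ne: "j < i ==> vs ! j ~= vs ! i" for j using lvs 3(1) by (simp add: nth_eq_iff_index_eq)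
  have "?I (Suc i) (run ?c (tick 6 (setg 22 i s')))"
   using 3(1,2) fv[OF 3(1)] ne by (simp add: less_Suc_eq)
  then show ?case using st by blast
 qed
 then show "steps bPW s \<le> 2 + 4 * n" by (simp add: bPW_def del: run.simps(6) steps.simps(6))
 show "\<forall>v\<in>set vs. ar (run bPW s) 1 v = 2 ^ ix v & ar (run bPW s) 2 v = 2 ^ ix v"
 proof
  fix v assume "v \<in> set vs"
  then show "ar (run bPW s) 1 v = 2 ^ ix v & ar (run bPW s) 2 v = 2 ^ ix v"
   using conjunct2[OF conjunct1[OF *], rule_format, of "ix v"] by (simp add: bPW_def del: run.simps(6))
 qed
qed

lemma E_iff: "{v, w} \<in> E i <-> (v, w) \<in> set (es i) \<or> (w, v) \<in> set (es i)"
proof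
 assume "{v, w} \<in> E i"
 then obtain e where e: "e \<in> set (es i)" "{v, w} = (%(u, v). {u, v}) e" unfolding E_def set_map by (rule imageE)
 obtain a b where "e = (a, b)" by (cases e)
 with e show "(v, w) \<in> set (es i) \<or> (w, v) \<in> set (es i)" by (auto simp: doubleton_eq_iff)
next
 assume "(v, w) \<in> set (es i) \<or> (w, v) \<in> set (es i)"
 then show "{v, w} \<in> E i"
 proof
  assume "(v, w) \<in> set (es i)"
  then show ?thesis unfolding E_def set_map by (rule rev_image_eqI) simp
 next
  assume "(w, v) \<in> set (es i)"
  then show ?thesis unfolding E_def set_map by (rule rev_image_eqI) (simp add: insert_commute)
 qed
qed

definition Nc :: "nat => nat => nat set" where "Nc p v = insert v {w. {v, w} \<in> E p}"

text \<open>An edge adds a power of two to the mask of each endpoint. Addition acts as union of bit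
  sets here because no edge is listed twice, so the other endpoint is not yet present in the
  mask.\<close>

lemma bLoad:
 assumes "inp s = f" "p < T" "gv s 14 = ps p" "\<forall>v\<in>set vs. ar s 1 v = 2 ^ ix v & ar s 2 v = 2 ^ ix v" "ar s 3 = (%_. 0)"
 defines "s' \<equiv> run bLoad s"
 shows "gv s' 13 = length (es p)"
  "ALL j<length (es p). ar s' 8 j = fst (es p ! j) & ar s' 9 j = snd (es p ! j) & ar s' 3 (key (es p ! j)) = Suc j"
  "ALL c. c \<notin> key ` set (es p) --> ar s' 3 c = 0"
  "\<forall>v\<in>set vs. ar s' 2 v = set_encode (ix ` Nc p v)"
  "steps bLoad s \<le> 2 + 8 * length (es p)"
proof -
 define el where "el = es p"
 define nb where "nb j v = insert v {w. (v, w) \<in> set (take j el) \<or> (w, v) \<in> set (take j el)}" for j v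
 have elv: "u \<in> set vs & v \<in> set vs & u ~= v" if "(u, v) \<in> set (take j el)" for u v j
  using esv[OF assms(2), of u v] set_take_subset[of j el] that by (auto simp: el_def)
 have nbv: "v \<in> set vs ==> nb j v \<subseteq> set vs" for v j using elv by (auto simp: nb_def)
 let ?s = "run (Asg 13 (Inp (Glob 14 +. Num 1))) s"
 let ?I = "%i s. (ALL j<i. ar s 8 j = fst (el ! j) & ar s 9 j = snd (el ! j) & ar s 3 (key (el ! j)) = Suc j) &
   (ALL c. c \<notin> key ` set (take i el) --> ar s 3 c = 0) & (\<forall>v\<in>set vs. ar s 2 v = set_encode (ix ` nb i v))"
 have *: "?I (length el) (run (For 22 (Glob 13) bLoadB) ?s) & steps (For 22 (Glob 13) bLoadB) ?s \<le> 1 + (\<Sum>i<length el. 1 + 7)"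
 proof (rule For_rule, goal_cases)
  case 1 then show ?case using assms flen by (simp add: el_def)
 next
  case (2 s0) then show ?case using assms by (simp add: nb_def)
 next
  case (3 i s')
  have [simp]: "inp s' = f" using frm_inp[OF 3(3)] assms by simp
  have [simp]: "gv s' 14 = ps p" "ar s' 1 = ar s 1"
   using frm_gv[OF 3(3), of 14] frm_ar[OF 3(3), of 1] assms by (simp_all add: bLoadB_def bLoadM_def)
  have st: "steps bLoadB (tick 6 (setg 22 i s')) \<le> 7"
   by (rule order_trans[OF steps_flat]) (simp_all add: bLoadB_def bLoadM_def)
  obtain u v where uv: "el ! i = (u, v)" by (cases "el ! i")
  have fu: "f (ps p + 2 + i + i) = u" "f (ps p + 3 + i + i) = v"
  proof -
   have a: "ps p + 2 + i + i = ps p + 2 + 2 * i" "ps p + 3 + i + i = ps p + 3 + 2 * i" by simp_all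
   have "i < length (es p)" "es p ! i = (u, v)" using 3(1) uv unfolding el_def by simp_all
   then show "f (ps p + 2 + i + i) = u" "f (ps p + 3 + i + i) = v"
    unfolding a using fes[OF assms(2), of i] by simp_all
  qed
  have "(u, v) \<in> set (take (Suc i) el)" using 3(1) uv by (simp add: take_Suc_conv_app_nth)
  from elv[OF this] have uvv: "u \<in> set vs" "v \<in> set vs" "u ~= v" by simp_all
  have dist: "{fst (el ! j), snd (el ! j)} ~= {u, v}" if "j < i" for j
  proof -
   have "map (%(u, v). {u, v}) el ! j ~= map (%(u, v). {u, v}) el ! i"
    using esd[OF assms(2)] 3(1) that nth_eq_iff_index_eq[of "map (%(u, v). {u, v}) el" j i] by (simp add: el_def)
   then show ?thesis using 3(1) that uv by (simp add: case_prod_beta)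
  qed
  have new: "(u, v) \<notin> set (take i el)" "(v, u) \<notin> set (take i el)"
  proof -
   have "e \<in> set (take i el) ==> EX j<i. el ! j = e" for e by (auto simp: in_set_conv_nth)
   then show "(u, v) \<notin> set (take i el)" "(v, u) \<notin> set (take i el)"
    using dist by fastforce+
  qed
  have kne: "key (el ! j) ~= key (u, v)" if "j < i" for j
  proof -
   have "(fst (el ! j), snd (el ! j)) \<in> set (take i el)" using that 3(1) by (auto simp: in_set_conv_nth)
   from elv[OF this] show ?thesis
    using dist[OF that] uvv key_eq[of "fst (el ! j)" "snd (el ! j)" u v] by simp
  qed
  have kuv: "2 ^ ix u + 2 ^ ix v = key (u, v)" by (simp add: key_def)
  have tk: "take (Suc i) el = take i el @ [(u, v)]" using 3(1) uv by (simp add: take_Suc_conv_app_nth)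
  have nbS: "nb (Suc i) u = insert v (nb i u)" "nb (Suc i) v = insert u (nb i v)"
   "w ~= u ==> w ~= v ==> nb (Suc i) w = nb i w" for w
   using uvv by (auto simp: nb_def tk)
  have nin: "v \<notin> nb i u" "u \<notin> nb i v" using new uvv by (auto simp: nb_def)
  have enc: "set_encode (ix ` insert b (nb i a)) = set_encode (ix ` nb i a) + 2 ^ ix b"
   if "a \<in> set vs" "b \<in> set vs" "b \<notin> nb i a" for a b
  proof -
   have "ix b \<notin> ix ` nb i a" using nbv[OF that(1), of i] that ix_inj by blast
   moreover have "finite (ix ` nb i a)" using nbv[OF that(1), of i] finite_subset by blast
   ultimately show ?thesis by simp
  qed
  let ?r = "run bLoadB (tick 6 (setg 22 i s'))"
  have r: "ar ?r 8 = (ar s' 8)(i := u)" "ar ?r 9 = (ar s' 9)(i := v)" "ar ?r 3 = (ar s' 3)(key (u, v) := Suc i)"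
   "ar ?r 2 = (ar s' 2)(u := ar s' 2 u + 2 ^ ix v, v := ar s' 2 v + 2 ^ ix u)"
  proof -
   have pw: "ar s 1 u = 2 ^ ix u" "ar s 1 v = 2 ^ ix v" using assms(4) uvv by blast+
   note w = fu pw uvv(3) not_sym[OF uvv(3)]
   let ?c = "blk [Asg 23 (Inp (Glob 14 +. Num 2 +. Glob 22 +. Glob 22)), Asg 24 (Inp (Glob 14 +. Num 3 +. Glob 22 +. Glob 22)),
    Put 8 (Glob 22) (Glob 23), Put 9 (Glob 22) (Glob 24), Put 3 (Arr 1 (Glob 23) +. Arr 1 (Glob 24)) (Glob 22 +. Num 1)]"
   define t where "t = run ?c (tick 6 (setg 22 i s'))"
   have t: "gv t 23 = u" "gv t 24 = v" "ar t 1 = ar s 1" "ar t 2 = ar s' 2" "ar t 8 = (ar s' 8)(i := u)" "ar t 9 = (ar s' 9)(i := v)"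
    "ar t 3 = (ar s' 3)(key (u, v) := Suc i)"
    using w by (simp_all add: t_def key_def)
   have rt: "?r = run bLoadM t" by (simp add: t_def bLoadB_def)
   show "ar ?r 8 = (ar s' 8)(i := u)" "ar ?r 9 = (ar s' 9)(i := v)" "ar ?r 3 = (ar s' 3)(key (u, v) := Suc i)"
    using t by (simp_all add: rt run_ar bLoadM_def)
   show "ar ?r 2 = (ar s' 2)(u := ar s' 2 u + 2 ^ ix v, v := ar s' 2 v + 2 ^ ix u)"
    unfolding rt using t w by (simp add: bLoadM_def)
  qed
  have "(ALL j<Suc i. ar ?r 8 j = fst (el ! j) & ar ?r 9 j = snd (el ! j) & ar ?r 3 (key (el ! j)) = Suc j)"
   using 3(2) kne uv by (simp add: r less_Suc_eq)
  moreover have "ALL c. c \<notin> key ` set (take (Suc i) el) --> ar ?r 3 c = 0" using 3(2) by (simp add: r tk)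
  moreover have "\<forall>w\<in>set vs. ar ?r 2 w = set_encode (ix ` nb (Suc i) w)"
  proof
   fix w assume w: "w \<in> set vs"
   then have o: "ar s' 2 w = set_encode (ix ` nb i w)" using 3(2) by blast
   consider "w = u" | "w = v" | "w ~= u" "w ~= v" by blast
   then show "ar ?r 2 w = set_encode (ix ` nb (Suc i) w)"
   proof cases
    case 1 then show ?thesis using o uvv enc[of u v] nin by (simp add: r nbS del: image_insert)
   next
    case 2 then show ?thesis using o uvv enc[of v u] nin by (simp add: r nbS del: image_insert)
   next
    case 3 then show ?thesis using o by (simp add: r nbS)
   qed
  qed
  ultimately show ?case using st by blast
 qed
 have NN: "nb (length el) v = Nc p v" for v
  by (simp add: nb_def Nc_def E_iff el_def)
 have g: "gv s' 13 = length (es p)" unfolding s'_def bLoad_def using assms flen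
  by (simp add: run_gv bLoadB_def bLoadM_def del: run.simps(6))
 show "gv s' 13 = length (es p)" by (rule g)
 have s': "s' = run (For 22 (Glob 13) bLoadB) ?s" by (simp add: s'_def bLoad_def)
 from * show "ALL j<length (es p). ar s' 8 j = fst (es p ! j) & ar s' 9 j = snd (es p ! j) & ar s' 3 (key (es p ! j)) = Suc j"
  "ALL c. c \<notin> key ` set (es p) --> ar s' 3 c = 0"
  "\<forall>v\<in>set vs. ar s' 2 v = set_encode (ix ` Nc p v)"
  unfolding s' NN by (simp_all add: el_def)
 from * show "steps bLoad s \<le> 2 + 8 * length (es p)" by (simp add: bLoad_def el_def del: run.simps(6) steps.simps(6))
qed

lemma tab_iff:
 assumes "p < T" "ALL j<length (es p). tab (key (es p ! j)) = Suc j" "ALL c. c \<notin> key ` set (es p) --> tab c = 0"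
  "u \<in> set vs" "v \<in> set vs"
 shows "tab (2 ^ ix u + 2 ^ ix v) ~= 0 <-> {u, v} \<in> E p"
proof -
 have key: "2 ^ ix u + 2 ^ ix v = key (u, v)" by (simp add: key_def)
 have k: "key (a, b) = key (u, v) <-> {a, b} = {u, v}" if "(a, b) \<in> set (es p)" for a b
  using esv[OF assms(1) that] assms(4,5) by (intro key_eq) simp_all
 have "tab (key (u, v)) ~= 0 <-> key (u, v) \<in> key ` set (es p)"
 proof
  assume "key (u, v) \<in> key ` set (es p)"
  then obtain e where e: "e \<in> set (es p)" "key (u, v) = key e" by blast
  then obtain j where j: "j < length (es p)" "es p ! j = e" using in_set_conv_nth[of e "es p"] by blast
  have "tab (key (es p ! j)) = Suc j" using assms(2) j(1) by blast
  then show "tab (key (u, v)) ~= 0" unfolding e(2) j(2) by simp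
 next
  assume t: "tab (key (u, v)) ~= 0"
  show "key (u, v) \<in> key ` set (es p)"
  proof (rule ccontr)
   assume "key (u, v) \<notin> key ` set (es p)"
   from assms(3)[rule_format, OF this] t show False by simp
  qed
 qed
 also have "\<dots> <-> {u, v} \<in> E p"
 proof
  assume "key (u, v) \<in> key ` set (es p)"
  then obtain e where e: "e \<in> set (es p)" "key (u, v) = key e" by blast
  obtain a b where ab: "e = (a, b)" by (cases e)
  have m: "(a, b) \<in> set (es p)" using e ab by simp
  have "{a, b} = {u, v}" using k[OF m] e(2) ab by simp
  moreover have "{a, b} \<in> E p" using m by (simp add: E_iff)
  ultimately show "{u, v} \<in> E p" by simp
 next
  assume "{u, v} \<in> E p"
  then obtain a b where ab: "(a, b) \<in> set (es p)" "{a, b} = {u, v}" unfolding E_iff by auto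
  show "key (u, v) \<in> key ` set (es p)" unfolding k[OF ab(1), THEN iffD2, OF ab(2), symmetric] by (rule imageI[OF ab(1)])
 qed
 finally show ?thesis unfolding key .
qed

text \<open>The lists are free of repetitions, so equal length together with inclusion means
  equality. This makes the comparison of a sample linear in its own size.\<close>

lemma E_eq_iff: "p < T ==> i < T ==> E i = E p <-> length (es i) = length (es p) & (ALL j<length (es i). {fst (es i ! j), snd (es i ! j)} \<in> E p)"
proof -
 assume p: "p < T" "i < T"
 have c: "card (E p) = length (es p)" "card (E i) = length (es i)"
  using distinct_card[OF esd[OF p(1)]] distinct_card[OF esd[OF p(2)]] by (simp_all add: E_def)
 have fin: "finite (E p)" by (simp add: E_def)
 have sub: "(ALL j<length (es i). {fst (es i ! j), snd (es i ! j)} \<in> E p) <-> E i \<subseteq> E p"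
  unfolding E_def[of i] set_map image_subset_iff all_set_conv_all_nth by (simp add: case_prod_beta)
 show ?thesis unfolding sub using c card_subset_eq[OF fin, of "E i"] by auto
qed

lemma bComp:
 assumes "inp s = f" "p < T" "gv s 13 = length (es p)" "gv s 15 = T" "gv s 3 = n" "gv s 19 = 0" "\<forall>v\<in>set vs. ar s 1 v = 2 ^ ix v"
  "ALL j<length (es p). ar s 3 (key (es p ! j)) = Suc j" "ALL c. c \<notin> key ` set (es p) --> ar s 3 c = 0"
 shows "gv (run bComp s) 19 = 0 <-> (ALL i<T. lab i <-> E i = E p)"
  "steps bComp s \<le> 2 + (\<Sum>i<T. 12 + 4 * length (es i))"
proof -
 let ?s = "run (Asg 16 (Num 4 +. Glob 3)) s"
 let ?I = "%i s. gv s 16 = ps i & (gv s 19 = 0 <-> (ALL i'<i. lab i' <-> E i' = E p))"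
 have *: "?I T (run (For 22 (Glob 15) bCompB) ?s) & steps (For 22 (Glob 15) bCompB) ?s \<le> 1 + (\<Sum>i<T. 1 + (11 + 4 * length (es i)))"
 proof (rule For_rule, goal_cases)
  case 1 then show ?case using assms by simp
 next
  case (2 s0) then show ?case using assms ps0 by simp
 next
  case (3 i s')
  have [simp]: "inp s' = f" using frm_inp[OF 3(3)] assms by simp
  have [simp]: "gv s' 13 = length (es p)" "ar s' 1 = ar s 1" "ar s' 3 = ar s 3"
   using frm_gv[OF 3(3), of 13] frm_ar[OF 3(3), of 1] frm_ar[OF 3(3), of 3] assms
   by (simp_all add: bCompB_def bCompI_def bCompE_def pinc_def)
  have g16 [simp]: "gv s' 16 = ps i" using 3(2) by simp
  let ?c = "For 23 (Glob 25) bCompI"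
  \<comment> \<open>One of the two truncated differences is 0, so the sum is nonzero exactly if the
    edge counts differ.\<close>
  let ?d = "(length (es i) - length (es p)) + (length (es p) - length (es i))"
  define s1 where "s1 = run (Asg 26 ((Glob 25 -. Glob 13) +. (Glob 13 -. Glob 25))) (run (Asg 25 (Inp (Glob 16 +. Num 1))) (tick 6 (setg 22 i s')))"
  have s1: "inp s1 = f" "gv s1 16 = ps i" "gv s1 25 = length (es i)" "gv s1 26 = ?d" "gv s1 19 = gv s' 19" "ar s1 = ar s'"
   using flen[OF 3(1)] by (simp_all add: s1_def)
  have in_: "(gv (run ?c s1) 26 ~= 0 <-> ?d ~= 0 \<or> (EX j<length (es i). ar s 3 (key (es i ! j)) = 0)) & steps ?c s1 \<le> 1 + (\<Sum>j<length (es i). 1 + 2)"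
  proof (rule For_rule[where I="%i' s''. gv s'' 26 ~= 0 <-> ?d ~= 0 \<or> (EX j<i'. ar s 3 (key (es i ! j)) = 0)"], goal_cases)
   case 1 then show ?case using s1 by simp
  next
   case (2 s0) then show ?case using s1 by simp
  next
   case (3 j t)
   have [simp]: "inp t = f" "gv t 16 = ps i" "ar t 1 = ar s 1" "ar t 3 = ar s 3"
    using frm_inp[OF 3(3)] frm_gv[OF 3(3), of 16] frm_ar[OF 3(3), of 1] frm_ar[OF 3(3), of 3] s1 by (simp_all add: bCompI_def)
   have st: "steps bCompI (tick 6 (setg 23 j t)) \<le> 2"
    by (rule order_trans[OF steps_flat]) (simp_all add: bCompI_def)
   have m: "es i ! j \<in> set (es i)" using 3(1) by simp
   have v: "fst (es i ! j) \<in> set vs" "snd (es i ! j) \<in> set vs"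
    using esv[OF \<open>i < T\<close>, of "fst (es i ! j)" "snd (es i ! j)"] m by simp_all
   have ff: "f (ps i + 2 + j + j) = fst (es i ! j)" "f (ps i + 3 + j + j) = snd (es i ! j)"
   proof -
    have a: "ps i + 2 + j + j = ps i + 2 + 2 * j" "ps i + 3 + j + j = ps i + 3 + 2 * j" by simp_all
    show "f (ps i + 2 + j + j) = fst (es i ! j)" "f (ps i + 3 + j + j) = snd (es i ! j)"
     unfolding a using fes[OF \<open>i < T\<close>, of j] 3(1) by simp_all
   qed
   have "gv (run bCompI (tick 6 (setg 23 j t))) 26 = (if ar s 3 (key (es i ! j)) = 0 then 1 else gv t 26)"
   proof -
    have "ar s 1 (fst (es i ! j)) = 2 ^ ix (fst (es i ! j))" "ar s 1 (snd (es i ! j)) = 2 ^ ix (snd (es i ! j))"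
     using assms(7) v by blast+
    then show ?thesis using ff by (simp add: bCompI_def key_def)
   qed
   then show ?case using 3(2) st by (auto simp: less_Suc_eq)
  qed
  have E: "?d ~= 0 \<or> (EX j<length (es i). ar s 3 (key (es i ! j)) = 0) <-> E i ~= E p"
  proof -
   have "ar s 3 (key (es i ! j)) = 0 <-> {fst (es i ! j), snd (es i ! j)} \<notin> E p" if "j < length (es i)" for j
    using tab_iff[OF assms(2,8,9), of "fst (es i ! j)" "snd (es i ! j)"] that
     esv[OF 3(1), of "fst (es i ! j)" "snd (es i ! j)"] by (auto simp: key_def)
   then show ?thesis unfolding E_eq_iff[OF assms(2) 3(1)] by auto
  qed
  define s2 where "s2 = run ?c s1"
  have s2: "gv s2 26 ~= 0 <-> E i ~= E p" "gv s2 16 = ps i" "gv s2 19 = gv s' 19" "inp s2 = f"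
   using in_ E s1 by (simp_all add: s2_def run_gv bCompI_def del: run.simps(6))
  have rr: "run bCompB (tick 6 (setg 22 i s')) = run bCompE s2" by (simp add: bCompB_def s2_def s1_def del: run.simps(6))
  have A: "gv (run bCompE s2) 16 = ps (Suc i)" "gv (run bCompE s2) 19 = 0 <-> gv s' 19 = 0 & (lab i <-> E i = E p)"
   using s2 psS[OF 3(1)] flab[OF 3(1)] flen[OF 3(1)] by (auto simp: bCompE_def pinc_def)
  have B: "steps bCompE s2 \<le> 8"
   by (rule order_trans[OF steps_flat]) (simp_all add: bCompE_def pinc_def)
  have C: "steps bCompB (tick 6 (setg 22 i s')) = 2 + (steps ?c s1 + steps bCompE s2)"
   by (simp add: bCompB_def s2_def s1_def del: run.simps(6) steps.simps(6))
  have D: "steps ?c s1 \<le> 1 + 3 * length (es i)" using in_ by (simp del: run.simps(6) steps.simps(6))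
  show ?case unfolding rr All_less_Suc
  proof (intro conjI)
   show "gv (run bCompE s2) 16 = ps (Suc i)" by (rule A)
   show "gv (run bCompE s2) 19 = 0 <-> (lab i <-> E i = E p) & (ALL i'<i. lab i' <-> E i' = E p)"
    unfolding A(2) using 3(2) by blast
   show "steps bCompB (tick 6 (setg 22 i s')) \<le> 11 + 4 * length (es i)" unfolding C using B D by linarith
  qed
 qed
 have b: "run bComp s = run (For 22 (Glob 15) bCompB) ?s" "steps bComp s = 1 + steps (For 22 (Glob 15) bCompB) ?s"
  unfolding bComp_def blk.simps run.simps(1,4) steps.simps(1,2,4) by simp_all
 have c: "(\<Sum>i<T. 1 + (11 + 4 * length (es i))) = (\<Sum>i<T. 12 + 4 * length (es i))" by (rule sum.cong) simp_all
 show "gv (run bComp s) 19 = 0 <-> (ALL i<T. lab i <-> E i = E p)" unfolding b using * by blast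
 show "steps bComp s \<le> 2 + (\<Sum>i<T. 12 + 4 * length (es i))" unfolding b using * c by linarith
qed

text \<open>A vertex is isolated exactly if its neighbourhood mask is its own power of two, and such
  a vertex gets no class. Array 4 is addressed by the mask itself, so a lookup decides whether a
  twin has been met before.\<close>

lemma bRep:
 assumes "inp s = f" "gv s 3 = n" "gv s 9 = 0" "ar s 4 = (%_. 0)"
 defines "s' \<equiv> run bRep s"
 shows "ALL c<gv s' 9. ar s' 5 c \<in> set vs & ar s 2 (ar s' 5 c) ~= ar s 1 (ar s' 5 c) & ar s' 4 (ar s 2 (ar s' 5 c)) = Suc c"
  "\<forall>v\<in>set vs. ar s 2 v ~= ar s 1 v --> (EX c<gv s' 9. ar s' 4 (ar s 2 v) = Suc c & ar s 2 (ar s' 5 c) = ar s 2 v)"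
  "gv s' 9 \<le> n"
  "steps bRep s \<le> 1 + 9 * n"
proof -
 let ?I = "%i s'. gv s' 9 \<le> i & (ALL c<gv s' 9. ar s' 5 c \<in> set vs & ar s 2 (ar s' 5 c) ~= ar s 1 (ar s' 5 c) & ar s' 4 (ar s 2 (ar s' 5 c)) = Suc c) &
  (ALL x. ar s' 4 x ~= 0 --> (EX c<gv s' 9. ar s' 4 x = Suc c & ar s 2 (ar s' 5 c) = x)) &
  (ALL j<i. ar s 2 (vs ! j) ~= ar s 1 (vs ! j) --> ar s' 4 (ar s 2 (vs ! j)) ~= 0)"
 have *: "?I n (run (For 22 (Glob 3) bRepB) s) & steps (For 22 (Glob 3) bRepB) s \<le> 1 + (\<Sum>i<n. 1 + 8)"
 proof (rule For_rule, goal_cases)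
  case 1 then show ?case using assms by simp
 next
  case (2 s0) then show ?case using assms by simp
 next
  case (3 i t)
  have [simp]: "inp t = f" "ar t 1 = ar s 1" "ar t 2 = ar s 2"
   using frm_inp[OF 3(3)] frm_ar[OF 3(3), of 1] frm_ar[OF 3(3), of 2] assms by (simp_all add: bRepB_def)
  have st: "steps bRepB (tick 6 (setg 22 i t)) \<le> 8"
   by (rule order_trans[OF steps_flat]) (simp_all add: bRepB_def)
  let ?r = "run bRepB (tick 6 (setg 22 i t))" let ?v = "vs ! i"
  have v: "?v \<in> set vs" using 3(1) lvs by simp
  have "?I (Suc i) ?r"
  proof (cases "ar s 2 ?v = ar s 1 ?v \<or> ar t 4 (ar s 2 ?v) ~= 0")
   case True
   then have "gv ?r 9 = gv t 9" "ar ?r 4 = ar t 4" "ar ?r 5 = ar t 5"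
    using fv[OF 3(1)] by (auto simp: bRepB_def)
   then show ?thesis using 3(2) True by (auto simp: less_Suc_eq)
  next
   case False
   then have r: "gv ?r 9 = Suc (gv t 9)" "ar ?r 4 = (ar t 4)(ar s 2 ?v := Suc (gv t 9))" "ar ?r 5 = (ar t 5)(gv t 9 := ?v)"
    using fv[OF 3(1)] by (auto simp: bRepB_def)
   have o: "ar t 4 (ar s 2 ?v) = 0" using False by simp
   have ne: "c < gv t 9 ==> ar s 2 (ar t 5 c) ~= ar s 2 ?v" for c
    using 3(2) o by (metis nat.distinct(1))
   have "gv ?r 9 \<le> Suc i" using 3(2) r by simp
   moreover have "ALL c<gv ?r 9. ar ?r 5 c \<in> set vs & ar s 2 (ar ?r 5 c) ~= ar s 1 (ar ?r 5 c) & ar ?r 4 (ar s 2 (ar ?r 5 c)) = Suc c"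
    using 3(2) ne v False unfolding r by (auto simp: less_Suc_eq)
   moreover have "ALL x. ar ?r 4 x ~= 0 --> (EX c<gv ?r 9. ar ?r 4 x = Suc c & ar s 2 (ar ?r 5 c) = x)"
   proof (intro allI impI)
    fix x assume x: "ar ?r 4 x ~= 0"
    show "EX c<gv ?r 9. ar ?r 4 x = Suc c & ar s 2 (ar ?r 5 c) = x"
    proof (cases "x = ar s 2 ?v")
     case True then show ?thesis unfolding r by auto
    next
     case False
     then have "ar t 4 x ~= 0" using x unfolding r by simp
     then obtain c where "c < gv t 9" "ar t 4 x = Suc c" "ar s 2 (ar t 5 c) = x" using 3(2) by blast
     then show ?thesis using False unfolding r by (intro exI[of _ c]) auto
    qed
   qed
   moreover have "ALL j<Suc i. ar s 2 (vs ! j) ~= ar s 1 (vs ! j) --> ar ?r 4 (ar s 2 (vs ! j)) ~= 0"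
    using 3(2) unfolding r by (auto simp: less_Suc_eq)
   ultimately show ?thesis by blast
  qed
  then show ?case using st by blast
 qed
 have s': "s' = run (For 22 (Glob 3) bRepB) s" by (simp add: s'_def bRep_def)
 from * show "ALL c<gv s' 9. ar s' 5 c \<in> set vs & ar s 2 (ar s' 5 c) ~= ar s 1 (ar s' 5 c) & ar s' 4 (ar s 2 (ar s' 5 c)) = Suc c"
  "gv s' 9 \<le> n" unfolding s' by blast+
 from * show "steps bRep s \<le> 1 + 9 * n" by (simp add: bRep_def del: run.simps(6) steps.simps(6))
 show "\<forall>v\<in>set vs. ar s 2 v ~= ar s 1 v --> (EX c<gv s' 9. ar s' 4 (ar s 2 v) = Suc c & ar s 2 (ar s' 5 c) = ar s 2 v)"
 proof (intro ballI impI)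
  fix v assume v: "v \<in> set vs" "ar s 2 v ~= ar s 1 v"
  have "ALL j<n. ar s 2 (vs ! j) ~= ar s 1 (vs ! j) --> ar s' 4 (ar s 2 (vs ! j)) ~= 0" using * unfolding s' by blast
  then have "ar s' 4 (ar s 2 v) ~= 0" using v by (metis ix_less nth_ix)
  moreover have "ALL x. ar s' 4 x ~= 0 --> (EX c<gv s' 9. ar s' 4 x = Suc c & ar s 2 (ar s' 5 c) = x)" using * unfolding s' by blast
  ultimately show "EX c<gv s' 9. ar s' 4 (ar s 2 v) = Suc c & ar s 2 (ar s' 5 c) = ar s 2 v" by blast
 qed
qed

end

section \<open>Searching for labels\<close>

definition adjs :: "st => nat => nat => bool" where
 "adjs s i j <-> ar s 3 (ar s 1 (ar s 5 i) + ar s 1 (ar s 5 j)) ~= 0"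

text \<open>With \<open>md\<close> set the certificate is the labelling itself, as a table of
  \<open>k\<close> bits for each class; otherwise it is decoded as above.\<close>

definition lbof :: "bool => nat => nat => nat => nat => nat => nat => nat => (nat => nat => bool) => nat => nat => bool" where
 "lbof md M k ell q tau r b adj i x <-> (if md then bt b (k * i + x) else core.lb M k ell q tau r b adj i x)"

definition LBs :: "st => nat => nat => bool" where
 "LBs s = lbof (gv s 12 ~= 0) (gv s 0) (gv s 2) (gv s 6) (gv s 8) (gv s 7) (gv s 9) (gv s 21) (adjs s)"

text \<open>Variable 0 is large enough for both modes: the last inequality covers the bit addresses
  \<open>k * i + x\<close> of a table for up to \<open>2 ^ k\<close> classes, the others the field
  addresses of a certificate.\<close>

definition okst :: "st => bool" where
 "okst s <-> 6 * gv s 6 \<le> gv s 0 & 2 * gv s 7 \<le> gv s 0 & gv s 8 \<le> gv s 0 &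
  6 * gv s 6 * gv s 8 + 2 * gv s 7 * gv s 2 \<le> gv s 0 & gv s 9 \<le> 2 ^ gv s 2 & gv s 2 * 2 ^ gv s 2 + 2 ^ gv s 2 \<le> gv s 0"

definition "tLB = Cond (Glob 12) (call2 tbt (Glob 21) (call2 tmul (Glob 2) (Var 0) +. Var 1)) tlb"
definition "tchk = tAll (tAll (tImp (tAnd (tLt (Var 0) (Glob 9)) (tLt (Var 1) (Glob 9)))
  (tEq (call2 taC (Var 0) (Var 1)) (tEx (tAnd (tLt (Var 2) (Glob 2)) (tAnd (call2 tLB (Var 0) (Var 2)) (call2 tLB (Var 1) (Var 2))))))))"

definition chks :: "nat => nat => (nat => nat => bool) => (nat => nat => bool) => bool" where
 "chks r k adj L <-> (ALL i<r. ALL j<r. (i = j \<or> adj i j) <-> (EX x<k. L i x & L j x))"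

lemma LBs_cong:
 assumes "!!z. z \<in> {0, 2, 6, 7, 8, 9, 12, 21} ==> gv s' z = gv s z" "!!a. a \<in> {1, 3, 5} ==> ar s' a = ar s a"
 shows "LBs s' = LBs s" "adjs s' = adjs s" "okst s' = okst s"
 using assms by (simp_all add: LBs_def adjs_def[abs_def] okst_def)

lemma okst_less: "okst s ==> gv s 2 \<le> gv s 0" "okst s ==> gv s 9 \<le> gv s 0"
proof -
 assume o: "okst s"
 have "gv s 2 * 1 \<le> gv s 2 * 2 ^ gv s 2" by (intro mult_le_mono2) simp
 then show "gv s 2 \<le> gv s 0" "gv s 9 \<le> gv s 0" using o unfolding okst_def by linarith+
qed

lemma core_state_ok: "okst s ==> core_state s (adjs s)"
proof -
 assume o: "okst s"
 have "gv s 2 \<le> gv s 0" "gv s 9 \<le> gv s 0" using okst_less[OF o] by simp_all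
 then show ?thesis using o unfolding okst_def by unfold_locales (simp_all add: adjs_def)
qed

lemma eval_tLB: "okst s ==> i < gv s 9 ==> x < gv s 2 ==> eval tLB s [i, x] = of_bool (LBs s i x)"
proof -
 assume o: "okst s" and i: "i < gv s 9" and x: "x < gv s 2"
 have M: "gv s 2 \<le> gv s 0" using okst_less[OF o] by simp
 have "gv s 2 * i \<le> gv s 2 * 2 ^ gv s 2" using i o unfolding okst_def by (intro mult_le_mono2) simp
 moreover have "x \<le> 2 ^ gv s 2" using x less_exp[of "gv s 2"] by linarith
 ultimately have b: "gv s 2 * i + x \<le> gv s 0" using o unfolding okst_def by linarith
 have e: "eval tlb s [i, x] = of_bool (core.lb (gv s 0) (gv s 2) (gv s 6) (gv s 8) (gv s 7) (gv s 9) (gv s 21) (adjs s) i x)"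
  by (rule core_state.e_lb[OF core_state_ok[OF o]]) (use x M in simp)
 show ?thesis
 proof (cases "gv s 12 = 0")
  case True then show ?thesis using e by (simp add: tLB_def LBs_def lbof_def)
 next
  case False then show ?thesis using M b by (simp add: tLB_def LBs_def lbof_def eval_tmul eval_tbt)
 qed
qed

lemma eval_tchk: "okst s ==> eval tchk s [] ~= 0 <-> chks (gv s 9) (gv s 2) (adjs s) (LBs s)"
proof -
 assume o: "okst s"
 have M: "gv s 2 \<le> gv s 0" "gv s 9 \<le> gv s 0" using okst_less[OF o] by simp_all
 have ea: "eval taC s [i, j] = of_bool (i = j \<or> adjs s i j)" for i j
  by (simp add: taC_def tadj_def adjs_def)
 have ex: "(EX x<gv s 0. x < gv s 2 & eval tLB s [i, x] ~= 0 & eval tLB s [j, x] ~= 0) <-> (EX x<gv s 2. LBs s i x & LBs s j x)"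
  if "i < gv s 9" "j < gv s 9" for i j
 proof -
  have "x < gv s 0 & x < gv s 2 & eval tLB s [i, x] ~= 0 & eval tLB s [j, x] ~= 0 <-> x < gv s 2 & LBs s i x & LBs s j x" for x
   using M(1) eval_tLB[OF o that(1), of x] eval_tLB[OF o that(2), of x] by auto
  then show ?thesis by simp
 qed
 have "eval tchk s [] ~= 0 <-> (ALL i<gv s 0. ALL j<gv s 0. i < gv s 9 & j < gv s 9 -->
  ((i = j \<or> adjs s i j) <-> (EX x<gv s 0. x < gv s 2 & eval tLB s [i, x] ~= 0 & eval tLB s [j, x] ~= 0)))"
  by (simp add: tchk_def ea of_bool_eq_iff del: of_bool_or_iff split del: split_of_bool split_of_bool_asm) blast
 also have "\<dots> <-> chks (gv s 9) (gv s 2) (adjs s) (LBs s)"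
  unfolding chks_def
 proof (rule iffI; intro allI impI)
  fix i j assume H: "ALL i<gv s 0. ALL j<gv s 0. i < gv s 9 & j < gv s 9 -->
   ((i = j \<or> adjs s i j) <-> (EX x<gv s 0. x < gv s 2 & eval tLB s [i, x] ~= 0 & eval tLB s [j, x] ~= 0))" and ij: "i < gv s 9" "j < gv s 9"
  have "i < gv s 0" "j < gv s 0" using ij M by linarith+
  with H ij have "(i = j \<or> adjs s i j) <-> (EX x<gv s 0. x < gv s 2 & eval tLB s [i, x] ~= 0 & eval tLB s [j, x] ~= 0)" by blast
  then show "(i = j \<or> adjs s i j) <-> (EX x<gv s 2. LBs s i x & LBs s j x)" unfolding ex[OF ij] .
 next
  fix i j assume H: "ALL i<gv s 9. ALL j<gv s 9. (i = j \<or> adjs s i j) <-> (EX x<gv s 2. LBs s i x & LBs s j x)"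
   and ij: "i < gv s 9 & j < gv s 9"
  from H ij have "(i = j \<or> adjs s i j) <-> (EX x<gv s 2. LBs s i x & LBs s j x)" by blast
  then show "(i = j \<or> adjs s i j) <-> (EX x<gv s 0. x < gv s 2 & eval tLB s [i, x] ~= 0 & eval tLB s [j, x] ~= 0)"
   unfolding ex[OF conjunct1[OF ij] conjunct2[OF ij]] .
 qed
 finally show ?thesis .
qed

definition "bSearchB = If (Glob 20) Skip (blk [Asg 21 (Glob 10), If tchk (Asg 20 (Num 1)) Skip])"
definition "bSearchI = blk [Asg 12 (tLt (Glob 2) (Num (2 ^ 63))), Asg 27 (Cond (Glob 12) (call2 tmul (Glob 2) (Glob 9)) (Halve (Glob 4))),
 Asg 28 (Num 1), For 22 (Glob 27) (Asg 28 (Glob 28 +. Glob 28))]"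
definition "bSearch = blk [bSearchI, For 10 (Glob 28) bSearchB]"

lemma double_loop:
 assumes "gv s y = 1" "x ~= y" "gv s z = N"
 shows "gv (run (For x (Glob z) (Asg y (Glob y +. Glob y))) s) y = 2 ^ N" "steps (For x (Glob z) (Asg y (Glob y +. Glob y))) s \<le> 1 + 2 * N"
proof -
 have "gv (run (For x (Glob z) (Asg y (Glob y +. Glob y))) s) y = 2 ^ N & steps (For x (Glob z) (Asg y (Glob y +. Glob y))) s \<le> 1 + (\<Sum>i<N. 1 + 1)"
  by (rule For_rule[where I="%i s. gv s y = 2 ^ i"]) (use assms in \<open>simp_all del: One_nat_def\<close>)
 then show "gv (run (For x (Glob z) (Asg y (Glob y +. Glob y))) s) y = 2 ^ N" "steps (For x (Glob z) (Asg y (Glob y +. Glob y))) s \<le> 1 + 2 * N"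
  by (simp_all del: run.simps steps.simps)
qed

text \<open>After a success the remaining rounds only look at variable 20, so variable 21 keeps the
  certificate that was found.\<close>

lemma bSearch:
 assumes ok: "okst s" and "gv s 20 = 0" "gv s 2 = k" "gv s 9 = r" "gv s 4 = 2 ^ k"
 defines "s' \<equiv> run bSearch s" and "N \<equiv> (if k < 2 ^ 63 then k * r else 2 ^ k div 2)"
 shows "gv s' 20 = 0 ==> b < 2 ^ N ==> ~ chks r k (adjs s) (lbof (k < 2 ^ 63) (gv s 0) k (gv s 6) (gv s 8) (gv s 7) r b (adjs s))"
  "gv s' 20 ~= 0 ==> chks r k (adjs s) (LBs s')" "gv s' 12 = of_bool (k < 2 ^ 63)"
  "steps bSearch s \<le> 5 + 2 * N + 5 * 2 ^ N"
proof -
 define X :: nat where "X = 2 ^ 63"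
 define s1 where "s1 = run (blk [Asg 12 (tLt (Glob 2) (Num X)), Asg 27 (Cond (Glob 12) (call2 tmul (Glob 2) (Glob 9)) (Halve (Glob 4))), Asg 28 (Num 1)]) s"
 let ?d = "For 22 (Glob 27) (Asg 28 (Glob 28 +. Glob 28))"
 define s2 where "s2 = run ?d s1"
 have M: "k \<le> gv s 0" using okst_less(1)[OF ok] assms by simp
 have N: "N = (if k < X then k * r else 2 ^ k div 2)" by (simp add: N_def X_def)
 have s1: "gv s1 12 = of_bool (k < X)" "gv s1 27 = N" "gv s1 28 = 1"
  using assms(3-5) M by (auto simp: s1_def N eval_tmul)
 have s1': "steps (blk [Asg 12 (tLt (Glob 2) (Num X)), Asg 27 (Cond (Glob 12) (call2 tmul (Glob 2) (Glob 9)) (Halve (Glob 4))), Asg 28 (Num 1)]) s = 3"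
  by simp
 have d: "gv s2 28 = 2 ^ N" "steps ?d s1 \<le> 1 + 2 * N"
  unfolding s2_def by (rule double_loop; use s1 in simp)+
 have g2: "gv s2 z = gv s z" if "z \<notin> {12, 27, 28, 22}" for z
  using that unfolding s2_def s1_def by (simp add: run_gv del: run.simps)
 have g12: "gv s2 12 = of_bool (k < X)" using s1(1) unfolding s2_def by (simp add: run_gv del: run.simps)
 have a2: "ar s2 = ar s"
 proof
  fix a show "ar s2 a = ar s a" unfolding s2_def s1_def by (simp add: run_ar del: run.simps)
 qed
 define lbb where "lbb b = lbof (k < X) (gv s 0) k (gv s 6) (gv s 8) (gv s 7) r b (adjs s)" for b
 let ?F = "For 10 (Glob 28) bSearchB"
 let ?I = "%i t. if gv t 20 = 0 then ALL b<i. ~ chks r k (adjs s) (lbb b) else chks r k (adjs s) (lbb (gv t 21))"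
 have F: "?I (2 ^ N) (run ?F s2) & steps ?F s2 \<le> 1 + (\<Sum>i<(2::nat) ^ N. 1 + 4)"
 proof (rule For_rule, goal_cases)
  case 1 then show ?case using d by simp
 next
  case (2 s0) then show ?case using assms g2[of 20] by simp
 next
  case (3 i t)
  have gt: "gv t z = gv s z" if "z \<notin> {12, 27, 28, 22, 10, 20, 21}" for z
   using frm_gv[OF 3(3), of z] g2[of z] that by (simp add: bSearchB_def)
  have g12t: "gv t 12 = of_bool (k < X)" using frm_gv[OF 3(3), of 12] g12 by (simp add: bSearchB_def)
  have at: "ar t = ar s"
  proof
   fix a show "ar t a = ar s a" using frm_ar[OF 3(3), of a] a2 by (simp add: bSearchB_def)
  qed
  have st: "steps bSearchB (tick 6 (setg 10 i t)) \<le> 4"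
   by (rule order_trans[OF steps_flat]) (simp_all add: bSearchB_def)
  show ?case
  proof (cases "gv t 20 = 0")
   case False
   then have "gv (run bSearchB (tick 6 (setg 10 i t))) 20 ~= 0" "gv (run bSearchB (tick 6 (setg 10 i t))) 21 = gv t 21"
    by (simp_all add: bSearchB_def)
   then show ?thesis using 3(2) False st by simp
  next
   case True
   define u where "u = run (Asg 21 (Glob 10)) (tick (tcost (Glob 20) (gv t 0) + 2) (tick 6 (setg 10 i t)))"
   have gu: "gv u z = gv s z" if "z \<notin> {12, 27, 28, 22, 10, 20, 21}" for z using gt[of z] that by (simp add: u_def)
   have u: "gv u 21 = i" "gv u 20 = 0" "gv u 12 = of_bool (k < X)" "ar u = ar s" using True g12t at by (simp_all add: u_def)
   have ad: "adjs u = adjs s" "okst u" using u(4) gu ok by (simp_all add: adjs_def[abs_def] okst_def)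
   have lb: "LBs u = lbb i" using u gu assms(3,4) by (simp add: LBs_def lbb_def ad)
   have ck: "eval tchk u [] ~= 0 <-> chks r k (adjs s) (lbb i)"
    using eval_tchk[OF ad(2)] gu assms(3,4) ad lb by simp
   have r: "run bSearchB (tick 6 (setg 10 i t)) = run (If tchk (Asg 20 (Num 1)) Skip) u"
    using True by (simp add: bSearchB_def u_def del: tcost.simps)
   have r2: "gv (run bSearchB (tick 6 (setg 10 i t))) 20 = of_bool (chks r k (adjs s) (lbb i))"
    "gv (run bSearchB (tick 6 (setg 10 i t))) 21 = i"
    unfolding r using u ck by auto
   show ?thesis
   proof (cases "chks r k (adjs s) (lbb i)")
    case c: True
    then show ?thesis using r2 st by simp
   next
    case c: False
    have "ALL b<i. ~ chks r k (adjs s) (lbb b)" using 3(2) True by simp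
    then show ?thesis using r2 st c by (simp add: All_less_Suc)
   qed
  qed
 qed
 have rs: "s' = run ?F s2"
  by (simp add: s'_def bSearch_def bSearchI_def s2_def s1_def X_def del: run.simps(6))
 have ss: "steps bSearch s = 3 + steps ?d s1 + steps ?F s2"
  using s1' by (simp add: bSearch_def bSearchI_def s2_def s1_def X_def del: run.simps(6) steps.simps(6))
 show "steps bSearch s \<le> 5 + 2 * N + 5 * 2 ^ N" unfolding ss using F d(2) by (simp del: run.simps steps.simps)
 have g12': "gv s' 12 = of_bool (k < X)" unfolding rs using g12 by (simp add: run_gv bSearchB_def del: run.simps)
 then show "gv s' 12 = of_bool (k < 2 ^ 63)" unfolding X_def .
 { assume "gv s' 20 = 0" "b < 2 ^ N"
  then have "~ chks r k (adjs s) (lbb b)" using F unfolding rs by (simp del: run.simps)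
  then show "~ chks r k (adjs s) (lbof (k < 2 ^ 63) (gv s 0) k (gv s 6) (gv s 8) (gv s 7) r b (adjs s))"
   unfolding lbb_def X_def . }
 { assume "gv s' 20 ~= 0"
  then have c: "chks r k (adjs s) (lbb (gv s' 21))" using F unfolding rs by (simp del: run.simps)
  have "gv s' z = gv s z" if "z \<notin> {12, 27, 28, 22, 10, 20, 21}" for z
   unfolding rs using g2[of z] that by (simp add: run_gv bSearchB_def del: run.simps)
  moreover have "adjs s' = adjs s"
   unfolding rs adjs_def[abs_def] using a2 by (simp add: run_ar bSearchB_def del: run.simps)
  ultimately have "LBs s' = lbb (gv s' 21)" using g12' assms(3,4) by (simp add: LBs_def lbb_def)
  with c show "chks r k (adjs s) (LBs s')" by simp }
qed

text \<open>The bit length of \<open>k\<close>, in a form that a bounded sum of comparisons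
  computes.\<close>

definition hh :: "nat => nat" where "hh k = card {i. 2 ^ i \<le> k}"

lemma hh_set: "{i. (2::nat) ^ i \<le> k} = {..<hh k}"
proof (cases "k = 0")
 case True then show ?thesis by (simp add: hh_def)
next
 case False
 define m where "m = (LEAST m. k < 2 ^ m)"
 have m: "k < 2 ^ m" unfolding m_def by (rule LeastI[of _ k]) (rule less_exp)
 have "(2::nat) ^ i \<le> k <-> i < m" for i
 proof
  assume "2 ^ i \<le> k"
  then have "2 ^ i < (2::nat) ^ m" using m by linarith
  then show "i < m" by simp
 next
  assume "i < m"
  then show "2 ^ i \<le> k" unfolding m_def using not_less_Least by (metis not_less)
 qed
 then have "{i. (2::nat) ^ i \<le> k} = {..<m}" by auto
 then show ?thesis by (simp add: hh_def)
qed

lemma hh_bounds: "k < 2 ^ hh k" "0 < k ==> 2 ^ (hh k - 1) \<le> k" "hh k \<le> k" "0 < k ==> 0 < hh k"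
proof -
 have iff: "2 ^ i \<le> k <-> i < hh k" for i using hh_set[of k] by blast
 show "k < 2 ^ hh k" using iff[of "hh k"] by simp
 show p: "0 < k ==> 0 < hh k" using iff[of 0] by simp
 then show "0 < k ==> 2 ^ (hh k - 1) \<le> k" using iff[of "hh k - 1"] by simp
 show "hh k \<le> k" using iff[of k] less_exp[of k] by (simp add: not_less[symmetric])
qed

text \<open>Below \<open>2 ^ 63\<close> the table of the given labels is itself a certificate. From
  \<open>2 ^ 63\<close> on the bit length is at least 64, as \<open>core_complete\<close>
  demands.\<close>

lemma search_complete:
 assumes "2 * 2 ^ (k - hh k div 4) \<le> M" "r \<le> 2 ^ k" "!!i j. adj i j <-> adj j i"
  and lab: "!!i. i < r ==> lab i \<subseteq> {..<k}" "!!i j. i < r ==> j < r ==> (i = j \<or> adj i j) <-> lab i \<inter> lab j ~= {}"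
 shows "EX b<2 ^ (if k < 2 ^ 63 then k * r else 2 ^ k div 2).
  chks r k adj (lbof (k < 2 ^ 63) M k (2 ^ (k - hh k div 4)) (9 * hh k) (2 ^ (k - 2 * hh k)) r b adj)"
proof (cases "k < 2 ^ 63")
 case True
 define A where "A = {k * i + x | i x. i < r & x \<in> lab i}"
 have "A \<subseteq> {..<k * r}"
 proof
  fix y assume "y \<in> A"
  then obtain i x where y: "y = k * i + x" "i < r" "x \<in> lab i" by (auto simp: A_def)
  then have "x < k" using lab(1)[OF y(2)] by auto
  then have "y < k * Suc i" using y by simp
  also have "\<dots> \<le> k * r" using y by (intro mult_le_mono2) simp
  finally show "y \<in> {..<k * r}" by simp
 qed
 then have b: "set_encode A < 2 ^ (k * r)" "finite A" using set_encode_less finite_subset by blast+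
 have bt: "bt (set_encode A) (k * i + x) <-> x \<in> lab i" if "i < r" "x < k" for i x
 proof -
  have "k * i + x \<in> A <-> x \<in> lab i"
  proof
   assume "k * i + x \<in> A"
   then obtain i' x' where y: "k * i + x = k * i' + x'" "i' < r" "x' \<in> lab i'" unfolding A_def by blast
   then have "x' < k" using lab(1)[OF y(2)] by auto
   have "(k * i + x) div k = i" "(k * i + x) mod k = x" "(k * i' + x') div k = i'" "(k * i' + x') mod k = x'"
    using that(2) \<open>x' < k\<close> by simp_all
   then have "i' = i" "x' = x" using y(1) by simp_all
   then show "x \<in> lab i" using y by simp
  qed (use that in \<open>auto simp: A_def\<close>)
  then show ?thesis using bt_set_encode[OF b(2)] by simp
 qed
 have "chks r k adj (lbof True M k (2 ^ (k - hh k div 4)) (9 * hh k) (2 ^ (k - 2 * hh k)) r (set_encode A) adj)"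
  unfolding chks_def
 proof (intro allI impI)
  fix i j assume ij: "i < r" "j < r"
  have "(EX x<k. x \<in> lab i & x \<in> lab j) <-> lab i \<inter> lab j ~= {}" using lab(1)[OF ij(1)] by auto
  moreover have "(EX x<k. bt (set_encode A) (k * i + x) & bt (set_encode A) (k * j + x)) <-> (EX x<k. x \<in> lab i & x \<in> lab j)"
   using bt[OF ij(1)] bt[OF ij(2)] by auto
  ultimately show "(i = j \<or> adj i j) <-> (EX x<k. lbof True M k (2 ^ (k - hh k div 4)) (9 * hh k) (2 ^ (k - 2 * hh k)) r (set_encode A) adj i x &
   lbof True M k (2 ^ (k - hh k div 4)) (9 * hh k) (2 ^ (k - 2 * hh k)) r (set_encode A) adj j x)"
   using lab(2)[OF ij] by (simp add: lbof_def)
 qed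
 then show ?thesis using True b by auto
next
 case False
 have k: "0 < k" using False by (cases k) simp_all
 have h: "64 \<le> hh k"
 proof (rule ccontr)
  assume "~ 64 \<le> hh k"
  then have "(2::nat) ^ hh k \<le> 2 ^ 63" by (intro power_increasing) simp_all
  then show False using False hh_bounds(1)[of k] by linarith
 qed
 obtain b where b: "b < 2 ^ 2 ^ (k - 1)" "core.chk M k (2 ^ (k - hh k div 4)) (9 * hh k) (2 ^ (k - 2 * hh k)) r b adj"
  using core_complete[OF h hh_bounds(2)[OF k] hh_bounds(1) refl refl refl assms(1,2,3) lab] by blast
 have e: "(2::nat) ^ k div 2 = 2 ^ (k - 1)" using k by (cases k) simp_all
 have "chks r k adj (lbof (k < 2 ^ 63) M k (2 ^ (k - hh k div 4)) (9 * hh k) (2 ^ (k - 2 * hh k)) r b adj)"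
  using b(2) False unfolding chks_def core.chk_def core.aC_def lbof_def by (simp only: if_False)
 then show ?thesis using b(1) False e by auto
qed

section \<open>Writing the family\<close>

definition addl :: "nat => 'a => 'a list => 'a list" where
 "addl k f L = (if length L < k & f \<notin> set L then L @ [f] else L)"

lemma addl_simps:
 "set L \<subseteq> set (addl k c L)" "set (addl k c L) \<subseteq> insert c (set L)" "distinct L ==> distinct (addl k c L)"
 "length L \<le> k ==> length (addl k c L) \<le> k" "length L \<le> length (addl k c L)"
 by (auto simp: addl_def)

lemma fold_addl:
 "set L \<subseteq> set (fold (addl k) cs L) & set (fold (addl k) cs L) \<subseteq> set L \<union> set cs &
  (distinct L --> distinct (fold (addl k) cs L)) & (length L \<le> k --> length (fold (addl k) cs L) \<le> k) &
  length L \<le> length (fold (addl k) cs L)"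
proof (induction cs arbitrary: L)
 case (Cons c cs)
 let ?L = "addl k c L" let ?R = "fold (addl k) cs ?L"
 note IH = Cons.IH[of ?L]
 have "set L \<subseteq> set ?R" using addl_simps(1)[of L k c] IH by (metis order_trans)
 moreover have "set ?R \<subseteq> set L \<union> set (c # cs)" using addl_simps(2)[of k c L] IH by auto
 moreover have "length L \<le> length ?R" using addl_simps(5)[of L k c] IH by linarith
 ultimately show ?case using addl_simps(3,4)[of L] IH by simp
qed simp

text \<open>A list that is not full at the end was never full, so no candidate was turned away for
  lack of room.\<close>

lemma fold_addl_full: "length (fold (addl k) cs L) < k ==> set cs \<subseteq> set (fold (addl k) cs L)"
proof (induction cs arbitrary: L)
 case (Cons c cs)
 have "length L \<le> length (addl k c L)" by (simp add: addl_def)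
 also have "\<dots> \<le> length (fold (addl k) cs (addl k c L))" using fold_addl[of "addl k c L" k cs] by simp
 also have "\<dots> < k" using Cons.prems by simp
 finally have "c \<in> set (addl k c L)" by (simp add: addl_def)
 then have "c \<in> set (fold (addl k) cs (addl k c L))" using fold_addl[of "addl k c L" k cs] by (meson subsetD)
 moreover have "set cs \<subseteq> set (fold (addl k) cs (addl k c L))" using Cons.prems by (intro Cons.IH) simp
 ultimately show ?case by simp
qed simp

definition outl :: "st => nat => nat list => bool" where
 "outl s k L <-> gv s 29 = length L & (ALL i<length L. ar s 7 i = L ! i) & (ALL f. ar s 6 f ~= 0 <-> f \<in> set L)"

lemma outl_cong: "gv t 29 = gv s 29 ==> ar t 6 = ar s 6 ==> ar t 7 = ar s 7 ==> outl t k L = outl s k L"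
 by (simp add: outl_def)

definition "bAdd = If (tAnd (tLt (Glob 29) (Glob 2)) (tNot (Arr 6 (Glob 23)))) (blk [Put 6 (Glob 23) (Num 1), Put 7 (Glob 29) (Glob 23), Asg 29 (Glob 29 +. Num 1)]) Skip"

lemma bAdd:
 assumes "outl s k L" "gv s 2 = k"
 shows "outl (run bAdd s) k (addl k (gv s 23) L)" "steps bAdd s \<le> 4"
proof -
 have m: "ar s 6 (gv s 23) = 0 <-> gv s 23 \<notin> set L" using assms(1) unfolding outl_def by blast
 have g: "gv s 29 = length L" using assms(1) unfolding outl_def by blast
 show "outl (run bAdd s) k (addl k (gv s 23) L)"
 proof (cases "length L < k & gv s 23 \<notin> set L")
  case True
  let ?t = "run bAdd s"
  have "gv ?t 29 = Suc (length L)" "ar ?t 6 = (ar s 6)(gv s 23 := 1)" "ar ?t 7 = (ar s 7)(length L := gv s 23)"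
   using True m g assms(2) by (simp_all add: bAdd_def)
  then show ?thesis using True assms(1) by (auto simp: outl_def addl_def nth_append less_Suc_eq)
 next
  case False
  have "gv (run bAdd s) 29 = gv s 29" "ar (run bAdd s) 6 = ar s 6" "ar (run bAdd s) 7 = ar s 7"
   using False m g assms(2) by (auto simp: bAdd_def)
  then have "outl (run bAdd s) k L" using assms(1) outl_cong by blast
  moreover have "addl k (gv s 23) L = L" unfolding addl_def using False by auto
  ultimately show ?thesis by simp
 qed
 show "steps bAdd s \<le> 4" by (rule order_trans[OF steps_flat]) (simp_all add: bAdd_def)
qed

definition "tcls a = Arr 4 (Arr 2 (Arr a (Glob 25))) -. Num 1"
definition "bFinI = blk [If (tAnd (call2 tLB (tcls 8) (Glob 22)) (call2 tLB (tcls 9) (Glob 22))) (Asg 23 (Glob 23 +. Glob 24)) Skip, Asg 24 (Glob 24 +. Glob 24)]"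
definition "bFinB = blk [Asg 23 (Num 0), Asg 24 (Num 1), For 25 (Glob 13) bFinI, bAdd]"
definition "bFin = For 22 (Glob 2) bFinB"

text \<open>\<open>A x\<close> consists of the numbers of the edges both of whose ends carry
  \<open>x\<close>, the edges of the clique belonging to \<open>x\<close>. Different
  \<open>x\<close> may give the same mask, and \<open>bAdd\<close> keeps it once; this is why
  padding becomes necessary.\<close>

lemma bFin:
 assumes ok: "okst s" and g: "gv s 2 = k" "gv s 13 = m" and L: "outl s k L0"
  and cls: "!!j. j < m ==> ar s 4 (ar s 2 (ar s 8 j)) - 1 < gv s 9 & ar s 4 (ar s 2 (ar s 9 j)) - 1 < gv s 9"
 defines "A \<equiv> %x. {j. j < m & LBs s (ar s 4 (ar s 2 (ar s 8 j)) - 1) x & LBs s (ar s 4 (ar s 2 (ar s 9 j)) - 1) x}"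
 shows "outl (run bFin s) k (fold (addl k) (map (%x. set_encode (A x)) [0..<k]) L0)" "steps bFin s \<le> 1 + k * (8 + 4 * m)"
proof -
 have *: "outl (run bFin s) k (fold (addl k) (map (%x. set_encode (A x)) [0..<k]) L0) & steps bFin s \<le> 1 + (\<Sum>i<k. 1 + (7 + 4 * m))"
  unfolding bFin_def
 proof (rule For_rule[where I="%i t. outl t k (fold (addl k) (map (%x. set_encode (A x)) [0..<i]) L0)"], goal_cases)
  case 1 then show ?case using g by simp
 next
  case (2 s0) then show ?case using L by (simp add: outl_def)
 next
  case (3 x t)
  have gt: "gv t z = gv s z" if "z \<notin> {22, 23, 24, 25, 29}" for z
   using frm_gv[OF 3(3), of z] that by (simp add: bFinB_def bFinI_def bAdd_def)
  have at: "ar t a = ar s a" if "a \<notin> {6, 7}" for a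
   using frm_ar[OF 3(3), of a] that by (simp add: bFinB_def bFinI_def bAdd_def)
  define s1 where "s1 = run (Asg 24 (Num 1)) (run (Asg 23 (Num 0)) (tick 6 (setg 22 x t)))"
  have s1: "gv s1 23 = 0" "gv s1 24 = 1" "gv s1 22 = x" "ar s1 = ar t" "gv s1 29 = gv t 29" by (simp_all add: s1_def)
  have g1: "gv s1 z = gv s z" if "z \<notin> {22, 23, 24, 25, 29}" for z using gt[of z] that by (simp add: s1_def)
  let ?F = "For 25 (Glob 13) bFinI"
  let ?A = "%j. {i. i < j & i \<in> A x}"
  have F: "(gv (run ?F s1) 23 = set_encode (?A m) & gv (run ?F s1) 24 = 2 ^ m) & steps ?F s1 \<le> 1 + (\<Sum>i<m. 1 + 3)"
  proof (rule For_rule[where I="%j t. gv t 23 = set_encode (?A j) & gv t 24 = 2 ^ j"], goal_cases)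
   case 1 then show ?case using g1[of 13] g by simp
  next
   case (2 s0) then show ?case using s1 by simp
  next
   case (3 j u)
   define u' where "u' = tick 6 (setg 25 j u)"
   have gu: "gv u' z = gv s z" if "z \<notin> {22, 23, 24, 25, 29}" for z
    using frm_gv[OF 3(3), of z] g1[of z] that by (simp add: bFinI_def u'_def)
   have au: "ar u' a = ar s a" if "a \<notin> {6, 7}" for a
    using frm_ar[OF 3(3), of a] at[of a] s1 that by (simp add: bFinI_def u'_def)
   have u: "gv u' 22 = x" "gv u' 25 = j" "gv u' 23 = set_encode (?A j)" "gv u' 24 = 2 ^ j"
    using frm_gv[OF 3(3), of 22] s1 3(2) by (simp_all add: bFinI_def u'_def)
   have oku: "okst u'" "LBs u' = LBs s"
   proof -
    have z: "gv u' z = gv s z" if "z \<in> {0, 2, 6, 7, 8, 9, 12, 21}" for z by (rule gu) (use that in auto)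
    have a: "ar u' a = ar s a" if "a \<in> {1, 3, 5}" for a by (rule au) (use that in auto)
    show "okst u'" "LBs u' = LBs s" using LBs_cong(1,3)[OF z a] ok by simp_all
   qed
   define i1 where "i1 = ar s 4 (ar s 2 (ar s 8 j)) - 1" define i2 where "i2 = ar s 4 (ar s 2 (ar s 9 j)) - 1"
   have i: "i1 < gv u' 9" "i2 < gv u' 9" "x < gv u' 2"
    using cls[OF 3(1)] gu[of 9] gu[of 2] g \<open>x < k\<close> by (simp_all add: i1_def i2_def)
   have e: "eval tLB u' [i1, x] = of_bool (LBs s i1 x)" "eval tLB u' [i2, x] = of_bool (LBs s i2 x)"
    using eval_tLB[OF oku(1) i(1,3)] eval_tLB[OF oku(1) i(2,3)] oku(2) by simp_all
   have jA: "j \<in> A x <-> LBs s i1 x & LBs s i2 x" using 3(1) by (simp add: A_def i1_def i2_def)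
   have c: "eval (tAnd (call2 tLB (tcls 8) (Glob 22)) (call2 tLB (tcls 9) (Glob 22))) u' [] = of_bool (j \<in> A x)"
    using e u au[of 8] au[of 9] au[of 2] au[of 4] unfolding jA by (simp add: tcls_def i1_def[symmetric] i2_def[symmetric])
   have A': "?A (Suc j) = (if j \<in> A x then insert j (?A j) else ?A j)" by (auto simp: less_Suc_eq)
   have "gv (run bFinI u') 23 = set_encode (?A j) + (if j \<in> A x then 2 ^ j else 0)" "gv (run bFinI u') 24 = 2 ^ Suc j"
    using c u by (simp_all add: bFinI_def del: eval_bool)
   moreover have "set_encode (?A (Suc j)) = set_encode (?A j) + (if j \<in> A x then 2 ^ j else 0)"
    unfolding A' by simp
   moreover have "steps bFinI u' \<le> 3" by (rule order_trans[OF steps_flat]) (simp_all add: bFinI_def)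
   ultimately show ?case unfolding u'_def by simp
  qed
  define s2 where "s2 = run ?F s1"
  have A: "?A m = A x" by (auto simp: A_def)
  have o: "outl s2 k (fold (addl k) (map (%x. set_encode (A x)) [0..<x]) L0)"
   using 3(2) s1 outl_cong[of s2 t] by (simp add: s2_def run_gv run_ar bFinI_def del: run.simps)
  have g2: "gv s2 2 = k" using g1[of 2] g by (simp add: s2_def run_gv bFinI_def del: run.simps)
  have e2: "gv s2 23 = set_encode (A x)" using F unfolding s2_def A by blast
  have r: "run bFinB (tick 6 (setg 22 x t)) = run bAdd s2" "steps bFinB (tick 6 (setg 22 x t)) = 2 + (steps ?F s1 + steps bAdd s2)"
   by (simp_all add: bFinB_def s2_def s1_def del: run.simps(6) steps.simps(6))
  have "steps ?F s1 \<le> 1 + 4 * m" using F by (simp del: run.simps steps.simps)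
  then show ?case unfolding r using bAdd[OF o g2] e2 by simp
 qed
 then show "outl (run bFin s) k (fold (addl k) (map (%x. set_encode (A x)) [0..<k]) L0)" by blast
 from * show "steps bFin s \<le> 1 + k * (8 + 4 * m)" by (simp del: run.simps steps.simps)
qed

definition "tprm = tOr (tEq (Var 0) (Var 1)) (call1 (tAnd (Var 0) (call2 tbt (Glob 23) (Var 0 -. Num 1))) (Arr 3 (Arr 1 (Var 0) +. Arr 1 (Var 1))))"
definition "tclq = tAll (tImp (tAnd (tLt (Var 0) (Glob 13)) (call2 tbt (Glob 23) (Var 0)))
  (tAll (tImp (tAnd (tLt (Var 1) (Glob 13)) (call2 tbt (Glob 23) (Var 1)))
   (tAnd (tAnd (call2 tprm (Arr 8 (Var 0)) (Arr 8 (Var 1))) (call2 tprm (Arr 8 (Var 0)) (Arr 9 (Var 1))))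
    (tAnd (call2 tprm (Arr 9 (Var 0)) (Arr 8 (Var 1))) (call2 tprm (Arr 9 (Var 0)) (Arr 9 (Var 1))))))))"
definition "bPadI = blk [bAdd, Asg 23 (Glob 23 +. Glob 23)]"
definition "bPadJ = blk [Asg 23 (Glob 22), If tclq bAdd Skip]"
definition "bPadL = If (tLt (Glob 13) (Glob 2)) (For 22 (Glob 13) (Asg 28 (Glob 28 +. Glob 28))) Skip"
definition "bPad = blk [Asg 23 (Num 1), For 22 (Glob 13) bPadI, Asg 28 (Num 1), bPadL, For 22 (Glob 28) bPadJ]"

text \<open>Single edges are cliques in every case and, if there are at least \<open>k\<close>
  edges, enough of them to fill the list. Only for \<open>m < k\<close> are all masks tried, fewer
  than \<open>2 ^ k\<close> in number; otherwise \<open>N = 1\<close> leaves the empty mask as the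
  only one to be tested.\<close>

lemma bPad:
 assumes g: "gv s 2 = k" "gv s 13 = m" and L: "outl s k L0"
 defines "N \<equiv> (if m < k then 2 ^ m else 1)"
 assumes Q: "!!t f. f < N ==> gv t 23 = f ==> gv t 0 = gv s 0 ==> gv t 13 = gv s 13 ==>
  (!!a. a \<in> {1, 3, 8, 9} ==> ar t a = ar s a) ==> eval tclq t [] ~= 0 <-> Q f"
 shows "outl (run bPad s) k (fold (addl k) (map (%j. 2 ^ j) [0..<m] @ filter Q [0..<N]) L0)" "steps bPad s \<le> 6 + 9 * m + 7 * N"
proof -
 define s1 where "s1 = run (Asg 23 (Num 1)) s"
 define s2 where "s2 = run (For 22 (Glob 13) bPadI) s1"
 define s3 where "s3 = run (Asg 28 (Num 1)) s2"
 define s4 where "s4 = run bPadL s3"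
 let ?L = "fold (addl k) (map (%j. 2 ^ j) [0..<m]) L0"
 have F: "(outl s2 k ?L & gv s2 23 = 2 ^ m) & steps (For 22 (Glob 13) bPadI) s1 \<le> 1 + (\<Sum>i<m. 1 + 5)"
  unfolding s2_def
 proof (rule For_rule[where I="%i t. outl t k (fold (addl k) (map (%j. 2 ^ j) [0..<i]) L0) & gv t 23 = 2 ^ i"], goal_cases)
  case 1 then show ?case using g by (simp add: s1_def)
 next
  case (2 s0) then show ?case using L by (simp add: s1_def outl_def)
 next
  case (3 i t)
  let ?t = "tick 6 (setg 22 i t)"
  have g2: "gv ?t 2 = k" using frm_gv[OF 3(3), of 2] g by (simp add: s1_def bPadI_def bAdd_def)
  have o: "outl ?t k (fold (addl k) (map (%j. 2 ^ j) [0..<i]) L0)" using 3(2) by (simp add: outl_def)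
  have g23: "gv ?t 23 = 2 ^ i" using 3(2) by simp
  have "outl (run bAdd ?t) k (fold (addl k) (map (%j. 2 ^ j) [0..<Suc i]) L0)" using bAdd(1)[OF o g2] unfolding g23 by simp
  then have "outl (run bPadI ?t) k (fold (addl k) (map (%j. 2 ^ j) [0..<Suc i]) L0)" by (simp add: bPadI_def outl_def)
  moreover have "gv (run bPadI ?t) 23 = 2 ^ Suc i" using g23 by (simp add: bPadI_def run_gv bAdd_def)
  moreover have "steps bPadI ?t \<le> 5" using bAdd(2)[OF o g2] by (simp add: bPadI_def)
  ultimately show ?case by blast
 qed
 have g3: "gv s3 z = gv s z" if "z \<notin> {22, 23, 28, 29}" for z
  using that by (simp add: s3_def s2_def s1_def run_gv bPadI_def bAdd_def del: run.simps(6))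
 have a3: "ar s3 a = ar s a" if "a \<notin> {6, 7}" for a
  using that by (simp add: s3_def s2_def s1_def run_ar bPadI_def bAdd_def del: run.simps(6))
 have s3: "gv s3 28 = 1" "outl s3 k ?L" using F by (simp_all add: s3_def outl_def)
 have s4: "gv s4 28 = N" "steps bPadL s3 \<le> 2 + 2 * m"
 proof -
  let ?u = "tick (tcost (tLt (Glob 13) (Glob 2)) (gv s3 0) + 2) s3"
  have d: "gv (run (For 22 (Glob 13) (Asg 28 (Glob 28 +. Glob 28))) ?u) 28 = 2 ^ m"
   "steps (For 22 (Glob 13) (Asg 28 (Glob 28 +. Glob 28))) ?u \<le> 1 + 2 * m"
   by (rule double_loop; use s3 g3[of 13] g in simp)+
  show "gv s4 28 = N" "steps bPadL s3 \<le> 2 + 2 * m"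
   using d s3(1) g3[of 13] g3[of 2] g by (simp_all add: s4_def bPadL_def N_def del: run.simps(6) steps.simps(6) tcost.simps)
 qed
 have g4: "gv s4 z = gv s z" if "z \<notin> {22, 23, 28, 29}" for z
  using g3[of z] that by (simp add: s4_def run_gv bPadL_def del: run.simps)
 have a4: "ar s4 a = ar s3 a" for a by (simp add: s4_def run_ar bPadL_def del: run.simps)
 have o4: "outl s4 k ?L" using s3(2) outl_cong[of s4 s3] a4 by (simp add: s4_def run_gv bPadL_def del: run.simps)
 define s5 where "s5 = run (For 22 (Glob 28) bPadJ) s4"
 have G: "outl s5 k (fold (addl k) (filter Q [0..<N]) ?L) & steps (For 22 (Glob 28) bPadJ) s4 \<le> 1 + (\<Sum>i<N. 1 + 6)"
  unfolding s5_def
 proof (rule For_rule[where I="%i t. outl t k (fold (addl k) (filter Q [0..<i]) ?L)"], goal_cases)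
  case 1 then show ?case using s4 by simp
 next
  case (2 s0) then show ?case using o4 by (simp add: outl_def)
 next
  case (3 i t)
  define u where "u = run (Asg 23 (Glob 22)) (tick 6 (setg 22 i t))"
  have gu: "gv u z = gv s z" if "z \<notin> {22, 23, 28, 29}" for z
   using frm_gv[OF 3(3), of z] g4[of z] that by (simp add: u_def bPadJ_def bAdd_def)
  have au: "ar u a = ar s a" if "a \<notin> {6, 7}" for a
   using frm_ar[OF 3(3), of a] a4[of a] a3[of a] that by (simp add: u_def bPadJ_def bAdd_def)
  have u: "gv u 23 = i" "outl u k (fold (addl k) (filter Q [0..<i]) ?L)" using 3(2) by (simp_all add: u_def outl_def)
  have q: "eval tclq u [] ~= 0 <-> Q i" using 3(1) u(1) gu[of 0] gu[of 13] au by (intro Q) auto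
  let ?u = "tick (tcost tclq (gv u 0) + 2) u"
  have o: "outl ?u k (fold (addl k) (filter Q [0..<i]) ?L)" using u by (simp add: outl_def)
  have g2: "gv ?u 2 = k" "gv ?u 23 = i" using gu[of 2] g u by simp_all
  have r: "run bPadJ (tick 6 (setg 22 i t)) = (if Q i then run bAdd ?u else ?u)"
   "steps bPadJ (tick 6 (setg 22 i t)) \<le> 2 + steps bAdd ?u"
  proof -
   have "run bPadJ (tick 6 (setg 22 i t)) = run (If tclq bAdd Skip) u"
    "steps bPadJ (tick 6 (setg 22 i t)) = 1 + (steps (If tclq bAdd Skip) u + 0)"
    by (simp_all only: bPadJ_def blk.simps run.simps(1,4) steps.simps(1,2,4) u_def)
   then show "run bPadJ (tick 6 (setg 22 i t)) = (if Q i then run bAdd ?u else ?u)"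
    "steps bPadJ (tick 6 (setg 22 i t)) \<le> 2 + steps bAdd ?u"
    unfolding run.simps(1,5) steps.simps(1,5) using q by (cases "Q i"; simp)+
  qed
  show ?case
  proof (cases "Q i")
   case True then show ?thesis using r bAdd[OF o g2(1)] g2(2) by simp
  next
   case False then show ?thesis using r bAdd(2)[OF o g2(1)] o by simp
  qed
 qed
 have rr: "run bPad s = s5" by (simp add: bPad_def s5_def s4_def s3_def s2_def s1_def del: run.simps(5,6))
 show "outl (run bPad s) k (fold (addl k) (map (%j. 2 ^ j) [0..<m] @ filter Q [0..<N]) L0)"
  using G unfolding rr by simp
 have "steps bPad s = 1 + (steps (For 22 (Glob 13) bPadI) s1 + (1 + (steps bPadL s3 + steps (For 22 (Glob 28) bPadJ) s4)))"
  by (simp add: bPad_def s4_def s3_def s2_def s1_def del: run.simps(5,6) steps.simps(5,6))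
 then show "steps bPad s \<le> 6 + 9 * m + 7 * N" using F G s4(2) by (simp del: run.simps steps.simps)
qed

text \<open>With many edges the loops inside \<open>tclq\<close> need not reach all of them, and
  \<open>eval_tclq\<close> is not applicable. The empty mask, the only one tested in that case,
  passes regardless.\<close>

lemma eval_tclq_0: "gv s 23 = 0 ==> eval tclq s [] ~= 0"
proof -
 assume "gv s 23 = 0"
 moreover have "~ bt 0 j" for j by (simp add: bt_def)
 ultimately show ?thesis by (simp add: tclq_def eval_tbt)
qed

lemma eval_tclq:
 assumes "gv s 13 \<le> gv s 0" "!!c. ar s 3 c \<le> gv s 13"
 shows "eval tclq s [] ~= 0 <-> (ALL i<gv s 13. ALL j<gv s 13. bt (gv s 23) i & bt (gv s 23) j -->
  (\<forall>a\<in>{ar s 8 i, ar s 9 i}. \<forall>c\<in>{ar s 8 j, ar s 9 j}. a = c \<or>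
   ar s 3 (ar s 1 a + ar s 1 c) ~= 0 & bt (gv s 23) (ar s 3 (ar s 1 a + ar s 1 c) - 1)))"
proof -
 define P where "P a c <-> a = c \<or> ar s 3 (ar s 1 a + ar s 1 c) ~= 0 & bt (gv s 23) (ar s 3 (ar s 1 a + ar s 1 c) - 1)" for a c
 have p: "eval tprm s [a, c] = of_bool (P a c)" for a c
 proof -
  have "ar s 3 (ar s 1 a + ar s 1 c) - 1 \<le> gv s 0" using assms(1) assms(2)[of "ar s 1 a + ar s 1 c"] by linarith
  then show ?thesis by (simp add: tprm_def P_def eval_tbt)
 qed
 have "eval tclq s [] ~= 0 <-> (ALL i<gv s 0. i < gv s 13 & bt (gv s 23) i --> (ALL j<gv s 0. j < gv s 13 & bt (gv s 23) j -->
  (P (ar s 8 i) (ar s 8 j) & P (ar s 8 i) (ar s 9 j)) & P (ar s 9 i) (ar s 8 j) & P (ar s 9 i) (ar s 9 j)))"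
  by (simp add: tclq_def eval_tbt p split del: split_of_bool split_of_bool_asm; blast)
 also have "\<dots> <-> (ALL i<gv s 13. ALL j<gv s 13. bt (gv s 23) i & bt (gv s 23) j -->
  (P (ar s 8 i) (ar s 8 j) & P (ar s 8 i) (ar s 9 j)) & P (ar s 9 i) (ar s 8 j) & P (ar s 9 i) (ar s 9 j))" (is "?l <-> ?r")
 proof
  assume l: ?l
  show ?r
  proof (intro allI impI)
   fix i j assume ij: "i < gv s 13" "j < gv s 13" "bt (gv s 23) i & bt (gv s 23) j"
   then have "i < gv s 0" "j < gv s 0" using assms(1) by linarith+
   then show "(P (ar s 8 i) (ar s 8 j) & P (ar s 8 i) (ar s 9 j)) & P (ar s 9 i) (ar s 8 j) & P (ar s 9 i) (ar s 9 j)"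
    using l[rule_format, of i j] ij by simp
  qed
 next
  assume r: ?r
  show ?l
  proof (intro allI impI)
   fix i j assume ij: "i < gv s 13 & bt (gv s 23) i" "j < gv s 13 & bt (gv s 23) j"
   then show "(P (ar s 8 i) (ar s 8 j) & P (ar s 8 i) (ar s 9 j)) & P (ar s 9 i) (ar s 8 j) & P (ar s 9 i) (ar s 9 j)"
    using r[rule_format, of i j] by simp
  qed
 qed
 also have "\<dots> <-> (ALL i<gv s 13. ALL j<gv s 13. bt (gv s 23) i & bt (gv s 23) j --> (\<forall>a\<in>{ar s 8 i, ar s 9 i}. \<forall>c\<in>{ar s 8 j, ar s 9 j}. P a c))"
  by simp
 finally show ?thesis unfolding P_def .
qed

section \<open>Writing the answer as a word\<close>

definition hw :: "st => nat list => bool" where "hw s w <-> (ALL i<length w. ar s 0 (Suc i) = w ! i)"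

lemma hw_app: "hw s w ==> ar t 0 = (ar s 0)(Suc (length w) := x) ==> hw t (w @ [x])"
 by (auto simp: hw_def nth_append less_Suc_eq)

text \<open>The number of edges of a set is known only after they have been written. A cell is
  therefore reserved in front of them and filled in afterwards.\<close>

lemma hw_upd: "hw s (w @ d # z) ==> ar t 0 = (ar s 0)(Suc (length w) := x) ==> hw t (w @ x # z)"
 by (auto simp: hw_def nth_append nth_Cons' split: if_splits)

definition sel :: "nat => nat => nat list" where "sel f j = filter (bt f) [0..<j]"
definition ebody :: "(nat => nat) => (nat => nat) => nat list => nat list" where "ebody U V js = concat (map (%j. [U j, V j]) js)"

definition "bEmitW = blk [Put 0 (Glob 30) (Arr 8 (Glob 25)), Put 0 (Glob 30 +. Num 1) (Arr 9 (Glob 25)), Asg 30 (Glob 30 +. Num 2), Asg 24 (Glob 24 +. Num 1)]"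
definition "bEmitI = blk [If (Glob 23 -. (Halve (Glob 23) +. Halve (Glob 23))) bEmitW Skip, Asg 23 (Halve (Glob 23))]"
definition "bEmitP = blk [Asg 23 (Arr 7 (Glob 22)), Asg 31 (Glob 30), Asg 30 (Glob 30 +. Num 1), Asg 24 (Num 0)]"
definition "bEmitB = blk [bEmitP, For 25 (Glob 13) bEmitI, Put 0 (Glob 31) (Glob 24)]"
definition "bEmitS = blk [Put 0 (Num 1) (Num 1), Put 0 (Num 2) (Glob 2), Asg 30 (Num 3)]"
definition "bEmitE = blk [Asg 1 (Glob 30 -. Num 1), Put 0 (Num 0) (Glob 30 -. Num 1)]"
definition "bEmitN = blk [Put 0 (Num 1) (Num 0), Asg 1 (Num 1), Put 0 (Num 0) (Num 1)]"
definition "bEmit = If (Glob 20) (blk [bEmitS, For 22 (Glob 2) bEmitB, bEmitE]) bEmitN"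

lemma bEmit_none:
 assumes "gv s 20 = 0"
 shows "gv (run bEmit s) 1 = length [0]" "\<forall>i\<le>length [0]. ar (run bEmit s) 0 i = (length [0] # [0::nat]) ! i" "steps bEmit s \<le> 4"
proof -
 have "gv (run bEmit s) 1 = 1" "ar (run bEmit s) 0 1 = 0" "ar (run bEmit s) 0 0 = 1"
  using assms by (simp_all add: bEmit_def bEmitN_def)
 then show "gv (run bEmit s) 1 = length [0]" "\<forall>i\<le>length [0]. ar (run bEmit s) 0 i = (length [0] # [0::nat]) ! i"
  by (simp_all add: le_Suc_eq One_nat_def)
 show "steps bEmit s \<le> 4" using assms by (simp add: bEmit_def bEmitN_def)
qed

lemma bEmit:
 assumes "gv s 20 ~= 0" "gv s 2 = k" "gv s 13 = m" "length L = k" "ALL i<k. ar s 7 i = L ! i"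
 defines "ys \<equiv> 1 # k # concat (map (%f. length (sel f m) # ebody (ar s 8) (ar s 9) (sel f m)) L)"
 shows "gv (run bEmit s) 1 = length ys" "\<forall>i\<le>length ys. ar (run bEmit s) 0 i = (length ys # ys) ! i"
  "steps bEmit s \<le> 7 + k * (7 + 7 * m)"
proof -
 let ?cd = "%f. length (sel f m) # ebody (ar s 8) (ar s 9) (sel f m)"
 define s1 where "s1 = run bEmitS (tick (tcost (Glob 20) (gv s 0) + 2) s)"
 define s2 where "s2 = run (For 22 (Glob 2) bEmitB) s1"
 have s1: "hw s1 [1, k]" "gv s1 30 = 3" using assms(2) by (simp_all add: s1_def bEmitS_def hw_def less_Suc_eq One_nat_def numeral_2_eq_2)
 have g1: "gv s1 z = gv s z" if "z ~= 30" for z using that by (simp add: s1_def run_gv bEmitS_def)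
 have a1: "ar s1 a = ar s a" if "a ~= 0" for a using that by (simp add: s1_def run_ar bEmitS_def)
 let ?w = "%i. 1 # k # concat (map ?cd (take i L))"
 have F: "(hw s2 (?w k) & gv s2 30 = Suc (length (?w k))) & steps (For 22 (Glob 2) bEmitB) s1 \<le> 1 + (\<Sum>i<k. 1 + (6 + 7 * m))"
  unfolding s2_def
 proof (rule For_rule[where I="%i t. hw t (?w i) & gv t 30 = Suc (length (?w i))"], goal_cases)
  case 1 then show ?case using assms g1[of 2] by simp
 next
  case (2 s0) then show ?case using s1 by (simp add: hw_def)
 next
  case (3 i t)
  define w where "w = ?w i"
  define f where "f = L ! i"
  have mods: "gvars bEmitB = {1, 22, 23, 24, 25, 30, 31} - {1, 22}" "avars bEmitB = {0}"
   by (auto simp: bEmitB_def bEmitP_def bEmitI_def bEmitW_def)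
  have at: "ar t a = ar s a" if "a ~= 0" for a using frm_ar[OF 3(3), of a] a1[OF that] that by (simp add: mods)
  have gt: "gv t 13 = m" using frm_gv[OF 3(3), of 13] g1[of 13] assms(3) by (simp add: mods)
  define u where "u = run bEmitP (tick 6 (setg 22 i t))"
  have u: "gv u 23 = f" "gv u 31 = Suc (length w)" "gv u 30 = Suc (Suc (length w))" "gv u 24 = 0" "gv u 13 = m" "ar u = ar t"
   using 3(1,2) at[of 7] assms(5) gt by (simp_all add: u_def bEmitP_def f_def w_def)
  have hwu: "EX d. hw u (w @ [d])"
  proof -
   have "hw u (w @ [ar u 0 (Suc (length w))])" using 3(2) u(6) unfolding w_def[symmetric] by (auto simp: hw_def nth_append less_Suc_eq)
   then show ?thesis by blast
  qed
  let ?F = "For 25 (Glob 13) bEmitI"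
  let ?b = "%j. ebody (ar s 8) (ar s 9) (sel f j)"
  \<comment> \<open>\<open>d\<close> is the provisional content of the reserved cell for the number
    of edges. Variable 23 holds the part of the mask not yet scanned.\<close>
  let ?I = "%j t. gv t 23 = f div 2 ^ j & gv t 24 = length (sel f j) & (EX d. hw t (w @ d # ?b j) & gv t 30 = Suc (length (w @ d # ?b j)))"
  have F: "?I m (run ?F u) & steps ?F u \<le> 1 + (\<Sum>j<m. 1 + 6)"
  proof (rule For_rule, goal_cases)
   case 1 then show ?case using u by simp
  next
   case (2 s0) then show ?case using u hwu by (simp add: sel_def ebody_def hw_def)
  next
   case (3 j v)
   have av: "ar v a = ar s a" if "a ~= 0" for a
    using frm_ar[OF 3(3), of a] at[OF that] u(6) that by (simp add: bEmitI_def bEmitW_def)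
   have st: "steps bEmitI (tick 6 (setg 25 j v)) \<le> 6"
    by (rule order_trans[OF steps_flat]) (simp_all add: bEmitI_def bEmitW_def)
   obtain d where d: "hw v (w @ d # ?b j)" "gv v 30 = Suc (length (w @ d # ?b j))" using 3(2) by blast
   let ?W = "w @ d # ?b j" let ?v = "tick 6 (setg 25 j v)"
   let ?o = "Glob 23 -. (Halve (Glob 23) +. Halve (Glob 23))"
   have o: "eval ?o ?v [] = of_bool (bt f j)"
   proof -
    have "y - (y div 2 + y div 2) = of_bool (odd y)" for y :: nat by (cases "odd y") (auto elim!: oddE evenE)
    then show ?thesis using 3(2) by (simp add: bt_def)
   qed
   have dd: "f div 2 ^ Suc j = f div 2 ^ j div 2" by (simp add: div_mult2_eq[symmetric] mult.commute)
   show ?case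
   proof (cases "bt f j")
    case False
    then have S: "sel f (Suc j) = sel f j" by (simp add: sel_def)
    have "gv (run bEmitI ?v) 23 = f div 2 ^ Suc j" "gv (run bEmitI ?v) 24 = gv v 24" "gv (run bEmitI ?v) 30 = gv v 30" "ar (run bEmitI ?v) = ar v"
     using o False 3(2) unfolding dd by (simp_all add: bEmitI_def)
    then show ?thesis unfolding S using 3(2) st by (simp add: hw_def)
   next
    case True
    then have S: "sel f (Suc j) = sel f j @ [j]" by (simp add: sel_def)
    define v' where "v' = tick (tcost ?o (gv ?v 0) + 2) ?v"
    have v': "gv v' 25 = j" "gv v' 23 = f div 2 ^ j" "gv v' 24 = length (sel f j)" "gv v' 30 = Suc (length ?W)" "ar v' = ar v"
     using 3(2) d by (simp_all add: v'_def)
    define v1 where "v1 = run (Put 0 (Glob 30) (Arr 8 (Glob 25))) v'"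
    define v2 where "v2 = run (Put 0 (Glob 30 +. Num 1) (Arr 9 (Glob 25))) v1"
    have h1: "hw v1 (?W @ [ar s 8 j])" by (rule hw_app[OF d(1)]) (use v' av[of 8] in \<open>simp add: v1_def\<close>)
    have h2: "hw v2 ((?W @ [ar s 8 j]) @ [ar s 9 j])"
     by (rule hw_app[OF h1]) (use v' av[of 9] in \<open>simp add: v2_def v1_def\<close>)
    have g2: "gv v2 = gv v'" by (simp add: v2_def v1_def)
    have r: "run bEmitI ?v = run (Asg 23 (Halve (Glob 23))) (run (Asg 24 (Glob 24 +. Num 1)) (run (Asg 30 (Glob 30 +. Num 2)) v2))"
     using o True by (simp add: bEmitI_def bEmitW_def v2_def v1_def v'_def)
    have "ar (run bEmitI ?v) = ar v2" unfolding r by simp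
    then have h3: "hw (run bEmitI ?v) ((?W @ [ar s 8 j]) @ [ar s 9 j])" using h2 by (simp add: hw_def)
    have e: "(?W @ [ar s 8 j]) @ [ar s 9 j] = w @ d # ?b (Suc j)" unfolding S by (simp add: ebody_def)
    have g: "gv (run bEmitI ?v) 23 = f div 2 ^ Suc j" "gv (run bEmitI ?v) 24 = length (sel f (Suc j))" "gv (run bEmitI ?v) 30 = Suc (length ?W) + 2"
     unfolding r dd S using v' g2 by simp_all
    have "gv (run bEmitI ?v) 30 = Suc (length (w @ d # ?b (Suc j)))" unfolding g(3) e[symmetric] by simp
    then show ?thesis using g st h3 unfolding e by blast
   qed
  qed
  define u2 where "u2 = run ?F u"
  obtain d where d: "hw u2 (w @ d # ?b m)" "gv u2 30 = Suc (length (w @ d # ?b m))" "gv u2 24 = length (sel f m)" using F unfolding u2_def by blast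
  have g31: "gv u2 31 = Suc (length w)" using u by (simp add: u2_def run_gv bEmitI_def bEmitW_def del: run.simps)
  have r: "run bEmitB (tick 6 (setg 22 i t)) = run (Put 0 (Glob 31) (Glob 24)) u2"
   "steps bEmitB (tick 6 (setg 22 i t)) = 4 + (steps ?F u + 1)"
   by (simp_all add: bEmitB_def u2_def u_def bEmitP_def del: run.simps(6) steps.simps(6))
  have h: "hw (run (Put 0 (Glob 31) (Glob 24)) u2) (w @ length (sel f m) # ?b m)"
   by (rule hw_upd[OF d(1)]) (use g31 d in simp)
  have w': "?w (Suc i) = w @ length (sel f m) # ?b m" using 3(1) assms(4) by (simp add: w_def f_def take_Suc_conv_app_nth)
  have "gv (run (Put 0 (Glob 31) (Glob 24)) u2) 30 = Suc (length (w @ length (sel f m) # ?b m))" using d(2) by simp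
  moreover have "steps ?F u \<le> 1 + 7 * m" using F by (simp del: run.simps steps.simps)
  ultimately show ?case unfolding r w' using h by (simp del: run.simps steps.simps)
 qed
 have yw: "?w k = ys" using assms(4) by (simp add: ys_def)
 have r: "run bEmit s = run bEmitE s2" "steps bEmit s = 1 + (3 + (steps (For 22 (Glob 2) bEmitB) s1 + 2))"
  using assms(1) by (simp_all add: bEmit_def s2_def s1_def bEmitS_def bEmitE_def del: run.simps(6) steps.simps(6))
 have s2: "hw s2 ys" "gv s2 30 = Suc (length ys)" using F unfolding yw by blast+
 have e: "gv (run bEmit s) 1 = length ys" "ar (run bEmit s) 0 = (ar s2 0)(0 := length ys)" unfolding r using s2 by (simp_all add: bEmitE_def)
 show "gv (run bEmit s) 1 = length ys" by (rule e)
 show "\<forall>i\<le>length ys. ar (run bEmit s) 0 i = (length ys # ys) ! i"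
 proof (intro allI impI)
  fix i assume "i \<le> length ys"
  then show "ar (run bEmit s) 0 i = (length ys # ys) ! i" unfolding e using s2(1) by (cases i) (simp_all add: hw_def)
 qed
 show "steps bEmit s \<le> 7 + k * (7 + 7 * m)" unfolding r using F by (simp del: run.simps steps.simps)
qed

section \<open>Masks, cliques and twin classes\<close>

definition eds :: "nat \<times> nat => nat set" where "eds e = {fst e, snd e}"
definition eset :: "(nat \<times> nat) list => nat => nat set set" where
 "eset el f = {eds (el ! j) | j. j < length el & bt f j}"

lemma eds_conv: "(%(u, v). {u, v}) = eds"
 by (auto simp: eds_def)

lemma bt_eqI:
 assumes "f < 2 ^ m" "g < 2 ^ m" "!!j. j < m ==> bt f j <-> bt g j"
 shows "f = g"
proof -
 have *: "~ bt h j" if "h < 2 ^ m" "~ j < m" for h j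
 proof -
  have "(2::nat) ^ m \<le> 2 ^ j" using that(2) by (intro power_increasing) simp_all
  then have "h < 2 ^ j" using that(1) by linarith
  then show ?thesis by (simp add: bt_def)
 qed
 have "set_decode f = set_decode g"
 proof (rule set_eqI)
  fix j
  have "bt f j <-> bt g j" using assms *[of f j] *[of g j] by (cases "j < m") auto
  then show "j \<in> set_decode f <-> j \<in> set_decode g" by (simp add: set_decode_def bt_def)
 qed
 then have "set_encode (set_decode f) = set_encode (set_decode g)" by simp
 then show ?thesis by simp
qed

lemma eset_bt:
 assumes "distinct (map eds el)" "j < length el"
 shows "eds (el ! j) \<in> eset el f <-> bt f j"
proof
 assume "eds (el ! j) \<in> eset el f"
 then obtain i where i: "eds (el ! j) = eds (el ! i)" "i < length el" "bt f i" unfolding eset_def by blast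
 then have "map eds el ! j = map eds el ! i" using assms(2) by simp
 then have "j = i" using assms i(2) by (subst (asm) nth_eq_iff_index_eq) simp_all
 then show "bt f j" using i by simp
qed (use assms in \<open>auto simp: eset_def\<close>)

lemma eset_inj:
 assumes "distinct (map eds el)" "f < 2 ^ length el" "g < 2 ^ length el" "eset el f = eset el g"
 shows "f = g"
 by (rule bt_eqI[OF assms(2,3)]) (use eset_bt[OF assms(1)] assms(4) in metis)

lemma eset_encode:
 assumes "distinct (map eds el)" "F \<subseteq> set (map eds el)"
 shows "EX f<2 ^ length el. eset el f = F"
proof (intro exI conjI)
 let ?A = "{j. j < length el & eds (el ! j) \<in> F}"
 show "set_encode ?A < 2 ^ length el" by (rule set_encode_less) auto
 have b: "bt (set_encode ?A) j <-> j \<in> ?A" for j by (rule bt_set_encode) simp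
 show "eset el (set_encode ?A) = F"
 proof (rule set_eqI)
  fix e
  have "e \<in> F ==> EX j<length el. e = eds (el ! j)" using assms(2) by (metis (no_types) in_set_conv_nth length_map nth_map subsetD)
  then show "e \<in> eset el (set_encode ?A) <-> e \<in> F" unfolding eset_def b by auto
 qed
qed

lemma edge_set_code_sel:
 assumes "distinct (map eds el)" "!!j. j < length el ==> U j = fst (el ! j) & W j = snd (el ! j)"
 shows "edge_set_code (eset el f) (length (sel f (length el)) # ebody U W (sel f (length el)))"
proof -
 let ?js = "sel f (length el)" let ?es = "map ((!) el) ?js"
 have js: "set ?js = {j. j < length el & bt f j}" "distinct ?js" by (auto simp: sel_def)
 have m: "map eds ?es = map ((!) (map eds el)) ?js" using js(1) by simp
 have d: "distinct (map eds ?es)" unfolding m distinct_map using js assms(1)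
  by (auto simp: inj_on_def nth_eq_iff_index_eq[of "map eds el"] simp del: nth_map)
 have s: "set (map eds ?es) = eset el f" using js(1) by (auto simp: eset_def)
 have "map (%(u, v). [u, v]) ?es = map (%j. [U j, W j]) ?js" using js(1) assms(2) by (simp add: case_prod_beta)
 then have "ebody U W ?js = concat (map (%(u, v). [u, v]) ?es)" by (simp only: ebody_def)
 then show ?thesis unfolding edge_set_code_def eds_conv using d s by (intro exI[of _ ?es]) simp
qed

lemma family_code_masks:
 assumes "distinct (map eds el)" "!!j. j < length el ==> U j = fst (el ! j) & W j = snd (el ! j)"
  "distinct L" "!!f. f \<in> set L ==> f < 2 ^ length el"
 shows "family_code (eset el ` set L) (length L # concat (map (%f. length (sel f (length el)) # ebody U W (sel f (length el))) L))"
  "card (eset el ` set L) = length L"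
proof -
 have inj: "inj_on (eset el) (set L)" using eset_inj[OF assms(1)] assms(4) by (intro inj_onI) blast
 then show "card (eset el ` set L) = length L" using assms(3) by (simp add: card_image distinct_card)
 have "distinct (map (eset el) L)" using inj assms(3) by (simp add: distinct_map)
 moreover have "list_all2 edge_set_code (map (eset el) L) (map (%f. length (sel f (length el)) # ebody U W (sel f (length el))) L)"
  unfolding list_all2_map1 list_all2_map2 list_all2_same
  by (intro ballI edge_set_code_sel[OF assms(1)]) (use assms(2) in blast)
 ultimately show "family_code (eset el ` set L) (length L # concat (map (%f. length (sel f (length el)) # ebody U W (sel f (length el))) L))"
  unfolding family_code_def
  by (intro exI[of _ "map (eset el) L"] exI[of _ "map (%f. length (sel f (length el)) # ebody U W (sel f (length el))) L"]) simp
qed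

text \<open>The union of \<open>F\<close> recovers the vertices of the clique, except for a clique
  with a single vertex, which has the same edges as the empty one. The right-hand side refers to
  \<open>F\<close> alone, so it can be tested on a mask.\<close>

lemma clique_edge_set_iff:
 assumes "E \<subseteq> nsets V 2" "F \<subseteq> E"
 shows "clique_edge_set V E F <-> (\<forall>e\<in>F. \<forall>e'\<in>F. \<forall>a\<in>e. \<forall>c\<in>e'. a = c \<or> {a, c} \<in> F)" (is "_ <-> ?r")
proof
 assume "clique_edge_set V E F"
 then obtain C where C: "F = nsets C 2" unfolding clique_edge_set_def by blast
 show ?r
 proof (intro ballI)
  fix e e' a c assume "e \<in> F" "e' \<in> F" "a \<in> e" "c \<in> e'"
  then have "a \<in> C" "c \<in> C" unfolding C nsets_def by auto
  then show "a = c \<or> {a, c} \<in> F" unfolding C nsets_def by (cases "a = c") auto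
 qed
next
 assume r: ?r
 have "F = nsets (\<Union>F) 2"
 proof
  show "F \<subseteq> nsets (\<Union>F) 2" using assms by (auto simp: nsets_def)
  show "nsets (\<Union>F) 2 \<subseteq> F"
  proof
   fix e assume "e \<in> nsets (\<Union>F) 2"
   then obtain a c where ac: "e = {a, c}" "a ~= c" "a \<in> \<Union>F" "c \<in> \<Union>F" by (auto simp: nsets_def card_2_iff)
   then obtain e1 e2 where "e1 \<in> F" "a \<in> e1" "e2 \<in> F" "c \<in> e2" by blast
   then show "e \<in> F" using r ac by blast
  qed
 qed
 moreover have "\<Union>F \<subseteq> V" using assms by (auto simp: nsets_def)
 moreover have "clique (\<Union>F) E" unfolding clique_def
 proof (intro ballI impI)
  fix a c assume "a \<in> \<Union>F" "c \<in> \<Union>F" "a ~= c"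
  then show "{a, c} \<in> E" using r assms(2) by blast
 qed
 ultimately show "clique_edge_set V E F" unfolding clique_edge_set_def by blast
qed

lemma clique_edge_set_sub: "clique_edge_set V E F ==> F \<subseteq> E"
 by (auto simp: clique_edge_set_def clique_def nsets_def card_2_iff)

lemma ecc_Union: "edge_clique_cover V E \<F> ==> E = \<Union>\<F>"
 unfolding edge_clique_cover_def using clique_edge_set_sub by blast

context input
begin

lemma E_eds: "E i = set (map eds (es i))"
 by (simp add: E_def eds_conv)

lemma E_nsets: "i < T ==> E i \<subseteq> nsets (set vs) 2"
proof -
 assume i: "i < T"
 show ?thesis
 proof
  fix e assume "e \<in> E i"
  then obtain u v where "(u, v) \<in> set (es i)" "e = {u, v}" by (auto simp: E_def)
  then show "e \<in> nsets (set vs) 2" using esv[OF i, of u v] by (auto simp: nsets_def)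
 qed
qed

lemma dist_eds: "i < T ==> distinct (map eds (es i))"
 using esd unfolding eds_conv .

lemma Nc_eq: "p < T ==> u \<in> set vs ==> v \<in> set vs ==> set_encode (ix ` Nc p u) = set_encode (ix ` Nc p v) <-> Nc p u = Nc p v"
proof -
 assume a: "p < T" "u \<in> set vs" "v \<in> set vs"
 have sub: "Nc p w \<subseteq> set vs" if "w \<in> set vs" for w using that E_nsets[OF a(1)] by (auto simp: Nc_def nsets_def)
 have "inj_on ix (set vs)" using ix_inj by (auto intro: inj_onI)
 then have "ix ` Nc p u = ix ` Nc p v <-> Nc p u = Nc p v" using sub[OF a(2)] sub[OF a(3)] by (rule inj_on_image_eq_iff)
 moreover have "finite (ix ` Nc p u)" "finite (ix ` Nc p v)" using sub[OF a(2)] sub[OF a(3)] finite_subset by blast+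
 ultimately show ?thesis by (simp add: set_encode_eq)
qed

lemma Nc_isol: "p < T ==> v \<in> set vs ==> set_encode (ix ` Nc p v) = 2 ^ ix v <-> (ALL w. {v, w} \<notin> E p)"
proof -
 assume a: "p < T" "v \<in> set vs"
 have sub: "Nc p v \<subseteq> set vs" using a E_nsets[OF a(1)] by (auto simp: Nc_def nsets_def)
 have nv: "{v, v} \<notin> E p" using E_nsets[OF a(1)] by (auto simp: nsets_def)
 have "inj_on ix (set vs)" using ix_inj by (auto intro: inj_onI)
 then have "ix ` Nc p v = ix ` {v} <-> Nc p v = {v}" using sub a by (intro inj_on_image_eq_iff) auto
 moreover have "finite (ix ` Nc p v)" using sub finite_subset by blast
 moreover have "(2::nat) ^ ix v = set_encode (ix ` {v})" by simp
 moreover have "Nc p v = {v} <-> (ALL w. {v, w} \<notin> E p)" using nv by (auto simp: Nc_def)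
 ultimately show ?thesis by (metis finite.emptyI finite_imageI finite_insert set_encode_eq)
qed

end

text \<open>An interface between arrays and graph theory: closed-twin classes of the non-isolated
  vertices with representatives \<open>rv\<close> and numbering \<open>cl\<close>, free of program
  states. A class number is meaningful only for vertices that are not isolated.\<close>

locale classes = input +
 fixes p r :: nat and rv :: "nat => nat" and cl :: "nat => nat" and adj :: "nat => nat => bool"
 assumes pT: "p < T"
  and rv: "!!c. c < r ==> rv c \<in> set vs & (EX w. {rv c, w} \<in> E p) & cl (rv c) = c"
  and cl: "!!v. v \<in> set vs ==> EX w. {v, w} \<in> E p ==> cl v < r & Nc p (rv (cl v)) = Nc p v"
  and adj: "!!i j. i < r ==> j < r ==> adj i j <-> {rv i, rv j} \<in> E p"
  and cl_eq: "!!u v. u \<in> set vs ==> v \<in> set vs ==> Nc p u = Nc p v ==> cl u = cl v"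
begin

abbreviation "m \<equiv> length (es p)"
abbreviation "Ep \<equiv> E p"

lemma sym: "{u, v} \<in> Ep <-> {v, u} \<in> Ep" by (simp add: insert_commute)

lemma Ep_vs: "{u, v} \<in> Ep ==> u \<in> set vs & v \<in> set vs & u ~= v"
proof -
 assume "{u, v} \<in> Ep"
 then have "(u, v) \<in> set (es p) \<or> (v, u) \<in> set (es p)" by (simp add: E_iff)
 then show ?thesis using esv[OF pT, of u v] esv[OF pT, of v u] by auto
qed

text \<open>Membership of \<open>v\<close> in the closed neighbourhood of \<open>u\<close> depends
  on \<open>u\<close> only through that neighbourhood. So one endpoint after the other can be
  replaced by the representative of its class.\<close>

lemma twin_adj:
 assumes "EX w. {u, w} \<in> Ep" "EX w. {v, w} \<in> Ep" "u ~= v"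
 shows "{u, v} \<in> Ep <-> cl u = cl v \<or> adj (cl u) (cl v)"
proof -
 have uv: "u \<in> set vs" "v \<in> set vs" using assms Ep_vs by blast+
 note cu = cl[OF uv(1) assms(1)] note cv = cl[OF uv(2) assms(2)]
 let ?a = "rv (cl u)" let ?b = "rv (cl v)"
 have n: "x \<in> Nc p y <-> x = y \<or> {y, x} \<in> Ep" for x y by (auto simp: Nc_def)
 have "{u, v} \<in> Ep <-> v \<in> Nc p u" using assms(3) n by auto
 also have "\<dots> <-> v \<in> Nc p ?a" using cu by simp
 also have "\<dots> <-> ?a \<in> Nc p v" using n sym by auto
 also have "\<dots> <-> ?a \<in> Nc p ?b" using cv by simp
 also have "\<dots> <-> ?a = ?b \<or> adj (cl u) (cl v)" using n[of ?a ?b] sym[of ?b ?a] adj[of "cl u" "cl v"] cu cv by blast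
 also have "?a = ?b <-> cl u = cl v" using rv cu cv by metis
 finally show ?thesis .
qed

definition Ax :: "(nat => nat => bool) => nat => nat set" where
 "Ax L x = {j. j < m & L (cl (fst (es p ! j))) x & L (cl (snd (es p ! j))) x}"

lemma nth_edge: "j < m ==> {fst (es p ! j), snd (es p ! j)} \<in> Ep"
 unfolding E_iff by simp

lemma Ax_mask: "set_encode (Ax L x) < 2 ^ m" "bt (set_encode (Ax L x)) j <-> j \<in> Ax L x"
 by (rule set_encode_less, force simp: Ax_def) (rule bt_set_encode, simp add: Ax_def)

lemma eset_sub: "eset (es p) g \<subseteq> Ep"
 by (auto simp: eset_def E_eds)

text \<open>Two vertices whose labels share \<open>x\<close> lie in the same class or in adjacent
  classes, hence are adjacent by \<open>twin_adj\<close>; and the edge joining them belongs to the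
  mask of \<open>x\<close>.\<close>

lemma Ax_clique:
 assumes "chks r k adj L" "x < k"
 shows "clique_edge_set (set vs) Ep (eset (es p) (set_encode (Ax L x)))"
 unfolding clique_edge_set_iff[OF E_nsets[OF pT] eset_sub]
proof (intro ballI)
 let ?F = "eset (es p) (set_encode (Ax L x))"
 have F: "{a, c} \<in> ?F" if "{a, c} \<in> Ep" "L (cl a) x" "L (cl c) x" for a c
 proof -
  from that(1) obtain j where j: "j < m" "es p ! j = (a, c) \<or> es p ! j = (c, a)" unfolding E_iff by (auto simp: in_set_conv_nth)
  then have "j \<in> Ax L x" "eds (es p ! j) = {a, c}" using that(2,3) by (auto simp: Ax_def eds_def)
  then show ?thesis unfolding eset_def Ax_mask(2) using j(1) by blast
 qed
 have mem: "L (cl a) x & (EX w. {a, w} \<in> Ep)" if ae: "a \<in> e" and eF: "e \<in> ?F" for a e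
 proof -
  from eF obtain j where j: "j \<in> Ax L x" "j < m" "e = eds (es p ! j)" unfolding eset_def Ax_mask(2) by blast
  have "{fst (es p ! j), snd (es p ! j)} \<in> Ep" "{snd (es p ! j), fst (es p ! j)} \<in> Ep" using nth_edge[OF j(2)] sym by blast+
  moreover have "a = fst (es p ! j) \<or> a = snd (es p ! j)" using j(3) ae by (auto simp: eds_def)
  moreover have "L (cl (fst (es p ! j))) x" "L (cl (snd (es p ! j))) x" using j(1) by (simp_all add: Ax_def)
  ultimately show ?thesis by blast
 qed
 fix e e' a c assume h: "e \<in> ?F" "e' \<in> ?F" "a \<in> e" "c \<in> e'"
 note ma = mem[OF h(3,1)] and mc = mem[OF h(4,2)]
 show "a = c \<or> {a, c} \<in> ?F"
 proof (cases "a = c")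
  case False
  have "a \<in> set vs" "c \<in> set vs" using ma mc Ep_vs by blast+
  then have "cl a < r" "cl c < r" using cl ma mc by blast+
  then have "cl a = cl c \<or> adj (cl a) (cl c)" using assms ma mc unfolding chks_def by blast
  then have "{a, c} \<in> Ep" using twin_adj[of a c] ma mc False by blast
  then show ?thesis using F ma mc by blast
 qed simp
qed

lemma Ax_cover:
 assumes "chks r k adj L" "e \<in> Ep"
 shows "EX x<k. e \<in> eset (es p) (set_encode (Ax L x))"
proof -
 from assms(2) obtain j where j: "j < m" "e = eds (es p ! j)" unfolding E_eds by (auto simp: in_set_conv_nth)
 let ?u = "fst (es p ! j)" let ?v = "snd (es p ! j)"
 have e: "{?u, ?v} \<in> Ep" using nth_edge[OF j(1)] .
 have i: "EX w. {?u, w} \<in> Ep" "EX w. {?v, w} \<in> Ep" "?u ~= ?v" using e sym Ep_vs[OF e] by blast+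
 have c: "cl ?u < r" "cl ?v < r" using cl i Ep_vs[OF e] by blast+
 have "cl ?u = cl ?v \<or> adj (cl ?u) (cl ?v)" using twin_adj[OF i] e by blast
 then obtain x where "x < k" "L (cl ?u) x" "L (cl ?v) x" using assms(1) c unfolding chks_def by blast
 then have "x < k" "j \<in> Ax L x" using j by (simp_all add: Ax_def)
 then show ?thesis unfolding eset_def Ax_mask(2) using j by blast
qed

text \<open>A class is labelled by the cliques that have an edge at its representative. Since
  representatives are not isolated, labels are nonempty, which settles the case
  \<open>i = j\<close>. Distinct classes receive distinct labels, and this bounds their number by
  \<open>2 ^ k\<close>.\<close>

lemma labels_of_cover:
 assumes "edge_clique_cover (set vs) Ep \<F>" "card \<F> = k" "finite \<F>"
 shows "EX lb. (ALL i<r. lb i \<subseteq> {..<k}) & (ALL i<r. ALL j<r. (i = j \<or> adj i j) <-> lb i \<inter> lb j ~= {})" "r \<le> 2 ^ k"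
proof -
 obtain F where F: "bij_betw F {..<k} \<F>" using ex_bij_betw_nat_finite[OF assms(3)] assms(2) by (auto simp: atLeast0LessThan)
 define lb where "lb i = {x. x < k & rv i \<in> \<Union>(F x)}" for i
 have lk: "lb i \<subseteq> {..<k}" for i by (auto simp: lb_def)
 have FF: "x < k ==> F x \<in> \<F>" for x using F by (auto simp: bij_betw_def)
 have main: "(i = j \<or> adj i j) <-> lb i \<inter> lb j ~= {}" if ij: "i < r" "j < r" for i j
 proof
  assume h: "i = j \<or> adj i j"
  have "\<exists>e\<in>Ep. rv i \<in> e & rv j \<in> e"
  proof (cases "i = j")
   case True
   obtain w where "{rv i, w} \<in> Ep" using rv[OF ij(1)] by blast
   then show ?thesis using True by blast
  next
   case False
   then have "{rv i, rv j} \<in> Ep" using h adj[OF ij] by blast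
   then show ?thesis by blast
  qed
  then obtain e where e: "e \<in> Ep" "rv i \<in> e" "rv j \<in> e" by blast
  then obtain F' where "F' \<in> \<F>" "e \<in> F'" using assms(1) unfolding edge_clique_cover_def by blast
  moreover then obtain x where "x < k" "F' = F x" using F unfolding bij_betw_def by blast
  ultimately have "x \<in> lb i" "x \<in> lb j" using e by (auto simp: lb_def)
  then show "lb i \<inter> lb j ~= {}" by blast
 next
  assume "lb i \<inter> lb j ~= {}"
  then obtain x where x: "x < k" "rv i \<in> \<Union>(F x)" "rv j \<in> \<Union>(F x)" by (auto simp: lb_def)
  have "clique_edge_set (set vs) Ep (F x)" using assms(1) FF[OF x(1)] unfolding edge_clique_cover_def by blast
  then obtain C where C: "clique C Ep" "F x = nsets C 2" unfolding clique_edge_set_def by blast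
  have "rv i \<in> C" "rv j \<in> C" using x unfolding C(2) nsets_def by auto
  then have "rv i = rv j \<or> {rv i, rv j} \<in> Ep" using C(1) unfolding clique_def by blast
  then show "i = j \<or> adj i j"
  proof
   assume "rv i = rv j"
   then show ?thesis using rv[OF ij(1)] rv[OF ij(2)] by metis
  next
   assume "{rv i, rv j} \<in> Ep" then show ?thesis using adj[OF ij] by blast
  qed
 qed
 show "EX lb. (ALL i<r. lb i \<subseteq> {..<k}) & (ALL i<r. ALL j<r. (i = j \<or> adj i j) <-> lb i \<inter> lb j ~= {})"
  by (rule exI[of _ lb]) (use lk main in blast)
 have "inj_on lb {..<r}"
 proof (rule inj_onI)
  fix i j assume ij: "i \<in> {..<r}" "j \<in> {..<r}" "lb i = lb j"
  let ?a = "rv i" let ?b = "rv j"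
  \<comment> \<open>The closed neighbourhood of a representative can be read off from its label,
    given the labels of all classes; equal labels thus imply twins.\<close>
  have nb: "Nc p (rv c) = {w \<in> set vs. (EX w'. {w, w'} \<in> Ep) & lb c \<inter> lb (cl w) ~= {}}" if c: "c < r" for c
  proof (rule set_eqI)
   fix w
   have rc: "rv c \<in> set vs" "EX w'. {rv c, w'} \<in> Ep" "cl (rv c) = c" using rv[OF c] by blast+
   have "w \<in> Nc p (rv c) <-> w = rv c \<or> {rv c, w} \<in> Ep" by (auto simp: Nc_def)
   also have "\<dots> <-> w \<in> set vs & (EX w'. {w, w'} \<in> Ep) & (w = rv c \<or> {rv c, w} \<in> Ep)"
    using rc Ep_vs[of "rv c" w] sym[of "rv c" w] by blast
   also have "\<dots> <-> w \<in> set vs & (EX w'. {w, w'} \<in> Ep) & lb c \<inter> lb (cl w) ~= {}"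
   proof (cases "w \<in> set vs & (EX w'. {w, w'} \<in> Ep)")
    case True
    then have cw: "cl w < r" using cl by blast
    have "w = rv c \<or> {rv c, w} \<in> Ep <-> c = cl w \<or> adj c (cl w)"
    proof (cases "w = rv c")
     case False
     then show ?thesis using twin_adj[of "rv c" w] rc True by auto
    qed (use rc in simp)
    then show ?thesis using main[OF c cw] by blast
   qed blast
   finally show "w \<in> Nc p (rv c) <-> w \<in> {w \<in> set vs. (EX w'. {w, w'} \<in> Ep) & lb c \<inter> lb (cl w) ~= {}}" by simp
  qed
  have "Nc p ?a = Nc p ?b" using nb[of i] nb[of j] ij by simp
  then have "cl ?a = cl ?b" using cl_eq rv ij by blast
  then show "i = j" using rv[of i] rv[of j] ij by simp
 qed
 then have "card {..<r} \<le> card (Pow {..<k})" by (rule card_inj_on_le) (use lk in auto)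
 then show "r \<le> 2 ^ k" by (simp add: card_Pow)
qed

end

section \<open>Instances without positive samples\<close>

definition "bNegE = blk [Put 8 (Glob 13) (Inp (Num 3 +. Glob 25)), Put 9 (Glob 13) (Inp (Num 3 +. Glob 24)), Asg 13 (Glob 13 +. Num 1)]"
definition "bNegF = For 25 (Glob 24) bNegE"
text \<open>\<open>k + 3\<close> vertices span at least \<open>k\<close> edges, hence more than
  \<open>k\<close> masks, so further vertices need not be considered and the work is independent of
  their number.\<close>

definition "bNegP = blk [Asg 22 (Cond (tLt (Glob 3) (Glob 2 +. Num 3)) (Glob 3) (Glob 2 +. Num 3)), Asg 13 (Num 0)]"
text \<open>The family consists of the masks from \<open>lo\<close> (variable 26) to
  \<open>lo + k - 1\<close>. On three or more vertices, the truncated \<open>4 - k\<close> makes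
  mask 3 one of them: its two edges form a path on three vertices, never the edge set of a clique,
  so no graph is covered. On at most two vertices there is at most one edge; starting at 1 for
  \<open>k = 1\<close> replaces the empty set by this edge when some sample is empty. The empty
  family covers just the empty graph.\<close>

definition "bNegX = blk [Asg 26 (Cond (tLt (Num 2) (Glob 3)) (Num 4 -. Glob 2) (tAnd (tEq (Glob 2) (Num 1)) (Glob 17))),
 Asg 20 (Cond (Glob 2) (tAnd (tLe (Glob 26 +. Glob 2) (Glob 28)) (tOr (tLt (Num 2) (Glob 3)) (tNot (tAnd (Glob 18) (tLe (Num 2) (Glob 26 +. Glob 2))))))
   (tNot (Glob 17)))]"
definition "bNeg = blk [bNegP, For 24 (Glob 22) bNegF, Asg 28 (Num 1), For 27 (Glob 13) (Asg 28 (Glob 28 +. Glob 28)), bNegX,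
 For 22 (Glob 2) (Put 7 (Glob 22) (Glob 26 +. Glob 22))]"

context input
begin

text \<open>Ordered by the later endpoint, so that the list begins with the edges between positions
  0 and 1, 0 and 2, 1 and 2; mask 3 then denotes two edges with a common vertex.\<close>

definition edgs :: "nat => (nat \<times> nat) list" where
 "edgs j = concat (map (%j. map (%i. (vs ! i, vs ! j)) [0..<j]) [0..<j])"

definition elst :: "st => (nat \<times> nat) list => bool" where
 "elst t W <-> gv t 13 = length W & (ALL i<length W. ar t 8 i = fst (W ! i) & ar t 9 i = snd (W ! i))"

lemma elst_app: "elst t W ==> gv t' 13 = Suc (gv t 13) ==> ar t' 8 = (ar t 8)(gv t 13 := u) ==> ar t' 9 = (ar t 9)(gv t 13 := v) ==> elst t' (W @ [(u, v)])"
 by (auto simp: elst_def nth_append less_Suc_eq)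

lemma length_edgs: "length (edgs j) \<le> j * j"
 by (induction j) (auto simp: edgs_def)

lemma bNeg:
 assumes "inp s = f" "gv s 2 = k" "gv s 3 = n"
 defines "s' \<equiv> run bNeg s" and "n' \<equiv> min n (k + 3)" and "el \<equiv> edgs (min n (k + 3))"
  and "lo \<equiv> (if 2 < n then 4 - k else of_bool (k = 1 & gv s 17 ~= 0))"
 shows "elst s' el"
  "gv s' 20 ~= 0 <-> (if k = 0 then gv s 17 = 0 else lo + k \<le> 2 ^ length el & (2 < n \<or> ~ (gv s 18 ~= 0 & 2 \<le> lo + k)))"
  "ALL i<k. ar s' 7 i = lo + i"
  "steps bNeg s \<le> 10 + 8 * (k + 3) * (k + 3)"
proof -
 define s1 where "s1 = run bNegP s"
 have s1: "gv s1 22 = n'" "elst s1 []" "gv s1 3 = n" "gv s1 2 = k" "gv s1 17 = gv s 17" "gv s1 18 = gv s 18" "inp s1 = f"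
  using assms(1-3) by (auto simp: s1_def bNegP_def n'_def elst_def)
 define s2 where "s2 = run (For 24 (Glob 22) bNegF) s1"
 have n'3: "n' \<le> k + 3" "n' \<le> n" by (simp_all add: n'_def)
 have F: "elst s2 (edgs n') & steps (For 24 (Glob 22) bNegF) s1 \<le> 1 + (\<Sum>j<n'. 1 + (1 + 4 * (k + 3)))"
  unfolding s2_def
 proof (rule For_rule[where I="%j t. elst t (edgs j)"], goal_cases)
  case 1 then show ?case using s1 by simp
 next
  case (2 s0) then show ?case using s1(2) by (simp add: elst_def edgs_def)
 next
  case (3 j t)
  let ?t = "tick 6 (setg 24 j t)"
  have ti: "inp t = f" using frm_inp[OF 3(3)] s1 by simp
  have "elst (run bNegF ?t) (edgs j @ map (%i. (vs ! i, vs ! j)) [0..<j]) & steps bNegF ?t \<le> 1 + (\<Sum>i<j. 1 + 3)"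
   unfolding bNegF_def
  proof (rule For_rule[where I="%i u. elst u (edgs j @ map (%i. (vs ! i, vs ! j)) [0..<i])"], goal_cases)
   case 1 then show ?case by simp
  next
   case (2 s0) then show ?case using 3(2) by (simp add: elst_def)
  next
   case (3 i u)
   have ui: "inp u = f" "gv u 24 = j" using frm_inp[OF 3(3)] frm_gv[OF 3(3), of 24] ti by (simp_all add: bNegE_def)
   let ?u = "tick 6 (setg 25 i u)"
   have v: "f (3 + i) = vs ! i" "f (3 + j) = vs ! j" using fv 3(1) \<open>j < n'\<close> n'3(2) by simp_all
   have e: "gv (run bNegE ?u) 13 = Suc (gv u 13)" "ar (run bNegE ?u) 8 = (ar u 8)(gv u 13 := vs ! i)" "ar (run bNegE ?u) 9 = (ar u 9)(gv u 13 := vs ! j)"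
    using ui v by (simp_all add: bNegE_def)
   have "elst (run bNegE ?u) ((edgs j @ map (%i. (vs ! i, vs ! j)) [0..<i]) @ [(vs ! i, vs ! j)])"
    by (rule elst_app[OF 3(2) e])
   moreover have "steps bNegE ?u \<le> 3" by (simp add: bNegE_def)
   ultimately show ?case by simp
  qed
  moreover have "edgs (Suc j) = edgs j @ map (%i. (vs ! i, vs ! j)) [0..<j]" by (simp add: edgs_def)
  moreover have "j \<le> k + 3" using 3(1) n'3 by simp
  ultimately show ?case by simp
 qed
 define s3 where "s3 = run (Asg 28 (Num 1)) s2"
 define s4 where "s4 = run (For 27 (Glob 13) (Asg 28 (Glob 28 +. Glob 28))) s3"
 have l: "gv s3 13 = length el" using F by (simp add: s3_def elst_def el_def n'_def)
 have s4: "gv s4 28 = 2 ^ length el" "steps (For 27 (Glob 13) (Asg 28 (Glob 28 +. Glob 28))) s3 \<le> 1 + 2 * length el"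
  unfolding s4_def by (rule double_loop; use l in \<open>simp add: s3_def\<close>)+
 have mods: "gvars bNegF = {25, 13}" "avars bNegF = {8, 9}" by (auto simp: bNegF_def bNegE_def)
 have g4: "gv s4 z = gv s1 z" if "z \<notin> {13, 24, 25, 27, 28}" for z
  using that by (simp add: s4_def s3_def s2_def run_gv mods del: run.simps(6))
 define s5 where "s5 = run bNegX s4"
 have g: "gv s4 2 = k" "gv s4 3 = n" "gv s4 17 = gv s 17" "gv s4 18 = gv s 18" using g4 s1 by simp_all
 have s5: "gv s5 26 = lo" "gv s5 20 ~= 0 <-> (if k = 0 then gv s 17 = 0 else lo + k \<le> 2 ^ length el & (2 < n \<or> ~ (gv s 18 ~= 0 & 2 \<le> lo + k)))"
 proof -
  define u where "u = run (Asg 26 (Cond (tLt (Num 2) (Glob 3)) (Num 4 -. Glob 2) (tAnd (tEq (Glob 2) (Num 1)) (Glob 17)))) s4"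
  have u: "gv u 26 = lo" "gv u 28 = 2 ^ length el" "gv u 2 = k" "gv u 3 = n" "gv u 17 = gv s 17" "gv u 18 = gv s 18"
   using g s4(1) by (auto simp: u_def lo_def)
  have "s5 = run (Asg 20 (Cond (Glob 2) (tAnd (tLe (Glob 26 +. Glob 2) (Glob 28)) (tOr (tLt (Num 2) (Glob 3)) (tNot (tAnd (Glob 18) (tLe (Num 2) (Glob 26 +. Glob 2))))))
   (tNot (Glob 17)))) u" by (simp add: s5_def bNegX_def u_def)
  then show "gv s5 26 = lo" "gv s5 20 ~= 0 <-> (if k = 0 then gv s 17 = 0 else lo + k \<le> 2 ^ length el & (2 < n \<or> ~ (gv s 18 ~= 0 & 2 \<le> lo + k)))"
   using u by auto
 qed
 have g52: "gv s5 2 = k" using g by (simp add: s5_def run_gv bNegX_def del: run.simps)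
 have e5: "elst s5 el" using F by (simp add: s5_def s4_def s3_def run_gv run_ar bNegX_def elst_def el_def n'_def del: run.simps(6))
 let ?G = "For 22 (Glob 2) (Put 7 (Glob 22) (Glob 26 +. Glob 22))"
 have G: "(ALL i<k. ar (run ?G s5) 7 i = lo + i) & steps ?G s5 \<le> 1 + (\<Sum>i<k. 1 + 1)"
 proof (rule For_rule[where I="%i t. ALL j<i. ar t 7 j = lo + j"], goal_cases)
  case 1 then show ?case using g52 by simp
 next
  case (3 i t)
  have "gv t 26 = lo" using frm_gv[OF 3(3), of 26] s5 by simp
  then show ?case using 3(2) by (simp add: less_Suc_eq)
 qed simp
 have r: "s' = run ?G s5" by (simp add: s'_def bNeg_def s5_def s4_def s3_def s2_def s1_def del: run.simps(6))
 have st: "steps bNeg s = 2 + (steps (For 24 (Glob 22) bNegF) s1 + (1 + (steps (For 27 (Glob 13) (Asg 28 (Glob 28 +. Glob 28))) s3 + (2 + steps ?G s5))))"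
  by (simp add: bNeg_def s5_def s4_def s3_def s2_def s1_def bNegP_def bNegX_def del: run.simps(6) steps.simps(6))
 show "elst s' el" unfolding r elst_def using e5 by (simp add: run_gv run_ar elst_def del: run.simps)
 show "gv s' 20 ~= 0 <-> (if k = 0 then gv s 17 = 0 else lo + k \<le> 2 ^ length el & (2 < n \<or> ~ (gv s 18 ~= 0 & 2 \<le> lo + k)))"
  unfolding r s5(2)[symmetric] by (simp add: run_gv del: run.simps)
 show "ALL i<k. ar s' 7 i = lo + i" unfolding r using G by blast
 have "length el \<le> (k + 3) * (k + 3)" using length_edgs[of n'] mult_le_mono[OF n'3(1) n'3(1)] by (simp add: el_def n'_def)
 moreover have "steps (For 24 (Glob 22) bNegF) s1 \<le> 1 + (k + 3) * (2 + 4 * (k + 3))"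
 proof -
  have "(\<Sum>j<n'. 1 + (1 + 4 * (k + 3))) = n' * (2 + 4 * (k + 3))" by simp
  then show ?thesis using F mult_le_mono1[OF n'3(1), of "2 + 4 * (k + 3)"] by linarith
 qed
 ultimately show "steps bNeg s \<le> 10 + 8 * (k + 3) * (k + 3)" unfolding st using s4(2) G
  by (simp add: algebra_simps del: run.simps steps.simps)
qed

lemma edgs_set: "j \<le> n ==> distinct (map eds (edgs j)) & set (map eds (edgs j)) = nsets (set (take j vs)) 2"
proof (induction j)
 case (Suc j)
 let ?e = "map (%i. (vs ! i, vs ! j)) [0..<j]"
 have e: "edgs (Suc j) = edgs j @ ?e" by (simp add: edgs_def)
 have IH: "distinct (map eds (edgs j))" "set (map eds (edgs j)) = nsets (set (take j vs)) 2" using Suc by simp_all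
 have tk: "take (Suc j) vs = take j vs @ [vs ! j]" using Suc.prems lvs by (simp add: take_Suc_conv_app_nth)
 have d: "distinct (take (Suc j) vs)" using lvs by simp
 have vj: "vs ! j \<notin> set (take j vs)" using d unfolding tk by simp
 have m: "map eds ?e = map (%v. {v, vs ! j}) (take j vs)" using Suc.prems lvs by (intro nth_equalityI) (simp_all add: eds_def)
 have d2: "distinct (map eds ?e)" unfolding m distinct_map using d vj unfolding tk by (auto simp: inj_on_def doubleton_eq_iff)
 have s2: "set (map eds ?e) = (%v. {v, vs ! j}) ` set (take j vs)" unfolding m by simp
 have disj: "set (map eds (edgs j)) \<inter> set (map eds ?e) = {}" unfolding IH(2) s2 using vj by (auto simp: nsets_def)
 have "nsets (insert (vs ! j) (set (take j vs))) 2 = nsets (set (take j vs)) 2 \<union> (%v. {v, vs ! j}) ` set (take j vs)"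
 proof (rule set_eqI)
  fix e
  show "e \<in> nsets (insert (vs ! j) (set (take j vs))) 2 <-> e \<in> nsets (set (take j vs)) 2 \<union> (%v. {v, vs ! j}) ` set (take j vs)"
  proof
   assume "e \<in> nsets (insert (vs ! j) (set (take j vs))) 2"
   then obtain a c where "e = {a, c}" "a ~= c" "a \<in> insert (vs ! j) (set (take j vs))" "c \<in> insert (vs ! j) (set (take j vs))"
    by (auto simp: nsets_def card_2_iff)
   then show "e \<in> nsets (set (take j vs)) 2 \<union> (%v. {v, vs ! j}) ` set (take j vs)"
    by (auto simp: nsets_def insert_commute)
  next
   assume "e \<in> nsets (set (take j vs)) 2 \<union> (%v. {v, vs ! j}) ` set (take j vs)"
   then show "e \<in> nsets (insert (vs ! j) (set (take j vs))) 2" using vj by (auto simp: nsets_def card_insert_if)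
  qed
 qed
 then show ?case unfolding e tk using IH d2 disj s2 by simp
qed (simp add: edgs_def nsets_def)

end

section \<open>The loop bound and the numerical parameters\<close>

definition "bInit1 = blk [Asg 2 (Inp (Num 1)), Asg 3 (Inp (Num 2)), Asg 22 (Num 1024), For 23 (Glob 2) (Asg 22 (Glob 22 +. Glob 22 +. Glob 22 +. Glob 22))]"
definition "bInit = blk [bInit1, Asg 0 (Glob 22)]"
definition "bCfg = blk [Asg 4 (call2 tshl (Num 1) (Glob 2)), Asg 5 (Sum (tLe (call2 tshl (Num 1) (Var 0)) (Glob 2))),
 Asg 6 (call2 tshl (Num 1) (Glob 2 -. Halve (Halve (Glob 5)))), Asg 7 (call2 tshl (Num 1) (Glob 2 -. (Glob 5 +. Glob 5))),
 Asg 8 (Glob 5 +. Glob 5 +. Glob 5 +. Glob 5 +. Glob 5 +. Glob 5 +. Glob 5 +. Glob 5 +. Glob 5)]"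

definition cfg :: "nat => nat => st => bool" where
 "cfg k n s <-> gv s 0 = 1024 * 4 ^ k & gv s 2 = k & gv s 3 = n & gv s 4 = 2 ^ k & gv s 6 = 2 ^ (k - hh k div 4) &
  gv s 7 = 2 ^ (k - 2 * hh k) & gv s 8 = 9 * hh k"

lemma k_less_M: "k \<le> (4::nat) ^ k" "2 ^ k \<le> (4::nat) ^ k" "k * 2 ^ k \<le> (4::nat) ^ k"
proof -
 have e: "(4::nat) ^ k = 2 ^ k * 2 ^ k" by (simp add: power_mult_distrib[symmetric])
 have k: "k \<le> 2 ^ k" using less_exp[of k] by simp
 show "k * 2 ^ k \<le> (4::nat) ^ k" unfolding e by (rule mult_le_mono1[OF k])
 show b: "2 ^ k \<le> (4::nat) ^ k" by (rule power_mono) simp_all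
 show "k \<le> (4::nat) ^ k" using k b by linarith
qed

lemma cfg_okst: "cfg k n s ==> gv s 9 \<le> 2 ^ k ==> okst s"
proof -
 assume c: "cfg k n s" and r: "gv s 9 \<le> 2 ^ k"
 have l: "(2::nat) ^ (k - hh k div 4) \<le> 2 ^ k" "(2::nat) ^ (k - 2 * hh k) \<le> 2 ^ k" by (rule power_increasing; simp)+
 have h: "hh k \<le> k" by (rule hh_bounds)
 have "2 ^ (k - hh k div 4) * hh k \<le> 2 ^ k * k" "2 ^ (k - 2 * hh k) * k \<le> 2 ^ k * k" using l h by (intro mult_le_mono; simp)+
 moreover have "2 ^ k * k \<le> (4::nat) ^ k" using k_less_M(3)[of k] by (simp add: mult.commute)
 ultimately have "2 ^ (k - hh k div 4) * hh k \<le> 4 ^ k" "2 ^ (k - 2 * hh k) * k \<le> 4 ^ k" by linarith+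
 then have a: "6 * 2 ^ (k - hh k div 4) * (9 * hh k) + 2 * 2 ^ (k - 2 * hh k) * k \<le> 1024 * 4 ^ k" by simp
 have v: "gv s 0 = 1024 * 4 ^ k" "gv s 2 = k" "gv s 6 = 2 ^ (k - hh k div 4)" "gv s 7 = 2 ^ (k - 2 * hh k)" "gv s 8 = 9 * hh k"
  using c unfolding cfg_def by blast+
 show ?thesis unfolding okst_def v using r a l h k_less_M[of k] by (intro conjI) linarith+
qed

text \<open>The bound \<open>1024 * 4 ^ k\<close> is prepared in variable 22 while variable 0 is
  still 0, so that evaluating terms costs a constant here; only the last command installs it. It
  dominates every shift count of the search, and a power of it can be absorbed by the running
  time.\<close>

lemma bInit:
 assumes "inp s = f" "f 1 = k" "f 2 = n" "gv s 0 = 0"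
 shows "gv (run bInit s) 0 = 1024 * 4 ^ k" "gv (run bInit s) 2 = k" "gv (run bInit s) 3 = n" "EX C. \<forall>t\<in>ctms bInit1. tcost t 0 \<le> C"
  "(\<forall>t\<in>ctms bInit1. tcost t 0 \<le> C) ==> clk (run bInit s) \<le> clk s + (2 * C + 8) * (4 + 2 * k) + 4"
proof -
 let ?F = "For 23 (Glob 2) (Asg 22 (Glob 22 +. Glob 22 +. Glob 22 +. Glob 22))"
 define s1 where "s1 = run (Asg 22 (Num 1024)) (run (Asg 3 (Inp (Num 2))) (run (Asg 2 (Inp (Num 1))) s))"
 have s1: "gv s1 2 = k" "gv s1 22 = 1024" "gv s1 3 = n" "gv s1 0 = 0" using assms by (simp_all add: s1_def)
 have F: "gv (run ?F s1) 22 = 1024 * 4 ^ k & steps ?F s1 \<le> 1 + (\<Sum>i<k. 1 + 1)"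
  by (rule For_rule[where I="%i t. gv t 22 = 1024 * 4 ^ i"]) (use s1 in simp_all)
 have r: "run bInit1 s = run ?F s1" "steps bInit1 s = 3 + steps ?F s1"
  by (simp_all add: bInit1_def s1_def del: run.simps(6) steps.simps(6))
 have rr: "run bInit s = run (Asg 0 (Glob 22)) (run bInit1 s)" by (simp add: bInit_def del: run.simps(6))
 show "gv (run bInit s) 0 = 1024 * 4 ^ k" "gv (run bInit s) 2 = k" "gv (run bInit s) 3 = n"
  unfolding rr r using F s1 by (simp_all add: run_gv del: run.simps(6))
 show "EX C. \<forall>t\<in>ctms bInit1. tcost t 0 \<le> C"
  using finite_ctms[of bInit1] by (intro exI[of _ "\<Sum>t\<in>ctms bInit1. tcost t 0"] ballI member_le_sum) auto
 assume C: "\<forall>t\<in>ctms bInit1. tcost t 0 \<le> C"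
 have st: "steps bInit1 s \<le> 4 + 2 * k" unfolding r using F by (simp del: run.simps steps.simps)
 have "clk (run bInit1 s) \<le> clk s + (2 * C + 8) * steps bInit1 s"
  by (rule clk_le_steps) (use C assms(4) in \<open>simp_all add: bInit1_def\<close>)
 also have "\<dots> \<le> clk s + (2 * C + 8) * (4 + 2 * k)" using mult_le_mono2[OF st, of "2 * C + 8"] by simp
 finally show "clk (run bInit s) \<le> clk s + (2 * C + 8) * (4 + 2 * k) + 4" unfolding rr by simp
qed

lemma bCfg:
 assumes "gv s 0 = 1024 * 4 ^ k" "gv s 2 = k" "gv s 3 = n"
 shows "cfg k n (run bCfg s)" "steps bCfg s = 5"
proof -
 have M: "k \<le> gv s 0" using k_less_M(1)[of k] unfolding assms(1) by linarith
 have tm: "eval (Sum (tLe (call2 tshl (Num 1) (Var 0)) (Glob 2))) t [] = hh k" if "gv t 0 = gv s 0" "gv t 2 = k" for t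
 proof -
  have "eval (Sum (tLe (call2 tshl (Num 1) (Var 0)) (Glob 2))) t [] = (\<Sum>i<gv t 0. of_bool (2 ^ i \<le> k))"
   using that(2) by (simp add: eval_tshl)
  also have "\<dots> = card {i. i < gv t 0 & 2 ^ i \<le> k}" by (rule sum_of_bool_card)
  also have "{i. i < gv t 0 & 2 ^ i \<le> k} = {i. 2 ^ i \<le> k}"
  proof -
   have "i < gv t 0" if i: "2 ^ i \<le> k" for i
   proof -
    have "i \<in> {..<hh k}" using i unfolding hh_set[of k, symmetric] by simp
    then show ?thesis using hh_bounds(3)[of k] M \<open>gv t 0 = gv s 0\<close> by simp
   qed
   then show ?thesis by blast
  qed
  finally show ?thesis by (simp add: hh_def)
 qed
 define s1 where "s1 = run (Asg 4 (call2 tshl (Num 1) (Glob 2))) s"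
 define s2 where "s2 = run (Asg 5 (Sum (tLe (call2 tshl (Num 1) (Var 0)) (Glob 2)))) s1"
 define s3 where "s3 = run (Asg 6 (call2 tshl (Num 1) (Glob 2 -. Halve (Halve (Glob 5))))) s2"
 define s4 where "s4 = run (Asg 7 (call2 tshl (Num 1) (Glob 2 -. (Glob 5 +. Glob 5)))) s3"
 have s1: "gv s1 4 = 2 ^ k" "gv s1 0 = gv s 0" "gv s1 2 = k" "gv s1 3 = n" using assms M by (simp_all add: s1_def eval_tshl)
 have s2: "gv s2 5 = hh k" "gv s2 4 = 2 ^ k" "gv s2 0 = gv s 0" "gv s2 2 = k" "gv s2 3 = n"
  using s1 tm[OF s1(2,3)] by (simp_all add: s2_def del: eval.simps(10))
 have q: "hh k div 2 div 2 = hh k div 4" by simp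
 have s3: "gv s3 6 = 2 ^ (k - hh k div 4)" "gv s3 5 = hh k" "gv s3 4 = 2 ^ k" "gv s3 0 = gv s 0" "gv s3 2 = k" "gv s3 3 = n"
  using s2 M by (simp_all add: s3_def eval_tshl q)
 have s4: "gv s4 7 = 2 ^ (k - 2 * hh k)" "gv s4 6 = 2 ^ (k - hh k div 4)" "gv s4 5 = hh k" "gv s4 4 = 2 ^ k" "gv s4 0 = gv s 0" "gv s4 2 = k" "gv s4 3 = n"
  using s3 M by (simp_all add: s4_def eval_tshl mult_2)
 have "run bCfg s = run (Asg 8 (Glob 5 +. Glob 5 +. Glob 5 +. Glob 5 +. Glob 5 +. Glob 5 +. Glob 5 +. Glob 5 +. Glob 5)) s4"
  unfolding bCfg_def blk.simps run.simps(1,4) s4_def s3_def s2_def s1_def ..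
 then show "cfg k n (run bCfg s)" using s4 assms(1) by (simp add: cfg_def)
 show "steps bCfg s = 5" by (simp add: bCfg_def)
qed

section \<open>Instances with a positive sample\<close>

definition "bOut = blk [bFin, bPad, Asg 20 (tEq (Glob 29) (Glob 2))]"
definition "bSolve = If (Glob 19) Skip (blk [bSearch, If (Glob 20) bOut Skip])"
definition "bRcheck = If (tLt (Glob 4) (Glob 9)) (Asg 19 (Num 1)) Skip"
definition "bPos = blk [bLoad, bComp, bRep, bRcheck, bSolve]"

lemma fold_addl_all:
 assumes "length cs \<le> k"
 shows "set (fold (addl k) cs []) = set cs"
proof -
 let ?R = "fold (addl k) cs []"
 have R: "set ?R \<subseteq> set cs" "distinct ?R" "length ?R \<le> k" using fold_addl[of "[]" k cs] by simp_all
 show ?thesis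
 proof (cases "length ?R < k")
  case True then show ?thesis using R(1) fold_addl_full[OF True] by blast
 next
  case False
  then have "card (set ?R) = k" using R distinct_card[OF R(2)] by simp
  moreover have "card (set cs) \<le> k" using card_length[of cs] assms by linarith
  ultimately show ?thesis using R(1) card_seteq[of "set cs" "set ?R"] by simp
 qed
qed

context input
begin

definition sol :: "nat set set set => bool" where
 "sol F <-> F \<subseteq> Pow (nsets (set vs) 2) & card F = k & (ALL i<T. edge_clique_cover (set vs) (E i) F <-> lab i)"

lemma finite_sub: "F \<subseteq> Pow (nsets (set vs) 2) ==> finite F"
 by (erule finite_subset) (rule finite_Pow_iff[THEN iffD2], rule finite_imp_finite_nsets, rule finite_set)

lemma sol_pos: "p < T ==> lab p ==> sol F ==> edge_clique_cover (set vs) (E p) F & (ALL i<T. lab i <-> E i = E p)"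
proof -
 assume p: "p < T" "lab p" and s: "sol F"
 have e: "edge_clique_cover (set vs) (E p) F" using s p unfolding sol_def by blast
 have "lab i <-> E i = E p" if "i < T" for i
 proof
  assume "lab i"
  then have "edge_clique_cover (set vs) (E i) F" using s that unfolding sol_def by blast
  then show "E i = E p" using ecc_Union e by metis
 next
  assume "E i = E p"
  then show "lab i" using s that e unfolding sol_def by metis
 qed
 with e show ?thesis by blast
qed

text \<open>Bounds the number of certificates; in the regime of plain labellings this uses that
  there are at most \<open>2 ^ k\<close> classes.\<close>

definition Zk :: nat where "Zk = (if k < 2 ^ 63 then 2 ^ (k * 2 ^ k) else 2 ^ (2 ^ k div 2))"

text \<open>Failure has four causes, each of which excludes a solution: a sample whose sign
  contradicts its comparison with the positive one, more than \<open>2 ^ k\<close> classes, no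
  labelling, or fewer than \<open>k\<close> different cliques. The step bound is a product that
  majorises the sum of the costs of reading, searching and writing.\<close>

lemma bPos:
 assumes c: "cfg k n s" and "inp s = f" and p: "p < T" "lab p" and "gv s 14 = ps p" "gv s 15 = T"
  and pw: "\<forall>v\<in>set vs. ar s 1 v = 2 ^ ix v & ar s 2 v = 2 ^ ix v"
  and z: "ar s 3 = (%_. 0)" "ar s 4 = (%_. 0)" "ar s 6 = (%_. 0)" "gv s 9 = 0" "gv s 19 = 0" "gv s 20 = 0" "gv s 29 = 0"
 defines "s' \<equiv> run bPos s" and "m \<equiv> length (es p)"
 shows "gv s' 13 = m" "ALL j<m. ar s' 8 j = fst (es p ! j) & ar s' 9 j = snd (es p ! j)" "gv s' 2 = k"
  "gv s' 20 ~= 0 ==> EX L. length L = k & (ALL i<k. ar s' 7 i = L ! i) & distinct L & (\<forall>f\<in>set L. f < 2 ^ m) &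
   edge_clique_cover (set vs) (E p) (eset (es p) ` set L) & (ALL i<T. lab i <-> E i = E p)"
  "gv s' 20 = 0 ==> ~ sol F"
  "3 + n + (\<Sum>i<T. 2 + 2 * length (es i)) \<le> S ==> steps bPos s \<le> 100 * (4 ^ k * S * Zk)"
proof -
 have g0: "gv s 2 = k" "gv s 3 = n" "gv s 4 = 2 ^ k" using c unfolding cfg_def by blast+
 define s1 where "s1 = run bLoad s"
 define s2 where "s2 = run bComp s1"
 define s3 where "s3 = run bRep s2"
 define s4 where "s4 = run bRcheck s3"
 have mL: "gvars bLoad = {13, 22, 23, 24}" "avars bLoad = {8, 9, 3, 2}" by (auto simp: bLoad_def bLoadB_def bLoadM_def)
 have mC: "gvars bComp = {16, 22, 23, 25, 26, 19}" "avars bComp = {}" by (auto simp: bComp_def bCompB_def bCompI_def bCompE_def pinc_def)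
 have mR: "gvars bRep = {22, 23, 24, 9}" "avars bRep = {5, 4}" by (auto simp: bRep_def bRepB_def)
 have mK: "gvars bRcheck = {19}" "avars bRcheck = {}" by (auto simp: bRcheck_def)
 have mS: "gvars bSearch = {12, 27, 28, 22, 10, 21, 20}" "avars bSearch = {}" by (auto simp: bSearch_def bSearchI_def bSearchB_def)
 have mF: "gvars bFin = {22, 23, 24, 25, 29}" "avars bFin = {6, 7}" by (auto simp: bFin_def bFinB_def bFinI_def bAdd_def)
 have mP: "gvars bPad = {23, 22, 28, 29}" "avars bPad = {6, 7}" by (auto simp: bPad_def bPadI_def bPadJ_def bPadL_def bAdd_def)
 note L = bLoad[OF assms(2) p(1) assms(5) pw z(1), folded s1_def m_def]
 have g1: "inp s1 = f" "gv s1 15 = T" "gv s1 3 = n" "gv s1 19 = 0" "\<forall>v\<in>set vs. ar s1 1 v = 2 ^ ix v"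
  using assms(2,6) g0 z pw by (simp_all add: s1_def run_gv run_ar mL)
 have tab: "ALL j<length (es p). ar s1 3 (key (es p ! j)) = Suc j" using L(2) unfolding m_def by blast
 note C = bComp[OF g1(1) p(1) L(1)[unfolded m_def] g1(2-5) tab L(3), folded s2_def]
 have g2: "inp s2 = f" "gv s2 3 = n" "gv s2 9 = 0" "ar s2 4 = (%_. 0)"
  using g1 z by (simp_all add: s2_def s1_def run_gv run_ar mC mL assms(2) g0)
 note R = bRep[OF g2, folded s3_def]
 have a3: "ar s3 1 = ar s 1" "ar s3 2 = ar s1 2" "ar s3 3 = ar s1 3" "ar s3 8 = ar s1 8" "ar s3 9 = ar s1 9" "ar s3 6 = ar s 6"
  "ar s2 1 = ar s 1" "ar s2 2 = ar s1 2"
  by (simp_all add: s3_def s2_def s1_def run_ar mR mC mL)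
 define r where "r = gv s3 9"
 define rv where "rv = ar s3 5"
 define cl where "cl v = ar s3 4 (ar s1 2 v) - 1" for v
 have P1: "ar s 1 v = 2 ^ ix v" if "v \<in> set vs" for v using pw that by blast
 have mask: "ar s1 2 v = set_encode (ix ` Nc p v)" if "v \<in> set vs" for v using L(4) that by blast
 have isol: "ar s1 2 v ~= ar s 1 v <-> (EX w. {v, w} \<in> E p)" if "v \<in> set vs" for v
  unfolding mask[OF that] P1[OF that] using Nc_isol[OF p(1) that] by blast
 interpret cs: classes f k n T vs es lab ps p r rv cl "adjs s3"
 proof (unfold_locales, goal_cases)
  case 1 then show ?case using p by simp
 next
  case (2 c)
  have "rv c \<in> set vs" "ar s1 2 (rv c) ~= ar s 1 (rv c)" "ar s3 4 (ar s1 2 (rv c)) = Suc c"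
   using R(1) 2 unfolding r_def rv_def a3 by blast+
  then show ?case using isol unfolding cl_def by simp
 next
  case (3 v)
  then have "ar s1 2 v ~= ar s 1 v" using isol by blast
  then obtain c where c: "c < r" "ar s3 4 (ar s1 2 v) = Suc c" "ar s1 2 (rv c) = ar s1 2 v"
   using R(2) 3 unfolding r_def rv_def a3 by blast
  have "rv c \<in> set vs" using R(1) c(1) unfolding r_def rv_def by blast
  then have "Nc p (rv c) = Nc p v" using c(3) Nc_eq[OF p(1) _ 3(1), of "rv c"] mask 3(1) by simp
  then show ?case using c unfolding cl_def by simp
 next
  case (4 i j)
  have "rv i \<in> set vs" "rv j \<in> set vs" using R(1) 4 unfolding r_def rv_def by blast+
  then show ?case unfolding adjs_def a3 using tab_iff[OF p(1) tab L(3), of "rv i" "rv j"] P1 by (simp add: rv_def)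
 next
  case (5 u v)
  then show ?case using mask[OF 5(1)] mask[OF 5(2)] unfolding cl_def by simp
 qed
 have g4: "gv s4 z = gv s z" if "z \<notin> {13, 22, 23, 24, 16, 25, 26, 19, 9}" for z
  using that by (simp add: s4_def s3_def s2_def s1_def run_gv mK mR mC mL)
 have g13: "gv s4 13 = m" "gv s4 9 = r" using L(1) by (simp_all add: s4_def s3_def s2_def run_gv mK mR mC r_def)
 have a4: "ar s4 = ar s3"
 proof
  fix a show "ar s4 a = ar s3 a" by (simp add: s4_def run_ar mK)
 qed
 have g19: "gv s4 19 = 0 <-> gv s2 19 = 0 & r \<le> 2 ^ k"
 proof -
  have "gv s3 19 = gv s2 19" "gv s3 4 = 2 ^ k" using g0 by (simp_all add: s3_def s2_def s1_def run_gv mR mC mL)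
  then show ?thesis by (auto simp: s4_def bRcheck_def r_def)
 qed
 have g20: "gv s4 20 = 0" using g4[of 20] z by simp
 have ro: "s' = run bSolve s4" unfolding s'_def bPos_def s4_def s3_def s2_def s1_def by simp
 have so: "steps bPos s = steps bLoad s + (steps bComp s1 + (steps bRep s2 + (steps bRcheck s3 + steps bSolve s4)))"
  unfolding bPos_def s4_def s3_def s2_def s1_def by simp
 have mB: "gvars bSolve = {12, 27, 28, 22, 10, 21, 20, 23, 24, 25, 29}" "avars bSolve = {6, 7}"
  by (auto simp: bSolve_def bOut_def mS mF mP)
 show "gv s' 13 = m" "gv s' 2 = k" unfolding ro using g13 g4[of 2] g0 by (simp_all add: run_gv mB)
 have e8: "ALL j<m. ar s4 8 j = fst (es p ! j) & ar s4 9 j = snd (es p ! j)" using L(2) unfolding a4 a3 by blast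
 show "ALL j<m. ar s' 8 j = fst (es p ! j) & ar s' 9 j = snd (es p ! j)" unfolding ro using e8 by (simp add: run_ar mB)
 define t4 where "t4 = tick (tcost (Glob 19) (gv s4 0) + 2) s4"
 have t4: "gv t4 = gv s4" "ar t4 = ar s4" by (simp_all add: t4_def)
 define s5 where "s5 = run bSearch t4"
 define t5 where "t5 = tick (tcost (Glob 20) (gv s5 0) + 2) s5"
 have t5: "gv t5 = gv s5" "ar t5 = ar s5" by (simp_all add: t5_def)
 have sv: "run bSolve s4 = (if gv s4 19 ~= 0 then t4 else if gv s5 20 = 0 then t5 else run bOut t5)"
  "steps bSolve s4 = 1 + (if gv s4 19 ~= 0 then 0 else steps bSearch t4 + (1 + (if gv s5 20 = 0 then 0 else steps bOut t5)))"
  unfolding bSolve_def run.simps(1,5) steps.simps(1,5) blk.simps run.simps(4) steps.simps(4) eval.simps(2) t4_def[symmetric] s5_def[symmetric] t5_def[symmetric]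
  by simp_all
 have ad: "adjs t4 = adjs s3" unfolding adjs_def[abs_def] t4 a4 ..
 have c4: "cfg k n t4" using c g4 unfolding cfg_def t4 by simp
 define N where "N = (if k < 2 ^ 63 then k * r else 2 ^ k div 2)"
 {
  assume b: "gv s4 19 = 0"
  then have r2: "r \<le> 2 ^ k" and E: "ALL i<T. lab i <-> E i = E p" using g19 C(1) by blast+
  have ok: "okst t4" using cfg_okst[OF c4] g13 r2 unfolding t4 by simp
  have pre: "gv t4 20 = 0" "gv t4 2 = k" "gv t4 9 = r" "gv t4 4 = 2 ^ k" using g20 g13 g4 g0 unfolding t4 by simp_all
  note S = bSearch[OF ok pre, folded s5_def N_def, unfolded ad]
  have g5: "gv s5 z = gv s4 z" if "z \<notin> {12, 27, 28, 22, 10, 21, 20}" for z using that by (simp add: s5_def run_gv mS t4)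
  have a5: "ar s5 = ar s3"
  proof
   fix a show "ar s5 a = ar s3 a" by (simp add: s5_def run_ar mS t4 a4)
  qed
  note S ok r2 E g5 a5
 } note st = this
 have LK: "gv s5 20 ~= 0 ==> gv s4 19 = 0 ==> chks r k (adjs s3) (LBs s5)" by (rule st(2))
 define Lb where "Lb = LBs s5"
 define L1 where "L1 = fold (addl k) (map (%x. set_encode (cs.Ax Lb x)) [0..<k]) []"
 define N2 where "N2 = (if m < k then (2::nat) ^ m else 1)"
 define Q where "Q g <-> clique_edge_set (set vs) (E p) (eset (es p) g)" for g
 define L2 where "L2 = fold (addl k) (map (%j. 2 ^ j) [0..<m] @ filter Q [0..<N2]) L1"
 \<comment> \<open>The clique condition in the form in which \<open>tclq\<close> evaluates it: the
   edge table returns the number of the edge between two endpoints, increased by one, and the mask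
   is inspected at that number.\<close>
 have Qiff: "Q g <-> (ALL i<m. ALL j<m. bt g i & bt g j -->
   (\<forall>a\<in>{fst (es p ! i), snd (es p ! i)}. \<forall>c\<in>{fst (es p ! j), snd (es p ! j)}. a = c \<or>
    ar s1 3 (ar s 1 a + ar s 1 c) ~= 0 & bt g (ar s1 3 (ar s 1 a + ar s 1 c) - 1)))" for g
 proof -
  have in_: "ar s1 3 (ar s 1 a + ar s 1 c) ~= 0 & bt g (ar s1 3 (ar s 1 a + ar s 1 c) - 1) <-> {a, c} \<in> eset (es p) g"
   if ac: "a \<in> set vs" "c \<in> set vs" for a c
  proof -
   have t: "ar s1 3 (ar s 1 a + ar s 1 c) ~= 0 <-> {a, c} \<in> E p" using tab_iff[OF p(1) tab L(3) ac] P1 ac by simp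
   show ?thesis
   proof (cases "{a, c} \<in> E p")
    case False
    then show ?thesis using t cs.eset_sub[of g] by blast
   next
    case True
    then obtain j where j: "j < m" "es p ! j = (a, c) \<or> es p ! j = (c, a)" unfolding E_iff m_def by (auto simp: in_set_conv_nth)
    have "key (es p ! j) = ar s 1 a + ar s 1 c" using j(2) P1 ac by (auto simp: key_def)
    then have "ar s1 3 (ar s 1 a + ar s 1 c) = Suc j" using tab j(1) unfolding m_def by metis
    moreover have "eds (es p ! j) = {a, c}" using j(2) by (auto simp: eds_def)
    then have "{a, c} \<in> eset (es p) g <-> bt g j" using eset_bt[OF dist_eds[OF p(1)], of j g] j(1) unfolding m_def by simp
    ultimately show ?thesis by simp
   qed
  qed
  have vv: "fst (es p ! i) \<in> set vs" "snd (es p ! i) \<in> set vs" if "i < m" for i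
   using cs.Ep_vs[OF cs.nth_edge, of i] that unfolding m_def by blast+
  have "Q g <-> (\<forall>e\<in>eset (es p) g. \<forall>e'\<in>eset (es p) g. \<forall>a\<in>e. \<forall>c\<in>e'. a = c \<or> {a, c} \<in> eset (es p) g)"
   unfolding Q_def by (rule clique_edge_set_iff[OF E_nsets[OF p(1)] cs.eset_sub])
  also have "\<dots> <-> (ALL i<m. ALL j<m. bt g i & bt g j -->
   (\<forall>a\<in>{fst (es p ! i), snd (es p ! i)}. \<forall>c\<in>{fst (es p ! j), snd (es p ! j)}. a = c \<or> {a, c} \<in> eset (es p) g))" (is "?l = ?r")
  proof
   assume l: ?l
   show ?r
   proof (intro allI impI)
    fix i j assume ij: "i < m" "j < m" "bt g i & bt g j"
    have h: "{fst (es p ! i), snd (es p ! i)} \<in> eset (es p) g" "{fst (es p ! j), snd (es p ! j)} \<in> eset (es p) g"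
     using ij unfolding eset_def m_def eds_def by blast+
    from bspec[OF bspec[OF l h(1)] h(2)]
    show "\<forall>a\<in>{fst (es p ! i), snd (es p ! i)}. \<forall>c\<in>{fst (es p ! j), snd (es p ! j)}. a = c \<or> {a, c} \<in> eset (es p) g" .
   qed
  next
   assume rr: ?r
   show ?l
   proof (intro ballI)
    fix e e' a c assume h: "e \<in> eset (es p) g" "e' \<in> eset (es p) g" "a \<in> e" "c \<in> e'"
    obtain i where i: "i < m" "bt g i" "e = {fst (es p ! i), snd (es p ! i)}" using h(1) unfolding eset_def m_def eds_def by blast
    obtain j where j: "j < m" "bt g j" "e' = {fst (es p ! j), snd (es p ! j)}" using h(2) unfolding eset_def m_def eds_def by blast
    show "a = c \<or> {a, c} \<in> eset (es p) g" using rr[rule_format, OF i(1) j(1), of a c] i j h by simp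
   qed
  qed
  also have "\<dots> <-> (ALL i<m. ALL j<m. bt g i & bt g j -->
   (\<forall>a\<in>{fst (es p ! i), snd (es p ! i)}. \<forall>c\<in>{fst (es p ! j), snd (es p ! j)}. a = c \<or>
    ar s1 3 (ar s 1 a + ar s 1 c) ~= 0 & bt g (ar s1 3 (ar s 1 a + ar s 1 c) - 1)))"
  proof -
   have "a = c \<or> {a, c} \<in> eset (es p) g <-> a = c \<or> ar s1 3 (ar s 1 a + ar s 1 c) ~= 0 & bt g (ar s1 3 (ar s 1 a + ar s 1 c) - 1)"
    if "i < m" "j < m" "a \<in> {fst (es p ! i), snd (es p ! i)}" "c \<in> {fst (es p ! j), snd (es p ! j)}" for i j a c
   proof -
    have "a \<in> set vs" "c \<in> set vs" using vv[OF that(1)] vv[OF that(2)] that(3,4) by blast+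
    from in_[OF this] show ?thesis by blast
   qed
   then show ?thesis by (intro all_cong imp_cong ball_cong refl) blast+
  qed
  finally show ?thesis .
 qed
 have tabm: "ar s1 3 x \<le> m" for x
 proof (cases "x \<in> key ` set (es p)")
  case True
  then obtain e where e: "e \<in> set (es p)" "x = key e" by (rule imageE) simp
  then obtain j where "j < length (es p)" "es p ! j = e" using in_set_conv_nth[of e "es p"] by blast
  then have "ar s1 3 x = Suc j" "Suc j \<le> m" using tab e unfolding m_def by auto
  then show ?thesis by simp
 next
  case False then have "ar s1 3 x = 0" using L(3) by blast
  then show ?thesis by simp
 qed
 {
  assume b: "gv s4 19 = 0" and f5: "gv s5 20 ~= 0"
  note S = st[OF b]
  have ok5: "okst t5"
  proof -
   have "cfg k n t5" using c4 S(8) unfolding cfg_def t5 t4 by simp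
   then show ?thesis using cfg_okst[of k n t5] S(8)[of 9] g13 S(6) unfolding t5 by simp
  qed
  have g: "gv t5 2 = k" "gv t5 13 = m" "gv t5 29 = 0" "gv t5 9 = r" "gv t5 0 = 1024 * 4 ^ k"
   using S(8) g4 g0 g13 z c unfolding t5 cfg_def by simp_all
  have o: "outl t5 k []" using g(3) z a3(6) unfolding outl_def t5 S(9) by simp
  have e85: "ar t5 8 j = fst (es p ! j)" "ar t5 9 j = snd (es p ! j)" if "j < m" for j
   using e8 that unfolding t5 S(9) a4 by blast+
  have cl5: "ar t5 4 (ar t5 2 v) - 1 = cl v" for v unfolding t5 S(9) a3 cl_def ..
  have clr: "cl (fst (es p ! j)) < r & cl (snd (es p ! j)) < r" if "j < m" for j
  proof -
   have e: "{fst (es p ! j), snd (es p ! j)} \<in> E p" using cs.nth_edge that unfolding m_def .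
   then have "{snd (es p ! j), fst (es p ! j)} \<in> E p" using cs.sym by blast
   then show ?thesis using e cs.cl cs.Ep_vs[OF e] by blast
  qed
  have lb5: "LBs t5 = Lb" unfolding Lb_def by (rule LBs_cong) (simp_all add: t5)
  have A: "{j. j < m & LBs t5 (ar t5 4 (ar t5 2 (ar t5 8 j)) - 1) x & LBs t5 (ar t5 4 (ar t5 2 (ar t5 9 j)) - 1) x} = cs.Ax Lb x" for x
   unfolding cl5 lb5 cs.Ax_def m_def[symmetric] using e85 by auto
  have clc: "ar t5 4 (ar t5 2 (ar t5 8 j)) - 1 < gv t5 9 & ar t5 4 (ar t5 2 (ar t5 9 j)) - 1 < gv t5 9" if "j < m" for j
   unfolding cl5 g(4) e85[OF that] using clr[OF that] .
  define s6 where "s6 = run bFin t5"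
  define s7 where "s7 = run bPad s6"
  have o6: "outl s6 k L1" "steps bFin t5 \<le> 1 + k * (8 + 4 * m)"
   using bFin[OF ok5 g(1,2) o clc] unfolding A L1_def s6_def by simp_all
  have g6: "gv s6 2 = k" "gv s6 13 = m" "gv s6 0 = 1024 * 4 ^ k" using g by (simp_all add: s6_def run_gv mF)
  have a6: "ar s6 a = ar s3 a" if "a \<notin> {6, 7}" for a using that S(9) by (simp add: s6_def run_ar mF t5)
  have q6: "eval tclq t [] ~= 0 <-> Q x"
   if t: "x < N2" "gv t 23 = x" "gv t 0 = gv s6 0" "gv t 13 = gv s6 13" "!!a. a \<in> {1, 3, 8, 9} ==> ar t a = ar s6 a" for t x
  proof (cases "m < k")
   case True
   have ta: "ar t 1 = ar s 1" "ar t 3 = ar s1 3" "ar t 8 = ar s1 8" "ar t 9 = ar s1 9" using t(5) a6 a3 by simp_all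
   have "m \<le> gv t 0" using True k_less_M(1)[of k] unfolding t(3) g6 by linarith
   then have "eval tclq t [] ~= 0 <-> (ALL i<m. ALL j<m. bt x i & bt x j -->
    (\<forall>a\<in>{ar s1 8 i, ar s1 9 i}. \<forall>c\<in>{ar s1 8 j, ar s1 9 j}. a = c \<or>
     ar s1 3 (ar s 1 a + ar s 1 c) ~= 0 & bt x (ar s1 3 (ar s 1 a + ar s 1 c) - 1)))"
    using eval_tclq[of t] tabm t(2,4) g6(2) unfolding ta by simp
   also have "\<dots> <-> Q x" unfolding Qiff
   proof -
    have "ar s1 8 i = fst (es p ! i)" "ar s1 9 i = snd (es p ! i)" if "i < m" for i using L(2) that by blast+
    then show "(ALL i<m. ALL j<m. bt x i & bt x j -->
    (\<forall>a\<in>{ar s1 8 i, ar s1 9 i}. \<forall>c\<in>{ar s1 8 j, ar s1 9 j}. a = c \<or>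
     ar s1 3 (ar s 1 a + ar s 1 c) ~= 0 & bt x (ar s1 3 (ar s 1 a + ar s 1 c) - 1))) <->
     (ALL i<m. ALL j<m. bt x i & bt x j -->
   (\<forall>a\<in>{fst (es p ! i), snd (es p ! i)}. \<forall>c\<in>{fst (es p ! j), snd (es p ! j)}. a = c \<or>
    ar s1 3 (ar s 1 a + ar s 1 c) ~= 0 & bt x (ar s1 3 (ar s 1 a + ar s 1 c) - 1)))"
     by (intro all_cong imp_cong refl) simp
   qed
   finally show ?thesis .
  next
   case False
   then have x: "x = 0" using t(1) by (simp add: N2_def)
   have "Q 0" unfolding Qiff by (simp add: bt_def)
   moreover have "eval tclq t [] ~= 0" by (rule eval_tclq_0) (use t x in simp)
   ultimately show ?thesis using x by simp
  qed
  have o7: "outl s7 k L2" "steps bPad s6 \<le> 6 + 9 * m + 7 * N2"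
  proof -
   show "outl s7 k L2" unfolding s7_def L2_def N2_def
    by (rule bPad(1)[OF g6(1,2) o6(1)], rule q6[unfolded N2_def], assumption+)
   show "steps bPad s6 \<le> 6 + 9 * m + 7 * N2" unfolding N2_def
    by (rule bPad(2)[OF g6(1,2) o6(1), where Q=Q], rule q6[unfolded N2_def], assumption+)
  qed
  have ro7: "run bOut t5 = run (Asg 20 (tEq (Glob 29) (Glob 2))) s7" "steps bOut t5 = steps bFin t5 + (steps bPad s6 + 1)"
   unfolding bOut_def s7_def s6_def by simp_all
  have g7: "gv s7 2 = k" "gv s7 29 = length L2" using g6 o7(1) by (simp_all add: s7_def run_gv mP outl_def)
  have o1: "gv (run bOut t5) 20 = of_bool (length L2 = k)" and o2: "ar (run bOut t5) 7 = ar s7 7" unfolding ro7 using g7 by simp_all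
  have "ALL i<length L2. ar s7 7 i = L2 ! i" using o7(1) unfolding outl_def by blast
  then have o3: "ALL i<length L2. ar (run bOut t5) 7 i = L2 ! i" unfolding o2 .
  have "N2 \<le> 2 ^ k" by (simp add: N2_def)
  then have "steps bOut t5 \<le> 8 + k * (8 + 4 * m) + 9 * m + 7 * 2 ^ k" unfolding ro7 using o6(2) o7(2) by linarith
  note o1 o3 this
 } note out = this
 have L1s: "set L1 = (%x. set_encode (cs.Ax Lb x)) ` {..<k}"
  unfolding L1_def by (subst fold_addl_all) (simp_all add: atLeast0LessThan)
 have L1d: "distinct L1" "length L1 \<le> k"
  unfolding L1_def using fold_addl[of "[]" k "map (%x. set_encode (cs.Ax Lb x)) [0..<k]"] by simp_all
 have L2p: "distinct L2" "length L2 \<le> k" "set L1 \<subseteq> set L2" "set L2 \<subseteq> set L1 \<union> ((%j. 2 ^ j) ` {..<m} \<union> {g. g < N2 & Q g})"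
  "length L2 < k ==> (%j. 2 ^ j) ` {..<m} \<subseteq> set L2 & {g. g < N2 & Q g} \<subseteq> set L2"
 proof -
  define cand where "cand = map (%j. (2::nat) ^ j) [0..<m] @ filter Q [0..<N2]"
  have sc: "set cand = (%j. 2 ^ j) ` {..<m} \<union> {g. g < N2 & Q g}" by (auto simp: cand_def)
  have L2: "L2 = fold (addl k) cand L1" by (simp add: L2_def cand_def)
  show "distinct L2" "length L2 \<le> k" "set L1 \<subseteq> set L2" "set L2 \<subseteq> set L1 \<union> ((%j. 2 ^ j) ` {..<m} \<union> {g. g < N2 & Q g})"
   unfolding sc[symmetric] L2 using fold_addl[of L1 k cand] L1d by simp_all
  assume "length L2 < k"
  from fold_addl_full[OF this[unfolded L2]]
  show "(%j. 2 ^ j) ` {..<m} \<subseteq> set L2 & {g. g < N2 & Q g} \<subseteq> set L2" unfolding sc L2[symmetric] by blast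
 qed
 have N2m: "N2 \<le> 2 ^ m" by (simp add: N2_def)
 have pow_Q: "Q (2 ^ j)" if "j < m" for j
  unfolding Q_def clique_edge_set_iff[OF E_nsets[OF p(1)] cs.eset_sub]
 proof (intro ballI)
  have bb: "bt (2 ^ j) i <-> i = j" for i using bt_set_encode[of "{j}" i] by simp
  have F: "eset (es p) (2 ^ j) = {eds (es p ! j)}" using that unfolding eset_def bb m_def by blast
  fix e e' a c assume "e \<in> eset (es p) (2 ^ j)" "e' \<in> eset (es p) (2 ^ j)" "a \<in> e" "c \<in> e'"
  then show "a = c \<or> {a, c} \<in> eset (es p) (2 ^ j)" unfolding F eds_def by auto
 qed
 {
  assume f': "gv s' 20 ~= 0"
  have b: "gv s4 19 = 0"
  proof (rule ccontr)
   assume "gv s4 19 ~= 0"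
   then have "s' = t4" unfolding ro sv by simp
   then show False using f' g20 t4(1) by simp
  qed
  have f5: "gv s5 20 ~= 0"
  proof
   assume "gv s5 20 = 0"
   then have "s' = t5" unfolding ro sv using b by simp
   then show False using f' \<open>gv s5 20 = 0\<close> t5(1) by simp
  qed
  note O = out[OF b f5]
  have sr: "s' = run bOut t5" unfolding ro sv using b f5 by simp
  have len: "length L2 = k" using f' O(1) unfolding sr by (cases "length L2 = k") simp_all
  have ck: "chks r k (adjs s3) Lb" using LK[OF f5 b] unfolding Lb_def .
  have L2c: "(EX x<k. g = set_encode (cs.Ax Lb x)) \<or> (EX j<m. g = 2 ^ j) \<or> (g < N2 & Q g)" if "g \<in> set L2" for g
   using subsetD[OF L2p(4) that] unfolding L1s Un_iff image_iff Bex_def lessThan_iff mem_Collect_eq .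
  have small: "g < 2 ^ m & Q g" if "g \<in> set L2" for g
   using L2c[OF that]
  proof (elim disjE exE conjE)
   fix x assume "x < k" "g = set_encode (cs.Ax Lb x)"
   then show ?thesis using cs.Ax_mask(1) cs.Ax_clique[OF ck] unfolding m_def Q_def by simp
  next
   fix j assume "j < m" "g = 2 ^ j" then show ?thesis using pow_Q by simp
  next
   assume "g < N2" "Q g" then show ?thesis using N2m by linarith
  qed
  have ec: "edge_clique_cover (set vs) (E p) (eset (es p) ` set L2)"
   unfolding edge_clique_cover_def
  proof (intro conjI ballI)
   fix F assume "F \<in> eset (es p) ` set L2"
   then obtain g where "F = eset (es p) g" "g \<in> set L2" by (rule imageE)
   then show "clique_edge_set (set vs) (E p) F" using small[of g] unfolding Q_def by simp
  next
   fix e assume "e \<in> E p"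
   from cs.Ax_cover[OF ck this] obtain x where x: "x < k" "e \<in> eset (es p) (set_encode (cs.Ax Lb x))" by blast
   have "set_encode (cs.Ax Lb x) \<in> set L1" unfolding L1s using x(1) by (intro imageI) simp
   then have "eset (es p) (set_encode (cs.Ax Lb x)) \<in> eset (es p) ` set L2" by (intro imageI subsetD[OF L2p(3)])
   then show "\<exists>F\<in>eset (es p) ` set L2. e \<in> F" using x(2) by (rule bexI[rotated])
  qed
  show "EX L. length L = k & (ALL i<k. ar s' 7 i = L ! i) & distinct L & (\<forall>f\<in>set L. f < 2 ^ m) &
   edge_clique_cover (set vs) (E p) (eset (es p) ` set L) & (ALL i<T. lab i <-> E i = E p)"
  proof (intro exI[of _ L2] conjI)
   show "ALL i<k. ar s' 7 i = L2 ! i" using O(2) unfolding sr len .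
   show "\<forall>f\<in>set L2. f < 2 ^ m" using small by simp
  qed (rule len L2p(1) ec st(7)[OF b])+
 }
 {
  assume f': "gv s' 20 = 0"
  show "~ sol F"
  proof
   assume so: "sol F"
   have F: "F \<subseteq> Pow (nsets (set vs) 2)" "card F = k" using so unfolding sol_def by blast+
   have fin: "finite F" by (rule finite_sub[OF F(1)])
   have ecc: "edge_clique_cover (set vs) (E p) F" and EE: "ALL i<T. lab i <-> E i = E p" using sol_pos[OF p so] by blast+
   have b: "gv s4 19 = 0" unfolding g19 C(1) using EE cs.labels_of_cover(2)[OF ecc F(2) fin] by blast
   have f5: "gv s5 20 ~= 0"
   proof
    assume n5: "gv s5 20 = 0"
    from cs.labels_of_cover(1)[OF ecc F(2) fin] obtain lb where
     lb: "ALL i<r. lb i \<subseteq> {..<k}" "ALL i<r. ALL j<r. (i = j \<or> adjs s3 i j) <-> lb i \<inter> lb j ~= {}" by blast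
    have M2: "2 * 2 ^ (k - hh k div 4) \<le> gv t4 0" using st(5)[OF b] c4 unfolding okst_def cfg_def by linarith
    have sy: "adjs s3 i j <-> adjs s3 j i" for i j unfolding adjs_def by (simp add: add.commute)
    have "EX b<2 ^ N. chks r k (adjs s3) (lbof (k < 2 ^ 63) (gv t4 0) k (2 ^ (k - hh k div 4)) (9 * hh k) (2 ^ (k - 2 * hh k)) r b (adjs s3))"
     unfolding N_def by (rule search_complete[OF M2 st(6)[OF b] sy, of lb]) (use lb in blast)+
    then obtain bb where "bb < 2 ^ N" "chks r k (adjs s3) (lbof (k < 2 ^ 63) (gv t4 0) k (2 ^ (k - hh k div 4)) (9 * hh k) (2 ^ (k - 2 * hh k)) r bb (adjs s3))" by blast
    moreover have "gv t4 6 = 2 ^ (k - hh k div 4)" "gv t4 8 = 9 * hh k" "gv t4 7 = 2 ^ (k - 2 * hh k)" using c4 unfolding cfg_def by blast+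
    ultimately show False using st(1)[OF b n5, of bb] by simp
   qed
   note O = out[OF b f5]
   have "s' = run bOut t5" unfolding ro sv using b f5 by simp
   then have "length L2 ~= k" using f' O(1) by (cases "length L2 = k") simp_all
   then have len: "length L2 < k" using L2p(2) by simp
   have lc: "card (set L2) < k" using len distinct_card[OF L2p(1)] by simp
   \<comment> \<open>The list stayed short, so no candidate was refused. For
     \<open>m \<ge> k\<close> the single edges alone would have filled it. For \<open>m < k\<close>
     it contains every clique of the graph, whereas a solution consists of \<open>k\<close>
     different cliques.\<close>
   show False
   proof (cases "m < k")
    case False
    have "card ((%j. (2::nat) ^ j) ` {..<m}) = m" by (subst card_image) (auto intro: inj_onI)
    moreover have "card ((%j. (2::nat) ^ j) ` {..<m}) \<le> card (set L2)" using L2p(5)[OF len] by (intro card_mono) auto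
    ultimately show False using lc False by linarith
   next
    case True
    have "F \<subseteq> eset (es p) ` set L2"
    proof
     fix G assume G: "G \<in> F"
     have q: "clique_edge_set (set vs) (E p) G" using ecc G unfolding edge_clique_cover_def by blast
     have "G \<subseteq> set (map eds (es p))" using clique_edge_set_sub[OF q] unfolding E_eds .
     then obtain g where "g < 2 ^ m" "eset (es p) g = G" using eset_encode[OF dist_eds[OF p(1)]] unfolding m_def by blast
     then have "g < N2" "Q g" "G = eset (es p) g" using True q unfolding Q_def by (simp_all add: N2_def)
     then show "G \<in> eset (es p) ` set L2" using subsetD[OF conjunct2[OF L2p(5)[OF len]], of g] by simp
    qed
    then have "card F \<le> card (set L2)" using card_mono[of "eset (es p) ` set L2" F] card_image_le[of "set L2" "eset (es p)"] by simp
    then show False using lc F(2) by linarith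
   qed
  qed
 }
 assume SS: "3 + n + (\<Sum>i<T. 2 + 2 * length (es i)) \<le> S"
 define X where "X = 4 ^ k * S * Zk"
 have Z1: "1 \<le> Zk" unfolding Zk_def by simp
 have X0: "4 ^ k * S \<le> X" unfolding X_def using Z1 by simp
 have "S * 1 \<le> S * 4 ^ k" by (intro mult_le_mono2) simp
 then have XS: "S \<le> X" using X0 mult.commute[of S "4 ^ k"] by linarith
 have S1: "1 \<le> S" using SS by linarith
 have "4 ^ k * 1 \<le> 4 ^ k * S" using S1 by (intro mult_le_mono2)
 then have X4: "4 ^ k \<le> X" using X0 by linarith
 have sm: "2 + 2 * length (es i) \<le> (\<Sum>i<T. 2 + 2 * length (es i))" if "i < T" for i
  by (rule member_le_sum) (use that in auto)
 have mS': "m \<le> S" using sm[OF p(1)] SS unfolding m_def by linarith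
 have km: "k * m \<le> X"
 proof -
  have "k * m \<le> 4 ^ k * S" using k_less_M(1)[of k] mS' by (rule mult_le_mono)
  then show ?thesis using X0 by linarith
 qed
 have "(\<Sum>i<T. 12 + 4 * length (es i)) \<le> (\<Sum>i<T. 6 * (2 + 2 * length (es i)))" by (rule sum_mono) simp
 then have sc: "(\<Sum>i<T. 12 + 4 * length (es i)) \<le> 6 * S" unfolding sum_distrib_left[symmetric] using SS by linarith
 have sR: "steps bRcheck s3 \<le> 2" by (rule order_trans[OF steps_flat]) (simp_all add: bRcheck_def)
 have sS: "steps bSolve s4 \<le> 20 + 8 * k + 4 * (k * m) + 9 * m + 7 * 2 ^ k + 7 * X"
 proof (cases "gv s4 19 = 0")
  case False then show ?thesis unfolding sv by simp
 next
  case True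
  have "(2::nat) ^ N \<le> Zk"
  proof (cases "k < 2 ^ 63")
   case True
   have "(2::nat) ^ (k * r) \<le> 2 ^ (k * 2 ^ k)" using st(6)[OF \<open>gv s4 19 = 0\<close>] by (intro power_increasing mult_le_mono2) simp_all
   then show ?thesis unfolding N_def Zk_def if_P[OF True] .
  next
   case False
   then show ?thesis unfolding N_def Zk_def if_not_P[OF False] by (rule_tac order_refl)
  qed
  moreover have "Zk * (1 * 1) \<le> Zk * (4 ^ k * S)" using S1 by (intro mult_le_mono2 mult_le_mono) simp_all
  ultimately have ZN: "2 ^ N \<le> X" unfolding X_def using mult.commute[of Zk "4 ^ k * S"] by linarith
  have "N \<le> 2 ^ N" using less_exp[of N] by simp
  then have sB: "steps bSearch t4 \<le> 5 + 7 * X" using st(4)[OF True] ZN by linarith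
  show ?thesis
  proof (cases "gv s5 20 = 0")
   case t: True
   then show ?thesis unfolding sv using True sB by simp
  next
   case False
   have "steps bOut t5 \<le> 8 + 8 * k + 4 * (k * m) + 9 * m + 7 * 2 ^ k" using out(3)[OF True False] by (simp add: algebra_simps)
   then show ?thesis unfolding sv using True False sB by simp
  qed
 qed
 show "steps bPos s \<le> 100 * (4 ^ k * S * Zk)"
  unfolding so X_def[symmetric] using L(5) C(2) R(4) sR sS sc km XS X4 S1 SS mS' k_less_M(1,2)[of k] unfolding m_def[symmetric] by linarith
qed

end

section \<open>The algorithm\<close>

lemma ecc_empty: "edge_clique_cover V {} {{}}" "edge_clique_cover V E {} <-> E = {}"
 by (auto simp: edge_clique_cover_def clique_edge_set_def nsets_def intro!: exI[of _ "{}"])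

lemma ecc_single:
 assumes "e \<in> nsets V 2" "\<F> \<subseteq> {{}, {e}}" "{e} \<in> \<F>"
 shows "edge_clique_cover V {e} \<F>"
proof -
 obtain a c where e: "e = {a, c}" "a ~= c" "a \<in> V" "c \<in> V" using assms(1) by (auto simp: nsets_def card_2_iff)
 have "clique_edge_set V {e} {e}" by (subst clique_edge_set_iff) (use assms(1) e in auto)
 moreover have "clique_edge_set V {e} {}" by (subst clique_edge_set_iff) (use assms(1) in auto)
 ultimately show ?thesis unfolding edge_clique_cover_def using assms(2,3) by blast
qed

context input
begin

text \<open>On three or more vertices failure means that the listed edges have fewer than
  \<open>k\<close> subsets, which happens only if all edges are listed, so that no family of size
  \<open>k\<close> exists at all. On at most two vertices the possible families consist of the empty
  set and the set of the single edge, and each choice is refuted by a sample.\<close>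

lemma bNeg_sol:
 assumes "inp s = f" "gv s 2 = k" "gv s 3 = n" and nl: "ALL i<T. ~ lab i"
  and he: "gv s 17 ~= 0 <-> (EX i<T. es i = [])" and hn: "gv s 18 ~= 0 <-> (EX i<T. es i ~= [])"
 defines "s' \<equiv> run bNeg s" and "el \<equiv> edgs (min n (k + 3))"
 shows "distinct (map eds el)" "set (map eds el) \<subseteq> nsets (set vs) 2"
  "gv s' 20 ~= 0 ==> EX L. length L = k & (ALL i<k. ar s' 7 i = L ! i) & distinct L & (\<forall>f\<in>set L. f < 2 ^ length el) &
   (ALL i<T. ~ edge_clique_cover (set vs) (E i) (eset el ` set L))"
  "gv s' 20 = 0 ==> ~ sol F"
proof -
 define n' where "n' = min n (k + 3)"
 define m where "m = length el"
 define lo where "lo = (if 2 < n then 4 - k else of_bool (k = 1 & gv s 17 ~= 0))"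
 note B = bNeg[OF assms(1-3), folded s'_def el_def, folded lo_def m_def]
 have n': "n' \<le> n" by (simp add: n'_def)
 have el: "el = edgs n'" by (simp add: el_def n'_def)
 have es: "distinct (map eds el)" "set (map eds el) = nsets (set (take n' vs)) 2" using edgs_set[OF n'] unfolding el by blast+
 have sub: "nsets (set (take n' vs)) 2 \<subseteq> nsets (set vs) 2" using set_take_subset[of n' vs] unfolding nsets_def by blast
 show "distinct (map eds el)" by (rule es)
 show "set (map eds el) \<subseteq> nsets (set vs) 2" unfolding es(2) by (rule sub)
 have "card (set (take n' vs)) = n'" using distinct_card[of "take n' vs"] lvs n' by simp
 then have "card (nsets (set (take n' vs)) 2) = n' choose 2" by (simp add: card_nsets)
 then have m: "m = n' choose 2" using distinct_card[OF es(1)] unfolding es(2) m_def by simp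
 have all: "set (map eds el) = nsets (set vs) 2" if "n \<le> k + 3" using es(2) that lvs unfolding n'_def by simp
 have kle: "k \<le> 2 ^ m" if "n \<le> k + 3" "sol F"
 proof -
  have "F \<subseteq> Pow (set (map eds el))" using that(2) all[OF that(1)] unfolding sol_def by simp
  then have "card F \<le> card (Pow (set (map eds el)))" by (rule card_mono[rotated]) simp
  also have "\<dots> = 2 ^ m" using distinct_card[OF es(1)] by (simp add: card_Pow m_def)
  finally show ?thesis using that(2) unfolding sol_def by simp
 qed
 have Ei: "E i = {} <-> es i = []" for i by (simp add: E_def)
 have cover: "E i = \<Union>(eset el ` A)" if "edge_clique_cover (set vs) (E i) (eset el ` A)" for i A
  by (rule ecc_Union[OF that])
 let ?L = "map (%i. lo + i) [0..<k]"
 have setL: "set ?L = {lo..<lo + k}" by (auto simp: image_iff)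
 {
  assume f': "gv s' 20 ~= 0"
  have big: "lo + k \<le> 2 ^ m \<or> k = 0" using f' B(2) by (auto split: if_splits)
  have no: "~ edge_clique_cover (set vs) (E i) (eset el ` set ?L)" if i: "i < T" for i
  proof
   assume e: "edge_clique_cover (set vs) (E i) (eset el ` set ?L)"
   show False
   proof (cases "k = 0")
    case True
    then have "E i = {}" using e by (simp add: ecc_empty)
    then show False using f' B(2) True he i unfolding Ei by auto
   next
    case k0: False
    show False
    proof (cases "2 < n")
     case True
     then have n3: "3 \<le> n'" by (simp add: n'_def)
     define w where "w = concat (map (%j. map (%i. (vs ! i, vs ! j)) [0..<j]) [3..<n'])"
     have "[0..<n'] = [0, 1, 2] @ [3..<n']" using n3 upt_add_eq_append[of 0 3 "n' - 3"] by (simp add: upt_rec numeral_2_eq_2 numeral_3_eq_3 One_nat_def)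
     then have el3: "el = [(vs ! 0, vs ! 1), (vs ! 0, vs ! 2), (vs ! 1, vs ! 2)] @ w"
      unfolding el edgs_def w_def by (simp add: upt_rec numeral_2_eq_2 One_nat_def)
     have v: "vs ! 1 ~= vs ! 2" "vs ! 0 ~= vs ! 1" "vs ! 0 ~= vs ! 2" using True lvs by (simp_all add: nth_eq_iff_index_eq)
     have lo: "lo = 4 - k" using True by (simp add: lo_def)
     have "4 - k \<le> 3" "3 < 4 - k + k" using k0 by arith+
     then have "3 \<in> set ?L" unfolding setL lo by simp
     then have cq: "clique_edge_set (set vs) (E i) (eset el 3)" using e unfolding edge_clique_cover_def by blast
     have b0: "bt 3 0" "bt 3 1" by (simp_all add: bt_def)
     have b2: "~ bt 3 j" if "2 \<le> j" for j
     proof -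
      have "(2::nat) ^ 2 \<le> 2 ^ j" using that by (intro power_increasing) simp_all
      then have "(3::nat) < 2 ^ j" by simp
      then show ?thesis by (simp add: bt_def)
     qed
     have F: "eset el 3 = {{vs ! 0, vs ! 1}, {vs ! 0, vs ! 2}}"
     proof (rule set_eqI)
      fix e
      have "e \<in> eset el 3 <-> (EX j. e = eds (el ! j) & j < length el & bt 3 j)" unfolding eset_def by blast
      also have "\<dots> <-> e = eds (el ! 0) \<or> e = eds (el ! 1)"
      proof -
       have j: "j < length el & bt 3 j <-> j = 0 \<or> j = 1" for j
       proof (cases "2 \<le> j")
        case True then show ?thesis using b2 by auto
       next
        case False
        then have "j = 0 \<or> j = 1" by auto
        then show ?thesis using b0 by (auto simp: el3)
       qed
       show ?thesis unfolding j by blast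
      qed
      also have "\<dots> <-> e \<in> {{vs ! 0, vs ! 1}, {vs ! 0, vs ! 2}}" by (simp add: el3 eds_def One_nat_def)
      finally show "e \<in> eset el 3 <-> e \<in> {{vs ! 0, vs ! 1}, {vs ! 0, vs ! 2}}" .
     qed
     have "\<forall>e\<in>eset el 3. \<forall>e'\<in>eset el 3. \<forall>a\<in>e. \<forall>c\<in>e'. a = c \<or> {a, c} \<in> eset el 3"
      using cq clique_edge_set_iff[OF E_nsets[OF i] clique_edge_set_sub[OF cq]] by blast
     \<comment> \<open>A clique containing both edges contains the third edge of the triangle, which
       mask 3 leaves out.\<close>
     then have "{vs ! 1, vs ! 2} \<in> eset el 3" unfolding F using v by auto
     then show False unfolding F using v by (auto simp: doubleton_eq_iff)
    next
     case n2: False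
     have lk: "lo + k \<le> 2 ^ m" "~ (gv s 18 ~= 0 & 2 \<le> lo + k)" using f' B(2) k0 n2 by (auto split: if_splits)
     have lo1: "lo \<le> 1" using n2 by (simp add: lo_def)
     show False
     proof (cases "2 \<le> lo + k")
      case True
      then have "E i = {}" using lk(2) hn i unfolding Ei by blast
      moreover have "m ~= 0" using True lk(1) by (intro notI) simp
      then have "eds (el ! 0) \<in> eset el 1" unfolding eset_def m_def bt_def by force
      moreover have "1 \<in> set ?L" unfolding setL using lo1 True k0 by simp
      ultimately show False using cover[OF e] by blast
     next
      case False
      then have k1: "k = 1" "lo = 0" using k0 by simp_all
      then have nh: "gv s 17 = 0" using n2 by (simp add: lo_def split: if_splits)
      have "set ?L = {0}" unfolding setL k1 by auto
      moreover have "eset el 0 = {}" by (simp add: eset_def bt_def)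
      ultimately have "E i = {}" using cover[OF e] by simp
      then show False using nh he i unfolding Ei by blast
     qed
    qed
   qed
  qed
  have dl: "distinct ?L" by (simp add: distinct_map inj_on_def)
  have sm: "\<forall>f\<in>set ?L. f < 2 ^ m" unfolding setL using big by auto
  have "ALL i<k. ar s' 7 i = ?L ! i" using B(3) by simp
  then show "EX L. length L = k & (ALL i<k. ar s' 7 i = L ! i) & distinct L & (\<forall>f\<in>set L. f < 2 ^ length el) &
   (ALL i<T. ~ edge_clique_cover (set vs) (E i) (eset el ` set L))"
   using dl sm no unfolding m_def by (intro exI[of _ ?L] conjI) (simp_all only: length_map length_upt minus_nat.diff_0, blast)
 }
 {
  assume f': "gv s' 20 = 0"
  show "~ sol F"
  proof
   assume so: "sol F"
   have F: "F \<subseteq> Pow (nsets (set vs) 2)" "card F = k" and ne: "!!i. i < T ==> ~ edge_clique_cover (set vs) (E i) F"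
    using so nl unfolding sol_def by blast+
   have fin: "finite F" by (rule finite_sub[OF F(1)])
   show False
   proof (cases "k = 0")
    case True
    then have "gv s 17 ~= 0" using f' B(2) by simp
    then obtain i where "i < T" "E i = {}" using he Ei by blast
    moreover have "F = {}" using F(2) True fin by simp
    ultimately show False using ne[of i] by (simp add: ecc_empty)
   next
    case k0: False
    show False
    proof (cases "2 < n")
     case True
     then have "3 \<le> n'" by (simp add: n'_def)
     then have "3 * 2 \<le> n' * (n' - 1)" by (intro mult_le_mono) simp_all
     then have m3: "3 \<le> m" unfolding m choose_two by simp
     have "(2::nat) ^ 3 \<le> 2 ^ m" using m3 by (intro power_increasing) simp_all
     then have m8: "4 \<le> (2::nat) ^ m" by simp
     have "~ lo + k \<le> 2 ^ m" using f' B(2) k0 True by (auto split: if_splits)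
     then have km: "2 ^ m < k" using m8 True unfolding lo_def by (simp split: if_splits)
     \<comment> \<open>If all vertices are listed, \<open>2 ^ m < k\<close> contradicts the
       existence of \<open>k\<close> different sets of edges. If the list was cut off at
       \<open>k + 3\<close> vertices, then \<open>k \<le> m < 2 ^ m\<close>.\<close>
     show False
     proof (cases "n \<le> k + 3")
      case True then show False using kle[OF True so] km by simp
     next
      case False
      then have "n' = k + 3" by (simp add: n'_def)
      then have "2 * (k + 3) \<le> n' * (n' - 1)" by (simp add: algebra_simps)
      then have "k \<le> m" unfolding m choose_two by simp
      then have "k < 2 ^ m" using less_exp[of k] power_increasing[of k m "2::nat"] by linarith
      then show False using km by simp
     qed
    next
     case n2: False
     have nk: "n \<le> k + 3" using n2 by simp
     have k2m: "k \<le> 2 ^ m" by (rule kle[OF nk so])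
     have "n' = n" using n2 by (simp add: n'_def)
     then have mn: "m = n choose 2" using m by simp
     have m1: "m \<le> 1" using n2 unfolding mn choose_two by (cases n; cases "n - 1") (auto simp: One_nat_def numeral_2_eq_2)
     have cV: "nsets (set vs) 2 = set (map eds el)" using all[OF nk] by simp
     have lo: "lo = of_bool (k = 1 & gv s 17 ~= 0)" using n2 by (simp add: lo_def)
     have nf: "~ lo + k \<le> 2 ^ m \<or> (gv s 18 ~= 0 & 2 \<le> lo + k)" using f' B(2) k0 n2 by (auto split: if_splits)
     have E0: "EX i<T. E i = {}" if "gv s 17 ~= 0" using he that Ei by blast
     show False
     proof (cases "m = 0")
      case True
      then have "nsets (set vs) 2 = {}" using cV unfolding m_def by simp
      then have FF: "F \<subseteq> {{}}" using F(1) by simp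
      have k1: "k = 1" using k2m True k0 by simp
      then have F1: "F = {{}}" using F(2) FF by (auto simp: subset_singleton_iff)
      have "gv s 17 ~= 0 \<or> gv s 18 ~= 0" using nf True k1 lo by (auto split: if_splits)
      moreover have "gv s 18 = 0"
      proof (rule ccontr)
       assume "gv s 18 ~= 0"
       then obtain i where "i < T" "E i ~= {}" using hn Ei by blast
       then show False using E_nsets[of i] \<open>nsets (set vs) 2 = {}\<close> by blast
      qed
      ultimately obtain i where "i < T" "E i = {}" using E0 by blast
      then show False using ne[of i] ecc_empty(1) unfolding F1 by metis
     next
      case False
      then have me: "m = 1" using m1 by simp
      define e where "e = eds (el ! 0)"
      have "map eds el = [e]" using me unfolding m_def e_def by (cases el) (simp_all add: One_nat_def)
      then have V1: "nsets (set vs) 2 = {e}" using cV by simp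
      have en: "e \<in> nsets (set vs) 2" unfolding V1 by simp
      have FF: "F \<subseteq> {{}, {e}}" using F(1) unfolding V1 by auto
      have h18: "gv s 18 ~= 0" using nf k2m lo me by (auto split: if_splits)
      then obtain i where i: "i < T" "E i ~= {}" using hn Ei by blast
      then have "E i = {e}" using E_nsets[OF i(1)] unfolding V1 by blast
      then have notE: "{e} \<notin> F" using ne[OF i(1)] ecc_single[OF en FF] by metis
      then have "F \<subseteq> {{}}" using FF by blast
      then have F1: "F = {{}}" "k = 1" using F(2) k0 by (auto simp: subset_singleton_iff)
      then have "gv s 17 ~= 0" using nf me lo by (auto split: if_splits)
      then obtain i where "i < T" "E i = {}" using E0 by blast
      then show False using ne[of i] ecc_empty(1) unfolding F1 by metis
     qed
    qed
   qed
  qed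
 }
qed

end

definition "bCase = If (Glob 14) bPos bNeg"
definition "bMain = blk [bCfg, bScan, bPW, bCase, bEmit]"

context input
begin

lemma emit_answer:
 assumes "gv s 20 ~= 0" "gv s 2 = k" "gv s 13 = length el" "length L = k" "ALL i<k. ar s 7 i = L ! i"
  and d: "distinct (map eds el)" and U: "ALL j<length el. ar s 8 j = fst (el ! j) & ar s 9 j = snd (el ! j)"
  and L: "distinct L" "\<forall>f\<in>set L. f < 2 ^ length el"
 shows "EX ws. let ys = 1 # ws in gv (run bEmit s) 1 = length ys & (\<forall>i\<le>length ys. ar (run bEmit s) 0 i = (length ys # ys) ! i) &
  family_code (eset el ` set L) ws & card (eset el ` set L) = k & length ys \<le> 2 + k * (1 + 2 * length el)"
proof -
 define ws where "ws = k # concat (map (%f. length (sel f (length el)) # ebody (ar s 8) (ar s 9) (sel f (length el))) L)"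
 note B = bEmit[OF assms(1-5), folded ws_def]
 have U': "ar s 8 j = fst (el ! j) & ar s 9 j = snd (el ! j)" if "j < length el" for j using U that by blast
 have L': "f < 2 ^ length el" if "f \<in> set L" for f using L(2) that by blast
 note C = family_code_masks[OF d U' L(1) L']
 have "length (length (sel f (length el)) # ebody (ar s 8) (ar s 9) (sel f (length el))) \<le> 1 + 2 * length el" for f
 proof -
  have "length (ebody (ar s 8) (ar s 9) js) = 2 * length js" for js by (induction js) (simp_all add: ebody_def)
  moreover have "length (sel f (length el)) \<le> length el" unfolding sel_def by (rule order_trans[OF length_filter_le]) simp
  ultimately show ?thesis by simp
 qed
 then have "(\<Sum>f\<leftarrow>L. length (length (sel f (length el)) # ebody (ar s 8) (ar s 9) (sel f (length el)))) \<le> (\<Sum>f\<leftarrow>L. 1 + 2 * length el)"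
  by (intro sum_list_mono)
 then have len: "length (1 # ws) \<le> 2 + k * (1 + 2 * length el)"
  using assms(4) by (simp add: ws_def length_concat o_def sum_list_triv)
 show ?thesis
  by (rule exI[of _ ws]) (use B C len assms(4) in \<open>simp only: Let_def ws_def simp_thms\<close>)
qed

text \<open>The quantity \<open>X = 4 ^ k * S * Zk\<close> serves as a common yardstick: reading is
  linear in \<open>S\<close>, the search in \<open>Zk\<close>, and writing costs about
  \<open>k\<close> times the number of edges. The answer is exact in both branches, with and without
  a positive sample.\<close>

lemma bMain:
 assumes "inp s = f" "gv s 0 = 1024 * 4 ^ k" "gv s 2 = k" "gv s 3 = n"
  and z: "!!x. x \<notin> {0, 2, 3, 22, 23} ==> gv s x = 0" and za: "ar s = (%_ _. 0)"
  and SS: "3 + n + (\<Sum>i<T. 2 + 2 * length (es i)) \<le> S"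
 shows "EX ys. gv (run bMain s) 1 = length ys & (\<forall>i\<le>length ys. ar (run bMain s) 0 i = (length ys # ys) ! i) &
  (if EX F. sol F then EX F ws. sol F & family_code F ws & ys = 1 # ws else ys = [0]) &
  length ys \<le> 500 * (4 ^ k * S * Zk) & steps bMain s \<le> 500 * (4 ^ k * S * Zk)"
proof -
 define s1 where "s1 = run bCfg s"
 define s2 where "s2 = run bScan s1"
 define s3 where "s3 = run bPW s2"
 define t3 where "t3 = tick (tcost (Glob 14) (gv s3 0) + 2) s3"
 define s4 where "s4 = run bCase s3"
 have mC: "gvars bCfg = {4, 5, 6, 7, 8}" "avars bCfg = {}" by (auto simp: bCfg_def)
 have mS: "gvars bScan = {15, 16, 22, 14, 18, 17}" "avars bScan = {}" by (auto simp: bScan_def bScanB_def pinc_def)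
 have mP: "gvars bPW = {23, 22}" "avars bPW = {1, 2}" by (auto simp: bPW_def)
 note c1 = bCfg[OF assms(2-4), folded s1_def]
 have p1: "inp s1 = f" "gv s1 3 = n" "gv s1 14 = 0" "gv s1 17 = 0" "gv s1 18 = 0"
  using assms(1,4) z by (simp_all add: s1_def run_gv mC)
 note c2 = bScan[OF p1, folded s2_def]
 have p2: "inp s2 = f" "gv s2 3 = n" using p1 by (simp_all add: s2_def run_gv mS)
 note c3 = bPW[OF p2, folded s3_def]
 have g3: "gv s3 x = gv s2 x" if "x \<notin> {22, 23}" for x using that by (simp add: s3_def run_gv mP)
 have cf: "cfg k n t3" using c1(1) unfolding cfg_def by (simp add: t3_def s3_def s2_def run_gv mP mS)
 have t3: "inp t3 = f" "gv t3 = gv s3" "ar t3 = ar s3" "gv t3 2 = k" "gv t3 3 = n" using p2 cf unfolding cfg_def by (simp_all add: t3_def s3_def)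
 have zz: "ar t3 3 = (%_. 0)" "ar t3 4 = (%_. 0)" "ar t3 6 = (%_. 0)" "gv t3 9 = 0" "gv t3 19 = 0" "gv t3 20 = 0" "gv t3 29 = 0"
  using za z by (simp_all add: t3_def s3_def s2_def s1_def run_gv run_ar mP mS mC)
 define X where "X = 4 ^ k * S * Zk"
 have Z1: "1 \<le> Zk" unfolding Zk_def by simp
 have X0: "4 ^ k * S \<le> X" unfolding X_def using Z1 by simp
 have S1: "1 \<le> S" "n \<le> S" using SS by linarith+
 have TS: "T \<le> S"
 proof -
  have "(\<Sum>i<T. 1) \<le> (\<Sum>i<T. 2 + 2 * length (es i))" by (rule sum_mono) simp
  then show ?thesis using SS by simp
 qed
 have "S * 1 \<le> S * 4 ^ k" by (intro mult_le_mono2) simp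
 then have XS: "S \<le> X" using X0 mult.commute[of S "4 ^ k"] by linarith
 have "4 ^ k * 1 \<le> 4 ^ k * S" using S1(1) by (intro mult_le_mono2)
 then have X4: "4 ^ k \<le> X" using X0 by linarith
 have kk: "k * k \<le> X"
 proof -
  have "k * k \<le> k * 2 ^ k" using less_exp[of k] by (intro mult_le_mono2) simp
  then show ?thesis using k_less_M(3)[of k] X4 by linarith
 qed
 have kX: "k \<le> X" using k_less_M(1)[of k] X4 by linarith
 have key: "gv s4 2 = k & (EX el. gv s4 13 = length el & distinct (map eds el) & set (map eds el) \<subseteq> nsets (set vs) 2 &
   (ALL j<length el. ar s4 8 j = fst (el ! j) & ar s4 9 j = snd (el ! j)) & k * length el \<le> 20 * X &
   (gv s4 20 ~= 0 --> (EX L. length L = k & (ALL i<k. ar s4 7 i = L ! i) & distinct L & (\<forall>f\<in>set L. f < 2 ^ length el) &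
     (ALL i<T. edge_clique_cover (set vs) (E i) (eset el ` set L) <-> lab i)))) &
   (gv s4 20 = 0 --> (ALL F. ~ sol F)) & steps bCase s3 \<le> 1 + 100 * X + 200 * X"
 proof (cases "gv s3 14 = 0")
  case False
  then have g14: "gv s2 14 ~= 0" using g3[of 14] by simp
  then have "EX p. p < T & lab p & gv s2 14 = ps p" using c2(2) by simp
  then obtain p where p: "p < T" "lab p" "gv s2 14 = ps p" by (elim exE conjE)
  have r: "s4 = run bPos t3" "steps bCase s3 = 1 + steps bPos t3" using False by (simp_all add: s4_def bCase_def t3_def)
  have g: "gv t3 14 = ps p" "gv t3 15 = T" using p(3) c2(1) g3 unfolding t3(2) by simp_all
  have pw: "\<forall>v\<in>set vs. ar t3 1 v = 2 ^ ix v & ar t3 2 v = 2 ^ ix v" using c3(1) unfolding t3(3) .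
  note P = bPos[OF cf t3(1) p(1,2) g pw zz, folded r(1)]
  have km: "k * length (es p) \<le> X"
  proof -
   have "2 + 2 * length (es p) \<le> (\<Sum>i<T. 2 + 2 * length (es i))" by (rule member_le_sum) (use p in auto)
   then have "length (es p) \<le> S" using SS by linarith
   then have "k * length (es p) \<le> 4 ^ k * S" using k_less_M(1)[of k] by (intro mult_le_mono)
   then show ?thesis using X0 by linarith
  qed
  have eq: "edge_clique_cover (set vs) (E i) G <-> lab i"
   if "edge_clique_cover (set vs) (E p) G" "ALL i<T. lab i <-> E i = E p" "i < T" for i G
   using that ecc_Union by metis
  have l: "EX L. length L = k & (ALL i<k. ar s4 7 i = L ! i) & distinct L & (\<forall>f\<in>set L. f < 2 ^ length (es p)) &
     (ALL i<T. edge_clique_cover (set vs) (E i) (eset (es p) ` set L) <-> lab i)" if "gv s4 20 ~= 0"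
  proof -
   from P(4)[OF that] obtain L where L: "length L = k" "ALL i<k. ar s4 7 i = L ! i" "distinct L" "\<forall>f\<in>set L. f < 2 ^ length (es p)"
    "edge_clique_cover (set vs) (E p) (eset (es p) ` set L)" "ALL i<T. lab i <-> E i = E p" by blast
   show ?thesis using L(1-4) eq[OF L(5,6)] by (intro exI[of _ L] conjI) blast+
  qed
  have ns: "set (map eds (es p)) \<subseteq> nsets (set vs) 2" using E_nsets[OF p(1)] unfolding E_eds .
  show ?thesis
  proof (intro conjI exI[of _ "es p"])
   show "k * length (es p) \<le> 20 * X" using km by simp
   show "steps bCase s3 \<le> 1 + 100 * X + 200 * X" using P(6)[OF SS] unfolding r X_def[symmetric] by simp
   show "gv s4 20 ~= 0 --> (EX L. length L = k & (ALL i<k. ar s4 7 i = L ! i) & distinct L & (\<forall>f\<in>set L. f < 2 ^ length (es p)) &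
     (ALL i<T. edge_clique_cover (set vs) (E i) (eset (es p) ` set L) <-> lab i))" using l by (rule impI)
   show "gv s4 20 = 0 --> (ALL F. ~ sol F)"
   proof (intro impI allI)
    fix F assume h: "gv s4 20 = 0" show "~ sol F" by (rule P(5)[OF h])
   qed
  qed (fact P(1) P(2) P(3) dist_eds[OF p(1)] ns)+
 next
  case True
  then have g14: "gv s2 14 = 0" using g3[of 14] by simp
  have nl: "ALL i<T. ~ lab i"
  proof -
   have ne: "ps i ~= 0" if "i < T" for i using ps_ge[of i] that by simp
   show ?thesis using c2(2)
   proof
    assume "EX i<T. lab i & gv s2 14 = ps i"
    then obtain i where "i < T" "gv s2 14 = ps i" by blast
    then show ?thesis using ne[of i] g14 by simp
   qed blast
  qed
  have r: "s4 = run bNeg t3" "steps bCase s3 = 1 + steps bNeg t3" using True by (simp_all add: s4_def bCase_def t3_def)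
  have h: "gv t3 17 ~= 0 <-> (EX i<T. es i = [])" "gv t3 18 ~= 0 <-> (EX i<T. es i ~= [])"
   using c2(3,4) g3 unfolding t3(2) by simp_all
  define el where "el = edgs (min n (k + 3))"
  note P = bNeg[OF t3(1,4,5), folded r(1) el_def] and Q = bNeg_sol[OF t3(1,4,5) nl h, folded r(1) el_def]
  have l: "EX L. length L = k & (ALL i<k. ar s4 7 i = L ! i) & distinct L & (\<forall>f\<in>set L. f < 2 ^ length el) &
     (ALL i<T. edge_clique_cover (set vs) (E i) (eset el ` set L) <-> lab i)" if "gv s4 20 ~= 0"
  proof -
   from Q(3)[OF that] obtain L where L: "length L = k" "ALL i<k. ar s4 7 i = L ! i" "distinct L" "\<forall>f\<in>set L. f < 2 ^ length el"
    "ALL i<T. ~ edge_clique_cover (set vs) (E i) (eset el ` set L)" by blast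
   show ?thesis using L nl by (intro exI[of _ L] conjI) blast+
  qed
  have g2: "gv s4 2 = k"
   unfolding r using t3(4) by (simp add: run_gv bNeg_def bNegP_def bNegF_def bNegE_def bNegX_def del: run.simps)
  have e1: "gv s4 13 = length el" "ALL j<length el. ar s4 8 j = fst (el ! j) & ar s4 9 j = snd (el ! j)" using P(1) unfolding elst_def by blast+
  have le: "length el \<le> (k + 3) * (k + 3)"
   using length_edgs[of "min n (k + 3)"] mult_le_mono[of "min n (k + 3)" "k + 3" "min n (k + 3)" "k + 3"] unfolding el_def by simp
  have kel: "k * length el \<le> 20 * X"
  proof -
   have a: "(j::nat) * ((j + 3) * (j + 3)) \<le> 20 * 4 ^ j" for j
   proof (induction j)
    case (Suc j)
    have b: "j * j \<le> 4 ^ j" using k_less_M(3)[of j] less_exp[of j] mult_le_mono2[of j "2 ^ j" j] by linarith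
    have "Suc j * ((Suc j + 3) * (Suc j + 3)) = j * ((j + 3) * (j + 3)) + (3 * (j * j) + 15 * j + 16)" by (simp add: algebra_simps)
    also have "\<dots> \<le> 20 * 4 ^ j + 34 * 4 ^ j" using Suc b k_less_M(1)[of j] one_le_power[of "4::nat" j] by linarith
    finally show ?case by simp
   qed simp
   have "k * length el \<le> k * ((k + 3) * (k + 3))" using le by (rule mult_le_mono2)
   then show ?thesis using a[of k] X4 by linarith
  qed
  have st: "steps bCase s3 \<le> 1 + 100 * X + 200 * X"
  proof -
   have "steps bNeg t3 \<le> 82 + 8 * (k * k) + 48 * k" using P(4) by (simp add: algebra_simps)
   then show ?thesis unfolding r using kk kX XS S1 by linarith
  qed
  show ?thesis
  proof (intro conjI exI[of _ "el"])
   show "gv s4 20 ~= 0 --> (EX L. length L = k & (ALL i<k. ar s4 7 i = L ! i) & distinct L & (\<forall>f\<in>set L. f < 2 ^ length (el)) &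
     (ALL i<T. edge_clique_cover (set vs) (E i) (eset (el) ` set L) <-> lab i))" using l by (rule impI)
   show "gv s4 20 = 0 --> (ALL F. ~ sol F)"
   proof (intro impI allI)
    fix F assume h: "gv s4 20 = 0" show "~ sol F" by (rule Q(4)[OF h])
   qed
  qed (fact g2 e1 Q(1,2) kel st)+
 qed
 obtain el where el: "gv s4 13 = length el" "distinct (map eds el)" "set (map eds el) \<subseteq> nsets (set vs) 2"
   "ALL j<length el. ar s4 8 j = fst (el ! j) & ar s4 9 j = snd (el ! j)" "k * length el \<le> 20 * X"
   "gv s4 20 ~= 0 --> (EX L. length L = k & (ALL i<k. ar s4 7 i = L ! i) & distinct L & (\<forall>f\<in>set L. f < 2 ^ length el) &
     (ALL i<T. edge_clique_cover (set vs) (E i) (eset el ` set L) <-> lab i))"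
  using conjunct1[OF conjunct2[OF key]] by (elim exE conjE)
 have g42: "gv s4 2 = k" and ns: "gv s4 20 = 0 ==> ~ sol F" and sc: "steps bCase s3 \<le> 1 + 300 * X" for F using key by simp_all
 have rM: "run bMain s = run bEmit s4" "steps bMain s = 5 + (steps bScan s1 + (steps bPW s2 + (steps bCase s3 + steps bEmit s4)))"
  using c1(2) unfolding bMain_def s4_def s3_def s2_def s1_def by simp_all
 have base: "steps bMain s \<le> 11 + 311 * X + steps bEmit s4"
  unfolding rM(2) using c2(5) c3(2) sc TS S1(2) XS by linarith
 show ?thesis
 proof (cases "gv s4 20 = 0")
  case True
  have "~ (EX F. sol F)" using ns[OF True] by blast
  then show ?thesis unfolding rM(1) X_def[symmetric]
   using bEmit_none[OF True] base XS S1(1) by (intro exI[of _ "[0]"] conjI) simp_all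
 next
  case False
  then obtain L where L: "length L = k" "ALL i<k. ar s4 7 i = L ! i" "distinct L" "\<forall>f\<in>set L. f < 2 ^ length el"
   "ALL i<T. edge_clique_cover (set vs) (E i) (eset el ` set L) <-> lab i" using el(6) by blast
  from emit_answer[OF False g42 el(1) L(1,2) el(2,4) L(3,4)] obtain ws where
   ws: "gv (run bEmit s4) 1 = length (1 # ws)" "\<forall>i\<le>length (1 # ws). ar (run bEmit s4) 0 i = (length (1 # ws) # 1 # ws) ! i"
    "family_code (eset el ` set L) ws" "card (eset el ` set L) = k" "length (1 # ws) \<le> 2 + k * (1 + 2 * length el)"
   unfolding Let_def by blast
  have ssub: "eset el ` set L \<subseteq> Pow (nsets (set vs) 2)"
  proof
   fix G assume "G \<in> eset el ` set L"
   then obtain g where "G = eset el g" by (rule imageE)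
   moreover have "eset el g \<subseteq> set (map eds el)" unfolding eset_def by auto
   ultimately show "G \<in> Pow (nsets (set vs) 2)" using el(3) by blast
  qed
  have so: "sol (eset el ` set L)" unfolding sol_def using ssub ws(4) L(5) by blast
  have se: "steps bEmit s4 \<le> 7 + k * (7 + 7 * length el)" by (rule bEmit(3)[OF False g42 el(1) L(1,2)])
  show ?thesis unfolding rM(1) X_def[symmetric]
  proof (intro exI[of _ "1 # ws"] conjI)
   show "if EX F. sol F then EX F ws'. sol F & family_code F ws' & 1 # ws = 1 # ws' else 1 # ws = [0]"
    using so ws(3) by auto
   show "length (1 # ws) \<le> 500 * X" using ws(5) el(5) kX XS S1(1) by (simp add: algebra_simps)
   have "steps bEmit s4 \<le> 7 + 7 * k + 7 * (k * length el)" using se by (simp add: algebra_simps)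
   then show "steps bMain s \<le> 500 * X" using base el(5) kX XS S1(1) by linarith
  qed (fact ws(1) ws(2))+
 qed
qed

end

section \<open>From codes of instances to the assumptions on the memory\<close>

lemma nth_pairs:
 "j < length es ==> concat (map (%(u, v). [u, v]) es) ! (2 * j) = fst (es ! j) & concat (map (%(u, v). [u, v]) es) ! (2 * j + 1) = snd (es ! j)"
proof (induction es arbitrary: j)
 case (Cons e es)
 obtain u v where e: "e = (u, v)" by (cases e)
 show ?case
 proof (cases j)
  case 0 then show ?thesis by (simp add: e One_nat_def)
 next
  case (Suc i)
  then have "i < length es" using Cons.prems by simp
  from Cons.IH[OF this] show ?thesis by (simp add: Suc e)
 qed
qed simp

lemma length_pairs: "length (concat (map (%(u, v). [u, v]) es)) = 2 * length es"
 by (induction es) auto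

lemma concat_nth:
 assumes "i < length wss" "j < length (wss ! i)"
 shows "length (concat (take i wss)) + j < length (concat wss)" "concat wss ! (length (concat (take i wss)) + j) = wss ! i ! j"
proof -
 have e: "concat wss = concat (take i wss) @ wss ! i @ concat (drop (Suc i) wss)"
  using arg_cong[OF id_take_nth_drop[OF assms(1)], of concat] by simp
 show "length (concat (take i wss)) + j < length (concat wss)" by (subst e) (use assms(2) in simp)
 show "concat wss ! (length (concat (take i wss)) + j) = wss ! i ! j" by (subst e) (use assms(2) in \<open>simp add: nth_append\<close>)
qed

text \<open>Memory addresses exceed list positions by one, as cell 0 contains the length of the
  word. Sample \<open>i\<close> starts behind the codes of its predecessors, which gives
  \<open>ps\<close>.\<close>

lemma decode:
 assumes wf: "conscheck_wf I" and code: "conscheck_code I xs"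
 obtains vs es lab ps where "input (mem (initial xs)) (parameter I) (length vs) (length (samples I)) vs es lab ps"
  "set vs = vertices I" "!!i. i < length (samples I) ==> samples I ! i = (set (map (%(u, v). {u, v}) (es i)), lab i)"
  "conscheck_size I = 3 + length vs + (\<Sum>i<length (samples I). 2 + 2 * length (es i))"
proof -
 obtain vs wss where vs: "distinct vs" "set vs = vertices I" and w: "list_all2 sample_code (samples I) wss"
  and xs: "xs = parameter I # length vs # vs @ length (samples I) # concat wss"
  using code unfolding conscheck_code_def by blast
 define T where "T = length (samples I)"
 have lw: "length wss = T" using list_all2_lengthD[OF w] by (simp add: T_def)
 have "ALL i. EX es. i < T --> distinct (map (%(u, v). {u, v}) es) & set (map (%(u, v). {u, v}) es) = fst (samples I ! i) &
  wss ! i = of_bool (snd (samples I ! i)) # length es # concat (map (%(u, v). [u, v]) es)"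
 proof
  fix i
  show "EX es. i < T --> distinct (map (%(u, v). {u, v}) es) & set (map (%(u, v). {u, v}) es) = fst (samples I ! i) &
   wss ! i = of_bool (snd (samples I ! i)) # length es # concat (map (%(u, v). [u, v]) es)"
  proof (cases "i < T")
   case True
   then have "sample_code (samples I ! i) (wss ! i)" using list_all2_nthD[OF w, of i] by (simp add: T_def)
   then show ?thesis unfolding sample_code_def edge_set_code_def by blast
  qed simp
 qed
 from choice[OF this] obtain es :: "nat => (nat \<times> nat) list" where es: "ALL i. i < T --> distinct (map (%(u, v). {u, v}) (es i)) &
  set (map (%(u, v). {u, v}) (es i)) = fst (samples I ! i) &
  wss ! i = of_bool (snd (samples I ! i)) # length (es i) # concat (map (%(u, v). [u, v]) (es i))" by blast
 define lab where "lab i = snd (samples I ! i)" for i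
 define ps where "ps i = 4 + length vs + length (concat (take i wss))" for i
 define f where "f = mem (initial xs)"
 have f: "f (Suc a) = xs ! a" if "a < length xs" for a using that by (simp add: f_def initial_def)
 have wi: "wss ! i = of_bool (lab i) # length (es i) # concat (map (%(u, v). [u, v]) (es i))" if "i < T" for i
  using es that unfolding lab_def by blast
 have lwi: "length (wss ! i) = 2 + 2 * length (es i)" if "i < T" for i using wi[OF that] length_pairs[of "es i"] by simp
 have fw: "f (ps i + j) = wss ! i ! j" if "i < T" "j < length (wss ! i)" for i j
 proof -
  let ?o = "length (concat (take i wss)) + j"
  have o: "?o < length (concat wss)" "concat wss ! ?o = wss ! i ! j" using concat_nth[of i wss j] that lw by simp_all
  have l: "3 + length vs + ?o < length xs" using o(1) unfolding xs by simp
  have a: "xs ! (3 + length vs + ?o) = concat wss ! ?o"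
  proof -
   have "xs = (parameter I # length vs # vs @ [length (samples I)]) @ concat wss" unfolding xs by simp
   moreover have "length (parameter I # length vs # vs @ [length (samples I)]) = 3 + length vs" by simp
   ultimately show ?thesis by (metis nth_append_length_plus)
  qed
  have b: "ps i + j = Suc (3 + length vs + ?o)" by (simp add: ps_def)
  show ?thesis by (simp only: b f[OF l] a o(2))
 qed
 have inp: "input f (parameter I) (length vs) T vs es lab ps"
 proof
  show "f 1 = parameter I" using f[of 0] unfolding xs by (simp add: One_nat_def)
  show "f 2 = length vs" using f[of 1] unfolding xs by (simp add: numeral_2_eq_2 One_nat_def)
  show "length vs = length vs" "distinct vs" using vs by simp_all
  show "f (3 + i) = vs ! i" if "i < length vs" for i
   using f[of "2 + i"] that unfolding xs by (simp add: nth_append numeral_3_eq_3 numeral_2_eq_2)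
  show "f (3 + length vs) = T"
   using f[of "2 + length vs"] unfolding xs T_def by (simp add: nth_append numeral_3_eq_3 numeral_2_eq_2)
  show "ps 0 = 4 + length vs" by (simp add: ps_def)
  show "ps (Suc i) = ps i + 2 + 2 * length (es i)" if "i < T" for i
   using that lw lwi[OF that] by (simp add: ps_def take_Suc_conv_app_nth)
  show "f (ps i) = of_bool (lab i)" if "i < T" for i
   using fw[OF that, of 0] wi[OF that] by simp
  show "f (ps i + 1) = length (es i)" if "i < T" for i
   using fw[OF that, of 1] wi[OF that] by (simp add: One_nat_def)
  show "f (ps i + 2 + 2 * j) = fst (es i ! j) & f (ps i + 3 + 2 * j) = snd (es i ! j)" if "i < T" "j < length (es i)" for i j
  proof -
   have a: "ps i + 2 + 2 * j = ps i + (2 + 2 * j)" "ps i + 3 + 2 * j = ps i + (3 + 2 * j)" by simp_all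
   have b: "wss ! i ! (2 + 2 * j) = concat (map (%(u, v). [u, v]) (es i)) ! (2 * j)"
    "wss ! i ! (3 + 2 * j) = concat (map (%(u, v). [u, v]) (es i)) ! (2 * j + 1)"
    unfolding wi[OF that(1)] by (simp_all add: numeral_2_eq_2 numeral_3_eq_3)
   have "2 + 2 * j < length (wss ! i)" "3 + 2 * j < length (wss ! i)" using lwi[OF that(1)] that(2) by simp_all
   then have "f (ps i + (2 + 2 * j)) = wss ! i ! (2 + 2 * j)" "f (ps i + (3 + 2 * j)) = wss ! i ! (3 + 2 * j)"
    using fw[OF that(1)] by blast+
   then show ?thesis unfolding a b using nth_pairs[OF that(2)] by simp
  qed
  show "u \<in> set vs & v \<in> set vs & u ~= v" if "i < T" "(u, v) \<in> set (es i)" for i u v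
  proof -
   have "(%(u, v). {u, v}) (u, v) \<in> set (map (%(u, v). {u, v}) (es i))" unfolding set_map using that(2) by (rule imageI)
   moreover have "set (map (%(u, v). {u, v}) (es i)) = fst (samples I ! i)" using es[rule_format, OF that(1)] by blast
   ultimately have mem: "{u, v} \<in> fst (samples I ! i)" by simp
   have "samples I ! i \<in> set (samples I)" using that(1) by (simp add: T_def)
   from bspec[OF wf[unfolded conscheck_wf_def, THEN conjunct2] this]
   have sub: "fst (samples I ! i) \<subseteq> nsets (vertices I) 2" by (simp add: case_prod_beta)
   have "{u, v} \<in> nsets (set vs) 2" unfolding vs(2) by (rule subsetD[OF sub mem])
   then show ?thesis by (cases "u = v") (auto simp: nsets_def)
  qed
  show "distinct (map (%(u, v). {u, v}) (es i))" if "i < T" for i using es that by blast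
 qed
 have smp: "samples I ! i = (set (map (%(u, v). {u, v}) (es i)), lab i)" if "i < T" for i
  using es[rule_format, OF that] unfolding lab_def by simp
 have "length xs = 3 + length vs + (\<Sum>i<T. 2 + 2 * length (es i))"
 proof -
  have "length (concat wss) = (\<Sum>i<T. length (wss ! i))"
   using lw by (simp add: length_concat sum_list_sum_nth atLeast0LessThan)
  also have "\<dots> = (\<Sum>i<T. 2 + 2 * length (es i))" using lwi by (intro sum.cong) auto
  finally show ?thesis unfolding xs by simp
 qed
 then have "conscheck_size I = 3 + length vs + (\<Sum>i<T. 2 + 2 * length (es i))" using conscheck_code_length[OF code] by simp
 then show ?thesis using smp unfolding T_def by (intro that[OF inp[unfolded f_def T_def] vs(2)])
qed

section \<open>The total running time\<close>

lemma ctms_poly: "finite A ==> EX C D. \<forall>t\<in>A. ALL M. tcost t M \<le> C * (M + 1) ^ D"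
proof (induction A rule: finite_induct)
 case (insert t A)
 then obtain C D where CD: "\<forall>t\<in>A. ALL M. tcost t M \<le> C * (M + 1) ^ D" by blast
 obtain C' D' where CD': "ALL M. tcost t M \<le> C' * (M + 1) ^ D'" using tcost_poly by blast
 have up: "c * (M + 1) ^ d \<le> (C + C') * (M + 1) ^ (D + D')" if "c \<le> C + C'" "d \<le> D + D'" for c d M
  using that by (intro mult_le_mono power_increasing) simp_all
 have "tcost t' M \<le> (C + C') * (M + 1) ^ (D + D')" if t': "t' \<in> insert t A" for t' M
 proof (cases "t' = t")
  case True
  then show ?thesis using CD' up[of C' D' M] order_trans by (metis le_add2)
 next
  case False
  then have "tcost t' M \<le> C * (M + 1) ^ D" using t' CD by blast
  then show ?thesis using up[of C D M] by linarith
 qed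
 then show ?case by blast
qed simp

text \<open>From \<open>k = 4 * D + 4\<close> on, \<open>4 * D * k \<le> k * k \<le> 2 ^ k\<close>;
  the additive constant takes care of smaller \<open>k\<close>.\<close>

lemma lin_le_pow: "EX e. ALL k. 2 * k * D \<le> (2::nat) ^ k div 2 + e"
proof (intro exI allI)
 fix k :: nat
 show "2 * k * D \<le> 2 ^ k div 2 + 2 * (4 * D + 4) * D"
 proof (cases "4 * D + 4 \<le> k")
  case True
  have sq: "4 \<le> j ==> j * j \<le> (2::nat) ^ j" for j
  proof (induction j rule: dec_induct)
   case (step j)
   have "Suc j * Suc j = j * j + 2 * j + 1" by simp
   also have "\<dots> \<le> j * j + j * j"
   proof -
    have "4 * j \<le> j * j" using step by (intro mult_le_mono1)
    then show ?thesis using step by linarith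
   qed
   finally show ?case using step by simp
  qed simp
  have "4 * D * k \<le> k * k" using True by (intro mult_le_mono1) simp
  then have "4 * D * k \<le> 2 ^ k" using sq[of k] True by linarith
  then have "2 * (2 * k * D) \<le> 2 ^ k" by (simp add: ac_simps)
  then show ?thesis by linarith
 next
  case False
  then have "2 * k * D \<le> 2 * (4 * D + 4) * D" by (intro mult_le_mono) simp_all
  then show ?thesis by (rule trans_le_add2)
 qed
qed

lemma search_time_bound: "EX c. ALL k::nat. (4 ^ k) ^ D * (if k < 2 ^ 63 then 2 ^ (k * 2 ^ k) else 2 ^ (2 ^ k div 2)) \<le> c * (2::nat) ^ 2 ^ k"
proof -
 obtain e where e: "ALL k. 2 * k * D \<le> (2::nat) ^ k div 2 + e" using lin_le_pow by blast
 define X :: nat where "X = 2 ^ 63"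
 define Z :: "nat => nat" where "Z k = (if k < X then 2 ^ (k * 2 ^ k) else 2 ^ (2 ^ k div 2))" for k
 have four: "((4::nat) ^ k) ^ D = 2 ^ (2 * k * D)" for k
 proof -
  have "((2::nat) ^ 2) = 4" by simp
  then show ?thesis unfolding power_mult by (simp only:)
 qed
 let ?c = "2 ^ (2 * X * D) * 2 ^ (X * 2 ^ X) + (2::nat) ^ e"
 have "(4 ^ k) ^ D * Z k \<le> ?c * 2 ^ 2 ^ k" for k
 proof (cases "k < X")
  case True
  have "(2::nat) ^ (2 * k * D) \<le> 2 ^ (2 * X * D)" using True by (intro power_increasing mult_le_mono) simp_all
  moreover have "(2::nat) ^ (k * 2 ^ k) \<le> 2 ^ (X * 2 ^ X)" using True by (intro power_increasing mult_le_mono) simp_all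
  ultimately have "(4 ^ k) ^ D * Z k \<le> 2 ^ (2 * X * D) * 2 ^ (X * 2 ^ X)"
   unfolding Z_def four if_P[OF True] by (rule mult_le_mono)
  also have "\<dots> \<le> ?c * 1" unfolding mult_1_right by (rule le_add1)
  also have "\<dots> \<le> ?c * 2 ^ 2 ^ k" by (intro mult_le_mono2) simp
  finally show ?thesis .
 next
  case False
  have "2 * k * D + 2 ^ k div 2 \<le> e + 2 ^ k" using e[rule_format, of k] by linarith
  then have "(2::nat) ^ (2 * k * D + 2 ^ k div 2) \<le> 2 ^ (e + 2 ^ k)" by (intro power_increasing) simp_all
  then have "(4 ^ k) ^ D * Z k \<le> 2 ^ e * 2 ^ 2 ^ k" unfolding Z_def four if_not_P[OF False] power_add .
  also have "\<dots> \<le> ?c * 2 ^ 2 ^ k" by (intro mult_le_mono1 le_add2)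
  finally show ?thesis .
 qed
 then have "ALL k. (4 ^ k) ^ D * Z k \<le> ?c * 2 ^ 2 ^ k" by (rule allI)
 then have "EX c. ALL k. (4 ^ k) ^ D * Z k \<le> c * 2 ^ 2 ^ k" by (rule exI)
 then show ?thesis unfolding Z_def X_def .
qed

text \<open>The main part keeps the loop bound, as \<open>clk_le_steps\<close> requires.\<close>

lemma main_no_0: "0 \<notin> gvars bMain"
 by (simp add: bMain_def bCfg_def bScan_def bScanB_def pinc_def bPW_def bCase_def bPos_def bLoad_def bLoadB_def bLoadM_def
  bComp_def bCompB_def bCompI_def bCompE_def bRep_def bRepB_def bRcheck_def bSolve_def bSearch_def bSearchI_def bSearchB_def
  bOut_def bFin_def bFinB_def bFinI_def bAdd_def bPad_def bPadI_def bPadJ_def bPadL_def bNeg_def bNegP_def bNegF_def bNegE_def bNegX_def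
  bEmit_def bEmitS_def bEmitB_def bEmitP_def bEmitI_def bEmitW_def bEmitE_def bEmitN_def)

theorem theorem8:
  shows "\<exists>(P :: program) (c :: nat). \<forall>(I :: conscheck_instance) (xs :: nat list).
    conscheck_wf I \<longrightarrow> conscheck_code I xs \<longrightarrow>
    (\<exists>ys. computes_within P xs (c * (2 ^ (2 ^ parameter I) * conscheck_size I)) ys \<and>
          conscheck_answer I ys)"
proof -
 obtain C0 where C0: "\<forall>t\<in>ctms bInit1. tcost t 0 \<le> C0"
 proof
  show "\<forall>t\<in>ctms bInit1. tcost t 0 \<le> (\<Sum>t\<in>ctms bInit1. tcost t 0)" using finite_ctms[of bInit1] by (intro ballI member_le_sum) auto
 qed
 obtain C D where CD: "\<forall>t\<in>ctms bMain. ALL M. tcost t M \<le> C * (M + 1) ^ D" using ctms_poly[OF finite_ctms] by blast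
 \<comment> \<open>\<open>D\<close> is a common degree for the costs of all terms; one more factor
   \<open>4 ^ k\<close> comes from the number of commands.\<close>
 from search_time_bound[of "D + 1"] obtain c where
  c: "ALL k::nat. (4 ^ k) ^ (D + 1) * (if k < 2 ^ 63 then 2 ^ (k * 2 ^ k) else 2 ^ (2 ^ k div 2)) \<le> c * (2::nat) ^ 2 ^ k" by (rule exE)
 \<comment> \<open>The summands belong to the initialisation, to the main part (500 bounds the
   commands, the bracket the cost of each) and to the delivery of the output. \<open>1025\<close>
   majorises \<open>1024 * 4 ^ k + 1\<close> divided by \<open>4 ^ k\<close>.\<close>
 define G where "G = (2 * C0 + 8) * 6 + 4 + (2 * (C * 1025 ^ D) + 8) * 500 + 14 * 500 + 22"
 let ?P = "assemble (Seq bInit bMain)"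
 show ?thesis
 proof (intro exI[of _ ?P] exI[of _ "G * c"] allI impI)
  fix I xs assume wf: "conscheck_wf I" and code: "conscheck_code I xs"
  define k where "k = parameter I"
  obtain vs es lab ps where inp: "input (mem (initial xs)) (parameter I) (length vs) (length (samples I)) vs es lab ps"
   and V: "set vs = vertices I" and smp: "!!i. i < length (samples I) ==> samples I ! i = (set (map (%(u, v). {u, v}) (es i)), lab i)"
   and sz: "conscheck_size I = 3 + length vs + (\<Sum>i<length (samples I). 2 + 2 * length (es i))"
   using decode[OF wf code] by blast
  define S where "S = conscheck_size I"
  interpret input "mem (initial xs)" k "length vs" "length (samples I)" vs es lab ps using inp unfolding k_def .
  let ?s0 = "start_state xs"
  define s where "s = run bInit ?s0"
  have i0: "inp ?s0 = mem (initial xs)" "gv ?s0 0 = 0" by (simp_all add: start_state_def)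
  note B = bInit[OF i0(1) fk fn i0(2), folded s_def]
  have mI: "gvars bInit = {0, 2, 3, 22, 23}" "avars bInit = {}" by (auto simp: bInit_def bInit1_def)
  have z: "gv s x = 0" if "x \<notin> {0, 2, 3, 22, 23}" for x using run_gv[of x bInit ?s0] that unfolding mI s_def by (simp add: start_state_def)
  have za: "ar s = (%_ _. 0)"
  proof
   fix a show "ar s a = (%_. 0)" using run_ar[of a bInit ?s0] unfolding mI s_def by (simp add: start_state_def)
  qed
  have "3 + length vs + (\<Sum>i<length (samples I). 2 + 2 * length (es i)) \<le> S" using sz unfolding S_def by simp
  from bMain[OF _ B(1-3) z za this] obtain ys where
   ys: "gv (run bMain s) 1 = length ys" "\<forall>i\<le>length ys. ar (run bMain s) 0 i = (length ys # ys) ! i"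
    "if EX F. sol F then EX F ws. sol F & family_code F ws & ys = 1 # ws else ys = [0]"
    "length ys \<le> 500 * (4 ^ k * S * Zk)" "steps bMain s \<le> 500 * (4 ^ k * S * Zk)"
   using i0(1) by (auto simp: s_def)
  have r: "run (Seq bInit bMain) ?s0 = run bMain s" by (simp add: s_def)
  have cw: "computes_within ?P xs (clk (run bMain s) + 14 * length ys + 22) ys"
   using assemble_correct[of "Seq bInit bMain" xs ys] ys(1,2) unfolding r by blast
  have sol: "conscheck_solution I F <-> sol F" for F
  proof -
   have q: "(\<forall>(E', l)\<in>set (samples I). edge_clique_cover (vertices I) E' F <-> l) <->
    (ALL i<length (samples I). edge_clique_cover (set vs) (E i) F <-> lab i)"
    unfolding all_set_conv_all_nth by (intro all_cong) (simp only: smp prod.case E_def V)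
   show ?thesis unfolding conscheck_solution_def q sol_def V unfolding k_def ..
  qed
  have ans: "conscheck_answer I ys" unfolding conscheck_answer_def sol by (rule ys(3))
  define W where "W = C * (1024 * 4 ^ k + 1) ^ D"
  have "clk (run bMain s) \<le> clk s + (2 * W + 8) * steps bMain s"
   by (rule clk_le_steps[OF main_no_0]) (unfold B(1) W_def, use CD in blast)
  also have "\<dots> \<le> clk s + (2 * W + 8) * (500 * (4 ^ k * S * Zk))" using ys(5) by (intro add_left_mono mult_le_mono2)
  finally have t1: "clk (run bMain s) \<le> clk s + (2 * W + 8) * (500 * (4 ^ k * S * Zk))" .
  have t0: "clk s \<le> (2 * C0 + 8) * (4 + 2 * k) + 4" using B(5)[OF C0] by (simp add: start_state_def)
  define Y where "Y = (4 ^ k) ^ D * (4 ^ k * S * Zk)"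
  have S1: "1 \<le> S" using sz unfolding S_def by simp
  have Z1: "1 \<le> Zk" unfolding Zk_def by (split if_split) simp
  have A: "4 ^ k * 1 * 1 \<le> 4 ^ k * S * Zk" using S1 Z1 by (intro mult_le_mono order_refl)
  have D1: "1 * (4 ^ k * S * Zk) \<le> Y" unfolding Y_def by (intro mult_le_mono1) simp
  have Y4: "4 ^ k \<le> Y" "4 ^ k * S * Zk \<le> Y" using A D1 by linarith+
  have Y1: "1 \<le> Y" using Y4(1) one_le_power[of "4::nat" k] by linarith
  have "4 + 2 * k \<le> 6 * 4 ^ k" using k_less_M(1)[of k] one_le_power[of "4::nat" k] by linarith
  then have "4 + 2 * k \<le> 6 * Y" using Y4 by linarith
  then have e1: "(2 * C0 + 8) * (4 + 2 * k) \<le> (2 * C0 + 8) * (6 * Y)" by (rule mult_le_mono2)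
  have W: "W \<le> C * 1025 ^ D * (4 ^ k) ^ D"
  proof -
   have "1024 * 4 ^ k + 1 \<le> 1025 * (4::nat) ^ k" using one_le_power[of "4::nat" k] by linarith
   then have "(1024 * 4 ^ k + 1) ^ D \<le> (1025 * (4::nat) ^ k) ^ D" by (rule power_mono) simp
   then have "W \<le> C * (1025 * (4::nat) ^ k) ^ D" unfolding W_def by (rule mult_le_mono2)
   then show ?thesis by (simp only: power_mult_distrib mult.assoc)
  qed
  have e2: "(2 * W + 8) * (500 * (4 ^ k * S * Zk)) \<le> (2 * (C * 1025 ^ D) + 8) * 500 * Y"
  proof -
   have "8 * 1 \<le> 8 * ((4::nat) ^ k) ^ D" by (intro mult_le_mono2) simp
   then have "2 * W + 8 \<le> (2 * (C * 1025 ^ D) + 8) * (4 ^ k) ^ D" using W unfolding add_mult_distrib by linarith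
   then have "(2 * W + 8) * (500 * (4 ^ k * S * Zk)) \<le> (2 * (C * 1025 ^ D) + 8) * (4 ^ k) ^ D * (500 * (4 ^ k * S * Zk))" by (rule mult_le_mono1)
   also have "\<dots> = (2 * (C * 1025 ^ D) + 8) * 500 * Y" unfolding Y_def by (simp only: mult_ac)
   finally show ?thesis .
  qed
  have "clk (run bMain s) + 14 * length ys + 22 \<le> (2 * C0 + 8) * (6 * Y) + 4 * Y + (2 * (C * 1025 ^ D) + 8) * 500 * Y + 14 * (500 * Y) + 22 * Y"
   using t0 t1 e1 e2 ys(4) Y4(2) Y1 by linarith
  also have "\<dots> = G * Y" unfolding G_def add_mult_distrib by (simp only: mult.assoc)
  also have "Y = ((4 ^ k) ^ (D + 1) * Zk) * S" unfolding Y_def by (simp add: mult_ac)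
  also have "G * (((4 ^ k) ^ (D + 1) * Zk) * S) \<le> G * (c * 2 ^ 2 ^ k * S)" unfolding Zk_def by (intro mult_le_mono2 mult_le_mono1 c[rule_format])
  also have "\<dots> = G * c * (2 ^ 2 ^ k * S)" by (simp only: mult_ac)
  finally have time: "clk (run bMain s) + 14 * length ys + 22 \<le> G * c * (2 ^ 2 ^ k * S)" .
  have "computes_within ?P xs (G * c * (2 ^ 2 ^ k * S)) ys"
   using cw time unfolding computes_within_def by (meson order_trans)
  then show "EX ys. computes_within ?P xs (G * c * (2 ^ 2 ^ parameter I * conscheck_size I)) ys & conscheck_answer I ys"
   using ans unfolding k_def S_def by blast
 qed
qed

end
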